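(* Let $(w,d,N,L)$ be a stable, reduced Levi–Schubert quadruple. Let $p_w$ be the minimal index with $1<p_w<b_L-1$ such that $h_{p_w+1}+\dots+h_{b_L}<2$, and if no such index exists set $p_w=b_L-1$. Then $(w,d,N,L)$ is multiplicity free (equivalently, $X(w)$ is a spherical $L$-variety) if and only if one of the following holds: (i) $b_L\le2$; (ii) $b_L=3$, and at least one of: $N_2=1$; $h_1+1\ge N_1$; ($N_2=h_2$ and $h_1+2\ge N_1$); ($h_2>0$ and $h_3<2$); ($h_2=0$ and $h_3\le2$); (iii) $b_L\ge4$, and either $p_w=2$, or $p_w>2$ and $h_1+\dots+h_{p_w-1}+1\ge N_1+\dots+N_{p_w-1}$.
   Context: Work over $\mathbb{C}$. $G_{d,N}$ is the Grassmannian of $d$-planes in $\mathbb{C}^N$ with its Plücker embedding; $B\subset GL_N$ upper triangular. $I_{d,N}$ is the set of sequences $(i_1<\dots<i_d)$ in $\{1,\dots,N\}$. For $w=(\ell_1,\dots,\ell_d)\in I_{d,N}$, $X(w)$ is the closure of $B\cdot[e_{\ell_1}\wedge\dots\wedge e_{\ell_d}]$ and $\mathbb{C}[X(w)]$ its Plücker homogeneous coordinate ring. A standard Levi $L\subseteq GL_N$ is given by $0=j_0<j_1<\dots<j_{b_L}=N$: invertible block diagonal matrices with blocks of sizes $N_k=j_k-j_{k-1}$, $L\cong GL_{N_1}\times\dots\times GL_{N_{b_L}}$; blocks $\mathrm{Bl}_k=\{j_{k-1}+1,\dots,j_k\}$. A Levi–Schubert quadruple $(w,d,N,L)$ ($1\le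 d<N$, $w\in I_{d,N}$) is stable if $X(w)$ is stable under left multiplication by $L$; reduced if $\ell_1\ne1$ and $\ell_d=N$; a stable quadruple is multiplicity free if each irreducible $L$-module occurs at most once in $\mathbb{C}[X(w)]$, and spherical if $X(w)$ has a dense open orbit of a Borel subgroup of $L$. $h_k=|\{j:\ell_j\in\mathrm{Bl}_k\}|$ for $1\le k\le b_L$. *)

theory Defs
  imports "Jordan_Normal_Form.Determinant" "Jordan_Normal_Form.Matrix"
begin

text \<open>Conventions. Indices of C^N are 1..N; an N x N complex matrix g (JNF type complex mat,
  0-based) has entry (i,j) (1-based) at g $$ (i-1, j-1).
  I_{d,N} is the set of strictly increasing lists of length d with entries in 1..N.
  The exterior power of C^N (d-th) is modelled by functions  nat list => complex  supported
  on I_{d,N}: x s is the Pluecker coordinate of x at the basis vector e_s.\<close>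

definition Idn :: "nat \<Rightarrow> nat \<Rightarrow> nat list set" where
  "Idn d N = {s. length s = d \<and> sorted_wrt (<) s \<and> set s \<subseteq> {1..N}}"

definition GLn :: "nat \<Rightarrow> complex mat set" where
  "GLn N = {g. g \<in> carrier_mat N N \<and> det g \<noteq> 0}"

definition Bor :: "nat \<Rightarrow> complex mat set" where
  "Bor N = {g \<in> GLn N. \<forall>i j. i < N \<longrightarrow> j < i \<longrightarrow> g $$ (i, j) = 0}"

definition minv :: "nat \<Rightarrow> complex mat \<Rightarrow> complex mat" where
  "minv N g = (SOME h. h \<in> carrier_mat N N \<and> h * g = 1\<^sub>m N)"

definition minor :: "complex mat \<Rightarrow> nat list \<Rightarrow> nat list \<Rightarrow> complex" where
  "minor g s t = det (mat (length s) (length s) (\<lambda>(i, j). g $$ (s ! i - 1, t ! j - 1)))"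

text \<open>Action of g on the d-th exterior power: g e_t = sum_s det(g[s,t]) e_s.\<close>
definition wact :: "nat \<Rightarrow> nat \<Rightarrow> complex mat \<Rightarrow> (nat list \<Rightarrow> complex) \<Rightarrow> (nat list \<Rightarrow> complex)" where
  "wact d N g x = (\<lambda>s. if s \<in> Idn d N then (\<Sum>t\<in>Idn d N. minor g s t * x t) else 0)"

definition ew :: "nat list \<Rightarrow> (nat list \<Rightarrow> complex)" where
  "ew w = (\<lambda>s. if s = w then 1 else 0)"

inductive_set polyfun :: "((nat list \<Rightarrow> complex) \<Rightarrow> complex) set" where
  pconst: "(\<lambda>x. c) \<in> polyfun"
| pcoord: "(\<lambda>x. x s) \<in> polyfun"
| padd: "f \<in> polyfun \<Longrightarrow> g \<in> polyfun \<Longrightarrow> (\<lambda>x. f x + g x) \<in> polyfun"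
| pmult: "f \<in> polyfun \<Longrightarrow> g \<in> polyfun \<Longrightarrow> (\<lambda>x. f x * g x) \<in> polyfun"

definition zar_closure :: "(nat list \<Rightarrow> complex) set \<Rightarrow> (nat list \<Rightarrow> complex) set" where
  "zar_closure A = {x. \<forall>f \<in> polyfun. (\<forall>y\<in>A. f y = 0) \<longrightarrow> f x = 0}"

text \<open>Affine cone over the Schubert variety X(w) in its Pluecker embedding:
  the Zariski closure of the B-orbit of e_w (B contains the scalars, so this is the cone
  over the closure of B.[e_w]).\<close>
definition Xcone :: "nat \<Rightarrow> nat \<Rightarrow> nat list \<Rightarrow> (nat list \<Rightarrow> complex) set" where
  "Xcone d N w = zar_closure ((\<lambda>g. wact d N g (ew w)) ` Bor N)"

definition levi_ok :: "nat \<Rightarrow> nat list \<Rightarrow> bool" where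
  "levi_ok N js = (js \<noteq> [] \<and> sorted_wrt (<) (0 # js) \<and> last js = N)"

definition bL :: "nat list \<Rightarrow> nat" where
  "bL js = length js"

definition jj :: "nat list \<Rightarrow> nat \<Rightarrow> nat" where
  "jj js k = (0 # js) ! k"

definition Bl :: "nat list \<Rightarrow> nat \<Rightarrow> nat set" where
  "Bl js k = {jj js (k - 1) + 1 .. jj js k}"

definition Nk :: "nat list \<Rightarrow> nat \<Rightarrow> nat" where
  "Nk js k = jj js k - jj js (k - 1)"

definition hk :: "nat list \<Rightarrow> nat list \<Rightarrow> nat \<Rightarrow> nat" where
  "hk js w k = card {j. j < length w \<and> w ! j \<in> Bl js k}"

definition Levi :: "nat \<Rightarrow> nat list \<Rightarrow> complex mat set" where
  "Levi N js = {g \<in> GLn N. \<forall>i j. i < N \<longrightarrow> j < N \<longrightarrow>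
      \<not> (\<exists>k\<in>{1..bL js}. i + 1 \<in> Bl js k \<and> j + 1 \<in> Bl js k) \<longrightarrow> g $$ (i, j) = 0}"

definition stable :: "nat \<Rightarrow> nat \<Rightarrow> nat list \<Rightarrow> nat list \<Rightarrow> bool" where
  "stable d N w js = (\<forall>g\<in>Levi N js. \<forall>x\<in>Xcone d N w. wact d N g x \<in> Xcone d N w)"

definition reduced :: "nat \<Rightarrow> nat list \<Rightarrow> bool" where
  "reduced N w = (w ! 0 \<noteq> 1 \<and> last w = N)"

text \<open>The homogeneous coordinate ring C[X(w)]: polynomial functions restricted to the cone
  (functions are set to 0 off the cone).\<close>
definition coord_ring :: "nat \<Rightarrow> nat \<Rightarrow> nat list \<Rightarrow> ((nat list \<Rightarrow> complex) \<Rightarrow> complex) set" where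
  "coord_ring d N w = {(\<lambda>x. if x \<in> Xcone d N w then f x else 0) | f. f \<in> polyfun}"

definition fact :: "nat \<Rightarrow> nat \<Rightarrow> nat list \<Rightarrow> complex mat
    \<Rightarrow> ((nat list \<Rightarrow> complex) \<Rightarrow> complex) \<Rightarrow> ((nat list \<Rightarrow> complex) \<Rightarrow> complex)" where
  "fact d N w g f = (\<lambda>x. if x \<in> Xcone d N w then f (wact d N (minv N g) x) else 0)"

definition is_subspace :: "((nat list \<Rightarrow> complex) \<Rightarrow> complex) set \<Rightarrow> bool" where
  "is_subspace W = ((\<lambda>x. 0) \<in> W \<and> (\<forall>f\<in>W. \<forall>g\<in>W. (\<lambda>x. f x + g x) \<in> W)
      \<and> (\<forall>c. \<forall>f\<in>W. (\<lambda>x. c * f x) \<in> W))"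

definition Lsubmod :: "nat \<Rightarrow> nat \<Rightarrow> nat list \<Rightarrow> nat list
    \<Rightarrow> ((nat list \<Rightarrow> complex) \<Rightarrow> complex) set \<Rightarrow> bool" where
  "Lsubmod d N w js W = (W \<subseteq> coord_ring d N w \<and> is_subspace W \<and>
      (\<forall>g\<in>Levi N js. \<forall>f\<in>W. fact d N w g f \<in> W))"

definition Lirred :: "nat \<Rightarrow> nat \<Rightarrow> nat list \<Rightarrow> nat list
    \<Rightarrow> ((nat list \<Rightarrow> complex) \<Rightarrow> complex) set \<Rightarrow> bool" where
  "Lirred d N w js W = (Lsubmod d N w js W \<and> W \<noteq> {\<lambda>x. 0} \<and>
      (\<forall>V. Lsubmod d N w js V \<and> V \<subseteq> W \<longrightarrow> V = {\<lambda>x. 0} \<or> V = W))"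

definition Liso :: "nat \<Rightarrow> nat \<Rightarrow> nat list \<Rightarrow> nat list
    \<Rightarrow> ((nat list \<Rightarrow> complex) \<Rightarrow> complex) set \<Rightarrow> ((nat list \<Rightarrow> complex) \<Rightarrow> complex) set \<Rightarrow> bool" where
  "Liso d N w js W1 W2 = (\<exists>\<phi>. bij_betw \<phi> W1 W2 \<and>
      (\<forall>f\<in>W1. \<forall>g\<in>W1. \<phi> (\<lambda>x. f x + g x) = (\<lambda>x. \<phi> f x + \<phi> g x)) \<and>
      (\<forall>c. \<forall>f\<in>W1. \<phi> (\<lambda>x. c * f x) = (\<lambda>x. c * \<phi> f x)) \<and>
      (\<forall>g\<in>Levi N js. \<forall>f\<in>W1. \<phi> (fact d N w g f) = fact d N w g (\<phi> f)))"

text \<open>Multiplicity free: every irreducible L-module occurs at most once in C[X(w)], i.e. two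
  isomorphic irreducible L-submodules of C[X(w)] coincide.\<close>
definition mult_free :: "nat \<Rightarrow> nat \<Rightarrow> nat list \<Rightarrow> nat list \<Rightarrow> bool" where
  "mult_free d N w js = (\<forall>W1 W2. Lirred d N w js W1 \<and> Lirred d N w js W2 \<and>
      Liso d N w js W1 W2 \<longrightarrow> W1 = W2)"

definition zar_open_in :: "(nat list \<Rightarrow> complex) set \<Rightarrow> (nat list \<Rightarrow> complex) set \<Rightarrow> bool" where
  "zar_open_in X U = (U \<subseteq> X \<and> (\<exists>F \<subseteq> polyfun. X - U = {x\<in>X. \<forall>f\<in>F. f x = 0}))"

definition zar_dense_in :: "(nat list \<Rightarrow> complex) set \<Rightarrow> (nat list \<Rightarrow> complex) set \<Rightarrow> bool" where
  "zar_dense_in X U = (\<forall>f\<in>polyfun. (\<forall>x\<in>U. f x = 0) \<longrightarrow> (\<forall>x\<in>X. f x = 0))"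

text \<open>Spherical: X(w) has a dense open orbit of the Borel subgroup B_L = B \<inter> L of L;
  expressed on the affine cone (the cone over the orbit B_L.[v] is C^* B_L v).\<close>
definition spherical :: "nat \<Rightarrow> nat \<Rightarrow> nat list \<Rightarrow> nat list \<Rightarrow> bool" where
  "spherical d N w js = (\<exists>v\<in>Xcone d N w. v \<noteq> (\<lambda>s. 0) \<and>
     (let U = {(\<lambda>s. c * wact d N b v s) | c b. c \<noteq> 0 \<and> b \<in> Bor N \<inter> Levi N js}
      in zar_open_in (Xcone d N w) U \<and> zar_dense_in (Xcone d N w) U))"

definition pw :: "nat list \<Rightarrow> nat list \<Rightarrow> nat" where
  "pw js w = (let b = bL js; P = (\<lambda>p. 1 < p \<and> p < b - 1 \<and> (\<Sum>k=p+1..b. hk js w k) < 2)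
     in if (\<exists>p. P p) then (LEAST p. P p) else b - 1)"

definition mf_condition :: "nat list \<Rightarrow> nat list \<Rightarrow> bool" where
  "mf_condition js w = (let b = bL js; h = hk js w; n = Nk js; p = pw js w in
     b \<le> 2
   \<or> (b = 3 \<and> (n 2 = 1 \<or> h 1 + 1 \<ge> n 1 \<or> (n 2 = h 2 \<and> h 1 + 2 \<ge> n 1)
               \<or> (h 2 > 0 \<and> h 3 < 2) \<or> (h 2 = 0 \<and> h 3 \<le> 2)))
   \<or> (b \<ge> 4 \<and> (p = 2 \<or> (p > 2 \<and> (\<Sum>k=1..p-1. h k) + 1 \<ge> (\<Sum>k=1..p-1. n k)))))"

end

(*
  The cell of X(w) on which the Pluecker coordinate p_w does not vanish consists of the matrices M(i,c)
  with i not in w, c in w, i < c. Stability says that the members of w in a block k form its final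
  segment, so that M(i,c) = 0 unless i lies in an earlier block than c. With q_k = N_k - h_k, the Borel
  subgroup of L acts on these matrices by row operations within the q_l free rows of a block l and column
  operations within the h_k columns of a block k.

  If the condition holds, then the nonzero part of M is covered by few rectangular pieces and elimination
  brings a generic M to a single normal form; hence there is a dense open Borel orbit. A dense orbit
  implies multiplicity freeness: isomorphic irreducible submodules contain Borel eigenvectors of the same
  weight, whose ratio is constant on the orbit.

  If the condition fails, then two different products of three Pluecker coordinates, each indexed by a
  union of final segments of the blocks, are linearly independent and have the same Borel weight. For the
  Hermitian form on the degree 3 part that makes conjugate transpose the adjoint, a Borel eigenvector
  generates an irreducible L-module, and two eigenvectors of equal weight that are orthogonal and of equal
  norm generate different isomorphic ones: the isomorphism has as its graph the module generated by their
  sum, which is orthogonal to the one generated by their difference.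
*)
theory Submission
  imports Defs "HOL-Library.FuncSet"
begin

section \<open>Determinants and the Cauchy-Binet formula\<close>

text \<open>The proof closes a cycle: condition, dense orbit, multiplicity freeness, condition.
  Genericity always means a polynomial that is nonzero at one explicit point; irreducibility of X(w)
  and density in the Levi group come from restricting polynomials to a line, where a nonzero one has
  finitely many zeros. An irreducible submodule is not known in advance to be finite dimensional, so
  its Borel eigenvector is found as a vector of least weight for the one-parameter group
  diag(t^(N-i)).

  The dividing line is a bipartite graph of rows and columns. In the normal forms the nonzero
  entries form a forest, and a torus can scale the entries along a forest to 1. When the condition
  fails, a quotient of products of minors survives as an invariant of the Borel subgroup; the
  configurations used are a four-cycle of blocks and \<open>column_star\<close>,
  \<open>row_star\<close>, \<open>path_four\<close>, \<open>column_pair\<close>,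
  \<open>row_pair\<close>. The last three need three factors on at least one side, the others two on
  each; filling up with the coordinate p_w makes degree 3 serve for all.\<close>

definition dt :: "nat \<Rightarrow> (nat \<Rightarrow> nat \<Rightarrow> complex) \<Rightarrow> complex" where
  "dt n a = det (mat n n (\<lambda>(i, j). a i j))"

lemma dt_cong: "(\<And>i j. i < n \<Longrightarrow> j < n \<Longrightarrow> a i j = b i j) \<Longrightarrow> dt n a = dt n b"
  unfolding dt_def by (rule arg_cong[of _ _ det]) auto

lemma dt_leibniz:
  "dt n a = (\<Sum>p | p permutes {0..<n}. signof p * (\<Prod>i<n. a i (p i)))"
proof -
  have "dt n a = (\<Sum>p | p permutes {0..<n}. signof p * (\<Prod>i = 0..<n. mat n n (\<lambda>(i, j). a i j) $$ (i, p i)))"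
    unfolding dt_def by (rule det_def') auto
  also have "\<dots> = (\<Sum>p | p permutes {0..<n}. signof p * (\<Prod>i<n. a i (p i)))"
  proof (rule sum.cong[OF refl])
    fix p assume "p \<in> {p. p permutes {0..<n}}"
    then have p: "\<And>i. i < n \<Longrightarrow> p i < n"
      by (metis atLeastLessThan_iff mem_Collect_eq permutes_in_image zero_le)
    show "signof p * (\<Prod>i = 0..<n. mat n n (\<lambda>(i, j). a i j) $$ (i, p i)) = (signof p :: complex) * (\<Prod>i<n. a i (p i))"
      using p by (auto simp: atLeast0LessThan intro!: prod.cong)
  qed
  finally show ?thesis .
qed

lemma dt_permute_rows:
  assumes "p permutes {0..<n}"
  shows "dt n (\<lambda>i j. a (p i) j) = signof p * dt n a"
proof -
  have p: "\<And>i. i < n \<Longrightarrow> p i < n"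
    by (metis assms atLeastLessThan_iff permutes_in_image zero_le)
  have "dt n (\<lambda>i j. a (p i) j) = det (mat n n (\<lambda>(i,j). mat n n (\<lambda>(i, j). a i j) $$ (p i, j)))"
    unfolding dt_def using p by (intro arg_cong[of _ _ det]) auto
  also have "\<dots> = signof p * dt n a"
    unfolding dt_def by (rule det_permute_rows) (use assms in auto)
  finally show ?thesis .
qed

lemma dt_identical_rows:
  assumes "i < n" "k < n" "i \<noteq> k" "\<And>j. j < n \<Longrightarrow> a i j = a k j"
  shows "dt n a = 0"
  unfolding dt_def
  by (rule det_identical_rows[OF _ assms(3,1,2)]) (use assms in auto)

lemma dt_mult: "dt n (\<lambda>i j. \<Sum>k<n. a i k * b k j) = dt n a * dt n b"
proof -
  have "mat n n (\<lambda>(i, j). \<Sum>k<n. a i k * b k j) = mat n n (\<lambda>(i, j). a i j) * mat n n (\<lambda>(i, j). b i j)"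
    by (rule eq_matI) (auto simp: scalar_prod_def atLeast0LessThan intro!: sum.cong)
  then show ?thesis
    unfolding dt_def by (simp add: det_mult[of _ n])
qed

lemma dt_transpose: "dt n (\<lambda>i j. a j i) = dt n a"
proof -
  have "mat n n (\<lambda>(i, j). a j i) = transpose_mat (mat n n (\<lambda>(i, j). a i j))"
    by (rule eq_matI) auto
  then show ?thesis unfolding dt_def by (simp add: det_transpose[of _ n])
qed

lemma dt_upper_triangular:
  assumes "\<And>i j. i < n \<Longrightarrow> j < i \<Longrightarrow> a i j = 0"
  shows "dt n a = (\<Prod>i<n. a i i)"
proof -
  have "dt n a = prod_list (diag_mat (mat n n (\<lambda>(i, j). a i j)))"
    unfolding dt_def by (rule det_upper_triangular[of _ n]) (use assms in auto)
  also have "\<dots> = prod_list (map (\<lambda>i. a i i) [0..<n])"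
    unfolding diag_mat_def by (intro arg_cong[of _ _ prod_list]) auto
  also have "\<dots> = (\<Prod>i<n. a i i)"
    by (simp add: prod.list_conv_set_nth atLeast0LessThan)
  finally show ?thesis .
qed

lemma dt_one: "dt n (\<lambda>i j. if i = j then 1 else 0) = 1"
  by (subst dt_upper_triangular) auto

lemma dt_left_kernel:
  assumes "i0 < n" "y i0 \<noteq> 0" "\<And>j. j < n \<Longrightarrow> (\<Sum>i<n. y i * a i j) = 0"
  shows "dt n a = 0"
proof -
  define v where "v = vec n y"
  let ?A = "mat n n (\<lambda>(i, j). a j i)"
  have "v \<noteq> 0\<^sub>v n" using assms(1,2) by (metis index_vec index_zero_vec(1) v_def)
  moreover have "?A *\<^sub>v v = 0\<^sub>v n"
  proof (rule eq_vecI)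
    fix j assume "j < dim_vec (0\<^sub>v n :: complex vec)"
    then have j: "j < n" by simp
    have "(?A *\<^sub>v v) $ j = (\<Sum>i<n. y i * a i j)"
      using j by (auto simp: v_def scalar_prod_def atLeast0LessThan mult.commute intro!: sum.cong)
    then show "(?A *\<^sub>v v) $ j = 0\<^sub>v n $ j" using assms(3)[OF j] j by simp
  qed (simp add: v_def)
  moreover have "v \<in> carrier_vec n" by (simp add: v_def)
  ultimately have "det ?A = 0"
    using det_0_iff_vec_prod_zero[of ?A n] by (metis mat_carrier)
  then show ?thesis using dt_transpose[of n a] by (simp add: dt_def)
qed

lemma dt_nonzero:
  assumes "\<And>v. (\<And>i. i < n \<Longrightarrow> (\<Sum>j<n. a i j * v j) = 0) \<Longrightarrow> \<forall>j<n. v j = 0"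
  shows "dt n a \<noteq> 0"
proof
  let ?A = "mat n n (\<lambda>(i, j). a i j)"
  assume "dt n a = 0"
  then obtain v where v: "v \<in> carrier_vec n" "v \<noteq> 0\<^sub>v n" "?A *\<^sub>v v = 0\<^sub>v n"
    unfolding dt_def using det_0_iff_vec_prod_zero[of ?A n] by auto
  have "(\<Sum>j<n. a i j * v $ j) = 0" if "i < n" for i
  proof -
    have "(?A *\<^sub>v v) $ i = 0" using v that by simp
    then show ?thesis using that v(1) by (simp add: scalar_prod_def atLeast0LessThan)
  qed
  then have "\<forall>j<n. v $ j = 0" using assms by blast
  then have "v = 0\<^sub>v n" using v(1) by (intro eq_vecI) auto
  then show False using v(2) by simp
qed

lemma Idn_length: "s \<in> Idn d N \<Longrightarrow> length s = d"
  and Idn_sorted: "s \<in> Idn d N \<Longrightarrow> sorted_wrt (<) s"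
  and Idn_subset: "s \<in> Idn d N \<Longrightarrow> set s \<subseteq> {1..N}"
  by (auto simp: Idn_def)

lemma Idn_distinct: "s \<in> Idn d N \<Longrightarrow> distinct s"
  using Idn_sorted strict_sorted_iff by blast

lemma Idn_card: "s \<in> Idn d N \<Longrightarrow> card (set s) = d"
  using Idn_distinct Idn_length distinct_card by blast

lemma Idn_nth_bij: "s \<in> Idn d N \<Longrightarrow> bij_betw (nth s) {..<d} (set s)"
  using Idn_distinct Idn_length by (auto intro!: bij_betw_nth)

lemma Idn_nth: "s \<in> Idn d N \<Longrightarrow> i < d \<Longrightarrow> 1 \<le> s ! i \<and> s ! i \<le> N"
  using Idn_subset[of s d N] Idn_length[of s d N] nth_mem[of i s] by fastforce

lemma Idn_sorted_list:
  assumes "A \<subseteq> {1..N}" "card A = d"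
  shows "sorted_list_of_set A \<in> Idn d N" "set (sorted_list_of_set A) = A"
proof -
  have "finite A" using assms(1) finite_subset by blast
  then show "sorted_list_of_set A \<in> Idn d N" "set (sorted_list_of_set A) = A"
    using assms by (auto simp: Idn_def)
qed

lemma Idn_eqI: "s \<in> Idn d N \<Longrightarrow> t \<in> Idn d N \<Longrightarrow> set s = set t \<Longrightarrow> s = t"
  using Idn_sorted strict_sorted_equal by blast

lemma Idn_finite: "finite (Idn d N)"
proof (rule inj_on_finite[of set _ "Pow {1..N}"])
  show "inj_on set (Idn d N)" using Idn_eqI by (auto simp: inj_on_def)
  show "set ` Idn d N \<subseteq> Pow {1..N}" using Idn_subset by auto
qed simp

text \<open>Expanding the product of sums gives a sum over all maps \<open>f\<close> from rows to
  {1..N}, weighted by the determinant of \<open>Z\<close> with rows \<open>f i\<close>. That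
  determinant vanishes when \<open>f\<close> repeats a value, and an injective \<open>f\<close> is
  in a unique way an increasing list composed with a permutation, whose sign moves into the first
  determinant.\<close>

lemma cauchy_binet:
  "dt d (\<lambda>i j. \<Sum>m = 1..N. a i m * Z m j)
     = (\<Sum>t\<in>Idn d N. dt d (\<lambda>i j. a i (t ! j)) * dt d (\<lambda>i j. Z (t ! i) j))"
proof -
  let ?P = "{p. p permutes {0..<d}}" and ?F = "{..<d} \<rightarrow>\<^sub>E {1..N}"
  have finP: "finite ?P" by (simp add: finite_permutations)
  have finF: "finite ?F" by (intro finite_PiE) auto
  have "dt d (\<lambda>i j. \<Sum>m = 1..N. a i m * Z m j)
      = (\<Sum>p\<in>?P. signof p * (\<Sum>f\<in>?F. \<Prod>i<d. a i (f i) * Z (f i) (p i)))"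
    unfolding dt_leibniz by (subst prod_sum_PiE) auto
  also have "\<dots> = (\<Sum>f\<in>?F. (\<Prod>i<d. a i (f i)) * dt d (\<lambda>i j. Z (f i) j))"
    unfolding dt_leibniz sum_distrib_left prod.distrib
    by (subst sum.swap) (intro sum.cong refl, simp add: ac_simps)
  also have "\<dots> = (\<Sum>f\<in>{f \<in> ?F. inj_on f {..<d}}. (\<Prod>i<d. a i (f i)) * dt d (\<lambda>i j. Z (f i) j))"
  proof (rule sum.mono_neutral_right[OF finF])
    show "\<forall>f\<in>?F - {f \<in> ?F. inj_on f {..<d}}. (\<Prod>i<d. a i (f i)) * dt d (\<lambda>i j. Z (f i) j) = 0"
    proof
      fix f assume "f \<in> ?F - {f \<in> ?F. inj_on f {..<d}}"
      then obtain i k where "i < d" "k < d" "i \<noteq> k" "f i = f k" by (auto simp: inj_on_def)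
      then show "(\<Prod>i<d. a i (f i)) * dt d (\<lambda>i j. Z (f i) j) = 0"
        using dt_identical_rows[of i d k "\<lambda>i j. Z (f i) j"] by simp
    qed
  qed auto
  also have "\<dots> = (\<Sum>(t, p)\<in>Idn d N \<times> ?P. (\<Prod>i<d. a i (t ! p i)) * dt d (\<lambda>i j. Z (t ! p i) j))"
  proof -
    let ?h = "\<lambda>(t :: nat list, p). restrict (\<lambda>i. t ! p i) {..<d}"
    have P_lt: "p i < d \<longleftrightarrow> i < d" if "p \<in> ?P" for p i
      using that permutes_in_image[of p "{0..<d}" i] by auto
    have "bij_betw ?h (Idn d N \<times> ?P) {f \<in> ?F. inj_on f {..<d}}"
    proof (rule bij_betwI')
      fix x y assume "x \<in> Idn d N \<times> ?P" "y \<in> Idn d N \<times> ?P"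
      then obtain t p t' p' where xy: "x = (t, p)" "y = (t', p')" "t \<in> Idn d N" "t' \<in> Idn d N" "p \<in> ?P" "p' \<in> ?P"
        by auto
      have img: "?h (u, q) ` {..<d} = set u" if "u \<in> Idn d N" "q \<in> ?P" for u q
      proof -
        have "?h (u, q) ` {..<d} = nth u ` (q ` {..<d})" by (auto simp: image_image)
        also have "q ` {..<d} = {..<d}" using that(2) permutes_image[of q "{0..<d}"] by (simp add: atLeast0LessThan)
        finally show ?thesis using Idn_nth_bij[OF that(1)] by (simp add: bij_betw_def)
      qed
      show "(?h x = ?h y) = (x = y)"
      proof
        assume eq: "?h x = ?h y"
        then have "set t = set t'" using img xy by metis
        then have tt: "t = t'" using Idn_eqI xy by blast
        have "p i = p' i" for i
        proof (cases "i < d")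
          case True
          have "t ! p i = t ! p' i" using fun_cong[OF eq, of i] True tt xy(1,2) by simp
          then show ?thesis using Idn_nth_bij[OF xy(3)] True P_lt xy(5,6)
            by (auto simp: bij_betw_def inj_on_def)
        next
          case False
          then show ?thesis using xy(5,6) by (auto simp: permutes_def)
        qed
        then show "x = y" using tt xy by auto
      qed simp
    next
      fix x assume "x \<in> Idn d N \<times> ?P"
      then obtain t p where xy: "x = (t, p)" "t \<in> Idn d N" "p \<in> ?P" by auto
      have "inj_on (?h x) {..<d}"
      proof (rule inj_onI)
        fix i k assume "i \<in> {..<d}" "k \<in> {..<d}" "?h x i = ?h x k"
        then have "p i = p k" using Idn_nth_bij[OF xy(2)] P_lt[OF xy(3)] xy
          by (auto simp: bij_betw_def inj_on_def)
        then show "i = k" using xy(3) permutes_inj[of p] by (auto simp: inj_def)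
      qed
      moreover have "?h x \<in> ?F"
        using Idn_nth[OF xy(2)] P_lt[OF xy(3)] xy by auto
      ultimately show "?h x \<in> {f \<in> ?F. inj_on f {..<d}}" by simp
    next
      fix f assume "f \<in> {f \<in> ?F. inj_on f {..<d}}"
      then have f: "f \<in> ?F" "inj_on f {..<d}" by auto
      define t where "t = sorted_list_of_set (f ` {..<d})"
      have t: "t \<in> Idn d N" "set t = f ` {..<d}"
      proof -
        have "f ` {..<d} \<subseteq> {1..N}" using f(1) by auto
        moreover have "card (f ` {..<d}) = d" using f(2) by (simp add: card_image)
        ultimately show "t \<in> Idn d N" "set t = f ` {..<d}"
          unfolding t_def by (rule Idn_sorted_list)+
      qed
      have bt: "bij_betw (nth t) {..<d} (f ` {..<d})" using Idn_nth_bij[OF t(1)] t(2) by simp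
      have bf: "bij_betw f {..<d} (f ` {..<d})" using f(2) by (simp add: bij_betw_def)
      \<comment> \<open>\<open>p i\<close> is the position of \<open>f i\<close> in the increasing
        list \<open>t\<close> of the values of \<open>f\<close>.\<close>
      define p where "p = (\<lambda>i. if i < d then inv_into {..<d} (nth t) (f i) else i)"
      have "bij_betw (inv_into {..<d} (nth t) \<circ> f) {..<d} {..<d}"
        using bf bij_betw_inv_into[OF bt] by (rule bij_betw_trans)
      then have "bij_betw p {..<d} {..<d}"
        by (subst bij_betw_cong[of _ _ "inv_into {..<d} (nth t) \<circ> f"]) (auto simp: p_def)
      moreover have "p i = i" if "i \<notin> {..<d}" for i using that by (auto simp: p_def)
      ultimately have "p \<in> ?P" by (auto simp: atLeast0LessThan intro!: bij_imp_permutes)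
      moreover have "f = ?h (t, p)"
      proof
        fix i show "f i = ?h (t, p) i"
        proof (cases "i < d")
          case True
          then have "t ! p i = f i" using bij_betw_inv_into_right[OF bt, of "f i"] by (simp add: p_def)
          then show ?thesis using True by simp
        next
          case False
          then show ?thesis using f(1) by (auto simp: PiE_def extensional_def)
        qed
      qed
      ultimately show "\<exists>x\<in>Idn d N \<times> ?P. f = ?h x" using t(1) by blast
    qed
    from sum.reindex_bij_betw[OF this, of "\<lambda>f. (\<Prod>i<d. a i (f i)) * dt d (\<lambda>i j. Z (f i) j)", symmetric]
    have "?thesis \<longleftrightarrow> (\<Sum>x\<in>Idn d N \<times> ?P. (\<Prod>i<d. a i (?h x i)) * dt d (\<lambda>i j. Z (?h x i) j))
      = (\<Sum>(t, p)\<in>Idn d N \<times> ?P. (\<Prod>i<d. a i (t ! p i)) * dt d (\<lambda>i j. Z (t ! p i) j))"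
      by simp
    also have "\<dots>"
      unfolding case_prod_beta
      by (intro sum.cong refl arg_cong2[of _ _ _ _ "(*)"] prod.cong dt_cong) auto
    finally show ?thesis by (simp add: case_prod_beta)
  qed
  also have "\<dots> = (\<Sum>t\<in>Idn d N. \<Sum>p\<in>?P. (\<Prod>i<d. a i (t ! p i)) * dt d (\<lambda>i j. Z (t ! p i) j))"
    by (simp add: sum.cartesian_product)
  also have "\<dots> = (\<Sum>t\<in>Idn d N. dt d (\<lambda>i j. a i (t ! j)) * dt d (\<lambda>i j. Z (t ! i) j))"
  proof (rule sum.cong[OF refl])
    fix t assume "t \<in> Idn d N"
    have "(\<Sum>p\<in>?P. (\<Prod>i<d. a i (t ! p i)) * dt d (\<lambda>i j. Z (t ! p i) j))
        = (\<Sum>p\<in>?P. (signof p * (\<Prod>i<d. a i (t ! p i))) * dt d (\<lambda>i j. Z (t ! i) j))"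
      by (intro sum.cong refl) (simp add: dt_permute_rows[of _ d "\<lambda>i j. Z (t ! i) j"])
    also have "\<dots> = dt d (\<lambda>i j. a i (t ! j)) * dt d (\<lambda>i j. Z (t ! i) j)"
      by (subst (2) dt_leibniz) (simp add: sum_distrib_right)
    finally show "(\<Sum>p\<in>?P. (\<Prod>i<d. a i (t ! p i)) * dt d (\<lambda>i j. Z (t ! p i) j))
        = dt d (\<lambda>i j. a i (t ! j)) * dt d (\<lambda>i j. Z (t ! i) j)" .
  qed
  finally show ?thesis .
qed

section \<open>The action on Pluecker coordinates\<close>

text \<open>Both \<open>polyfun\<close> and the one-variable functions \<open>polyline\<close> are
  such algebras; the closure lemmas, up to determinants, are proved once for the two of
  them.\<close>

definition fun_alg :: "('a \<Rightarrow> complex) set \<Rightarrow> bool" where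
  "fun_alg A \<longleftrightarrow> (\<forall>c. (\<lambda>_. c) \<in> A) \<and> (\<forall>f\<in>A. \<forall>g\<in>A. (\<lambda>x. f x + g x) \<in> A \<and> (\<lambda>x. f x * g x) \<in> A)"

lemma fun_alg_const: "fun_alg A \<Longrightarrow> (\<lambda>_. c) \<in> A"
  and fun_alg_add: "fun_alg A \<Longrightarrow> f \<in> A \<Longrightarrow> g \<in> A \<Longrightarrow> (\<lambda>x. f x + g x) \<in> A"
  and fun_alg_mult: "fun_alg A \<Longrightarrow> f \<in> A \<Longrightarrow> g \<in> A \<Longrightarrow> (\<lambda>x. f x * g x) \<in> A"
  by (auto simp: fun_alg_def)

lemma fun_alg_cmult: "fun_alg A \<Longrightarrow> f \<in> A \<Longrightarrow> (\<lambda>x. c * f x) \<in> A"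
  by (rule fun_alg_mult[OF _ fun_alg_const])

lemma fun_alg_diff: "fun_alg A \<Longrightarrow> f \<in> A \<Longrightarrow> g \<in> A \<Longrightarrow> (\<lambda>x. f x - g x) \<in> A"
  using fun_alg_add[of A f "\<lambda>x. (-1) * g x"] fun_alg_cmult[of A g "-1"] by simp

lemma fun_alg_power: "fun_alg A \<Longrightarrow> f \<in> A \<Longrightarrow> (\<lambda>x. f x ^ n) \<in> A"
  by (induction n) (auto intro: fun_alg_const fun_alg_mult)

lemma fun_alg_sum:
  assumes "fun_alg A" "\<And>i. i \<in> I \<Longrightarrow> f i \<in> A"
  shows "(\<lambda>x. \<Sum>i\<in>I. f i x) \<in> A"
  using assms(2)
proof (induction I rule: infinite_finite_induct)
  case (insert i I)
  then show ?case using fun_alg_add[OF assms(1), of "f i" "\<lambda>x. \<Sum>i\<in>I. f i x"] by simp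
qed (auto intro: fun_alg_const[OF assms(1)])

lemma fun_alg_prod:
  assumes "fun_alg A" "\<And>i. i \<in> I \<Longrightarrow> f i \<in> A"
  shows "(\<lambda>x. \<Prod>i\<in>I. f i x) \<in> A"
  using assms(2)
proof (induction I rule: infinite_finite_induct)
  case (insert i I)
  then show ?case using fun_alg_mult[OF assms(1), of "f i" "\<lambda>x. \<Prod>i\<in>I. f i x"] by simp
qed (auto intro: fun_alg_const[OF assms(1)])

lemma fun_alg_dt:
  assumes "fun_alg A" "\<And>i j. i < n \<Longrightarrow> j < n \<Longrightarrow> (\<lambda>x. a x i j) \<in> A"
  shows "(\<lambda>x. dt n (a x)) \<in> A"
  unfolding dt_leibniz
proof (intro fun_alg_sum fun_alg_cmult fun_alg_prod assms)
  fix p i assume "p \<in> {p. p permutes {0..<n}}" "i \<in> {..<n}"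
  then show "p i < n" using permutes_in_image[of p "{0..<n}" i] by auto
qed auto

lemma fun_alg_polyfun: "fun_alg polyfun"
  by (auto simp: fun_alg_def intro: polyfun.intros)

text \<open>With \<open>A = polyline\<close> this restricts a polynomial to a curve, with
  \<open>A = polyfun\<close> it composes it with a polynomial map.\<close>

lemma polyfun_comp:
  assumes "fun_alg A" "f \<in> polyfun" "\<And>s. (\<lambda>t. T t s) \<in> A"
  shows "(\<lambda>t. f (T t)) \<in> A"
  using assms(2)
  by (induction rule: polyfun.induct)
     (auto intro: fun_alg_const[OF assms(1)] assms(3) fun_alg_add[OF assms(1)] fun_alg_mult[OF assms(1)])

definition polyline :: "(complex \<Rightarrow> complex) set" where
  "polyline = range poly"

lemma polylineI: "(\<And>t. f t = poly p t) \<Longrightarrow> f \<in> polyline"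
  unfolding polyline_def by (metis ext rangeI)

lemma fun_alg_polyline: "fun_alg polyline"
  unfolding fun_alg_def
proof (intro conjI allI ballI)
  fix c show "(\<lambda>_. c) \<in> polyline" by (rule polylineI[of _ "[:c:]"]) simp
next
  fix f g assume "f \<in> polyline" "g \<in> polyline"
  then obtain p q where "f = poly p" "g = poly q" by (auto simp: polyline_def)
  then show "(\<lambda>x. f x + g x) \<in> polyline" "(\<lambda>x. f x * g x) \<in> polyline"
    by (auto intro: polylineI[of _ "p + q"] polylineI[of _ "p * q"])
qed

lemma polyline_id: "(\<lambda>t. t) \<in> polyline"
  by (rule polylineI[of _ "[:0, 1:]"]) simp

text \<open>Two such functions, each nonzero somewhere, are nonzero at a common parameter because
  the complex numbers are infinite. The density arguments along lines rest on this.\<close>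

lemma polyline_zeros_finite:
  assumes "f \<in> polyline" "f a \<noteq> 0"
  shows "finite {t. f t = 0}"
proof -
  obtain p where "f = poly p" using assms(1) by (auto simp: polyline_def)
  moreover from this have "p \<noteq> 0" using assms(2) by auto
  ultimately show ?thesis using poly_roots_finite by auto
qed

section \<open>Minors and Pluecker coordinates of rectangular matrices\<close>

lemma minor_dt: "minor g s t = dt (length s) (\<lambda>i j. g $$ (s ! i - 1, t ! j - 1))"
  by (simp add: minor_def dt_def)

text \<open>Coordinates of the wedge of the \<open>d\<close> columns of \<open>Z\<close>. Rows are
  numbered from 1 like the basis of C^N, columns from 0 like list positions.\<close>

definition pl :: "nat \<Rightarrow> nat \<Rightarrow> (nat \<Rightarrow> nat \<Rightarrow> complex) \<Rightarrow> nat list \<Rightarrow> complex" where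
  "pl d N Z s = (if s \<in> Idn d N then dt d (\<lambda>i j. Z (s ! i) j) else 0)"

lemma pl_cong:
  assumes "\<And>i j. 1 \<le> i \<Longrightarrow> i \<le> N \<Longrightarrow> j < d \<Longrightarrow> Z i j = Z' i j"
  shows "pl d N Z = pl d N Z'"
proof
  fix s show "pl d N Z s = pl d N Z' s"
    unfolding pl_def using assms Idn_nth[of s d N] by (auto intro!: dt_cong)
qed

text \<open>Cauchy-Binet turns the action on a decomposable vector into a matrix product; the later
  orbit computations are done on the matrices \<open>Z\<close>.\<close>

lemma wact_pl: "wact d N g (pl d N Z) = pl d N (\<lambda>i j. \<Sum>m = 1..N. g $$ (i - 1, m - 1) * Z m j)"
proof
  fix s
  show "wact d N g (pl d N Z) s = pl d N (\<lambda>i j. \<Sum>m = 1..N. g $$ (i - 1, m - 1) * Z m j) s"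
  proof (cases "s \<in> Idn d N")
    case True
    have "wact d N g (pl d N Z) s
        = (\<Sum>t\<in>Idn d N. dt d (\<lambda>i j. g $$ (s ! i - 1, t ! j - 1)) * dt d (\<lambda>i j. Z (t ! i) j))"
      unfolding wact_def pl_def minor_dt using True Idn_length[OF True] by simp
    also have "\<dots> = pl d N (\<lambda>i j. \<Sum>m = 1..N. g $$ (i - 1, m - 1) * Z m j) s"
      unfolding pl_def using True
        cauchy_binet[where d = d and N = N and a = "\<lambda>i m. g $$ (s ! i - 1, m - 1)" and Z = Z, symmetric]
      by simp
    finally show ?thesis .
  qed (simp add: wact_def pl_def)
qed

lemma wact_ew:
  assumes "w \<in> Idn d N"
  shows "wact d N g (ew w) = pl d N (\<lambda>i j. g $$ (i - 1, w ! j - 1))"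
proof
  fix s
  have "(\<Sum>t\<in>Idn d N. minor g s t * ew w t) = minor g s w"
    unfolding ew_def using assms Idn_finite[of d N] by (simp add: if_distrib[of "\<lambda>x. _ * x"] cong: if_cong)
  then show "wact d N g (ew w) s = pl d N (\<lambda>i j. g $$ (i - 1, w ! j - 1)) s"
    unfolding wact_def pl_def minor_dt using Idn_length by auto
qed

text \<open>A change of basis of the column space moves the point only by a scalar, which is why
  echelon forms may be used as representatives.\<close>

lemma pl_colop: "pl d N (\<lambda>i j. \<Sum>l<d. Z i l * h l j) = (\<lambda>s. dt d h * pl d N Z s)"
  proof
  fix s
  show "pl d N (\<lambda>i j. \<Sum>l<d. Z i l * h l j) s = dt d h * pl d N Z s"
    unfolding pl_def using dt_mult[of d "\<lambda>i. Z (s ! i)" h] by (simp add: mult.commute)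
qed

lemma mat_mult_entry:
  assumes "A \<in> carrier_mat N N" "B \<in> carrier_mat N N" "1 \<le> i" "i \<le> N" "1 \<le> j" "j \<le> N"
  shows "(A * B) $$ (i - 1, j - 1) = (\<Sum>m = 1..N. A $$ (i - 1, m - 1) * B $$ (m - 1, j - 1))"
proof -
  have "(A * B) $$ (i - 1, j - 1) = (\<Sum>m = 0..<N. A $$ (i - 1, m) * B $$ (m, j - 1))"
    using assms by (auto simp: scalar_prod_def)
  also have "\<dots> = (\<Sum>m = 1..N. A $$ (i - 1, m - 1) * B $$ (m - 1, j - 1))"
    by (rule sum.reindex_bij_witness[of _ "\<lambda>m. m - 1" Suc]) auto
  finally show ?thesis .
qed

lemma minor_mult:
  assumes "A \<in> carrier_mat N N" "B \<in> carrier_mat N N" "s \<in> Idn d N" "u \<in> Idn d N"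
  shows "minor (A * B) s u = (\<Sum>t\<in>Idn d N. minor A s t * minor B t u)"
proof -
  have "minor (A * B) s u = dt d (\<lambda>i j. \<Sum>m = 1..N. A $$ (s ! i - 1, m - 1) * B $$ (m - 1, u ! j - 1))"
    unfolding minor_dt Idn_length[OF assms(3)]
    using Idn_nth[OF assms(3)] Idn_nth[OF assms(4)] assms(1,2) by (intro dt_cong mat_mult_entry) auto
  also have "\<dots> = (\<Sum>t\<in>Idn d N. minor A s t * minor B t u)"
    unfolding minor_dt Idn_length[OF assms(3)]
    by (subst cauchy_binet) (auto simp: Idn_length intro!: sum.cong)
  finally show ?thesis .
qed

lemma wact_mult:
  assumes "A \<in> carrier_mat N N" "B \<in> carrier_mat N N"
  shows "wact d N (A * B) x = wact d N A (wact d N B x)"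
proof
  fix s
  show "wact d N (A * B) x s = wact d N A (wact d N B x) s"
  proof (cases "s \<in> Idn d N")
    case True
    then have "wact d N (A * B) x s = (\<Sum>u\<in>Idn d N. (\<Sum>t\<in>Idn d N. minor A s t * minor B t u) * x u)"
      unfolding wact_def using minor_mult[OF assms] by simp
    also have "\<dots> = (\<Sum>t\<in>Idn d N. minor A s t * (\<Sum>u\<in>Idn d N. minor B t u * x u))"
      unfolding sum_distrib_left sum_distrib_right by (subst sum.swap) (simp add: mult.assoc)
    finally show ?thesis using True by (simp add: wact_def)
  qed (simp add: wact_def)
qed

lemma wact_scale: "wact d N g (\<lambda>s. c * x s) = (\<lambda>s. c * wact d N g x s)"
  unfolding wact_def by (auto simp: sum_distrib_left ac_simps)

lemma minor_eq_0_if_disjoint_row: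
  assumes "s \<in> Idn d N" "i < d" "\<And>j. j < d \<Longrightarrow> g $$ (s ! i - 1, t ! j - 1) = 0"
  shows "minor g s t = 0"
  unfolding minor_dt Idn_length[OF assms(1)]
  by (rule dt_left_kernel[of i _ "\<lambda>k. if k = i then 1 else 0"])
     (use assms in \<open>auto simp: if_distrib[of "\<lambda>x. x * _"] cong: if_cong\<close>)

text \<open>When \<open>s\<close> and \<open>u\<close> differ, some member of \<open>s\<close> is
  missing from \<open>u\<close>, and its row in the minor is zero.\<close>

lemma wact_diag:
  assumes "\<And>i. g $$ (i, i) = t i"
    and "\<And>i j. i < N \<Longrightarrow> j < N \<Longrightarrow> i \<noteq> j \<Longrightarrow> g $$ (i, j) = 0"
  shows "wact d N g x = (\<lambda>s. if s \<in> Idn d N then (\<Prod>i<d. t (s ! i - 1)) * x s else 0)"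
proof
  fix s
  have "minor g s u = (if s = u then \<Prod>i<d. t (s ! i - 1) else 0)" if s: "s \<in> Idn d N" and u: "u \<in> Idn d N" for u
  proof (cases "s = u")
    case True
    have ne: "s ! i - 1 < N \<and> s ! j - 1 < N \<and> s ! i - 1 \<noteq> s ! j - 1" if "i < d" "j < d" "i \<noteq> j" for i j
      using Idn_nth[OF s that(1)] Idn_nth[OF s that(2)] nth_eq_iff_index_eq[OF Idn_distinct[OF s], of i j]
        Idn_length[OF s] that by linarith
    have "g $$ (s ! i - 1, s ! j - 1) = 0" if "i < d" "j < i" for i j
      using assms(2) ne[of i j] that by simp
    then have "minor g s s = (\<Prod>i<d. t (s ! i - 1))"
      unfolding minor_dt Idn_length[OF s] by (subst dt_upper_triangular) (use assms(1) in auto)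
    then show ?thesis using True by simp
  next
    case False
    then have "set s \<noteq> set u" using Idn_eqI s u by blast
    then have "\<not> set s \<subseteq> set u" using Idn_card[OF s] Idn_card[OF u] by (metis List.finite_set card_subset_eq)
    then obtain i where i: "i < d" "s ! i \<notin> set u" using Idn_length[OF s] by (metis in_set_conv_nth subsetI)
    have "minor g s u = 0"
    proof (rule minor_eq_0_if_disjoint_row[OF s i(1)])
      fix j assume j: "j < d"
      then have "u ! j \<noteq> s ! i" using i(2) Idn_length[OF u] by (metis nth_mem)
      then have "s ! i - 1 \<noteq> u ! j - 1" using Idn_nth[OF s i(1)] Idn_nth[OF u j] by linarith
      then show "g $$ (s ! i - 1, u ! j - 1) = 0" using assms(2) Idn_nth[OF s i(1)] Idn_nth[OF u j] by force
    qed
    then show ?thesis using False by simp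
  qed
  then show "wact d N g x s = (if s \<in> Idn d N then (\<Prod>i<d. t (s ! i - 1)) * x s else 0)"
    unfolding wact_def using Idn_finite[of d N] by (simp add: if_distrib[of "\<lambda>x. x * _"] cong: if_cong)
qed

lemma wact_one: "(\<And>s. s \<notin> Idn d N \<Longrightarrow> x s = 0) \<Longrightarrow> wact d N (1\<^sub>m N) x = x"
proof -
  assume x: "\<And>s. s \<notin> Idn d N \<Longrightarrow> x s = 0"
  have "minor (1\<^sub>m N) s u = (if s = u then 1 else 0)" if s: "s \<in> Idn d N" and u: "u \<in> Idn d N" for s u
  proof (cases "s = u")
    case True
    have "minor (1\<^sub>m N) s s = dt d (\<lambda>i j. if i = j then 1 else 0)"
      unfolding minor_dt Idn_length[OF s]
    proof (rule dt_cong)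
      fix i j assume "i < d" "j < d"
      then show "(1\<^sub>m N :: complex mat) $$ (s ! i - 1, s ! j - 1) = (if i = j then 1 else 0)"
        using Idn_nth[OF s, of i] Idn_nth[OF s, of j] nth_eq_iff_index_eq[OF Idn_distinct[OF s], of i j] Idn_length[OF s]
        by (auto simp: one_mat_def)
    qed
    then show ?thesis using True dt_one by simp
  next
    case False
    then have "set s \<noteq> set u" using Idn_eqI s u by blast
    then have "\<not> set s \<subseteq> set u" using Idn_card[OF s] Idn_card[OF u] by (metis List.finite_set card_subset_eq)
    then obtain i where i: "i < d" "s ! i \<notin> set u" using Idn_length[OF s] by (metis in_set_conv_nth subsetI)
    have "minor (1\<^sub>m N) s u = 0"
    proof (rule minor_eq_0_if_disjoint_row[OF s i(1)])
      fix j assume j: "j < d"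
      then have "u ! j \<noteq> s ! i" using i(2) Idn_length[OF u] by (metis nth_mem)
      then have "s ! i - 1 \<noteq> u ! j - 1" using Idn_nth[OF s i(1)] Idn_nth[OF u j] by linarith
      then show "(1\<^sub>m N :: complex mat) $$ (s ! i - 1, u ! j - 1) = 0"
        using Idn_nth[OF s i(1)] Idn_nth[OF u j] by (auto simp: one_mat_def)
    qed
    then show ?thesis using False by simp
  qed
  then show "wact d N (1\<^sub>m N) x = x"
    unfolding wact_def using Idn_finite[of d N] x by (auto simp: if_distrib[of "\<lambda>x. x * _"] cong: if_cong)
qed

lemma wact_coord_polyfun: "(\<lambda>x. wact d N g x s) \<in> polyfun"
  unfolding wact_def
  by (cases "s \<in> Idn d N")
     (auto intro!: fun_alg_sum[OF fun_alg_polyfun] fun_alg_cmult[OF fun_alg_polyfun] polyfun.intros)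

lemma polyfun_wact: "f \<in> polyfun \<Longrightarrow> (\<lambda>x. f (wact d N g x)) \<in> polyfun"
  by (rule polyfun_comp[OF fun_alg_polyfun _ wact_coord_polyfun])

text \<open>Some Leibniz term is nonzero, and its permutation matches each row index with a column
  index that is not smaller. The nonzero entries are recorded as well, since for a Levi element they
  confine the matching to blocks.\<close>

lemma minor_upper_count:
  assumes g: "\<And>i j. i \<le> N \<Longrightarrow> 1 \<le> j \<Longrightarrow> j < i \<Longrightarrow> g $$ (i - 1, j - 1) = 0"
    and s: "s \<in> Idn d N" and t: "t \<in> Idn d N" and nz: "minor g s t \<noteq> 0"
  obtains p where "p permutes {0..<d}" "\<And>i. i < d \<Longrightarrow> g $$ (s ! i - 1, t ! p i - 1) \<noteq> 0"
    "\<And>i. i < d \<Longrightarrow> s ! i \<le> t ! p i"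
proof -
  obtain p where p: "p permutes {0..<d}" "(\<Prod>i<d. g $$ (s ! i - 1, t ! p i - 1)) \<noteq> 0"
    using nz unfolding minor_dt Idn_length[OF s] dt_leibniz
    by (smt (verit, ccfv_threshold) mem_Collect_eq mult_eq_0_iff sum.neutral)
  then have nz: "g $$ (s ! i - 1, t ! p i - 1) \<noteq> 0" if "i < d" for i using that by auto
  have "s ! i \<le> t ! p i" if "i < d" for i
  proof (rule ccontr)
    assume "\<not> s ! i \<le> t ! p i"
    moreover have "p i < d" using p(1) that permutes_in_image[of p "{0..<d}" i] by auto
    ultimately show False using g[of "s ! i" "t ! p i"] nz[OF that] Idn_nth[OF s that] Idn_nth[OF t, of "p i"] by auto
  qed
  with p(1) nz show thesis using that by blast
qed

lemma permuted_upset_card: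
  assumes s: "s \<in> Idn d N" and t: "t \<in> Idn d N" and p: "p permutes {0..<d}"
    and mono: "\<And>i. i < d \<Longrightarrow> s ! i \<in> S \<Longrightarrow> t ! p i \<in> T"
  shows "card (set s \<inter> S) \<le> card (set t \<inter> T)"
proof -
  have *: "card (set u \<inter> V) = card {i. i < d \<and> u ! i \<in> V}" if "u \<in> Idn d N" for u and V :: "nat set"
  proof -
    have "set u \<inter> V = nth u ` {i. i < d \<and> u ! i \<in> V}"
      using Idn_length[OF that] by (auto simp: in_set_conv_nth)
    moreover have "inj_on (nth u) {i. i < d \<and> u ! i \<in> V}"
      using Idn_nth_bij[OF that] by (auto simp: bij_betw_def inj_on_def)
    ultimately show ?thesis by (simp add: card_image)
  qed
  have "card {i. i < d \<and> s ! i \<in> S} \<le> card {i. i < d \<and> t ! i \<in> T}"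
  proof (rule card_inj_on_le[of p])
    show "inj_on p {i. i < d \<and> s ! i \<in> S}" using permutes_inj[OF p] by (auto simp: inj_def inj_on_def)
    show "p ` {i. i < d \<and> s ! i \<in> S} \<subseteq> {i. i < d \<and> t ! i \<in> T}"
      using mono permutes_in_image[OF p] by fastforce
  qed simp
  then show ?thesis using * s t by simp
qed

section \<open>Invertible and upper triangular matrices\<close>

lemma GLn_mult: "g \<in> GLn N \<Longrightarrow> h \<in> GLn N \<Longrightarrow> g * h \<in> GLn N"
  by (auto simp: GLn_def det_mult[of _ N])

lemma Bor_GLn: "g \<in> Bor N \<Longrightarrow> g \<in> GLn N"
  and Bor_carrier: "g \<in> Bor N \<Longrightarrow> g \<in> carrier_mat N N"
  by (auto simp: Bor_def GLn_def)

lemma Bor_lower: "g \<in> Bor N \<Longrightarrow> i \<le> N \<Longrightarrow> 1 \<le> j \<Longrightarrow> j < i \<Longrightarrow> g $$ (i - 1, j - 1) = 0"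
  by (auto simp: Bor_def)

lemma upper_det:
  fixes g :: "complex mat"
  assumes "g \<in> carrier_mat N N" "\<And>i j. i < N \<Longrightarrow> j < i \<Longrightarrow> g $$ (i, j) = 0"
  shows "det g = (\<Prod>i<N. g $$ (i, i))"
proof -
  have "g = mat N N (\<lambda>(i, j). g $$ (i, j))" using assms(1) by auto
  then have "det g = dt N (\<lambda>i j. g $$ (i, j))" by (simp add: dt_def)
  then show ?thesis using dt_upper_triangular[of N "\<lambda>i j. g $$ (i, j)"] assms(2) by simp
qed

lemma Bor_iff:
  assumes "g \<in> carrier_mat N N"
  shows "g \<in> Bor N \<longleftrightarrow> (\<forall>i<N. g $$ (i, i) \<noteq> 0) \<and> (\<forall>i<N. \<forall>j<i. g $$ (i, j) = 0)"
  using assms upper_det[OF assms] by (auto simp: Bor_def GLn_def)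

lemma Bor_diag: "g \<in> Bor N \<Longrightarrow> i < N \<Longrightarrow> g $$ (i, i) \<noteq> 0"
  using Bor_iff[OF Bor_carrier] by blast

lemma Bor_mult:
  assumes "g \<in> Bor N" "h \<in> Bor N"
  shows "g * h \<in> Bor N"
proof -
  have "(g * h) $$ (i, j) = 0" if "i < N" "j < i" for i j
  proof -
    have "(g * h) $$ (i, j) = (\<Sum>m = 0..<N. g $$ (i, m) * h $$ (m, j))"
      using Bor_carrier[OF assms(1)] Bor_carrier[OF assms(2)] that by (auto simp: scalar_prod_def)
    also have "\<dots> = 0"
    proof (rule sum.neutral, rule ballI)
      fix m assume "m \<in> {0..<N}"
      then show "g $$ (i, m) * h $$ (m, j) = 0"
        using assms that by (cases "m < i") (auto simp: Bor_def)
    qed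
    finally show ?thesis .
  qed
  then show ?thesis using GLn_mult[OF Bor_GLn[OF assms(1)] Bor_GLn[OF assms(2)]] by (auto simp: Bor_def)
qed

lemma dt_inverse:
  assumes "dt n a \<noteq> 0"
  obtains h where "\<And>i j. i < n \<Longrightarrow> j < n \<Longrightarrow> (\<Sum>k<n. a i k * h k j) = (if i = j then 1 else 0)"
    "dt n h * dt n a = 1"
proof -
  let ?A = "mat n n (\<lambda>(i, j). a i j)"
  define h where "h = (\<lambda>i j. adj_mat ?A $$ (i, j) / dt n a)"
  have A: "?A \<in> carrier_mat n n" by simp
  note adj = adj_mat[OF A]
  have inv: "(\<Sum>k<n. a i k * h k j) = (if i = j then 1 else 0)" if "i < n" "j < n" for i j
  proof -
    have "(\<Sum>k<n. a i k * adj_mat ?A $$ (k, j)) = (?A * adj_mat ?A) $$ (i, j)"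
      using that adj(1) by (auto simp: scalar_prod_def atLeast0LessThan intro!: sum.cong)
    also have "\<dots> = (if i = j then dt n a else 0)"
      unfolding adj(2) using that by (simp add: dt_def)
    finally have "(\<Sum>k<n. a i k * adj_mat ?A $$ (k, j)) / dt n a = (if i = j then 1 else 0)"
      using assms by simp
    then show ?thesis by (simp add: h_def sum_divide_distrib)
  qed
  have "dt n a * dt n h = dt n (\<lambda>i j. \<Sum>k<n. a i k * h k j)" by (rule dt_mult[symmetric])
  also have "\<dots> = dt n (\<lambda>i j. if i = j then 1 else 0)" by (rule dt_cong) (rule inv)
  finally show thesis using that[OF inv] by (simp add: dt_one mult.commute)
qed

lemma fun_alg_if:
  "(P \<Longrightarrow> f \<in> A) \<Longrightarrow> (\<not> P \<Longrightarrow> g \<in> A) \<Longrightarrow> (\<lambda>x. if P then f x else g x) \<in> A"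
  by (cases P) simp_all

section \<open>The open Schubert cell\<close>

locale schubert =
  fixes d N :: nat and w :: "nat list"
  assumes wI: "w \<in> Idn d N" and d1: "1 \<le> d"
begin

abbreviation X :: "(nat list \<Rightarrow> complex) set" where "X \<equiv> Xcone d N w"

abbreviation act :: "complex mat \<Rightarrow> (nat list \<Rightarrow> complex) \<Rightarrow> (nat list \<Rightarrow> complex)" where
  "act \<equiv> wact d N"

lemmas w_length = Idn_length[OF wI]
lemmas w_bij = Idn_nth_bij[OF wI]

lemma w_nth_eq: "i < d \<Longrightarrow> j < d \<Longrightarrow> w ! i = w ! j \<longleftrightarrow> i = j"
  using Idn_distinct[OF wI] w_length by (simp add: nth_eq_iff_index_eq)

lemma w_range: "c \<in> set w \<Longrightarrow> 1 \<le> c \<and> c \<le> N"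
  using Idn_subset[OF wI] by auto

lemma w_nth_mem: "j < d \<Longrightarrow> w ! j \<in> set w"
  using w_length by simp

lemma w_obtain: assumes "c \<in> set w" obtains j where "j < d" "w ! j = c"
  using assms w_length by (metis in_set_conv_nth)

lemma X_vanish:
  assumes "f \<in> polyfun" "\<And>b. b \<in> Bor N \<Longrightarrow> f (act b (ew w)) = 0" "x \<in> X"
  shows "f x = 0"
  using assms by (auto simp: Xcone_def zar_closure_def)

lemma X_mem: "(\<And>f. f \<in> polyfun \<Longrightarrow> \<forall>b\<in>Bor N. f (act b (ew w)) = 0 \<Longrightarrow> f x = 0) \<Longrightarrow> x \<in> X"
  by (auto simp: Xcone_def zar_closure_def)

lemma orbit_in_X: "b \<in> Bor N \<Longrightarrow> act b (ew w) \<in> X"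
  by (rule X_mem) blast

lemma X_Bor:
  assumes "b \<in> Bor N" "x \<in> X"
  shows "act b x \<in> X"
proof (rule X_mem)
  fix f assume f: "f \<in> polyfun" "\<forall>b\<in>Bor N. f (act b (ew w)) = 0"
  show "f (act b x) = 0"
  proof (rule X_vanish[OF polyfun_wact[OF f(1)] _ assms(2)])
    fix c assume "c \<in> Bor N"
    then show "f (act b (act c (ew w))) = 0"
      using f(2) Bor_mult[OF assms(1)] by (simp flip: wact_mult[OF Bor_carrier Bor_carrier, OF assms(1)])
  qed
qed

lemma X_scale:
  assumes "c \<noteq> 0" "x \<in> X"
  shows "(\<lambda>s. c * x s) \<in> X"
proof (rule X_mem)
  fix f assume f: "f \<in> polyfun" "\<forall>b\<in>Bor N. f (act b (ew w)) = 0"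
  \<comment> \<open>\<open>w ! 0\<close> occurs exactly once in \<open>w\<close>, so scaling this
    single basis vector multiplies \<open>ew w\<close> by \<open>c\<close>; the scalar is thereby
    absorbed into the Borel group.\<close>
  define t where "t = (\<lambda>i. if i = w ! 0 - 1 then c else 1)"
  define D where "D = mat N N (\<lambda>(i, j). if i = j then t i else 0)"
  have D: "D \<in> Bor N" using assms(1) by (subst Bor_iff) (auto simp: D_def t_def)
  have "wact d N D (ew w) = (\<lambda>s. c * ew w s)"
  proof
    fix s
    have "(\<Prod>i<d. if w ! i - 1 = w ! 0 - 1 then c else 1) = (\<Prod>i<d. if i = 0 then c else 1)"
    proof (rule prod.cong[OF refl])
      fix i assume "i \<in> {..<d}"
      then have "w ! i - 1 = w ! 0 - 1 \<longleftrightarrow> i = 0"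
        using w_nth_eq[of i 0] Idn_nth[OF wI, of i] Idn_nth[OF wI, of 0] d1 by auto
      then show "(if w ! i - 1 = w ! 0 - 1 then c else 1) = (if i = 0 then c else 1)" by simp
    qed
    also have "\<dots> = c" using d1 by simp
    finally have "(\<Prod>i<d. t (w ! i - 1)) = c" by (simp add: t_def)
    moreover have "wact d N D (ew w) s = (\<Sum>u\<in>Idn d N. minor D s u * ew w u)" if "s \<in> Idn d N"
      using that by (simp add: wact_def)
    moreover have "wact d N D (ew w) s = (if s \<in> Idn d N then (\<Prod>i<d. D $$ (s ! i - 1, s ! i - 1)) * ew w s else 0)"
      by (subst wact_diag[where t = "\<lambda>i. D $$ (i, i)"]) (auto simp: D_def)
    moreover have "(\<Prod>i<d. D $$ (w ! i - 1, w ! i - 1)) = (\<Prod>i<d. t (w ! i - 1))"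
    proof (rule prod.cong[OF refl])
      fix i assume "i \<in> {..<d}"
      then have "w ! i - 1 < N" using Idn_nth[OF wI, of i] by auto
      then show "D $$ (w ! i - 1, w ! i - 1) = t (w ! i - 1)" by (simp add: D_def)
    qed
    ultimately show "wact d N D (ew w) s = c * ew w s" using wI by (auto simp: ew_def)
  qed
  then have eq: "(\<lambda>s. c * act b (ew w) s) = act (b * D) (ew w)" if "b \<in> Bor N" for b
    using wact_mult[OF Bor_carrier[OF that] Bor_carrier[OF D]] by (simp add: wact_scale)
  have pf: "(\<lambda>x. f (\<lambda>s. c * x s)) \<in> polyfun"
    by (rule polyfun_comp[OF fun_alg_polyfun f(1)]) (auto intro: fun_alg_cmult[OF fun_alg_polyfun] polyfun.intros)
  show "f (\<lambda>s. c * x s) = 0"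
    using X_vanish[OF pf _ assms(2)] f(2) Bor_mult[OF _ D] eq by simp
qed

lemma X_supp: "x \<in> X \<Longrightarrow> s \<notin> Idn d N \<Longrightarrow> x s = 0"
  by (rule X_vanish[of "\<lambda>x. x s"]) (auto intro: polyfun.intros simp: wact_def)

text \<open>Bruhat order in counting form. A coordinate that is nonzero at a point of the closure is
  nonzero somewhere on the orbit, and there a nonzero minor of an upper triangular matrix matches
  \<open>s\<close> upwards into \<open>w\<close>.\<close>

lemma X_count:
  assumes "x \<in> X" "x s \<noteq> 0"
  shows "card (set s \<inter> {c..}) \<le> card (set w \<inter> {c..})"
proof -
  have s: "s \<in> Idn d N" using assms X_supp by blast
  obtain b where b: "b \<in> Bor N" "act b (ew w) s \<noteq> 0"
    using X_vanish[of "\<lambda>x. x s" x] assms by (auto intro: polyfun.intros)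
  then have "minor b s w \<noteq> 0"
    using s wI Idn_finite[of d N] by (auto simp: wact_def ew_def if_distrib[of "\<lambda>x. _ * x"] cong: if_cong)
  then obtain p where "p permutes {0..<d}" "\<And>i. i < d \<Longrightarrow> s ! i \<le> w ! p i"
    by (rule minor_upper_count[rotated 3]) (use Bor_lower[OF b(1)] s wI in auto)
  then show ?thesis using permuted_upset_card[OF s wI, of p "{c..}" "{c..}"] by force
qed

text \<open>Irreducibility of the cone. Two Borel elements at which \<open>f\<close> and
  \<open>g\<close> respectively do not vanish are joined by a line of upper triangular matrices;
  outside finitely many parameters its points are invertible and both functions are nonzero, against
  \<open>fg\<close>.\<close>

lemma X_domain:
  assumes f: "f \<in> polyfun" and g: "g \<in> polyfun" and fg: "\<And>x. x \<in> X \<Longrightarrow> f x = 0 \<or> g x = 0"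
    and x: "x \<in> X" "f x \<noteq> 0" and y: "y \<in> X"
  shows "g y = 0"
proof (rule X_vanish[OF g _ y])
  fix b2 assume b2: "b2 \<in> Bor N"
  obtain b1 where b1: "b1 \<in> Bor N" "f (act b1 (ew w)) \<noteq> 0"
    using X_vanish[OF f _ x(1)] x(2) by blast
  define b where "b = (\<lambda>t. mat N N (\<lambda>(i, j). b1 $$ (i, j) + t * (b2 $$ (i, j) - b1 $$ (i, j))))"
  have entry: "(\<lambda>t. b t $$ (i, j)) \<in> polyline" if "i < N" "j < N" for i j
    using that unfolding b_def
    by (auto intro!: fun_alg_add[OF fun_alg_polyline] fun_alg_mult[OF fun_alg_polyline] fun_alg_const[OF fun_alg_polyline] polyline_id)
  have "(\<lambda>t. act (b t) (ew w) s) \<in> polyline" for s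
    unfolding wact_ew[OF wI] pl_def
  proof (cases "s \<in> Idn d N")
    case True
    have "(\<lambda>t. dt d (\<lambda>i j. b t $$ (s ! i - 1, w ! j - 1))) \<in> polyline"
    proof (rule fun_alg_dt[OF fun_alg_polyline])
      fix i j assume "i < d" "j < d"
      then show "(\<lambda>t. b t $$ (s ! i - 1, w ! j - 1)) \<in> polyline"
        using Idn_nth[OF True, of i] Idn_nth[OF wI, of j] by (intro entry) auto
    qed
    then show "(\<lambda>t. if s \<in> Idn d N then dt d (\<lambda>i j. b t $$ (s ! i - 1, w ! j - 1)) else 0) \<in> polyline"
      using True by simp
  qed (auto intro: fun_alg_const[OF fun_alg_polyline])
  note coord = this
  have F: "(\<lambda>t. f (act (b t) (ew w))) \<in> polyline" and G: "(\<lambda>t. g (act (b t) (ew w))) \<in> polyline"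
    by (rule polyfun_comp[OF fun_alg_polyline _ coord]; fact)+
  have D: "(\<lambda>t. \<Prod>i<N. b t $$ (i, i)) \<in> polyline"
    by (rule fun_alg_prod[OF fun_alg_polyline]) (auto intro: entry)
  have b0: "b 0 = b1" and b1': "b 1 = b2"
    using Bor_carrier[OF b1(1)] Bor_carrier[OF b2] by (auto simp: b_def)
  show "g (act b2 (ew w)) = 0"
  proof (rule ccontr)
    assume "g (act b2 (ew w)) \<noteq> 0"
    then have "finite {t. g (act (b t) (ew w)) = 0}" using polyline_zeros_finite[OF G, of 1] b1' by simp
    moreover have "finite {t. f (act (b t) (ew w)) = 0}" using polyline_zeros_finite[OF F, of 0] b0 b1 by simp
    moreover have "finite {t. (\<Prod>i<N. b t $$ (i, i)) = 0}"
      using polyline_zeros_finite[OF D, of 0] b0 Bor_diag[OF b1(1)] by simp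
    ultimately have "finite ({t. g (act (b t) (ew w)) = 0} \<union> {t. f (act (b t) (ew w)) = 0} \<union> {t. (\<Prod>i<N. b t $$ (i, i)) = 0})"
      by simp
    from ex_new_if_finite[OF infinite_UNIV_char_0 this] obtain t where "t \<notin> {t. g (act (b t) (ew w)) = 0} \<union> {t. f (act (b t) (ew w)) = 0} \<union> {t. (\<Prod>i<N. b t $$ (i, i)) = 0}" ..
    then have t: "g (act (b t) (ew w)) \<noteq> 0" "f (act (b t) (ew w)) \<noteq> 0" "(\<Prod>i<N. b t $$ (i, i)) \<noteq> 0"
      by auto
    have "b t \<in> Bor N"
      using t(3) b1(1) b2 by (subst Bor_iff) (auto simp: b_def Bor_def)
    then show False using fg[OF orbit_in_X] t by blast
  qed
qed

text \<open>Column echelon form of a point of the cell: column \<open>j\<close> is labelled by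
  \<open>w ! j\<close>, and the rows in \<open>w\<close> form the identity matrix. Only the values
  of \<open>M\<close> at pairs of an index outside \<open>w\<close> and a member of \<open>w\<close>
  matter.\<close>

definition zred :: "(nat \<Rightarrow> nat \<Rightarrow> complex) \<Rightarrow> nat \<Rightarrow> nat \<Rightarrow> complex" where
  "zred M i j = (if i \<in> set w then (if i = w ! j then 1 else 0) else M i (w ! j))"

definition cellpt :: "(nat \<Rightarrow> nat \<Rightarrow> complex) \<Rightarrow> nat list \<Rightarrow> complex" where
  "cellpt M = pl d N (zred M)"

lemma cellpt_w: "cellpt M w = 1"
proof -
  have "cellpt M w = dt d (\<lambda>i j. if i = j then 1 else 0)"
    unfolding cellpt_def pl_def using wI w_nth_mem by (auto simp: zred_def w_nth_eq intro!: dt_cong)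
  then show ?thesis by (simp add: dt_one)
qed

lemma cellpt_in_X:
  assumes "\<And>i c. 1 \<le> i \<Longrightarrow> i \<le> N \<Longrightarrow> i \<notin> set w \<Longrightarrow> c \<in> set w \<Longrightarrow> c < i \<Longrightarrow> M i c = 0"
  shows "cellpt M \<in> X"
proof -
  define b where "b = mat N N (\<lambda>(i, j). if Suc j \<in> set w \<and> Suc i \<notin> set w then M (Suc i) (Suc j)
    else if i = j then 1 else 0)"
  have "b \<in> Bor N" using assms by (subst Bor_iff) (auto simp: b_def)
  moreover have "cellpt M = act b (ew w)"
    unfolding wact_ew[OF wI] cellpt_def
  proof (rule pl_cong)
    fix i j assume "1 \<le> i" "i \<le> N" "j < d"
    then show "zred M i j = b $$ (i - 1, w ! j - 1)"
      using Idn_nth[OF wI, of j] w_nth_mem[of j] by (auto simp: zred_def b_def)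
  qed
  ultimately show ?thesis using orbit_in_X by simp
qed

definition repl :: "nat \<Rightarrow> nat \<Rightarrow> nat list" where
  "repl i c = sorted_list_of_set (insert i (set w - {c}))"

lemma repl:
  assumes "1 \<le> i" "i \<le> N" "i \<notin> set w" "c \<in> set w"
  shows "repl i c \<in> Idn d N" "set (repl i c) = insert i (set w - {c})"
proof -
  have "card (insert i (set w - {c})) = d" using assms Idn_card[OF wI] d1 by simp
  moreover have "insert i (set w - {c}) \<subseteq> {1..N}" using assms Idn_subset[OF wI] by auto
  ultimately show "repl i c \<in> Idn d N" "set (repl i c) = insert i (set w - {c})"
    unfolding repl_def by (rule Idn_sorted_list[rotated])+
qed

text \<open>The determinant of a permutation matrix: the sign that arises because
  \<open>repl i c\<close> is sorted, so that \<open>i\<close> need not stand where \<open>c\<close>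
  stood. Only that it is nonzero will matter.\<close>

definition eps :: "nat \<Rightarrow> nat \<Rightarrow> complex" where
  "eps i c = dt d (\<lambda>a b. if w ! b = (if repl i c ! a = i then c else repl i c ! a) then 1 else 0)"

text \<open>In the rows of \<open>repl i c\<close> every row except that of \<open>i\<close> is a
  unit row, so a nonzero Leibniz term must send the row of \<open>i\<close> to the column of
  \<open>c\<close>.\<close>

lemma cellpt_repl:
  assumes ic: "1 \<le> i" "i \<le> N" "i \<notin> set w" "c \<in> set w"
  shows "cellpt M (repl i c) = M i c * eps i c" and "eps i c \<noteq> 0"
proof -
  let ?s = "repl i c"
  note s = repl[OF ic]
  obtain a0 where a0: "a0 < d" "?s ! a0 = i"
    using s Idn_length by (metis in_set_conv_nth insertI1)
  have a_mem: "?s ! a \<in> set w - {c}" if "a < d" "a \<noteq> a0" for a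
  proof -
    have "?s ! a \<in> set ?s" using that(1) Idn_length[OF s(1)] by simp
    moreover have "?s ! a \<noteq> i"
      using a0 that nth_eq_iff_index_eq[OF Idn_distinct[OF s(1)], of a a0] Idn_length[OF s(1)] by simp
    ultimately show ?thesis using s(2) by auto
  qed
  have term_eq: "(\<Prod>a<d. zred M (?s ! a) (p a))
      = M i c * (\<Prod>a<d. if w ! p a = (if ?s ! a = i then c else ?s ! a) then 1 else 0)"
    if p: "p permutes {0..<d}" for p
  proof -
    let ?P = "\<lambda>a. if w ! p a = (if ?s ! a = i then c else ?s ! a) then 1 else (0 :: complex)"
    have split: "(\<Prod>a<d. f a) = f a0 * (\<Prod>a\<in>{..<d} - {a0}. f a)" for f :: "nat \<Rightarrow> complex"
      using a0 by (simp add: prod.remove)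
    have rest: "(\<Prod>a\<in>{..<d} - {a0}. zred M (?s ! a) (p a)) = (\<Prod>a\<in>{..<d} - {a0}. ?P a)"
    proof (rule prod.cong[OF refl])
      fix a assume "a \<in> {..<d} - {a0}"
      then show "zred M (?s ! a) (p a) = ?P a" using a_mem[of a] ic by (auto simp: zred_def)
    qed
    show ?thesis
    proof (cases "(\<Prod>a\<in>{..<d} - {a0}. ?P a) = 0")
      case False
      then have eq: "w ! p a = ?s ! a" if "a < d" "a \<noteq> a0" for a
        using that a_mem[OF that] ic by (auto split: if_splits)
      have "c \<in> nth w ` {..<d}" using ic(4) w_bij by (auto simp: bij_betw_def)
      also have "{..<d} = p ` {..<d}" using permutes_image[OF p] by (simp add: atLeast0LessThan)
      finally obtain a where a: "a < d" "w ! p a = c" by auto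
      then have "a = a0" using eq[of a] a_mem[of a] by auto
      then have "zred M (?s ! a0) (p a0) = M i c" "?P a0 = 1" using a a0 ic by (auto simp: zred_def)
      then show ?thesis unfolding split rest by simp
    qed (simp add: split rest)
  qed
  show "cellpt M ?s = M i c * eps i c"
    unfolding cellpt_def pl_def eps_def dt_leibniz using s(1)
    by (auto simp: sum_distrib_left term_eq ac_simps intro!: sum.cong)
  show "eps i c \<noteq> 0"
    unfolding eps_def
  proof (rule dt_nonzero)
    fix v :: "nat \<Rightarrow> complex"
    assume v: "\<And>a. a < d \<Longrightarrow> (\<Sum>b<d. (if w ! b = (if ?s ! a = i then c else ?s ! a) then 1 else 0) * v b) = 0"
    show "\<forall>b<d. v b = 0"
    proof (intro allI impI)
      fix b assume b: "b < d"
      obtain a where a: "a < d" "w ! b = (if ?s ! a = i then c else ?s ! a)"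
      proof (cases "w ! b = c")
        case True
        then show thesis using a0 that by auto
      next
        case False
        then have "w ! b \<in> set ?s" using s(2) w_nth_mem[OF b] by auto
        then obtain a where "a < d" "?s ! a = w ! b" using Idn_length[OF s(1)] by (metis in_set_conv_nth)
        moreover have "w ! b \<noteq> i" using ic w_nth_mem[OF b] by auto
        ultimately show thesis using that[of a] by simp
      qed
      have "(\<Sum>b'<d. (if w ! b' = w ! b then 1 else 0) * v b') = (\<Sum>b'<d. if b' = b then v b' else 0)"
        using b by (intro sum.cong) (auto simp: w_nth_eq)
      then show "v b = 0" using v[OF a(1)] b unfolding a(2)[symmetric] by simp
    qed
  qed
qed

text \<open>For a point with \<open>x w\<close> nonzero this is \<open>x w\<close> times the matrix
  entry. Leaving out the division by \<open>x w\<close> keeps it linear in \<open>x\<close>, hence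
  in \<open>polyfun\<close>.\<close>

definition ent :: "(nat list \<Rightarrow> complex) \<Rightarrow> nat \<Rightarrow> nat \<Rightarrow> complex" where
  "ent x i c = (if 1 \<le> i \<and> i \<le> N \<and> i \<notin> set w \<and> c \<in> set w then x (repl i c) / eps i c else 0)"

lemma ent_polyfun: "(\<lambda>x. ent x i c) \<in> polyfun"
  unfolding ent_def
  using fun_alg_cmult[OF fun_alg_polyfun polyfun.pcoord, of "1 / eps i c" "repl i c"]
  by (intro fun_alg_if polyfun.pconst) simp

lemma ent_cellpt:
  "1 \<le> i \<Longrightarrow> i \<le> N \<Longrightarrow> i \<notin> set w \<Longrightarrow> c \<in> set w \<Longrightarrow> ent (\<lambda>s. k * cellpt M s) i c = k * M i c"
  using cellpt_repl by (simp add: ent_def)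

text \<open>The submatrix of \<open>b\<close> with rows and columns in \<open>w\<close> is
  triangular with nonzero diagonal; multiplying on the right by its inverse produces the echelon
  form.\<close>

lemma orbit_cellpt:
  assumes b: "b \<in> Bor N"
  obtains M k where "act b (ew w) = (\<lambda>s. k * cellpt M s)" "k \<noteq> 0"
proof -
  define Z where "Z = (\<lambda>i j. b $$ (i - 1, w ! j - 1))"
  have "dt d (\<lambda>a. Z (w ! a)) = (\<Prod>a<d. Z (w ! a) a)"
  proof (rule dt_upper_triangular)
    fix i j assume "i < d" "j < i"
    moreover from this have "w ! j < w ! i"
      using Idn_sorted[OF wI] w_length by (simp add: sorted_wrt_nth_less)
    ultimately show "Z (w ! i) j = 0"
      unfolding Z_def using Bor_lower[OF b, of "w ! i" "w ! j"] Idn_nth[OF wI, of i] Idn_nth[OF wI, of j] by simp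
  qed
  moreover have "Z (w ! a) a \<noteq> 0" if "a < d" for a
    using Bor_diag[OF b, of "w ! a - 1"] Idn_nth[OF wI that] unfolding Z_def by linarith
  ultimately have "dt d (\<lambda>a. Z (w ! a)) \<noteq> 0" by simp
  then obtain h where h: "\<And>i j. i < d \<Longrightarrow> j < d \<Longrightarrow> (\<Sum>k<d. Z (w ! i) k * h k j) = (if i = j then 1 else 0)"
    "dt d h * dt d (\<lambda>a. Z (w ! a)) = 1"
    using dt_inverse[of d "\<lambda>a. Z (w ! a)"] by blast
  define M where "M = (\<lambda>i c. \<Sum>k<d. Z i k * h k (inv_into {..<d} (nth w) c))"
  have "pl d N (zred M) = pl d N (\<lambda>i j. \<Sum>l<d. Z i l * h l j)"
  proof (rule pl_cong)
    fix i j assume j: "1 \<le> i" "i \<le> N" "j < d"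
    show "zred M i j = (\<Sum>l<d. Z i l * h l j)"
    proof (cases "i \<in> set w")
      case True
      then obtain a where "a < d" "w ! a = i" by (rule w_obtain)
      then show ?thesis using h(1)[of a j] j w_nth_eq w_nth_mem by (auto simp: zred_def)
    next
      case False
      have "inv_into {..<d} (nth w) (w ! j) = j"
        using w_bij j by (auto simp: bij_betw_def)
      then show ?thesis using False by (simp add: zred_def M_def)
    qed
  qed
  also have "\<dots> = (\<lambda>s. dt d h * pl d N Z s)" by (rule pl_colop)
  also have "pl d N Z = act b (ew w)" by (simp add: wact_ew[OF wI] Z_def)
  finally have eq: "cellpt M s = dt d h * act b (ew w) s" for s by (simp add: cellpt_def fun_eq_iff)
  have "dt d h \<noteq> 0" using h(2) by auto
  then show thesis using eq by (intro that[of "1 / dt d h" M]) (auto simp: fun_eq_iff)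
qed

text \<open>Cleared of denominators by the power \<open>x w ^ d\<close>, the claim is a polynomial
  identity. It holds on the orbit, where points are multiples of cell points, hence on the closure,
  and may then be divided by \<open>x w\<close>.\<close>

lemma cell_coords:
  assumes x: "x \<in> X" and xw: "x w \<noteq> 0"
  shows "x = (\<lambda>s. x w * cellpt (\<lambda>i c. ent x i c / x w) s)"
proof
  fix s
  define F where "F = (\<lambda>(y :: nat list \<Rightarrow> complex) i j. if i \<in> set w then (if i = w ! j then y w else 0) else ent y i (w ! j))"
  show "x s = x w * cellpt (\<lambda>i c. ent x i c / x w) s"
  proof (cases "s \<in> Idn d N")
    case True
    have Fpf: "(\<lambda>y. F y i j) \<in> polyfun" for i j
      unfolding F_def by (intro fun_alg_if ent_polyfun polyfun.intros)
    have "x s * x w ^ d - x w * dt d (\<lambda>a. F x (s ! a)) = 0"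
    proof (rule X_vanish[of "\<lambda>y. y s * y w ^ d - y w * dt d (\<lambda>a. F y (s ! a))", OF _ _ x])
      show "(\<lambda>y. y s * y w ^ d - y w * dt d (\<lambda>a. F y (s ! a))) \<in> polyfun"
        by (intro fun_alg_diff[OF fun_alg_polyfun] fun_alg_mult[OF fun_alg_polyfun] fun_alg_power[OF fun_alg_polyfun]
          fun_alg_dt[OF fun_alg_polyfun] Fpf polyfun.intros)
      fix b assume "b \<in> Bor N"
      then obtain M k where y: "act b (ew w) = (\<lambda>s. k * cellpt M s)" "k \<noteq> 0" by (rule orbit_cellpt)
      have "dt d (\<lambda>a. F (act b (ew w)) (s ! a)) = dt d (\<lambda>a j. \<Sum>l<d. zred M (s ! a) l * (if l = j then k else 0))"
      proof (rule dt_cong)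
        fix a j assume a: "a < d" "j < d"
        have "F (act b (ew w)) (s ! a) j = zred M (s ! a) j * k"
          unfolding y F_def zred_def using cellpt_w Idn_nth[OF True a(1)] w_nth_mem[OF a(2)]
          by (auto simp: ent_cellpt)
        then show "F (act b (ew w)) (s ! a) j = (\<Sum>l<d. zred M (s ! a) l * (if l = j then k else 0))"
          using a by (simp add: if_distrib[of "\<lambda>x. _ * x"] cong: if_cong)
      qed
      also have "\<dots> = dt d (\<lambda>a. zred M (s ! a)) * k ^ d"
        unfolding dt_mult by (subst (2) dt_upper_triangular) auto
      also have "dt d (\<lambda>a. zred M (s ! a)) = cellpt M s" using True by (simp add: cellpt_def pl_def)
      finally show "act b (ew w) s * act b (ew w) w ^ d - act b (ew w) w * dt d (\<lambda>a. F (act b (ew w)) (s ! a)) = 0"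
        unfolding y by (simp add: cellpt_w)
    qed
    moreover have "dt d (\<lambda>a. F x (s ! a)) = dt d (\<lambda>a j. \<Sum>l<d. zred (\<lambda>i c. ent x i c / x w) (s ! a) l * (if l = j then x w else 0))"
      using xw by (intro dt_cong) (auto simp: F_def zred_def if_distrib[of "\<lambda>x. _ * x"] cong: if_cong)
    moreover have "\<dots> = dt d (\<lambda>a. zred (\<lambda>i c. ent x i c / x w) (s ! a)) * x w ^ d"
      unfolding dt_mult by (subst (2) dt_upper_triangular) auto
    moreover have "dt d (\<lambda>a. zred (\<lambda>i c. ent x i c / x w) (s ! a)) = cellpt (\<lambda>i c. ent x i c / x w) s"
      using True by (simp add: cellpt_def pl_def)
    ultimately show ?thesis using xw by simp
  next
    case False
    then show ?thesis using X_supp[OF x] by (simp add: cellpt_def pl_def)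
  qed
qed

text \<open>Exchanging \<open>c\<close> for a larger \<open>i\<close> would raise the number of
  members that are at least \<open>i\<close>, which \<open>X_count\<close> forbids.\<close>

lemma ent_upper:
  assumes "x \<in> X" "c < i"
  shows "ent x i c = 0"
proof (rule ccontr)
  assume "ent x i c \<noteq> 0"
  then have ic: "1 \<le> i" "i \<le> N" "i \<notin> set w" "c \<in> set w" and nz: "x (repl i c) \<noteq> 0"
    by (auto simp: ent_def split: if_splits)
  have "set (repl i c) \<inter> {i..} = insert i (set w \<inter> {i..})"
    unfolding repl(2)[OF ic] using assms(2) by (auto simp del: set_sorted_list_of_set)
  then show False using X_count[OF assms(1) nz, of i] ic by simp
qed

end

section \<open>Stability under the Levi subgroup\<close>

locale levi_schubert = schubert +
  fixes js :: "nat list"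
  assumes lev: "levi_ok N js" and stab: "stable d N w js" and red: "reduced N w"
begin

abbreviation b where "b \<equiv> bL js"
abbreviation J where "J \<equiv> jj js"
abbreviation h where "h \<equiv> hk js w"
abbreviation n where "n \<equiv> Nk js"
abbreviation L where "L \<equiv> Levi N js"
abbreviation BLv where "BLv \<equiv> Bor N \<inter> Levi N js"

lemma b1: "1 \<le> b"
  using lev by (cases js) (auto simp: levi_ok_def bL_def)

lemma J_0: "J 0 = 0"
  by (simp add: jj_def)

lemma J_b: "J b = N"
  using lev by (cases js rule: rev_cases) (auto simp: levi_ok_def jj_def bL_def nth_append)

lemma J_less: "k < l \<Longrightarrow> l \<le> b \<Longrightarrow> J k < J l"
proof -
  assume kl: "k < l" "l \<le> b"
  have "sorted_wrt (<) (0 # js)" using lev by (simp add: levi_ok_def)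
  then show "J k < J l"
    unfolding jj_def by (rule sorted_wrt_nth_less) (use kl in \<open>auto simp: bL_def\<close>)
qed

lemma J_le: "k \<le> l \<Longrightarrow> l \<le> b \<Longrightarrow> J k \<le> J l"
  using J_less[of k l] by (cases "k = l") auto

lemma J_le_N: "k \<le> b \<Longrightarrow> J k \<le> N"
  using J_le[of k b] J_b by simp

definition blk :: "nat \<Rightarrow> nat" where
  "blk i = (LEAST k. i \<le> J k)"

lemma blk_eq_iff:
  assumes "1 \<le> i" "i \<le> N" "k \<in> {1..b}"
  shows "blk i = k \<longleftrightarrow> J (k - 1) < i \<and> i \<le> J k"
proof
  assume k: "blk i = k"
  have "i \<le> J k" using LeastI[of "\<lambda>k. i \<le> J k" b] assms(2) J_b k by (simp add: blk_def)
  moreover have "\<not> i \<le> J (k - 1)"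
  proof
    assume "i \<le> J (k - 1)"
    then have "blk i \<le> k - 1" unfolding blk_def by (rule Least_le)
    then show False using k assms(3) by auto
  qed
  ultimately show "J (k - 1) < i \<and> i \<le> J k" by simp
next
  assume i: "J (k - 1) < i \<and> i \<le> J k"
  show "blk i = k" unfolding blk_def
  proof (rule Least_equality)
    fix l assume l: "i \<le> J l"
    show "k \<le> l"
    proof (rule ccontr)
      assume "\<not> k \<le> l"
      then have "J l \<le> J (k - 1)" using assms(3) by (intro J_le) auto
      then show False using l i by simp
    qed
  qed (use i in simp)
qed

lemma blk_range:
  assumes "1 \<le> i" "i \<le> N"
  shows "blk i \<in> {1..b}"
proof -
  have "i \<le> J (blk i)" using LeastI[of "\<lambda>k. i \<le> J k" b] assms J_b by (simp add: blk_def)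
  then have "blk i \<noteq> 0" using assms J_0 by (cases "blk i = 0") auto
  moreover have "blk i \<le> b" unfolding blk_def using assms J_b by (intro Least_le) simp
  ultimately show ?thesis by simp
qed

lemma Bl_iff:
  assumes "1 \<le> i" "i \<le> N" "k \<in> {1..b}"
  shows "i \<in> Bl js k \<longleftrightarrow> blk i = k"
  unfolding Bl_def blk_eq_iff[OF assms] by auto

lemma blk_bounds:
  assumes "1 \<le> i" "i \<le> N"
  shows "J (blk i - 1) < i" "i \<le> J (blk i)"
  using blk_eq_iff[OF assms blk_range[OF assms]] by auto

lemma blk_mono: "1 \<le> i \<Longrightarrow> i \<le> j \<Longrightarrow> j \<le> N \<Longrightarrow> blk i \<le> blk j"
  unfolding blk_def[of i] using blk_bounds(2)[of j] by (intro Least_le) simp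

lemma Levi_iff:
  "g \<in> L \<longleftrightarrow> g \<in> GLn N \<and> (\<forall>i j. 1 \<le> i \<longrightarrow> i \<le> N \<longrightarrow> 1 \<le> j \<longrightarrow> j \<le> N \<longrightarrow> blk i \<noteq> blk j \<longrightarrow> g $$ (i - 1, j - 1) = 0)"
proof -
  have same: "(\<exists>k\<in>{1..b}. i \<in> Bl js k \<and> j \<in> Bl js k) \<longleftrightarrow> blk i = blk j"
    if "1 \<le> i" "i \<le> N" "1 \<le> j" "j \<le> N" for i j
  proof -
    have "i \<in> Bl js k \<and> j \<in> Bl js k \<longleftrightarrow> blk i = k \<and> blk j = k" if "k \<in> {1..b}" for k
      using Bl_iff[of i k] Bl_iff[of j k] \<open>1 \<le> i\<close> \<open>i \<le> N\<close> \<open>1 \<le> j\<close> \<open>j \<le> N\<close> that by simp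
    then show ?thesis using blk_range[OF that(1,2)] by metis
  qed
  show ?thesis
  proof
    assume g: "g \<in> L"
    have "g $$ (i - 1, j - 1) = 0" if "1 \<le> i" "i \<le> N" "1 \<le> j" "j \<le> N" "blk i \<noteq> blk j" for i j
    proof -
      have "i - 1 < N" "j - 1 < N" "i - 1 + 1 = i" "j - 1 + 1 = j" using that by auto
      then show ?thesis using g same[OF that(1-4)] that(5) unfolding Levi_def mem_Collect_eq by metis
    qed
    then show "g \<in> GLn N \<and> (\<forall>i j. 1 \<le> i \<longrightarrow> i \<le> N \<longrightarrow> 1 \<le> j \<longrightarrow> j \<le> N \<longrightarrow> blk i \<noteq> blk j \<longrightarrow> g $$ (i - 1, j - 1) = 0)"
      using g by (simp add: Levi_def)
  next
    assume g: "g \<in> GLn N \<and> (\<forall>i j. 1 \<le> i \<longrightarrow> i \<le> N \<longrightarrow> 1 \<le> j \<longrightarrow> j \<le> N \<longrightarrow> blk i \<noteq> blk j \<longrightarrow> g $$ (i - 1, j - 1) = 0)"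
    have "g $$ (i, j) = 0" if "i < N" "j < N" "\<not> (\<exists>k\<in>{1..b}. i + 1 \<in> Bl js k \<and> j + 1 \<in> Bl js k)" for i j
    proof -
      have "blk (i + 1) \<noteq> blk (j + 1)" using same[of "i + 1" "j + 1"] that by simp
      moreover have "1 \<le> i + 1" "i + 1 \<le> N" "1 \<le> j + 1" "j + 1 \<le> N" using that by auto
      ultimately have "g $$ (i + 1 - 1, j + 1 - 1) = 0" using g by blast
      then show ?thesis by simp
    qed
    then show "g \<in> L" using g by (auto simp: Levi_def)
  qed
qed

lemma Levi_GLn: "g \<in> L \<Longrightarrow> g \<in> GLn N"
  and Levi_carrier: "g \<in> L \<Longrightarrow> g \<in> carrier_mat N N"
  by (auto simp: Levi_def GLn_def)

lemma Levi_entry: "g \<in> L \<Longrightarrow> 1 \<le> i \<Longrightarrow> i \<le> N \<Longrightarrow> 1 \<le> j \<Longrightarrow> j \<le> N \<Longrightarrow> blk i \<noteq> blk j \<Longrightarrow> g $$ (i - 1, j - 1) = 0"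
  using Levi_iff by blast

lemma Levi_mult:
  assumes "g \<in> L" "g' \<in> L"
  shows "g * g' \<in> L"
proof -
  have "(g * g') $$ (i - 1, j - 1) = 0" if ij: "1 \<le> i" "i \<le> N" "1 \<le> j" "j \<le> N" "blk i \<noteq> blk j" for i j
  proof -
    have "(g * g') $$ (i - 1, j - 1) = (\<Sum>m = 1..N. g $$ (i - 1, m - 1) * g' $$ (m - 1, j - 1))"
      using mat_mult_entry[OF Levi_carrier Levi_carrier] assms ij by blast
    also have "\<dots> = 0"
    proof (rule sum.neutral, rule ballI)
      fix m assume m: "m \<in> {1..N}"
      then show "g $$ (i - 1, m - 1) * g' $$ (m - 1, j - 1) = 0"
        using Levi_entry[OF assms(1), of i m] Levi_entry[OF assms(2), of m j] ij by (cases "blk i = blk m") auto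
    qed
    finally show ?thesis .
  qed
  then show ?thesis using Levi_iff GLn_mult assms Levi_GLn by blast
qed

lemma BLv_mult: "g \<in> BLv \<Longrightarrow> g' \<in> BLv \<Longrightarrow> g * g' \<in> BLv"
  using Bor_mult Levi_mult by blast

lemma X_Levi: "g \<in> L \<Longrightarrow> x \<in> X \<Longrightarrow> act g x \<in> X"
  using stab by (auto simp: stable_def)

lemma Levi_inverse:
  assumes g: "g \<in> L"
  obtains g' where "g' \<in> L" "g' * g = 1\<^sub>m N" "g * g' = 1\<^sub>m N"
proof -
  have gc: "g \<in> carrier_mat N N" using g by (rule Levi_carrier)
  have "det g \<noteq> 0" using Levi_GLn[OF g] by (simp add: GLn_def)
  then obtain k where k: "k \<in> carrier_mat N N" "k * g = 1\<^sub>m N" "g * k = 1\<^sub>m N"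
    using det_non_zero_imp_unit[OF gc, of "()"] by (auto simp: Units_def ring_mat_def)
  \<comment> \<open>Cutting the inverse down to the diagonal blocks leaves a right inverse of the
    block diagonal \<open>g\<close>; by uniqueness nothing was cut off, so the inverse is block
    diagonal.\<close>
  define k' where "k' = mat N N (\<lambda>(i, j). if blk (Suc i) = blk (Suc j) then k $$ (i, j) else 0)"
  have k'c: "k' \<in> carrier_mat N N" by (simp add: k'_def)
  have k'_entry: "k' $$ (i - 1, j - 1) = (if blk i = blk j then k $$ (i - 1, j - 1) else 0)"
    if "1 \<le> i" "i \<le> N" "1 \<le> j" "j \<le> N" for i j
    using that by (auto simp: k'_def)
  have gk': "g * k' = 1\<^sub>m N"
  proof (rule eq_matI)
    fix a c assume "a < dim_row (1\<^sub>m N :: complex mat)" "c < dim_col (1\<^sub>m N :: complex mat)"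
    then have ac: "a < N" "c < N" by auto
    define i j where ij_def: "i = Suc a" "j = Suc c"
    have ij: "1 \<le> i" "i \<le> N" "1 \<le> j" "j \<le> N" "a = i - 1" "c = j - 1" using ac by (auto simp: ij_def)
    have sum: "(g * k') $$ (a, c) = (\<Sum>m = 1..N. g $$ (i - 1, m - 1) * k' $$ (m - 1, j - 1))"
      unfolding ij(5,6) using mat_mult_entry[OF gc k'c] ij by blast
    show "(g * k') $$ (a, c) = 1\<^sub>m N $$ (a, c)"
    proof (cases "blk i = blk j")
      case True
      have "(\<Sum>m = 1..N. g $$ (i - 1, m - 1) * k' $$ (m - 1, j - 1)) = (\<Sum>m = 1..N. g $$ (i - 1, m - 1) * k $$ (m - 1, j - 1))"
      proof (rule sum.cong[OF refl])
        fix m assume "m \<in> {1..N}"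
        then show "g $$ (i - 1, m - 1) * k' $$ (m - 1, j - 1) = g $$ (i - 1, m - 1) * k $$ (m - 1, j - 1)"
          using k'_entry[of m j] ij Levi_entry[OF g, of i m] True by (cases "blk m = blk j") auto
      qed
      also have "\<dots> = (g * k) $$ (i - 1, j - 1)" by (rule mat_mult_entry[OF gc k(1) ij(1-4), symmetric])
      finally show ?thesis using sum k(3) ij by simp
    next
      case False
      have "(\<Sum>m = 1..N. g $$ (i - 1, m - 1) * k' $$ (m - 1, j - 1)) = 0"
      proof (rule sum.neutral, rule ballI)
        fix m assume "m \<in> {1..N}"
        then show "g $$ (i - 1, m - 1) * k' $$ (m - 1, j - 1) = 0"
          using k'_entry[of m j] ij Levi_entry[OF g, of i m] False by (cases "blk m = blk j") auto
      qed
      moreover have "a \<noteq> c" using False by (auto simp: ij_def)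
      ultimately show ?thesis unfolding sum using ac by simp
    qed
  qed (use gc k'c in auto)
  have "k' = (k * g) * k'" using k(2) k'c by simp
  also have "\<dots> = k * (g * k')" using k(1) gc k'c by (intro assoc_mult_mat)
  also have "\<dots> = k" using gk' k(1) by simp
  finally have kk: "k' = k" .
  have "det k * det g = 1" using det_mult[OF k(1) gc] k(2) by simp
  then have "k \<in> GLn N" using k(1) by (auto simp: GLn_def)
  moreover have "k $$ (i - 1, j - 1) = 0" if "1 \<le> i" "i \<le> N" "1 \<le> j" "j \<le> N" "blk i \<noteq> blk j" for i j
    using k'_entry[OF that(1-4)] that(5) kk by simp
  ultimately have "k \<in> L" using Levi_iff by blast
  then show thesis using that k by blast
qed

text \<open>Otherwise the elementary matrix that adds row \<open>i\<close> to row
  \<open>i + 1\<close> lies in \<open>L\<close> and moves \<open>ew w\<close> to a point with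
  coordinate 1 at \<open>w\<close> with \<open>i\<close> replaced by \<open>i + 1\<close>. That list
  has too many members above \<open>i\<close> for a point of the cone.\<close>

lemma w_suc_closed:
  assumes i: "i \<in> set w" and i1: "i < N" "blk (Suc i) = blk i"
  shows "Suc i \<in> set w"
proof (rule ccontr)
  assume no: "Suc i \<notin> set w"
  have ige: "1 \<le> i" using w_range[OF i] by simp
  define g :: "complex mat" where "g = mat N N (\<lambda>(a, c). if a = c then 1 else if a = i \<and> c = i - 1 then 1 else 0)"
  have gc: "g \<in> carrier_mat N N" by (simp add: g_def)
  have "det g = dt N (\<lambda>a c. g $$ (c, a))"
    using dt_transpose[of N "\<lambda>a c. if a = c then 1 else if a = i \<and> c = i - 1 then 1 else 0"]
    unfolding g_def dt_def[of N "\<lambda>a c. if a = c then 1 else if a = i \<and> c = i - 1 then 1 else 0"]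
    by (subst (asm) dt_cong[of N _ "\<lambda>a c. g $$ (c, a)"]) (auto simp: g_def)
  also have "\<dots> = (\<Prod>a<N. g $$ (a, a))" by (rule dt_upper_triangular) (use ige in \<open>auto simp: g_def\<close>)
  also have "\<dots> = 1" by (simp add: g_def)
  finally have "g \<in> GLn N" using gc by (simp add: GLn_def)
  moreover have "g $$ (a - 1, c - 1) = 0" if "1 \<le> a" "a \<le> N" "1 \<le> c" "c \<le> N" "blk a \<noteq> blk c" for a c
  proof -
    have "a = c" if "a - 1 = c - 1" using that \<open>1 \<le> a\<close> \<open>1 \<le> c\<close> by linarith
    then have 1: "a - 1 \<noteq> c - 1" using that(5) by auto
    have "a = Suc i \<and> c = i" if "a - 1 = i \<and> c - 1 = i - 1" using that \<open>1 \<le> a\<close> \<open>1 \<le> c\<close> ige by linarith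
    then have 2: "\<not> (a - 1 = i \<and> c - 1 = i - 1)" using that(5) i1 by auto
    show ?thesis using that 1 2 by (simp add: g_def)
  qed
  ultimately have gL: "g \<in> L" using Levi_iff by blast
  have "1\<^sub>m N \<in> Bor N" by (subst Bor_iff) auto
  moreover have "act (1\<^sub>m N) (ew w) = ew w" by (rule wact_one) (use wI in \<open>auto simp: ew_def\<close>)
  ultimately have "ew w \<in> X" using orbit_in_X by metis
  then have gX: "act g (ew w) \<in> X" using X_Levi[OF gL] by simp
  define s where "s = map (\<lambda>c. if c = i then Suc i else c) w"
  have s_nth: "s ! a = (if w ! a = i then Suc i else w ! a)" if "a < d" for a
    using that w_length by (simp add: s_def)
  have "sorted_wrt (<) s"
    unfolding sorted_wrt_iff_nth_less
  proof (intro allI impI)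
    fix a c assume "a < c" "c < length s"
    then have ac: "a < c" "c < d" using w_length by (simp_all add: s_def)
    then have "w ! a < w ! c" using Idn_sorted[OF wI] w_length by (simp add: sorted_wrt_iff_nth_less)
    moreover have "w ! c \<noteq> Suc i" using no w_nth_mem[OF ac(2)] by auto
    ultimately show "s ! a < s ! c" using s_nth ac by auto
  qed
  moreover have sset: "set s = insert (Suc i) (set w - {i})" using i by (auto simp: s_def)
  ultimately have s: "s \<in> Idn d N" using w_length Idn_subset[OF wI] i1 by (auto simp: Idn_def s_def)
  have "act g (ew w) s = dt d (\<lambda>a c. if a = c then 1 else 0)"
    unfolding wact_ew[OF wI] pl_def if_P[OF s]
  proof (rule dt_cong)
    fix a c assume ac: "a < d" "c < d"
    have ra: "1 \<le> w ! a" "w ! a \<le> N" "1 \<le> w ! c" "w ! c \<le> N" using Idn_nth[OF wI] ac by auto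
    have "w ! a \<noteq> Suc i" "w ! c \<noteq> Suc i" using no w_nth_mem ac by metis+
    moreover have entry: "g $$ (x - 1, y - 1) = (if x = y \<or> (x = Suc i \<and> y = i) then 1 else 0)"
      if "1 \<le> x" "x \<le> N" "1 \<le> y" "y \<le> N" for x y
    proof -
      have "x - 1 = y - 1 \<longleftrightarrow> x = y" "x - 1 = i \<longleftrightarrow> x = Suc i" "y - 1 = i - 1 \<longleftrightarrow> y = i"
        using that ige by linarith+
      moreover have "x - 1 < N" "y - 1 < N" using that by linarith+
      ultimately show ?thesis by (simp add: g_def)
    qed
    moreover have "1 \<le> s ! a" "s ! a \<le> N" using Idn_nth[OF s ac(1)] by auto
    ultimately show "g $$ (s ! a - 1, w ! c - 1) = (if a = c then 1 else 0)"
      using entry[of "s ! a" "w ! c"] ra w_nth_eq[OF ac] s_nth[OF ac(1)] by (cases "w ! a = i") auto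
  qed
  then have "act g (ew w) s \<noteq> 0" by (simp add: dt_one)
  from X_count[OF gX this, of "Suc i"] have "card (set s \<inter> {Suc i..}) \<le> card (set w \<inter> {Suc i..})" .
  moreover have "set s \<inter> {Suc i..} = insert (Suc i) (set w \<inter> {Suc i..})" unfolding sset by auto
  ultimately show False using no by simp
qed

lemma w_final:
  assumes "i \<in> set w" "i \<le> j" "j \<le> N" "blk i = blk j"
  shows "j \<in> set w"
  using assms(2,3,4)
proof (induction j rule: dec_induct)
  case (step m)
  have "1 \<le> i" using w_range assms(1) by simp
  moreover have "i \<le> m" "m \<le> Suc m" "m \<le> N" "Suc m \<le> N" using step.hyps step.prems by auto
  ultimately have "blk i \<le> blk m" "blk m \<le> blk (Suc m)" by (intro blk_mono; linarith)+
  then have "blk m = blk i" "blk (Suc m) = blk m" using step.prems by auto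
  then show ?case using w_suc_closed[of m] step.IH step.prems by auto
qed (use assms in simp)

lemma h_card: "k \<in> {1..b} \<Longrightarrow> h k = card (set w \<inter> Bl js k)"
proof -
  have "set w \<inter> Bl js k = nth w ` {j. j < length w \<and> w ! j \<in> Bl js k}" by (auto simp: in_set_conv_nth)
  moreover have "inj_on (nth w) {j. j < length w \<and> w ! j \<in> Bl js k}"
    using Idn_nth_bij[OF wI] w_length by (auto simp: bij_betw_def inj_on_def)
  ultimately show ?thesis by (simp add: hk_def card_image)
qed

lemma h_le_n: "k \<in> {1..b} \<Longrightarrow> h k \<le> n k"
  using card_mono[of "Bl js k" "set w \<inter> Bl js k"] h_card by (simp add: Bl_def Nk_def)

lemma n_pos: "k \<in> {1..b} \<Longrightarrow> 1 \<le> n k"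
  using J_less[of "k - 1" k] by (simp add: Nk_def)

lemma J_n: "k \<in> {1..b} \<Longrightarrow> J k = J (k - 1) + n k"
  using J_less[of "k - 1" k] by (simp add: Nk_def)

lemma w_iff:
  assumes "1 \<le> i" "i \<le> N"
  shows "i \<in> set w \<longleftrightarrow> J (blk i) - h (blk i) < i"
proof -
  define k where "k = blk i"
  have k: "k \<in> {1..b}" using blk_range[OF assms] k_def by simp
  have JN: "J k \<le> N" using k J_le_N by simp
  have iB: "i \<in> Bl js k" using Bl_iff[OF assms k] k_def by simp
  have up: "{i..J k} \<subseteq> set w \<inter> Bl js k" if "i \<in> set w"
  proof
    fix j assume j: "j \<in> {i..J k}"
    then have "j \<in> Bl js k" using iB by (auto simp: Bl_def)
    moreover from this have "blk j = k" using Bl_iff[of j k] j assms JN k by simp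
    ultimately show "j \<in> set w \<inter> Bl js k" using w_final[OF that, of j] j JN k_def by simp
  qed
  have dn: "set w \<inter> Bl js k \<subseteq> {i<..J k}" if no: "i \<notin> set w"
  proof
    fix j assume j: "j \<in> set w \<inter> Bl js k"
    then have "blk j = k" using Bl_iff[of j k] w_range[of j] k by simp
    then have "\<not> j \<le> i" using w_final[of j i] j no assms k_def by auto
    then show "j \<in> {i<..J k}" using j by (auto simp: Bl_def)
  qed
  have iJ: "i \<le> J k" using blk_bounds[OF assms] k_def by simp
  show ?thesis
  proof
    assume "i \<in> set w"
    then have "card {i..J k} \<le> h k" unfolding h_card[OF k] using up by (intro card_mono) (auto simp: Bl_def)
    then show "J (blk i) - h (blk i) < i" using iJ k_def assms by simp
  next
    assume *: "J (blk i) - h (blk i) < i"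
    show "i \<in> set w"
    proof (rule ccontr)
      assume "i \<notin> set w"
      then have "h k \<le> card {i<..J k}" unfolding h_card[OF k] using dn by (intro card_mono) auto
      then show False using * iJ k_def by simp
    qed
  qed
qed

definition q :: "nat \<Rightarrow> nat" where "q k = n k - h k"

lemma n_eq: "k \<in> {1..b} \<Longrightarrow> n k = q k + h k"
  using h_le_n by (simp add: q_def)

text \<open>Together with \<open>hb_pos\<close> this is the content of \<open>reduced\<close>: index
  1 is a free row and index \<open>N\<close> a column. The case distinctions on both sides of the
  theorem start from these two facts.\<close>

lemma q1_pos: "1 \<le> q 1"
proof (rule ccontr)
  assume *: "\<not> 1 \<le> q 1"
  have k1: "1 \<in> {1..b}" using b1 by simp
  have N1: "1 \<le> N" using w_range w_nth_mem[of 0] d1 by fastforce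
  have "blk 1 = 1" using blk_eq_iff[OF _ N1 k1] J_0 J_less[of 0 1] b1 by auto
  moreover have "J 1 = n 1" using J_n[OF k1] J_0 by simp
  moreover have "h 1 = n 1" using * h_le_n[OF k1] by (simp add: q_def)
  ultimately have "1 \<in> set w" using w_iff[of 1] N1 by simp
  then obtain j where j: "j < d" "w ! j = 1" by (rule w_obtain)
  have "w ! 0 \<noteq> 1" using red by (simp add: reduced_def)
  moreover have "w ! 0 \<le> w ! j" using Idn_sorted[OF wI] w_length j(1) unfolding sorted_wrt_iff_nth_less
    by (cases "j = 0") (auto intro!: less_imp_le)
  ultimately show False using j Idn_nth[OF wI, of 0] d1 by auto
qed

lemma hb_pos: "1 \<le> h b"
proof -
  have kb: "b \<in> {1..b}" using b1 by simp
  have "N = last w" using red by (simp add: reduced_def)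
  then have Nw: "N \<in> set w" using w_length d1 by (metis One_nat_def last_in_set length_0_conv not_less_eq_eq zero_le)
  then have N1: "1 \<le> N" using w_range by blast
  have "blk N = b" using blk_eq_iff[OF N1 order.refl kb] J_b J_less[of "b - 1" b] b1 by auto
  then show ?thesis using w_iff[OF N1 order.refl] Nw J_b by simp
qed

end

text \<open>\<open>\<rho> i r\<close> permits adding row \<open>r\<close> to row \<open>i\<close>,
  and \<open>\<kappa> j c\<close> permits adding column \<open>c\<close> to column \<open>j\<close>;
  scaling is free. A step treats all rows (or columns) at once with a common source, so clearing a
  whole column is one step.\<close>

inductive elim_step :: "(nat \<Rightarrow> nat \<Rightarrow> bool) \<Rightarrow> (nat \<Rightarrow> nat \<Rightarrow> bool)
    \<Rightarrow> (nat \<Rightarrow> nat \<Rightarrow> complex) \<Rightarrow> (nat \<Rightarrow> nat \<Rightarrow> complex) \<Rightarrow> bool" for \<rho> \<kappa> where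
  row: "(\<And>i. t i \<noteq> 0) \<Longrightarrow> (\<And>i. u i \<noteq> 0 \<Longrightarrow> \<rho> i r) \<Longrightarrow>
    elim_step \<rho> \<kappa> M (\<lambda>i j. t i * M i j + u i * M r j)"
| col: "(\<And>j. t j \<noteq> 0) \<Longrightarrow> (\<And>j. u j \<noteq> 0 \<Longrightarrow> \<kappa> j c) \<Longrightarrow>
    elim_step \<rho> \<kappa> M (\<lambda>i j. t j * M i j + u j * M i c)"

abbreviation elim_eqv where "elim_eqv \<rho> \<kappa> \<equiv> (elim_step \<rho> \<kappa>)\<^sup>*\<^sup>*"

lemma elim_rowI:
  assumes "\<And>i. t i \<noteq> 0" "\<And>i. u i \<noteq> 0 \<Longrightarrow> \<rho> i r" "\<And>i j. M' i j = t i * M i j + u i * M r j"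
  shows "elim_step \<rho> \<kappa> M M'"
proof -
  have "M' = (\<lambda>i j. t i * M i j + u i * M r j)" using assms(3) by (auto simp: fun_eq_iff)
  then show ?thesis using elim_step.row[of t u \<rho> r \<kappa> M] assms(1,2) by simp
qed

lemma elim_colI:
  assumes "\<And>j. t j \<noteq> 0" "\<And>j. u j \<noteq> 0 \<Longrightarrow> \<kappa> j c" "\<And>i j. M' i j = t j * M i j + u j * M i c"
  shows "elim_step \<rho> \<kappa> M M'"
proof -
  have "M' = (\<lambda>i j. t j * M i j + u j * M i c)" using assms(3) by (auto simp: fun_eq_iff)
  then show ?thesis using elim_step.col[of t u \<kappa> c \<rho> M] assms(1,2) by simp
qed

lemma elim_step_transpose: "elim_step \<rho> \<kappa> M M' \<Longrightarrow> elim_step \<kappa> \<rho> (\<lambda>i j. M j i) (\<lambda>i j. M' j i)"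
proof (induction rule: elim_step.induct)
  case (row t u r M)
  then show ?case by (intro elim_colI[of t u _ r]) auto
next
  case (col t u c M)
  then show ?case by (intro elim_rowI[of t u _ c]) auto
qed

lemma elim_eqv_transpose: "elim_eqv \<rho> \<kappa> M M' \<Longrightarrow> elim_eqv \<kappa> \<rho> (\<lambda>i j. M j i) (\<lambda>i j. M' j i)"
  by (induction rule: rtranclp_induct) (auto dest: elim_step_transpose intro: rtranclp.rtrancl_into_rtrancl)

section \<open>Elimination on generic matrices\<close>

text \<open>A matrix is read as a point with coordinates indexed by two-element lists, so that polynomials
  in its entries are members of \<^const>\<open>polyfun\<close>.\<close>
definition enc :: "(nat \<Rightarrow> nat \<Rightarrow> complex) \<Rightarrow> nat list \<Rightarrow> complex" where
  "enc M = (\<lambda>s. M (s ! 0) (s ! 1))"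

text \<open>The normal form of a generic matrix with pivot rows \<open>rs\<close>, pivot columns \<open>cs\<close> and at most one
  additional column, the element of \<open>E\<close>; the lists are in the order of elimination.\<close>
fun nform :: "nat list \<Rightarrow> nat list \<Rightarrow> nat set \<Rightarrow> nat \<Rightarrow> nat \<Rightarrow> complex" where
  "nform [] cs E = (\<lambda>i j. 0)"
| "nform (r # rs) [] E = (\<lambda>i j. if i = r \<and> j \<in> E then 1 else 0)"
| "nform (r # rs) (c # cs) E = (\<lambda>i j. if i = r then (if j = c \<or> j \<in> E then 1 else 0) else nform rs cs E i j)"

lemma nform_outside: "i \<notin> set rs \<or> j \<notin> set cs \<union> E \<Longrightarrow> nform rs cs E i j = 0"
  by (induction rs cs E rule: nform.induct) auto

lemma nform_diag: "distinct xs \<Longrightarrow> i \<in> set xs \<Longrightarrow> j \<in> set xs \<Longrightarrow> nform xs xs {} i j = (if i = j then 1 else 0)"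
proof (induction xs)
  case (Cons x xs)
  then show ?case using nform_outside[of i xs x xs "{}"] nform_outside[of x xs j xs "{}"] by auto
qed simp

definition region :: "nat list \<times> nat list \<times> nat set \<Rightarrow> (nat \<times> nat) set" where
  "region = (\<lambda>(rs, cs, E). set rs \<times> (set cs \<union> E))"

text \<open>Operations on the rows \<open>rs\<close> and the pivot columns \<open>cs\<close> then
  leave everything else unchanged. Nothing is asked of the column in \<open>E\<close> outside
  \<open>rs\<close>: it is neither scaled nor added to others, so several pieces may share
  it.\<close>

definition isolated :: "nat list \<times> nat list \<times> nat set \<Rightarrow> (nat \<Rightarrow> nat \<Rightarrow> complex) \<Rightarrow> bool" where
  "isolated = (\<lambda>(rs, cs, E) M. (\<forall>i\<in>set rs. \<forall>j. j \<notin> set cs \<union> E \<longrightarrow> M i j = 0)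
      \<and> (\<forall>i j. i \<notin> set rs \<longrightarrow> j \<in> set cs \<longrightarrow> M i j = 0))"

text \<open>After column scalings have been spent on the pivots, the scaling of a row can normalise
  just one more entry; hence at most one extra column.\<close>

definition pivotable :: "(nat \<Rightarrow> nat \<Rightarrow> bool) \<Rightarrow> (nat \<Rightarrow> nat \<Rightarrow> bool) \<Rightarrow> nat list \<times> nat list \<times> nat set \<Rightarrow> bool" where
  "pivotable \<rho> \<kappa> = (\<lambda>(rs, cs, E). distinct rs \<and> distinct cs \<and> set cs \<inter> E = {} \<and> (\<exists>e. E \<subseteq> {e})
      \<and> sorted_wrt (\<lambda>r i. \<rho> i r) rs \<and> sorted_wrt (\<lambda>c j. \<kappa> j c) cs)"

definition overwrite :: "(nat \<times> nat) set \<Rightarrow> (nat \<Rightarrow> nat \<Rightarrow> complex) \<Rightarrow> (nat \<Rightarrow> nat \<Rightarrow> complex) \<Rightarrow> nat \<Rightarrow> nat \<Rightarrow> complex" where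
  "overwrite R V M = (\<lambda>i j. if (i, j) \<in> R then V i j else M i j)"

text \<open>\<open>f\<close> certifies genericity. That it is nonzero at \<open>V\<close> makes the
  condition satisfiable; that it depends only on the entries in \<open>R\<close> allows certificates
  for disjoint regions to be multiplied.\<close>

definition generic_eqv :: "(nat \<Rightarrow> nat \<Rightarrow> bool) \<Rightarrow> (nat \<Rightarrow> nat \<Rightarrow> bool) \<Rightarrow> ((nat \<Rightarrow> nat \<Rightarrow> complex) \<Rightarrow> bool)
    \<Rightarrow> (nat \<times> nat) set \<Rightarrow> (nat \<Rightarrow> nat \<Rightarrow> complex) \<Rightarrow> bool" where
  "generic_eqv \<rho> \<kappa> P R V \<longleftrightarrow> (\<exists>f\<in>polyfun. f (enc V) \<noteq> 0
     \<and> (\<forall>M M'. (\<forall>(i, j)\<in>R. M i j = M' i j) \<longrightarrow> f (enc M) = f (enc M'))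
     \<and> (\<forall>M. P M \<and> f (enc M) \<noteq> 0 \<longrightarrow> elim_eqv \<rho> \<kappa> M (overwrite R V M)))"

lemma generic_eqvI:
  assumes "f \<in> polyfun" "f (enc V) \<noteq> 0"
    "\<And>M M'. (\<And>i j. (i, j) \<in> R \<Longrightarrow> M i j = M' i j) \<Longrightarrow> f (enc M) = f (enc M')"
    "\<And>M. P M \<Longrightarrow> f (enc M) \<noteq> 0 \<Longrightarrow> elim_eqv \<rho> \<kappa> M (overwrite R V M)"
  shows "generic_eqv \<rho> \<kappa> P R V"
  unfolding generic_eqv_def using assms by (intro bexI[of _ f]) blast+

lemma generic_eqvE:
  assumes "generic_eqv \<rho> \<kappa> P R V"
  obtains f where "f \<in> polyfun" "f (enc V) \<noteq> 0"
    "\<And>M M'. (\<And>i j. (i, j) \<in> R \<Longrightarrow> M i j = M' i j) \<Longrightarrow> f (enc M) = f (enc M')"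
    "\<And>M. P M \<Longrightarrow> f (enc M) \<noteq> 0 \<Longrightarrow> elim_eqv \<rho> \<kappa> M (overwrite R V M)"
proof -
  obtain f where f: "f \<in> polyfun" "f (enc V) \<noteq> 0"
    "\<forall>M M'. (\<forall>(i, j)\<in>R. M i j = M' i j) \<longrightarrow> f (enc M) = f (enc M')"
    "\<forall>M. P M \<and> f (enc M) \<noteq> 0 \<longrightarrow> elim_eqv \<rho> \<kappa> M (overwrite R V M)"
    using assms unfolding generic_eqv_def by blast
  show thesis
  proof (rule that[OF f(1,2)])
    fix M M' :: "nat \<Rightarrow> nat \<Rightarrow> complex"
    assume "\<And>i j. (i, j) \<in> R \<Longrightarrow> M i j = M' i j"
    then show "f (enc M) = f (enc M')" by (intro f(3)[rule_format]) auto
  next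
    fix M assume "P M" "f (enc M) \<noteq> 0"
    then show "elim_eqv \<rho> \<kappa> M (overwrite R V M)" using f(4) by blast
  qed
qed

lemma generic_elimination:
  assumes "pivotable \<rho> \<kappa> (rs, cs, E)"
  shows "generic_eqv \<rho> \<kappa> (isolated (rs, cs, E)) (region (rs, cs, E)) (nform rs cs E)"
  using assms
proof (induction rs arbitrary: cs)
  case Nil
  show ?case
    by (rule generic_eqvI[of "\<lambda>_. 1"]) (auto intro: polyfun.intros simp: region_def overwrite_def)
next
  case (Cons r rs)
  note piv = Cons.prems[unfolded pivotable_def prod.case]
  obtain e where e: "E \<subseteq> {e}" using piv by auto
  have rho: "\<rho> i r" if "i \<in> set rs" for i using piv that by auto
  have rrs: "r \<notin> set rs" using piv by auto
  show ?case
  proof (cases cs)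
    case Nil
    show ?thesis
    proof (cases "E = {}")
      case True
      show ?thesis unfolding True Nil
        by (rule generic_eqvI[of "\<lambda>_. 1"]) (auto intro: polyfun.intros simp: region_def overwrite_def)
    next
      case False
      then have E: "E = {e}" using e by auto
      \<comment> \<open>No pivot column is left: the entry of row \<open>r\<close> in the extra
        column is scaled to 1 and clears that column in the remaining rows.\<close>
      show ?thesis unfolding Nil E
      proof (rule generic_eqvI[of "\<lambda>x. x [r, e]"])
        fix M assume iso: "isolated (r # rs, [], {e}) M" and nz: "enc M [r, e] \<noteq> 0"
        have z: "M i j = 0" if "i \<in> set (r # rs)" "j \<noteq> e" for i j
          using iso that by (auto simp: isolated_def)
        have "elim_step \<rho> \<kappa> M (overwrite (region (r # rs, [], {e})) (nform (r # rs) [] {e}) M)"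
        proof (rule elim_rowI[of "\<lambda>i. if i = r then 1 / M r e else 1" "\<lambda>i. if i \<in> set rs then - M i e / M r e else 0" _ r])
          fix i j
          show "overwrite (region (r # rs, [], {e})) (nform (r # rs) [] {e}) M i j
            = (if i = r then 1 / M r e else 1) * M i j + (if i \<in> set rs then - M i e / M r e else 0) * M r j"
            using z[of i j] z[of r j] nz rrs by (auto simp: overwrite_def region_def enc_def)
        qed (use nz rho in \<open>auto simp: enc_def split: if_splits\<close>)
        then show "elim_eqv \<rho> \<kappa> M (overwrite (region (r # rs, [], {e})) (nform (r # rs) [] {e}) M)" by simp
      qed (auto intro: polyfun.intros simp: enc_def region_def)
    qed
  next
    case (Cons c cs')
    have ccs: "c \<notin> set cs'" "c \<notin> E" "set cs' \<inter> E = {}" using piv Cons by auto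
    have kap: "\<kappa> j c" if "j \<in> set cs'" for j using piv that Cons by auto
    have "pivotable \<rho> \<kappa> (rs, cs', E)" using piv Cons by (auto simp: pivotable_def)
    from generic_eqvE[OF Cons.IH[OF this]] obtain f where f: "f \<in> polyfun" "f (enc (nform rs cs' E)) \<noteq> 0"
      "\<And>M M'. (\<And>i j. (i, j) \<in> region (rs, cs', E) \<Longrightarrow> M i j = M' i j) \<Longrightarrow> f (enc M) = f (enc M')"
      "\<And>M. isolated (rs, cs', E) M \<Longrightarrow> f (enc M) \<noteq> 0 \<Longrightarrow>
        elim_eqv \<rho> \<kappa> M (overwrite (region (rs, cs', E)) (nform rs cs' E) M)" by blast
    define \<tau> where "\<tau> = (\<lambda>M :: nat \<Rightarrow> nat \<Rightarrow> complex. if E = {} then 1 else M r e)"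
    \<comment> \<open>Fraction-free elimination: multiplying row \<open>i\<close> by the pivot keeps
      all entries polynomial in \<open>M\<close>, so the certificate of the smaller problem can be
      pulled back. Row \<open>r\<close> itself is divided by \<open>\<tau> M\<close>, its entry in
      the extra column.\<close>
    define D where "D = (\<lambda>(M :: nat \<Rightarrow> nat \<Rightarrow> complex) i j. M r c * M i j - M i c * M r j)"
    define g where "g = (\<lambda>x. x [r, c] * (if E = {} then 1 else x [r, e])
      * f (\<lambda>s. x [r, c] * x [s ! 0, s ! 1] - x [s ! 0, c] * x [r, s ! 1]))"
    have gM: "g (enc M) = M r c * \<tau> M * f (enc (D M))" for M
      by (simp add: g_def enc_def D_def \<tau>_def)
    show ?thesis unfolding Cons
    proof (rule generic_eqvI[of g])
      have "(\<lambda>x. f (\<lambda>s. x [r, c] * x [s ! 0, s ! 1] - x [s ! 0, c] * x [r, s ! 1])) \<in> polyfun"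
        by (rule polyfun_comp[OF fun_alg_polyfun f(1)])
           (intro fun_alg_diff[OF fun_alg_polyfun] polyfun.intros)
      then show "g \<in> polyfun"
        unfolding g_def by (intro fun_alg_mult[OF fun_alg_polyfun] fun_alg_if polyfun.intros)
    next
      have "f (enc (D (nform (r # rs) (c # cs') E))) = f (enc (nform rs cs' E))"
      proof (rule f(3))
        fix i j assume "(i, j) \<in> region (rs, cs', E)"
        then show "D (nform (r # rs) (c # cs') E) i j = nform rs cs' E i j"
          using rrs ccs nform_outside[of i rs c cs' E] by (auto simp: D_def region_def)
      qed
      then show "g (enc (nform (r # rs) (c # cs') E)) \<noteq> 0"
        unfolding gM using f(2) e by (auto simp: \<tau>_def)
    next
      fix M M' :: "nat \<Rightarrow> nat \<Rightarrow> complex"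
      assume eq: "\<And>i j. (i, j) \<in> region (r # rs, c # cs', E) \<Longrightarrow> M i j = M' i j"
      have "f (enc (D M)) = f (enc (D M'))"
        by (rule f(3)) (use eq in \<open>auto simp: D_def region_def\<close>)
      moreover have "\<tau> M = \<tau> M'" using eq e by (auto simp: \<tau>_def region_def)
      moreover have "M r c = M' r c" using eq by (auto simp: region_def)
      ultimately show "g (enc M) = g (enc M')" by (simp add: gM)
    next
      fix M assume iso: "isolated (r # rs, c # cs', E) M" and "g (enc M) \<noteq> 0"
      then have nz: "M r c \<noteq> 0" "\<tau> M \<noteq> 0" "f (enc (D M)) \<noteq> 0" by (auto simp: gM)
      have z1: "M i j = 0" if "i \<in> set (r # rs)" "j \<notin> set (c # cs') \<union> E" for i j
        using iso that by (auto simp: isolated_def)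
      have z2: "M i j = 0" if "i \<notin> set (r # rs)" "j \<in> set (c # cs')" for i j
        using iso that by (auto simp: isolated_def)
      define M1 where "M1 = (\<lambda>i j. if i \<in> set rs then D M i j else if i = r then M r j / \<tau> M else M i j)"
      define M2 where "M2 = (\<lambda>i j. if i = r then (if j = c \<or> j \<in> E then 1 else 0)
        else if i \<in> set rs then (if j = c then 0 else D M i j) else M i j)"
      have "elim_step \<rho> \<kappa> M M1"
        by (rule elim_rowI[of "\<lambda>i. if i \<in> set rs then M r c else if i = r then 1 / \<tau> M else 1"
              "\<lambda>i. if i \<in> set rs then - M i c else 0" _ r])
           (use nz rho rrs in \<open>auto simp: M1_def D_def split: if_splits\<close>)
      \<comment> \<open>After the row step the pivot is \<open>M r c / \<tau> M\<close>; the column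
        factor is its inverse. Column \<open>c\<close> is now zero outside row \<open>r\<close>, so
        it clears row \<open>r\<close> without touching other rows.\<close>
      moreover have "elim_step \<rho> \<kappa> M1 M2"
      proof (rule elim_colI[of "\<lambda>j. if j = c then \<tau> M / M r c else 1" "\<lambda>j. if j \<in> set cs' then - M r j / M r c else 0" _ c])
        fix i j
        have "D M i c = 0" by (simp add: D_def)
        moreover have "M r e / \<tau> M = 1" if "E \<noteq> {}" using that nz(2) by (simp add: \<tau>_def)
        ultimately show "M2 i j = (if j = c then \<tau> M / M r c else 1) * M1 i j + (if j \<in> set cs' then - M r j / M r c else 0) * M1 i c"
          using nz rrs ccs z1[of r j] z2[of i c] e by (auto simp: M1_def M2_def)
      qed (use nz kap in \<open>auto split: if_splits\<close>)
      moreover have "elim_eqv \<rho> \<kappa> M2 (overwrite (region (rs, cs', E)) (nform rs cs' E) M2)"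
      proof (rule f(4))
        show "isolated (rs, cs', E) M2"
          unfolding isolated_def prod.case
        proof (intro conjI ballI allI impI)
          fix i j assume "i \<in> set rs" "j \<notin> set cs' \<union> E"
          then show "M2 i j = 0"
            using rrs z1[of i j] z1[of r j] by (auto simp: M2_def D_def)
        next
          fix i j assume "i \<notin> set rs" "j \<in> set cs'"
          then show "M2 i j = 0" using z2[of i j] ccs by (auto simp: M2_def)
        qed
        have "f (enc M2) = f (enc (D M))"
          by (rule f(3)) (use rrs ccs in \<open>auto simp: M2_def region_def\<close>)
        then show "f (enc M2) \<noteq> 0" using nz by simp
      qed
      moreover have "overwrite (region (rs, cs', E)) (nform rs cs' E) M2
        = overwrite (region (r # rs, c # cs', E)) (nform (r # rs) (c # cs') E) M"
      proof (intro ext)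
        fix i j
        consider "i = r" | "i \<in> set rs" "i \<noteq> r" | "i \<notin> set (r # rs)" by auto
        then show "overwrite (region (rs, cs', E)) (nform rs cs' E) M2 i j
          = overwrite (region (r # rs, c # cs', E)) (nform (r # rs) (c # cs') E) M i j"
        proof cases
          case 1
          then show ?thesis using rrs ccs z1[of r j] by (auto simp: overwrite_def region_def M2_def)
        next
          case 2
          then show ?thesis using rrs ccs z1[of i j] z1[of r j] nform_outside[of i rs j cs' E]
            by (auto simp: overwrite_def region_def M2_def D_def)
        next
          case 3
          then show ?thesis by (auto simp: overwrite_def region_def M2_def)
        qed
      qed
      ultimately show "elim_eqv \<rho> \<kappa> M (overwrite (region (r # rs, c # cs', E)) (nform (r # rs) (c # cs') E) M)"
        by (metis converse_rtranclp_into_rtranclp)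
    qed
  qed
qed

text \<open>Normalising \<open>R1\<close> does not change the entries in \<open>R2\<close>, so the
  second certificate stays nonzero; \<open>pres\<close> provides that the first elimination
  preserves the hypothesis of the second.\<close>

lemma generic_eqv_conj:
  assumes 1: "generic_eqv \<rho> \<kappa> P1 R1 V1" and 2: "generic_eqv \<rho> \<kappa> P2 R2 V2" and disj: "R1 \<inter> R2 = {}"
    and pres: "\<And>M. P M \<Longrightarrow> P1 M \<and> P2 (overwrite R1 V1 M)"
  shows "generic_eqv \<rho> \<kappa> P (R1 \<union> R2) (overwrite R1 V1 V2)"
proof -
  obtain f1 where f1: "f1 \<in> polyfun" "f1 (enc V1) \<noteq> 0"
    "\<And>M M'. (\<And>i j. (i, j) \<in> R1 \<Longrightarrow> M i j = M' i j) \<Longrightarrow> f1 (enc M) = f1 (enc M')"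
    "\<And>M. P1 M \<Longrightarrow> f1 (enc M) \<noteq> 0 \<Longrightarrow> elim_eqv \<rho> \<kappa> M (overwrite R1 V1 M)" using generic_eqvE[OF 1] by blast
  obtain f2 where f2: "f2 \<in> polyfun" "f2 (enc V2) \<noteq> 0"
    "\<And>M M'. (\<And>i j. (i, j) \<in> R2 \<Longrightarrow> M i j = M' i j) \<Longrightarrow> f2 (enc M) = f2 (enc M')"
    "\<And>M. P2 M \<Longrightarrow> f2 (enc M) \<noteq> 0 \<Longrightarrow> elim_eqv \<rho> \<kappa> M (overwrite R2 V2 M)" using generic_eqvE[OF 2] by blast
  show ?thesis
  proof (rule generic_eqvI[of "\<lambda>x. f1 x * f2 x"])
    have "f1 (enc (overwrite R1 V1 V2)) = f1 (enc V1)" by (rule f1(3)) (auto simp: overwrite_def)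
    moreover have "f2 (enc (overwrite R1 V1 V2)) = f2 (enc V2)"
      by (rule f2(3)) (use disj in \<open>auto simp: overwrite_def\<close>)
    ultimately show "f1 (enc (overwrite R1 V1 V2)) * f2 (enc (overwrite R1 V1 V2)) \<noteq> 0" using f1(2) f2(2) by simp
  next
    fix M M' :: "nat \<Rightarrow> nat \<Rightarrow> complex"
    assume "\<And>i j. (i, j) \<in> R1 \<union> R2 \<Longrightarrow> M i j = M' i j"
    then show "f1 (enc M) * f2 (enc M) = f1 (enc M') * f2 (enc M')"
      using f1(3)[of M M'] f2(3)[of M M'] by auto
  next
    fix M assume P: "P M" and nz: "f1 (enc M) * f2 (enc M) \<noteq> 0"
    have "elim_eqv \<rho> \<kappa> M (overwrite R1 V1 M)" using f1(4) pres[OF P] nz by simp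
    moreover have "f2 (enc (overwrite R1 V1 M)) = f2 (enc M)"
      by (rule f2(3)) (use disj in \<open>auto simp: overwrite_def\<close>)
    then have "elim_eqv \<rho> \<kappa> (overwrite R1 V1 M) (overwrite R2 V2 (overwrite R1 V1 M))"
      using f2(4) pres[OF P] nz by simp
    moreover have "overwrite R2 V2 (overwrite R1 V1 M) = overwrite (R1 \<union> R2) (overwrite R1 V1 V2) M"
      using disj by (auto simp: overwrite_def fun_eq_iff)
    ultimately show "elim_eqv \<rho> \<kappa> M (overwrite (R1 \<union> R2) (overwrite R1 V1 V2) M)" by simp
  qed (auto intro: polyfun.intros f1(1) f2(1))
qed

text \<open>\<open>E\<close> and \<open>E'\<close> may coincide. A single extra column can serve the
  pieces of all row blocks, because each row is normalised at it by its own scaling.\<close>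

definition separated :: "nat list \<times> nat list \<times> nat set \<Rightarrow> nat list \<times> nat list \<times> nat set \<Rightarrow> bool" where
  "separated = (\<lambda>(rs, cs, E) (rs', cs', E'). set rs \<inter> set rs' = {} \<and> set cs \<inter> (set cs' \<union> E') = {}
     \<and> set cs' \<inter> E = {})"

lemma generic_elimination_family:
  assumes "\<And>p. p \<in> set ps \<Longrightarrow> pivotable \<rho> \<kappa> p" "sorted_wrt separated ps"
  shows "\<exists>V. generic_eqv \<rho> \<kappa> (\<lambda>M. \<forall>p\<in>set ps. isolated p M) (\<Union>p\<in>set ps. region p) V
    \<and> (\<forall>rs cs E. (rs, cs, E) \<in> set ps \<longrightarrow> (\<forall>(i, j)\<in>region (rs, cs, E). V i j = nform rs cs E i j))"
  using assms
proof (induction ps)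
  case Nil
  have "generic_eqv \<rho> \<kappa> (\<lambda>M. True) {} (\<lambda>_ _. 0)"
    by (rule generic_eqvI[of "\<lambda>_. 1"]) (auto intro: polyfun.intros simp: overwrite_def)
  then show ?case by auto
next
  case (Cons p ps)
  obtain rs cs E where p: "p = (rs, cs, E)" by (cases p) auto
  obtain V where V: "generic_eqv \<rho> \<kappa> (\<lambda>M. \<forall>p\<in>set ps. isolated p M) (\<Union>p\<in>set ps. region p) V"
    "\<And>rs cs E i j. (rs, cs, E) \<in> set ps \<Longrightarrow> (i, j) \<in> region (rs, cs, E) \<Longrightarrow> V i j = nform rs cs E i j"
    using Cons.IH Cons.prems by fastforce
  have piv: "pivotable \<rho> \<kappa> (rs, cs, E)" using Cons.prems(1)[of p] p by simp
  have sep: "separated (rs, cs, E) p'" if "p' \<in> set ps" for p' using Cons.prems(2) that p by auto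
  have disj: "region p \<inter> (\<Union>p\<in>set ps. region p) = {}"
    using sep unfolding p by (fastforce simp: region_def separated_def)
  have "generic_eqv \<rho> \<kappa> (\<lambda>M. \<forall>p\<in>set (p # ps). isolated p M) (region p \<union> (\<Union>p\<in>set ps. region p))
    (overwrite (region p) (nform rs cs E) V)"
    unfolding p
  proof (rule generic_eqv_conj[OF generic_elimination[OF piv] V(1) disj[unfolded p]])
    fix M assume iso: "\<forall>p\<in>set ((rs, cs, E) # ps). isolated p M"
    have "isolated p' (overwrite (region (rs, cs, E)) (nform rs cs E) M)" if p': "p' \<in> set ps" for p'
    proof -
      obtain rs' cs' E' where e: "p' = (rs', cs', E')" by (cases p') auto
      have "isolated (rs', cs', E') M" using iso p' e by simp
      moreover have "separated (rs, cs, E) (rs', cs', E')" using sep[OF p'] e by simp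
      ultimately show ?thesis unfolding e isolated_def separated_def overwrite_def region_def prod.case
        by (auto; blast)
    qed
    then show "isolated (rs, cs, E) M \<and> (\<forall>p\<in>set ps. isolated p (overwrite (region (rs, cs, E)) (nform rs cs E) M))"
      using iso by simp
  qed
  moreover have "overwrite (region p) (nform rs cs E) V i j = nform rs' cs' E' i j"
    if "(rs', cs', E') \<in> set (p # ps)" "(i, j) \<in> region (rs', cs', E')" for rs' cs' E' i j
    using that V(2) disj p by (auto simp: overwrite_def)
  ultimately show ?case by (intro exI[of _ "overwrite (region p) (nform rs cs E) V"]) auto
qed

text \<open>Irreflexivity makes the source row or column merely scaled, so it is still available for
  undoing the additions.\<close>

lemma elim_step_sym:
  assumes "elim_step \<rho> \<kappa> M M'" "\<And>i. \<not> \<rho> i i" "\<And>j. \<not> \<kappa> j j"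
  shows "elim_step \<rho> \<kappa> M' M"
  using assms(1)
proof cases
  case (row t u r)
  then have "u r = 0" using assms(2) by blast
  then show ?thesis using row
    by (intro elim_rowI[of "\<lambda>i. 1 / t i" "\<lambda>i. - u i / (t i * t r)" _ r]) (auto simp: field_simps)
next
  case (col t u c)
  then have "u c = 0" using assms(3) by blast
  then show ?thesis using col
    by (intro elim_colI[of "\<lambda>i. 1 / t i" "\<lambda>i. - u i / (t i * t c)" _ c]) (auto simp: field_simps)
qed

lemma generic_eqv_transpose:
  assumes "generic_eqv \<kappa> \<rho> P R V"
  shows "generic_eqv \<rho> \<kappa> (\<lambda>M. P (\<lambda>i j. M j i)) {(i, j). (j, i) \<in> R} (\<lambda>i j. V j i)"
proof -
  obtain f where f: "f \<in> polyfun" "f (enc V) \<noteq> 0"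
    "\<And>M M'. (\<And>i j. (i, j) \<in> R \<Longrightarrow> M i j = M' i j) \<Longrightarrow> f (enc M) = f (enc M')"
    "\<And>M. P M \<Longrightarrow> f (enc M) \<noteq> 0 \<Longrightarrow> elim_eqv \<kappa> \<rho> M (overwrite R V M)" using generic_eqvE[OF assms] by blast
  define g where "g = (\<lambda>x. f (\<lambda>s. x [s ! 1, s ! 0]))"
  have g: "g (enc M) = f (enc (\<lambda>i j. M j i))" for M by (simp add: g_def enc_def)
  show ?thesis
  proof (rule generic_eqvI[of g])
    show "g \<in> polyfun" unfolding g_def
      by (rule polyfun_comp[OF fun_alg_polyfun f(1)]) (rule polyfun.pcoord)
    show "g (enc (\<lambda>i j. V j i)) \<noteq> 0" using f(2) by (simp add: g)
  next
    fix M M' :: "nat \<Rightarrow> nat \<Rightarrow> complex"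
    assume "\<And>i j. (i, j) \<in> {(i, j). (j, i) \<in> R} \<Longrightarrow> M i j = M' i j"
    then show "g (enc M) = g (enc M')" unfolding g by (intro f(3)) auto
  next
    fix M assume "P (\<lambda>i j. M j i)" "g (enc M) \<noteq> 0"
    from f(4)[OF this(1) this(2)[unfolded g], THEN elim_eqv_transpose]
    show "elim_eqv \<rho> \<kappa> M (overwrite {(i, j). (j, i) \<in> R} (\<lambda>i j. V j i) M)"
      by (simp add: overwrite_def)
  qed
qed

lemma generic_eqv_mono:
  assumes "generic_eqv \<rho> \<kappa> P R V" "\<And>M. Q M \<Longrightarrow> P M"
  shows "generic_eqv \<rho> \<kappa> Q R V"
proof -
  obtain f where f: "f \<in> polyfun" "f (enc V) \<noteq> 0"
    "\<And>M M'. (\<And>i j. (i, j) \<in> R \<Longrightarrow> M i j = M' i j) \<Longrightarrow> f (enc M) = f (enc M')"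
    "\<And>M. P M \<Longrightarrow> f (enc M) \<noteq> 0 \<Longrightarrow> elim_eqv \<rho> \<kappa> M (overwrite R V M)" using generic_eqvE[OF assms(1)] by blast
  show ?thesis by (rule generic_eqvI[OF f(1,2)]) (use f(3,4) assms(2) in blast)+
qed

text \<open>Two rows against two families of columns: the first pivots are \<open>(r2, c1)\<close> and \<open>(r2, d1)\<close>; afterwards
  the only entry of the first row that cannot be cleared is the one in column \<open>d1\<close>.\<close>
lemma generic_two_rows:
  assumes rho: "\<rho> r1 r2" and r: "r1 \<noteq> r2"
    and cs: "sorted_wrt (\<lambda>c j. \<kappa> j c) (c1 # cs)" and ds: "sorted_wrt (\<lambda>c j. \<kappa> j c) (d1 # ds)"
    and dist: "distinct (c1 # cs)" "distinct (d1 # ds)" "set (c1 # cs) \<inter> set (d1 # ds) = {}"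
  defines "S \<equiv> {r1, r2} \<times> (set (c1 # cs) \<union> set (d1 # ds))"
  shows "\<exists>V. generic_eqv \<rho> \<kappa> (\<lambda>M. \<forall>i j. (i, j) \<notin> S \<longrightarrow> M i j = 0) S V"
proof -
  define H where "H = (\<lambda>xs (j :: nat). xs \<noteq> [] \<and> j = hd xs)"
  define V :: "nat \<Rightarrow> nat \<Rightarrow> complex" where "V = (\<lambda>i j. if i = r2 then (if j = c1 \<or> j = d1 then 1 else 0)
     else if i = r1 then (if j = d1 \<or> H cs j \<or> H ds j then 1 else 0) else 0)"
  \<comment> \<open>\<open>D\<close> is row \<open>r1\<close> after row \<open>r2\<close> has
    cleared its entry in column \<open>c1\<close>, and \<open>D'\<close> is what remains of it, up
    to the factor \<open>M r2 d1\<close>, after column \<open>d1\<close> has cleared row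
    \<open>r2\<close> in the columns \<open>ds\<close>.\<close>
  define D where "D = (\<lambda>(M :: nat \<Rightarrow> nat \<Rightarrow> complex) j. M r2 c1 * M r1 j - M r1 c1 * M r2 j)"
  define D' where "D' = (\<lambda>(M :: nat \<Rightarrow> nat \<Rightarrow> complex) j. M r2 d1 * D M j - M r2 j * D M d1)"
  define fD where "fD = (\<lambda>(x :: nat list \<Rightarrow> complex) j. x [r2, c1] * x [r1, j] - x [r1, c1] * x [r2, j])"
  define f where "f = (\<lambda>x. x [r2, c1] * x [r2, d1] * fD x d1 * (if cs = [] then 1 else fD x (hd cs))
     * (if ds = [] then 1 else x [r2, d1] * fD x (hd ds) - x [r2, hd ds] * fD x d1))"
  have f_enc: "f (enc M) = M r2 c1 * M r2 d1 * D M d1 * (if cs = [] then 1 else D M (hd cs))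
     * (if ds = [] then 1 else D' M (hd ds))" for M
    by (simp add: f_def fD_def D_def D'_def enc_def)
  have fD: "(\<lambda>x. fD x j) \<in> polyfun" for j
    unfolding fD_def by (intro fun_alg_diff[OF fun_alg_polyfun] polyfun.intros)
  have hd_cs: "hd cs \<in> set cs" if "cs \<noteq> []" using that by simp
  have hd_ds: "hd ds \<in> set ds" if "ds \<noteq> []" using that by simp
  have neq: "c1 \<noteq> d1" "c1 \<notin> set cs" "d1 \<notin> set ds" "d1 \<notin> set cs" "c1 \<notin> set ds" "set cs \<inter> set ds = {}"
    using dist by auto
  have kc: "\<kappa> j c1" if "j \<in> set cs" for j using cs that by auto
  have kd: "\<kappa> j d1" if "j \<in> set ds" for j using ds that by auto
  have kc2: "\<kappa> j (hd cs)" if "j \<in> set cs" "j \<noteq> hd cs" for j using cs that by (cases cs) auto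
  have kd2: "\<kappa> j (hd ds)" if "j \<in> set ds" "j \<noteq> hd ds" for j using ds that by (cases ds) auto
  have "generic_eqv \<rho> \<kappa> (\<lambda>M. \<forall>i j. (i, j) \<notin> S \<longrightarrow> M i j = 0) S V"
  proof (rule generic_eqvI[of f])
    show "f \<in> polyfun" unfolding f_def
      by (intro fun_alg_mult[OF fun_alg_polyfun] fun_alg_if fun_alg_diff[OF fun_alg_polyfun] fD polyfun.intros)
    have "c1 \<noteq> hd cs" "c1 \<noteq> hd ds" "d1 \<noteq> hd cs" "d1 \<noteq> hd ds" "hd cs \<noteq> hd ds" if "cs \<noteq> []" "ds \<noteq> []"
      using neq hd_cs[OF that(1)] hd_ds[OF that(2)] by auto
    moreover have "c1 \<noteq> hd cs" "d1 \<noteq> hd cs" if "cs \<noteq> []" using neq hd_cs[OF that(1)] by auto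
    moreover have "c1 \<noteq> hd ds" "d1 \<noteq> hd ds" if "ds \<noteq> []" using neq hd_ds[OF that(1)] by auto
    ultimately show "f (enc V) \<noteq> 0"
      unfolding f_enc using r neq by (auto simp: V_def D_def D'_def H_def)
  next
    fix M M' :: "nat \<Rightarrow> nat \<Rightarrow> complex"
    assume eq: "\<And>i j. (i, j) \<in> S \<Longrightarrow> M i j = M' i j"
    have e: "M r1 j = M' r1 j" "M r2 j = M' r2 j" if "j \<in> set (c1 # cs) \<union> set (d1 # ds)" for j
      using eq that by (auto simp: S_def)
    have "D M j = D M' j" if "j \<in> set (c1 # cs) \<union> set (d1 # ds)" for j
      using e[OF that] e[of c1] by (simp add: D_def)
    moreover from this have "D' M j = D' M' j" if "j \<in> set (c1 # cs) \<union> set (d1 # ds)" for j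
      using that e[OF that] e[of d1] by (simp add: D'_def)
    ultimately show "f (enc M) = f (enc M')" unfolding f_enc using e[of c1] e[of d1] hd_cs hd_ds by auto
  next
    fix M assume out: "\<forall>i j. (i, j) \<notin> S \<longrightarrow> M i j = 0" and nz: "f (enc M) \<noteq> 0"
    have nz: "M r2 c1 \<noteq> 0" "M r2 d1 \<noteq> 0" "D M d1 \<noteq> 0" "cs \<noteq> [] \<Longrightarrow> D M (hd cs) \<noteq> 0" "ds \<noteq> [] \<Longrightarrow> D' M (hd ds) \<noteq> 0"
      using nz by (auto simp: f_enc split: if_splits)
    have z: "M i j = 0" if "i \<notin> {r1, r2}" for i j using out that by (auto simp: S_def)
    have Dc1: "D M c1 = 0" by (simp add: D_def)
    have zz: "M i d1 * M r2 j = M i j * M r2 d1" if "i \<noteq> r1" for i j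
      using z[of i] that by (cases "i = r2") auto
    define M1 where "M1 = (\<lambda>i j. if i = r1 then D M j else M i j)"
    define M2 where "M2 = (\<lambda>i j. if i = r2 \<and> j \<in> set cs then 0 else M1 i j)"
    define M3 where "M3 = (\<lambda>i j. if j \<in> set ds then (if i = r1 then D' M j / M r2 d1 else 0) else M2 i j)"
    define M4 where "M4 = (\<lambda>i j. if j \<in> set cs then (if i = r1 then (if j = hd cs then D M j else 0) else 0) else M3 i j)"
    define M5 where "M5 = (\<lambda>i j. if j \<in> set ds then (if i = r1 then (if j = hd ds then D' M j / M r2 d1 else 0) else 0) else M4 i j)"
    define M6 where "M6 = (\<lambda>i j. if i = r1 then M5 i j / D M d1 else if i = r2 then M5 i j / M r2 d1 else M5 i j)"
    have "elim_step \<rho> \<kappa> M M1"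
      by (rule elim_rowI[of "\<lambda>i. if i = r1 then M r2 c1 else 1" "\<lambda>i. if i = r1 then - M r1 c1 else 0" _ r2])
         (use nz rho r in \<open>auto simp: M1_def D_def split: if_splits\<close>)
    moreover have "elim_step \<rho> \<kappa> M1 M2"
      by (rule elim_colI[of "\<lambda>j. 1" "\<lambda>j. if j \<in> set cs then - M r2 j / M r2 c1 else 0" _ c1])
         (use nz kc r Dc1 z in \<open>auto simp: M1_def M2_def split: if_splits\<close>)
    moreover have "elim_step \<rho> \<kappa> M2 M3"
    proof (rule elim_colI[of "\<lambda>j. 1" "\<lambda>j. if j \<in> set ds then - M r2 j / M r2 d1 else 0" _ d1])
      fix i j
      show "M3 i j = 1 * M2 i j + (if j \<in> set ds then - M r2 j / M r2 d1 else 0) * M2 i d1"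
      proof (cases "j \<in> set ds")
        case True
        then have j: "j \<notin> set cs" using neq by auto
        show ?thesis
        proof (cases "i = r1")
          case i: True
          have "M3 i j = D' M j / M r2 d1" "M2 i j = D M j" "M2 i d1 = D M d1"
            using True i r j by (simp_all add: M3_def M2_def M1_def)
          then show ?thesis using True nz(2) by (simp add: D'_def diff_divide_distrib)
        next
          case False
          have "M3 i j = 0" "M2 i j = M i j" "M2 i d1 = M i d1"
            using True False j neq by (simp_all add: M3_def M2_def M1_def)
          moreover have "M i j = M i d1 * M r2 j / M r2 d1" using zz[OF False, of j] nz(2) by simp
          ultimately show ?thesis using True by simp
        qed
      qed (simp add: M3_def)
    qed (use kd in \<open>auto split: if_splits\<close>)
    moreover have "elim_step \<rho> \<kappa> M3 M4"
    proof (rule elim_colI[of "\<lambda>j. 1" "\<lambda>j. if j \<in> set cs \<and> j \<noteq> hd cs then - D M j / D M (hd cs) else 0" _ "hd cs"])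
      fix i j
      show "M4 i j = 1 * M3 i j + (if j \<in> set cs \<and> j \<noteq> hd cs then - D M j / D M (hd cs) else 0) * M3 i (hd cs)"
      proof (cases "j \<in> set cs")
        case True
        then have cs0: "cs \<noteq> []" by auto
        have "j \<notin> set ds" "hd cs \<notin> set ds" using True neq hd_cs[OF cs0] by auto
        then show ?thesis using True hd_cs[OF cs0] nz(4)[OF cs0] z r
          by (cases "i = r1"; cases "i = r2") (simp_all add: M4_def M3_def M2_def M1_def)
      qed (simp add: M4_def)
    qed (use kc2 in \<open>auto split: if_splits\<close>)
    moreover have "elim_step \<rho> \<kappa> M4 M5"
    proof (rule elim_colI[of "\<lambda>j. 1" "\<lambda>j. if j \<in> set ds \<and> j \<noteq> hd ds then - D' M j / D' M (hd ds) else 0" _ "hd ds"])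
      fix i j
      show "M5 i j = 1 * M4 i j + (if j \<in> set ds \<and> j \<noteq> hd ds then - D' M j / D' M (hd ds) else 0) * M4 i (hd ds)"
      proof (cases "j \<in> set ds")
        case True
        then have ds0: "ds \<noteq> []" by auto
        have "j \<notin> set cs" "hd ds \<notin> set cs" using True neq hd_ds[OF ds0] by auto
        then show ?thesis using True hd_ds[OF ds0] nz(5)[OF ds0] z r
          by (cases "i = r1") (simp_all add: M5_def M4_def M3_def M2_def M1_def)
      qed (simp add: M5_def)
    qed (use kd2 in \<open>auto split: if_splits\<close>)
    \<comment> \<open>Five entries at most remain: row \<open>r2\<close> at \<open>c1\<close> and
      \<open>d1\<close>, row \<open>r1\<close> at \<open>d1\<close>, \<open>hd cs\<close> and
      \<open>hd ds\<close>. They form a tree on rows and columns, so scaling the two rows makes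
      column \<open>d1\<close> equal to 1, and scaling the other columns finishes.\<close>
    moreover have "elim_step \<rho> \<kappa> M5 M6"
      by (rule elim_rowI[of "\<lambda>i. if i = r1 then 1 / D M d1 else if i = r2 then 1 / M r2 d1 else 1" "\<lambda>i. 0" _ r2])
         (use nz in \<open>auto simp: M6_def\<close>)
    moreover have "elim_step \<rho> \<kappa> M6 V"
    proof (rule elim_colI[of "\<lambda>j. if j = c1 then M r2 d1 / M r2 c1 else if H cs j then D M d1 / D M j
          else if H ds j then D M d1 * M r2 d1 / D' M j else 1" "\<lambda>j. 0" _ c1])
      fix j
      show "(if j = c1 then M r2 d1 / M r2 c1 else if H cs j then D M d1 / D M j
          else if H ds j then D M d1 * M r2 d1 / D' M j else 1) \<noteq> 0"
        using nz by (auto simp: H_def)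
    next
      fix i j
      consider "j = c1" | "j = d1" | "j \<in> set cs" | "j \<in> set ds" | "j \<notin> set (c1 # cs) \<union> set (d1 # ds)" by auto
      then show "V i j = (if j = c1 then M r2 d1 / M r2 c1 else if H cs j then D M d1 / D M j
          else if H ds j then D M d1 * M r2 d1 / D' M j else 1) * M6 i j + 0 * M6 i c1"
      proof cases
        case 1
        then show ?thesis using nz r neq z Dc1 hd_cs hd_ds
          by (auto simp: V_def M6_def M5_def M4_def M3_def M2_def M1_def H_def)
      next
        case 2
        then show ?thesis using nz r neq z hd_cs hd_ds
          by (auto simp: V_def M6_def M5_def M4_def M3_def M2_def M1_def H_def)
      next
        case 3
        have "hd ds \<notin> set cs" if "ds \<noteq> []" using hd_ds[OF that] neq(6) by blast
        with 3 have "j \<notin> set ds" "j \<noteq> c1" "j \<noteq> d1" "cs \<noteq> []" "\<not> H ds j" using neq hd_ds by (auto simp: H_def)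
        then show ?thesis using nz r z 3
          by (auto simp: V_def M6_def M5_def M4_def H_def)
      next
        case 4
        have "hd cs \<notin> set ds" if "cs \<noteq> []" using hd_cs[OF that] neq(6) by blast
        with 4 have "j \<notin> set cs" "j \<noteq> c1" "j \<noteq> d1" "ds \<noteq> []" "\<not> H cs j" using neq hd_cs by (auto simp: H_def)
        then show ?thesis using nz r z 4
          by (auto simp: V_def M6_def M5_def M4_def M3_def H_def)
      next
        case 5
        then have "M i j = 0" for i using out by (auto simp: S_def)
        then show ?thesis using 5 hd_cs hd_ds
          by (auto simp: V_def M6_def M5_def M4_def M3_def M2_def M1_def D_def H_def)
      qed
    qed simp
    moreover have V: "overwrite S V M = V"
      using out by (auto simp: overwrite_def S_def V_def H_def fun_eq_iff hd_cs hd_ds)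
    ultimately show "elim_eqv \<rho> \<kappa> M (overwrite S V M)"
      unfolding V by (meson converse_rtranclp_into_rtranclp r_into_rtranclp)
  qed
  then show ?thesis by blast
qed

section \<open>Elimination steps as moves within Borel orbits\<close>

context levi_schubert
begin

definition rho :: "nat \<Rightarrow> nat \<Rightarrow> bool" where
  "rho i r \<longleftrightarrow> 1 \<le> i \<and> i < r \<and> r \<le> N \<and> blk i = blk r \<and> i \<notin> set w \<and> r \<notin> set w"

definition kappa :: "nat \<Rightarrow> nat \<Rightarrow> bool" where
  "kappa j c \<longleftrightarrow> c < j \<and> blk c = blk j \<and> c \<in> set w \<and> j \<in> set w"

definition orb :: "(nat list \<Rightarrow> complex) \<Rightarrow> (nat list \<Rightarrow> complex) \<Rightarrow> bool" where
  "orb x y \<longleftrightarrow> (\<exists>c g. c \<noteq> 0 \<and> g \<in> BLv \<and> y = (\<lambda>s. c * act g x s))"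

lemma orbI: "c \<noteq> 0 \<Longrightarrow> g \<in> BLv \<Longrightarrow> y = (\<lambda>s. c * act g x s) \<Longrightarrow> orb x y"
  by (auto simp: orb_def)

lemma orb_trans:
  assumes "orb x y" "orb y z" shows "orb x z"
proof -
  obtain c g c' g' where cg: "c \<noteq> 0" "g \<in> BLv" "y = (\<lambda>s. c * act g x s)"
    "c' \<noteq> 0" "g' \<in> BLv" "z = (\<lambda>s. c' * act g' y s)"
    using assms by (auto simp: orb_def)
  have "act g' (act g x) = act (g' * g) x"
    using wact_mult[of g' N g d x] cg Bor_carrier by auto
  then show ?thesis
    using cg by (intro orbI[of "c' * c" "g' * g"] BLv_mult) (auto simp: wact_scale)
qed

lemma orb_in_X: "orb x y \<Longrightarrow> x \<in> X \<Longrightarrow> y \<in> X"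
  unfolding orb_def using X_scale X_Bor by blast

lemma BLvI:
  assumes "g \<in> carrier_mat N N" "\<And>i. 1 \<le> i \<Longrightarrow> i \<le> N \<Longrightarrow> g $$ (i - 1, i - 1) \<noteq> 0"
    "\<And>i j. 1 \<le> i \<Longrightarrow> i \<le> N \<Longrightarrow> 1 \<le> j \<Longrightarrow> j \<le> N \<Longrightarrow> i \<noteq> j \<Longrightarrow> g $$ (i - 1, j - 1) \<noteq> 0 \<Longrightarrow> i < j \<and> blk i = blk j"
  shows "g \<in> BLv"
proof -
  have "g $$ (i, i) \<noteq> 0" if "i < N" for i using assms(2)[of "Suc i"] that by simp
  moreover have "g $$ (i, j) = 0" if "i < N" "j < i" for i j using assms(3)[of "Suc i" "Suc j"] that by force
  ultimately have B: "g \<in> Bor N" by (subst Bor_iff[OF assms(1)]) auto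
  moreover have "g \<in> L" using Levi_iff Bor_GLn[OF B] assms(3) by metis
  ultimately show ?thesis by simp
qed

definition emat :: "(nat \<Rightarrow> nat \<Rightarrow> complex) \<Rightarrow> complex mat" where
  "emat G = mat N N (\<lambda>(i, j). G (Suc i) (Suc j))"

lemma emat_entry: "1 \<le> i \<Longrightarrow> i \<le> N \<Longrightarrow> 1 \<le> j \<Longrightarrow> j \<le> N \<Longrightarrow> emat G $$ (i - 1, j - 1) = G i j"
  by (simp add: emat_def)

lemma emat_BLv:
  assumes "\<And>i. G i i \<noteq> 0"
    "\<And>i j. 1 \<le> i \<Longrightarrow> i \<le> N \<Longrightarrow> 1 \<le> j \<Longrightarrow> j \<le> N \<Longrightarrow> i \<noteq> j \<Longrightarrow> G i j \<noteq> 0 \<Longrightarrow> i < j \<and> blk i = blk j"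
  shows "emat G \<in> BLv"
  by (rule BLvI) (use assms emat_entry in \<open>auto simp: emat_def\<close>)

lemma act_emat_pl: "act (emat G) (pl d N Z) = pl d N (\<lambda>i j. \<Sum>m = 1..N. G i m * Z m j)"
  unfolding wact_pl
proof (rule pl_cong)
  fix i j assume i: "1 \<le> i" "i \<le> N" "j < d"
  have "emat G $$ (i - 1, m - 1) = G i m" if "m \<in> {1..N}" for m
    using that i by (intro emat_entry) auto
  then show "(\<Sum>m = 1..N. emat G $$ (i - 1, m - 1) * Z m j) = (\<Sum>m = 1..N. G i m * Z m j)"
    by (intro sum.cong) auto
qed

lemma sum_diag_plus:
  assumes "i \<in> {1..N}" "\<And>m. m \<in> {1..N} \<Longrightarrow> m \<noteq> i \<Longrightarrow> m \<noteq> r \<Longrightarrow> F m = (0 :: complex)" "r \<noteq> i"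
  shows "(\<Sum>m = 1..N. F m) = F i + (if r \<in> {1..N} then F r else 0)"
proof -
  have "(\<Sum>m = 1..N. F m) = (\<Sum>m\<in>{i} \<union> ({r} \<inter> {1..N}). F m)"
  proof (rule sum.mono_neutral_right)
    show "\<forall>m\<in>{1..N} - ({i} \<union> ({r} \<inter> {1..N})). F m = 0" using assms(2) by blast
  qed (use assms(1) in auto)
  also have "\<dots> = F i + (\<Sum>m\<in>{r} \<inter> {1..N}. F m)"
    using assms(3) by (subst sum.union_disjoint) auto
  finally show ?thesis by auto
qed

text \<open>Row operations are left multiplications. A column operation multiplies the echelon
  matrix by \<open>H\<close> on the right and spoils the identity in the rows of \<open>w\<close>;
  left multiplication by \<open>G\<close>, which inverts that block, restores it. The direction of
  \<open>kappa\<close> makes \<open>H\<close> and \<open>G\<close> upper triangular, and the cost is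
  the scalar \<open>dt d H\<close>.\<close>

lemma elim_step_orb:
  assumes "elim_step rho kappa M M'"
  shows "orb (cellpt M) (cellpt M')"
  using assms
proof cases
  case (row t u r)
  have ur: "u i \<noteq> 0 \<Longrightarrow> 1 \<le> i \<and> i < r \<and> r \<le> N \<and> blk i = blk r \<and> i \<notin> set w \<and> r \<notin> set w" for i
    using row(3) by (auto simp: rho_def)
  define G where "G = (\<lambda>i m. if i = m then (if i \<in> set w then 1 else t i) else if m = r then u i else 0)"
  have "emat G \<in> BLv"
    by (rule emat_BLv) (use row(2) ur in \<open>auto simp: G_def split: if_splits\<close>)
  moreover have "cellpt M' = act (emat G) (cellpt M)"
    unfolding cellpt_def act_emat_pl
  proof (rule pl_cong)
    fix i j assume ij: "1 \<le> i" "i \<le> N" "j < d"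
    show "zred M' i j = (\<Sum>m = 1..N. G i m * zred M m j)"
    proof (cases "i = r")
      case True
      then have u0: "u i = 0" using ur[of i] by auto
      have "(\<Sum>m = 1..N. G i m * zred M m j) = (\<Sum>m = 1..N. if m = i then G i i * zred M i j else 0)"
        using True by (intro sum.cong) (auto simp: G_def)
      then show ?thesis using ij u0 row(1) by (auto simp: zred_def G_def)
    next
      case False
      have "(\<Sum>m = 1..N. G i m * zred M m j) = G i i * zred M i j + (if r \<in> {1..N} then G i r * zred M r j else 0)"
        by (rule sum_diag_plus) (use ij False in \<open>auto simp: G_def\<close>)
      then show ?thesis using ur[of i] False row(1) by (cases "u i = 0") (auto simp: G_def zred_def)
    qed
  qed
  ultimately show ?thesis by (intro orbI[of 1 "emat G"]) auto
next
  case (col t u c)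
  have uc: "u j \<noteq> 0 \<Longrightarrow> c < j \<and> blk c = blk j \<and> c \<in> set w \<and> j \<in> set w" for j
    using col(3) by (auto simp: kappa_def)
  have uc0: "u c = 0" using uc[of c] by auto
  define H where "H = (\<lambda>l a. if l = a then t (w ! a) else if w ! l = c then u (w ! a) else 0)"
  define G where "G = (\<lambda>i m. if i = m then (if i \<in> set w then 1 / t i else 1)
    else if i = c \<and> m \<in> set w then - u m / (t m * t c) else 0)"
  have GB: "emat G \<in> BLv"
    by (rule emat_BLv) (use col(2) uc in \<open>auto simp: G_def split: if_splits\<close>)
  have "dt d H = (\<Prod>a<d. H a a)"
  proof (rule dt_upper_triangular)
    fix i j assume ij: "i < d" "j < i"
    then have "w ! j < w ! i"
      using Idn_sorted[OF wI] w_length by (simp add: sorted_wrt_nth_less)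
    then have "w ! i \<noteq> c" if "u (w ! j) \<noteq> 0" using uc[OF that] by auto
    then show "H i j = 0" using ij by (cases "u (w ! j) = 0") (auto simp: H_def)
  qed
  then have H0: "dt d H \<noteq> 0" using col(2) by (simp add: H_def)
  define Z' where "Z' = (\<lambda>i a. \<Sum>l<d. zred M i l * H l a)"
  have Z': "Z' i a = t (w ! a) * zred M i a + u (w ! a) * (if i \<in> set w then (if i = c then 1 else 0) else M i c)"
    if a: "a < d" for i a
  proof (cases "u (w ! a) = 0")
    case True
    then have "Z' i a = (\<Sum>l<d. if l = a then zred M i a * t (w ! a) else 0)"
      unfolding Z'_def by (intro sum.cong) (auto simp: H_def)
    then show ?thesis using True a by simp
  next
    case False
    then obtain k where k: "k < d" "w ! k = c" using uc w_obtain by metis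
    have ka: "k \<noteq> a" using False k uc0 by auto
    have "Z' i a = (\<Sum>l<d. (if l = a then zred M i a * t (w ! a) else 0) + (if l = k then zred M i k * u (w ! a) else 0))"
      unfolding Z'_def using ka k w_nth_eq by (intro sum.cong) (auto simp: H_def)
    also have "\<dots> = zred M i a * t (w ! a) + zred M i k * u (w ! a)" using a k by (simp add: sum.distrib)
    finally show ?thesis using k by (simp add: zred_def)
  qed
  have "cellpt M' = act (emat G) (pl d N Z')"
    unfolding cellpt_def act_emat_pl
  proof (rule pl_cong)
    fix i a assume ia: "1 \<le> i" "i \<le> N" "a < d"
    have wa: "w ! a \<in> set w" "1 \<le> w ! a" "w ! a \<le> N" using w_nth_mem w_range ia by auto
    show "zred M' i a = (\<Sum>m = 1..N. G i m * Z' m a)"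
    proof (cases "i \<in> set w")
      case False
      then have "(\<Sum>m = 1..N. G i m * Z' m a) = (\<Sum>m = 1..N. if m = i then Z' i a else 0)"
        using uc by (intro sum.cong) (auto simp: G_def)
      then show ?thesis using False ia Z'[of a i] col(1) by (simp add: zred_def)
    next
      case True
      have Zw: "Z' m a = (if m = w ! a then t (w ! a) else if m = c then u (w ! a) else 0)" if "m \<in> set w" for m
        using Z'[OF ia(3), of m] that uc0 by (auto simp: zred_def)
      show ?thesis
      proof (cases "i = c")
        case False
        then have "(\<Sum>m = 1..N. G i m * Z' m a) = (\<Sum>m = 1..N. if m = i then Z' i a / t i else 0)"
          using True by (intro sum.cong) (auto simp: G_def)
        then show ?thesis using True ia Zw[OF True] False col(2) by (simp add: zred_def)
      next
        case ic: True
        have eq: "G i m * Z' m a = (if m = c then Z' c a / t c else if m = w ! a then - u m / t c else 0)" if "m \<in> {1..N}" for m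
          using Zw[of m] True ic uc0 col(2) that wa(1) by (auto simp: G_def)
        have "(\<Sum>m = 1..N. G i m * Z' m a) = (\<Sum>m = 1..N. if m = c then Z' c a / t c else if m = w ! a then - u m / t c else 0)"
          by (rule sum.cong[OF refl eq])
        also have "\<dots> = (if c = w ! a then 1 else 0)"
        proof (cases "c = w ! a")
          case True
          then have "(\<Sum>m = 1..N. if m = c then Z' c a / t c else if m = w ! a then - u m / t c else 0)
            = (\<Sum>m = 1..N. if m = c then Z' c a / t c else 0)" by (intro sum.cong) auto
          then show ?thesis using True ia ic Zw[of c] col(2) \<open>i \<in> set w\<close> by simp
        next
          case False
          then have "(\<Sum>m = 1..N. if m = c then Z' c a / t c else if m = w ! a then - u m / t c else 0)
            = (\<Sum>m = 1..N. (if m = c then Z' c a / t c else 0) + (if m = w ! a then - u (w ! a) / t c else 0))"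
            by (intro sum.cong) auto
          also have "\<dots> = Z' c a / t c - u (w ! a) / t c" using ia ic wa by (simp add: sum.distrib)
          finally show ?thesis using False Zw[of c] \<open>i \<in> set w\<close> ic by simp
        qed
        finally show ?thesis using True ic by (simp add: zred_def)
      qed
    qed
  qed
  also have "pl d N Z' = (\<lambda>s. dt d H * cellpt M s)"
    unfolding Z'_def cellpt_def by (rule pl_colop)
  finally have "cellpt M' = (\<lambda>s. dt d H * act (emat G) (cellpt M) s)" by (simp add: wact_scale)
  then show ?thesis using H0 GB by (intro orbI)
qed

lemma elim_eqv_orb:
  assumes "elim_eqv rho kappa M M'"
  shows "orb (cellpt M') (cellpt M)"
  using assms
proof (induction rule: rtranclp_induct)
  case base
  have "elim_step rho kappa M M" by (rule elim_rowI[of "\<lambda>_. 1" "\<lambda>_. 0"]) auto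
  then show ?case by (rule elim_step_orb)
next
  case (step M1 M2)
  have "elim_step rho kappa M2 M1"
    by (rule elim_step_sym[OF step(2)]) (auto simp: rho_def kappa_def)
  then show ?case using elim_step_orb orb_trans step.IH by blast
qed

definition OD :: "(nat \<times> nat) set" where
  "OD = {(i, c). 1 \<le> i \<and> i \<le> N \<and> i \<notin> set w \<and> c \<in> set w \<and> blk i < blk c}"

definition off :: "(nat \<Rightarrow> nat \<Rightarrow> complex) \<Rightarrow> nat \<Rightarrow> nat \<Rightarrow> complex" where
  "off M = (\<lambda>i c. if (i, c) \<in> OD then M i c else 0)"

lemma blk_less_imp_less: "1 \<le> c \<Longrightarrow> i \<le> N \<Longrightarrow> blk i < blk c \<Longrightarrow> i < c"
  using blk_mono[of c i] by fastforce

text \<open>Entries whose row and column lie in the same block are themselves the entries of a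
  unipotent element of \<open>BLv\<close>; applied to the echelon form, whose rows in
  \<open>w\<close> are unit rows, it adds exactly these entries. A later row block is excluded by
  the hypothesis.\<close>

lemma orb_off:
  assumes "\<And>i c. 1 \<le> i \<Longrightarrow> i \<le> N \<Longrightarrow> i \<notin> set w \<Longrightarrow> c \<in> set w \<Longrightarrow> c < i \<Longrightarrow> M i c = 0"
  shows "orb (cellpt (off M)) (cellpt M)"
proof -
  define G where "G = (\<lambda>i m. if i = m then 1 else if i \<notin> set w \<and> m \<in> set w \<and> blk i = blk m then M i m else 0)"
  have "emat G \<in> BLv"
  proof (rule emat_BLv)
    fix i j assume ij: "1 \<le> i" "i \<le> N" "1 \<le> j" "j \<le> N" "i \<noteq> j" "G i j \<noteq> 0"
    then have *: "i \<notin> set w" "j \<in> set w" "blk i = blk j" by (auto simp: G_def split: if_splits)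
    then have "\<not> j \<le> i" using w_final[of j i] ij by auto
    then show "i < j \<and> blk i = blk j" using * by simp
  qed (simp add: G_def)
  moreover have "cellpt M = act (emat G) (cellpt (off M))"
    unfolding cellpt_def act_emat_pl
  proof (rule pl_cong)
    fix i a assume ia: "1 \<le> i" "i \<le> N" "a < d"
    have wa: "w ! a \<in> set w" "1 \<le> w ! a" "w ! a \<le> N" using w_nth_mem w_range ia by auto
    show "zred M i a = (\<Sum>m = 1..N. G i m * zred (off M) m a)"
    proof (cases "i \<in> set w")
      case True
      have "(\<Sum>m = 1..N. G i m * zred (off M) m a) = (\<Sum>m = 1..N. if m = i then zred (off M) i a else 0)"
        using True by (intro sum.cong) (auto simp: G_def)
      then show ?thesis using True ia by (simp add: zred_def)
    next
      case False
      have "(\<Sum>m = 1..N. G i m * zred (off M) m a)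
        = (\<Sum>m = 1..N. (if m = i then zred (off M) i a else 0) + (if m = w ! a then (if blk i = blk (w ! a) then M i (w ! a) else 0) else 0))"
        using False wa by (intro sum.cong) (auto simp: G_def zred_def)
      also have "\<dots> = off M i (w ! a) + (if blk i = blk (w ! a) then M i (w ! a) else 0)"
        unfolding sum.distrib using False ia wa by (simp add: zred_def)
      also have "\<dots> = M i (w ! a)"
        using assms[OF ia(1,2) False wa(1)] ia wa False blk_mono[of i "w ! a"]
        by (auto simp: off_def OD_def) (metis nat_neq_iff not_le_imp_less order.order_iff_strict)
      finally show ?thesis using False by (simp add: zred_def)
    qed
  qed
  ultimately show ?thesis by (intro orbI[of 1 "emat G"]) auto
qed

lemma Bor_inverse:
  assumes g: "g \<in> Bor N" and k: "k \<in> carrier_mat N N" "g * k = 1\<^sub>m N"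
  shows "k \<in> Bor N"
proof -
  have gc: "g \<in> carrier_mat N N" using g by (rule Bor_carrier)
  have up: "k $$ (i, j) = 0" if j: "j < i" "i < N" for i j
  proof (rule ccontr)
    assume nz: "k $$ (i, j) \<noteq> 0"
    \<comment> \<open>In the product with \<open>g\<close>, the lowest nonzero entry of column
      \<open>j\<close> of \<open>k\<close> meets only zeros below it and the diagonal of
      \<open>g\<close>, so it would survive off the diagonal of the identity.\<close>
    define S where "S = {i. j < i \<and> i < N \<and> k $$ (i, j) \<noteq> 0}"
    have S: "finite S" "i \<in> S" using nz j by (auto simp: S_def)
    define m where "m = Max S"
    have "m \<in> S" unfolding m_def using Max_in[of S] S by blast
    then have m: "j < m" "m < N" "k $$ (m, j) \<noteq> 0" by (auto simp: S_def)
    have above: "k $$ (l, j) = 0" if "m < l" "l < N" for l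
      using Max_ge[OF S(1), of l] that m(1) unfolding m_def[symmetric] by (force simp: S_def)
    have "(g * k) $$ (m, j) = (\<Sum>l = 0..<N. g $$ (m, l) * k $$ (l, j))"
      using gc k(1) m by (auto simp: scalar_prod_def)
    also have "\<dots> = (\<Sum>l = 0..<N. if l = m then g $$ (m, m) * k $$ (m, j) else 0)"
    proof (rule sum.cong[OF refl])
      fix l assume "l \<in> {0..<N}"
      then show "g $$ (m, l) * k $$ (l, j) = (if l = m then g $$ (m, m) * k $$ (m, j) else 0)"
        using above[of l] g m by (cases l m rule: linorder_cases) (auto simp: Bor_def)
    qed
    also have "\<dots> \<noteq> 0" using m Bor_diag[OF g] by simp
    finally show False using k(2) m by simp
  qed
  have "det g * det k = 1" using det_mult[OF gc k(1)] k(2) by simp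
  then have "k \<in> GLn N" using k(1) by (auto simp: GLn_def)
  then show ?thesis using up by (auto simp: Bor_def)
qed

lemma BLv_inverse:
  assumes g: "g \<in> BLv"
  obtains k where "k \<in> BLv" "k * g = 1\<^sub>m N" "g * k = 1\<^sub>m N"
proof -
  have "g \<in> L" "g \<in> Bor N" using g by auto
  then obtain k where "k \<in> L" "k * g = 1\<^sub>m N" "g * k = 1\<^sub>m N" using Levi_inverse by blast
  then show thesis using that Bor_inverse[OF \<open>g \<in> Bor N\<close>] Levi_carrier by blast
qed

lemma orb_sym:
  assumes "orb x y" "x \<in> X" shows "orb y x"
proof -
  obtain c g where cg: "c \<noteq> 0" "g \<in> BLv" "y = (\<lambda>s. c * act g x s)" using assms by (auto simp: orb_def)
  then obtain k where k: "k \<in> BLv" "k * g = 1\<^sub>m N" using BLv_inverse by metis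
  have "act k y = (\<lambda>s. c * act k (act g x) s)" unfolding cg(3) by (rule wact_scale)
  also have "act k (act g x) = act (1\<^sub>m N) x"
    using wact_mult[of k N g d x] k Bor_carrier[of k N] Bor_carrier[of g N] cg(2) by simp
  also have "\<dots> = x" using X_supp[OF assms(2)] by (intro wact_one)
  finally show ?thesis using cg(1) k(1) by (intro orbI[of "1 / c" k]) auto
qed

text \<open>Every point with \<open>F\<close> nonzero lies in the orbit of the normal form. The
  complement of the orbit is therefore the common zero set of all translates of \<open>F\<close>,
  which gives openness; density follows from irreducibility, as \<open>F\<close> does not vanish at
  \<open>v\<close>.\<close>

lemma spherical_if_generic:
  assumes G: "generic_eqv rho kappa (\<lambda>M. \<forall>i j. (i, j) \<notin> OD \<longrightarrow> M i j = 0) OD V"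
  shows "spherical d N w js"
proof -
  obtain f where f: "f \<in> polyfun" "f (enc V) \<noteq> 0"
    "\<And>M M'. (\<And>i j. (i, j) \<in> OD \<Longrightarrow> M i j = M' i j) \<Longrightarrow> f (enc M) = f (enc M')"
    "\<And>M. (\<forall>i j. (i, j) \<notin> OD \<longrightarrow> M i j = 0) \<Longrightarrow> f (enc M) \<noteq> 0 \<Longrightarrow> elim_eqv rho kappa M (overwrite OD V M)"
    using generic_eqvE[OF G] by blast
  define v where "v = cellpt (off V)"
  define F where "F = (\<lambda>x. x w * f (enc (off (ent x))))"
  define U where "U = {(\<lambda>s. c * act g v s) | c g. c \<noteq> 0 \<and> g \<in> BLv}"
  have U_orb: "x \<in> U \<longleftrightarrow> orb v x" for x by (auto simp: U_def orb_def)
  have vX: "v \<in> X" unfolding v_def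
  proof (rule cellpt_in_X)
    fix i c assume "1 \<le> i" "i \<le> N" "i \<notin> set w" "c \<in> set w" "c < i"
    then show "off V i c = 0" using blk_less_imp_less[of c i] w_range[of c] by (auto simp: off_def OD_def)
  qed
  have vw: "v w = 1" unfolding v_def by (rule cellpt_w)
  have Fpf: "F \<in> polyfun"
  proof -
    have "(\<lambda>x. f (enc (off (ent x)))) \<in> polyfun"
    proof (rule polyfun_comp[OF fun_alg_polyfun f(1)])
      fix s show "(\<lambda>x. enc (off (ent x)) s) \<in> polyfun"
        unfolding enc_def off_def by (intro fun_alg_if ent_polyfun polyfun.intros)
    qed
    then show ?thesis unfolding F_def by (intro fun_alg_mult[OF fun_alg_polyfun] polyfun.intros)
  qed
  have "ent v i c = off V i c" if "(i, c) \<in> OD" for i c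
    using ent_cellpt[of i c 1 "off V"] that by (auto simp: v_def OD_def)
  then have "f (enc (off (ent v))) = f (enc V)" by (intro f(3)) (auto simp: off_def)
  then have Fv: "F v \<noteq> 0" using f(2) vw by (simp add: F_def)
  have gen: "orb v x" if x: "x \<in> X" "F x \<noteq> 0" for x
  proof -
    have xw: "x w \<noteq> 0" and fx: "f (enc (off (ent x))) \<noteq> 0" using x(2) by (auto simp: F_def)
    define M where "M = (\<lambda>i c. ent x i c / x w)"
    have xM: "x = (\<lambda>s. x w * cellpt M s)" unfolding M_def by (rule cell_coords[OF x(1) xw])
    \<comment> \<open>\<open>ent x\<close> is \<open>x w\<close> times the matrix \<open>M\<close>
      of the point, and a common factor is a scaling of all rows.\<close>
    have "elim_step rho kappa (off M) (off (ent x))"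
      by (rule elim_rowI[of "\<lambda>_. x w" "\<lambda>_. 0"]) (use xw in \<open>auto simp: off_def M_def\<close>)
    moreover have "elim_eqv rho kappa (off (ent x)) (overwrite OD V (off (ent x)))"
      by (rule f(4)[OF _ fx]) (auto simp: off_def)
    moreover have "overwrite OD V (off (ent x)) = off V" by (auto simp: overwrite_def off_def fun_eq_iff)
    ultimately have "elim_eqv rho kappa (off M) (off V)" by simp
    then have "orb v (cellpt (off M))" unfolding v_def by (rule elim_eqv_orb)
    also have "orb (cellpt (off M)) (cellpt M)"
      by (rule orb_off) (use ent_upper[OF x(1)] in \<open>auto simp: M_def\<close>)
    finally (orb_trans) have *: "orb v (cellpt M)" .
    then obtain c g where cg: "c \<noteq> 0" "g \<in> BLv" "cellpt M = (\<lambda>s. c * act g v s)" by (auto simp: orb_def)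
    show ?thesis
    proof (rule orbI[of "x w * c" g])
      show "x = (\<lambda>s. x w * c * act g v s)"
      proof
        fix s
        have "x s = x w * cellpt M s" using xM by (rule fun_cong)
        also have "\<dots> = x w * c * act g v s" by (simp add: cg(3))
        finally show "x s = x w * c * act g v s" .
      qed
    qed (use cg xw in auto)
  qed
  have "zar_open_in X U"
    unfolding zar_open_in_def
  proof (intro conjI exI)
    show "U \<subseteq> X" using orb_in_X vX U_orb by blast
    let ?Fs = "{(\<lambda>x. F (\<lambda>s. c * act g x s)) | c g. c \<noteq> 0 \<and> g \<in> BLv}"
    have "(\<lambda>x. F (\<lambda>s. c * act g x s)) \<in> polyfun" for c g
      by (rule polyfun_comp[OF fun_alg_polyfun Fpf]) (intro fun_alg_cmult[OF fun_alg_polyfun] wact_coord_polyfun)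
    then show "?Fs \<subseteq> polyfun" by blast
    show "X - U = {x \<in> X. \<forall>f\<in>?Fs. f x = 0}"
    proof (rule Set.set_eqI, rule iffI)
      fix x assume x: "x \<in> X - U"
      have "F (\<lambda>s. c * act g x s) = 0" if "c \<noteq> 0" "g \<in> BLv" for c g
      proof (rule ccontr)
        assume nz: "F (\<lambda>s. c * act g x s) \<noteq> 0"
        have o: "orb x (\<lambda>s. c * act g x s)" using that by (intro orbI) auto
        then have "orb v (\<lambda>s. c * act g x s)" using gen nz orb_in_X x by blast
        then have "orb v x" using orb_sym[OF o] x orb_trans by blast
        then show False using x U_orb by blast
      qed
      then show "x \<in> {x \<in> X. \<forall>f\<in>?Fs. f x = 0}" using x by blast
    next
      fix x assume x: "x \<in> {x \<in> X. \<forall>f\<in>?Fs. f x = 0}"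
      have "x \<notin> U"
      proof
        assume "x \<in> U"
        then have "orb x v" using U_orb orb_sym vX by blast
        then obtain c g where "c \<noteq> 0" "g \<in> BLv" "v = (\<lambda>s. c * act g x s)" by (auto simp: orb_def)
        then show False using x Fv by auto
      qed
      then show "x \<in> X - U" using x by blast
    qed
  qed
  moreover have "zar_dense_in X U"
    unfolding zar_dense_in_def
  proof (intro ballI impI)
    fix p x assume p: "p \<in> polyfun" "\<forall>x\<in>U. p x = 0" and x: "x \<in> X"
    show "p x = 0"
      by (rule X_domain[OF Fpf p(1) _ vX Fv x]) (use gen p(2) U_orb in blast)
  qed
  moreover have "v \<noteq> (\<lambda>s. 0)" using vw by auto
  ultimately show ?thesis unfolding spherical_def Let_def U_def[symmetric] using vX U_def by blast
qed

section \<open>Dense Borel orbits\<close>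

text \<open>The order of elimination: free rows run downwards and columns upwards, because the upper
  triangular group adds later rows to earlier ones and earlier columns to later ones.\<close>

definition Ql :: "nat \<Rightarrow> nat list" where "Ql l = rev [J (l - 1) + 1 ..< J l - h l + 1]"

definition Al :: "nat \<Rightarrow> nat list" where "Al k = [J k - h k + 1 ..< J k + 1]"

lemma J_bounds: "k \<in> {1..b} \<Longrightarrow> J (k - 1) + q k + h k = J k"
  using J_n[of k] n_eq[of k] by simp

lemma blk_index:
  assumes "k \<in> {1..b}" "J (k - 1) < i" "i \<le> J k"
  shows "1 \<le> i \<and> i \<le> N \<and> blk i = k"
proof -
  have "i \<le> N" using assms J_le_N[of k] by auto
  then show ?thesis using blk_eq_iff[of i k] assms by auto
qed

lemma set_Ql:
  assumes "l \<in> {1..b}"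
  shows "i \<in> set (Ql l) \<longleftrightarrow> 1 \<le> i \<and> i \<le> N \<and> i \<notin> set w \<and> blk i = l"
proof
  assume "i \<in> set (Ql l)"
  then have i: "J (l - 1) < i" "i \<le> J l - h l" by (auto simp: Ql_def)
  then have "1 \<le> i \<and> i \<le> N \<and> blk i = l" using J_bounds[OF assms] by (intro blk_index[OF assms]) auto
  then show "1 \<le> i \<and> i \<le> N \<and> i \<notin> set w \<and> blk i = l" using w_iff[of i] i by auto
next
  assume i: "1 \<le> i \<and> i \<le> N \<and> i \<notin> set w \<and> blk i = l"
  then have "J (l - 1) < i" "i \<le> J l - h l" using w_iff[of i] blk_bounds[of i] by auto
  then show "i \<in> set (Ql l)" by (auto simp: Ql_def)
qed

lemma set_Al:
  assumes "k \<in> {1..b}"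
  shows "c \<in> set (Al k) \<longleftrightarrow> c \<in> set w \<and> blk c = k"
proof
  assume "c \<in> set (Al k)"
  then have c: "J k - h k < c" "c \<le> J k" by (auto simp: Al_def)
  then have "1 \<le> c \<and> c \<le> N \<and> blk c = k" using J_bounds[OF assms] by (intro blk_index[OF assms]) auto
  then show "c \<in> set w \<and> blk c = k" using w_iff[of c] c by auto
next
  assume c: "c \<in> set w \<and> blk c = k"
  then have "J k - h k < c" "c \<le> J k" using w_iff[of c] blk_bounds[of c] w_range[of c] by auto
  then show "c \<in> set (Al k)" by (auto simp: Al_def)
qed

lemma length_Ql: "l \<in> {1..b} \<Longrightarrow> length (Ql l) = q l"
  using J_bounds[of l] by (simp add: Ql_def del: upt_Suc)

lemma length_Al: "k \<in> {1..b} \<Longrightarrow> length (Al k) = h k"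
  using J_bounds[of k] by (simp add: Al_def del: upt_Suc)

lemma distinct_Ql: "distinct (Ql l)" and distinct_Al: "distinct (Al k)"
  by (simp_all add: Ql_def Al_def del: upt_Suc)

lemma sorted_Ql: assumes "l \<in> {1..b}" shows "sorted_wrt (\<lambda>r i. rho i r) (Ql l)"
proof -
  have "sorted_wrt (\<lambda>r i. i < r) (Ql l)"
    by (simp add: Ql_def sorted_wrt_rev del: upt_Suc)
  then show ?thesis
    by (rule sorted_wrt_mono_rel[rotated]) (use set_Ql[OF assms] in \<open>auto simp: rho_def\<close>)
qed

lemma sorted_Al: assumes "k \<in> {1..b}" shows "sorted_wrt (\<lambda>c j. kappa j c) (Al k)"
proof -
  have "sorted_wrt (<) (Al k)"
    by (simp add: Al_def del: upt_Suc)
  then show ?thesis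
    by (rule sorted_wrt_mono_rel[rotated]) (use set_Al[OF assms] in \<open>auto simp: kappa_def\<close>)
qed

lemma OD_iff: "(i, c) \<in> OD \<longleftrightarrow> 1 \<le> i \<and> i \<le> N \<and> i \<notin> set w \<and> c \<in> set w \<and> blk i < blk c"
  by (simp add: OD_def)

lemma OD_blocks:
  assumes "(i, c) \<in> OD"
  shows "blk i \<in> {1..b}" "blk c \<in> {1..b}" "blk i < blk c" "i \<in> set (Ql (blk i))" "c \<in> set (Al (blk c))"
  using assms blk_range[of i] blk_range[of c] w_range[of c] set_Ql[of "blk i" i] set_Al[of "blk c" c]
  by (auto simp: OD_iff)

lemma OD_I:
  assumes "l \<in> {1..b}" "k \<in> {1..b}" "l < k" "i \<in> set (Ql l)" "c \<in> set (Al k)"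
  shows "(i, c) \<in> OD"
  using assms set_Ql[of l i] set_Al[of k c] by (auto simp: OD_iff)

lemma spherical_family:
  assumes "\<And>p. p \<in> set ps \<Longrightarrow> pivotable rho kappa p" "sorted_wrt separated ps"
    "\<And>p M. p \<in> set ps \<Longrightarrow> (\<And>i j. (i, j) \<notin> OD \<Longrightarrow> M i j = 0) \<Longrightarrow> isolated p M"
    "(\<Union>p\<in>set ps. region p) = OD"
  shows "spherical d N w js"
proof -
  obtain V where "generic_eqv rho kappa (\<lambda>M. \<forall>p\<in>set ps. isolated p M) (\<Union>p\<in>set ps. region p) V"
    using generic_elimination_family[OF assms(1,2)] by blast
  then have "generic_eqv rho kappa (\<lambda>M. \<forall>i j. (i, j) \<notin> OD \<longrightarrow> M i j = 0) OD V"
    unfolding assms(4) by (rule generic_eqv_mono) (use assms(3) in blast)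
  then show ?thesis by (rule spherical_if_generic)
qed

lemma spherical_family_transpose:
  assumes "\<And>p. p \<in> set ps \<Longrightarrow> pivotable kappa rho p" "sorted_wrt separated ps"
    "\<And>p M. p \<in> set ps \<Longrightarrow> (\<And>i j. (i, j) \<notin> OD \<Longrightarrow> M i j = 0) \<Longrightarrow> isolated p (\<lambda>i j. M j i)"
    "\<And>i c. (i, c) \<in> OD \<longleftrightarrow> (c, i) \<in> (\<Union>p\<in>set ps. region p)"
  shows "spherical d N w js"
proof -
  obtain V where "generic_eqv kappa rho (\<lambda>M. \<forall>p\<in>set ps. isolated p M) (\<Union>p\<in>set ps. region p) V"
    using generic_elimination_family[OF assms(1,2)] by blast
  then have "generic_eqv rho kappa (\<lambda>M. \<forall>p\<in>set ps. isolated p (\<lambda>i j. M j i)) {(i, j). (j, i) \<in> (\<Union>p\<in>set ps. region p)} (\<lambda>i j. V j i)"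
    by (rule generic_eqv_transpose)
  moreover have "{(i, j). (j, i) \<in> (\<Union>p\<in>set ps. region p)} = OD" using assms(4) by auto
  ultimately have "generic_eqv rho kappa (\<lambda>M. \<forall>p\<in>set ps. isolated p (\<lambda>i j. M j i)) OD (\<lambda>i j. V j i)" by simp
  then have "generic_eqv rho kappa (\<lambda>M. \<forall>i j. (i, j) \<notin> OD \<longrightarrow> M i j = 0) OD (\<lambda>i j. V j i)"
    by (rule generic_eqv_mono) (use assms(3) in blast)
  then show ?thesis by (rule spherical_if_generic)
qed

text \<open>Apart from one extra column, only the free rows of block 1 meet columns, namely
  \<open>cs\<close>. So block 1 is one piece with pivots, and each later row block up to the block
  of the extra column is a piece without pivots; all of them share that column.\<close>

lemma spherical_column_type:
  assumes cs: "distinct cs" "sorted_wrt (\<lambda>c j. kappa j c) cs" "set cs \<subseteq> set w"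
    and E: "E \<subseteq> {e}" "E \<subseteq> set w" "set cs \<inter> E = {}"
    and blk2: "\<And>c. c \<in> set cs \<union> E \<Longrightarrow> 2 \<le> blk c"
    and cover: "\<And>i c. (i, c) \<in> OD \<Longrightarrow> c \<in> E \<or> (blk i = 1 \<and> c \<in> set cs)"
  shows "spherical d N w js"
proof -
  define ls where "ls = filter (\<lambda>l. \<forall>e\<in>E. l < blk e) [2..<b]"
  define ps where "ps = (Ql 1, cs, E) # map (\<lambda>l. (Ql l, [] :: nat list, E)) ls"
  have k1: "1 \<in> {1..b}" using b1 by simp
  have ls: "l \<in> {1..b}" "2 \<le> l" if "l \<in> set ls" for l using that by (auto simp: ls_def)
  have psE: thesis if "p \<in> set ps" "p = (Ql 1, cs, E) \<Longrightarrow> thesis" "\<And>l. l \<in> set ls \<Longrightarrow> p = (Ql l, [], E) \<Longrightarrow> thesis" for p thesis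
    using that by (auto simp: ps_def)
  have Q1: "i \<in> set (Ql 1) \<longleftrightarrow> 1 \<le> i \<and> i \<le> N \<and> i \<notin> set w \<and> blk i = 1" for i by (rule set_Ql[OF k1])
  show ?thesis
  proof (rule spherical_family[of ps])
    fix p assume "p \<in> set ps"
    then show "pivotable rho kappa p"
    proof (rule psE)
      assume "p = (Ql 1, cs, E)"
      then show ?thesis using cs E(1,3) distinct_Ql sorted_Ql[OF k1] by (auto simp: pivotable_def)
    next
      fix l assume "l \<in> set ls" "p = (Ql l, [], E)"
      then show ?thesis using E(1) distinct_Ql sorted_Ql[OF ls(1)] by (auto simp: pivotable_def)
    qed
  next
    have Qdisj: "set (Ql l) \<inter> set (Ql l') = {}" if "l \<noteq> l'" "l \<in> {1..b}" "l' \<in> {1..b}" for l l'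
      using that set_Ql by auto
    have "sorted_wrt (\<lambda>x y. separated (Ql x, [], E) (Ql y, [], E)) ls"
    proof (rule sorted_wrt_mono_rel[of _ "(<)"])
      show "sorted_wrt (<) ls" by (simp add: ls_def sorted_wrt_filter)
      show "separated (Ql x, [], E) (Ql y, [], E)" if "x \<in> set ls" "y \<in> set ls" "x < y" for x y
        using Qdisj[of x y] ls that by (simp add: separated_def)
    qed
    moreover have "separated (Ql 1, cs, E) (Ql l, [], E)" if "l \<in> set ls" for l
      using Qdisj[of 1 l] ls[OF that] k1 E(3) by (auto simp: separated_def)
    ultimately show "sorted_wrt separated ps"
      by (auto simp: ps_def sorted_wrt_map)
  next
    fix p and M :: "nat \<Rightarrow> nat \<Rightarrow> complex" assume p: "p \<in> set ps" and M: "\<And>i j. (i, j) \<notin> OD \<Longrightarrow> M i j = 0"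
    from p show "isolated p M"
    proof (rule psE)
      assume p: "p = (Ql 1, cs, E)"
      have "M i j = 0" if "i \<in> set (Ql 1)" "j \<notin> set cs \<union> E" for i j
        using cover[of i j] that M[of i j] by blast
      moreover have "M i j = 0" if "i \<notin> set (Ql 1)" "j \<in> set cs" for i j
      proof (rule M, rule notI)
        assume od: "(i, j) \<in> OD"
        then have "blk i = 1" using cover[OF od] that(2) E(3) by blast
        then show False using that(1) Q1 od by (simp add: OD_iff)
      qed
      ultimately show ?thesis unfolding p by (auto simp: isolated_def)
    next
      fix l assume l: "l \<in> set ls" and p: "p = (Ql l, [], E)"
      have "M i j = 0" if "i \<in> set (Ql l)" "j \<notin> E" for i j
      proof (rule M, rule notI)
        assume "(i, j) \<in> OD"
        then have "blk i = 1" using cover that(2) by blast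
        then show False using set_Ql[OF ls(1)[OF l]] that(1) ls(2)[OF l] by simp
      qed
      then show ?thesis unfolding p by (auto simp: isolated_def)
    qed
  next
    show "(\<Union>p\<in>set ps. region p) = OD"
    proof (rule Set.set_eqI, rule iffI)
      fix x assume "x \<in> (\<Union>p\<in>set ps. region p)"
      then obtain p where p: "p \<in> set ps" "x \<in> region p" by blast
      obtain i c where x: "x = (i, c)" by (cases x) auto
      from p(1) show "x \<in> OD"
      proof (rule psE)
        assume "p = (Ql 1, cs, E)"
        then have "i \<in> set (Ql 1)" "c \<in> set cs \<union> E" using p x by (auto simp: region_def)
        then show ?thesis using Q1 blk2[of c] cs(3) E(2) by (auto simp: x OD_iff)
      next
        fix l assume l: "l \<in> set ls" and "p = (Ql l, [], E)"
        then have "i \<in> set (Ql l)" "c \<in> E" using p x by (auto simp: region_def)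
        then show ?thesis using set_Ql[OF ls(1)[OF l]] l E(2) by (auto simp: x OD_iff ls_def)
      qed
    next
      fix x assume "x \<in> OD"
      obtain i c where x: "x = (i, c)" by (cases x) auto
      then have od: "(i, c) \<in> OD" using \<open>x \<in> OD\<close> by simp
      show "x \<in> (\<Union>p\<in>set ps. region p)"
      proof (cases "blk i = 1")
        case True
        then have "(i, c) \<in> region (Ql 1, cs, E)" using cover[OF od] OD_blocks(4)[OF od] by (auto simp: region_def)
        then show ?thesis by (auto simp: x ps_def)
      next
        case False
        then have c: "c \<in> E" using cover[OF od] by blast
        then have "blk i \<in> set ls" using OD_blocks[OF od] False E(1) by (auto simp: ls_def)
        moreover have "(i, c) \<in> region (Ql (blk i), [], E)" using OD_blocks(4)[OF od] c by (simp add: region_def)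
        ultimately show ?thesis unfolding x ps_def by auto
      qed
    qed
  qed
qed

text \<open>The transposed situation: one extra row, while all other free rows meet only columns of
  the last block.\<close>

lemma spherical_row_type:
  assumes qs: "distinct qs" "sorted_wrt (\<lambda>r i. rho i r) qs" "set qs \<subseteq> {1..N} - set w"
    and E: "E \<subseteq> {e}" "E \<subseteq> {1..N} - set w" "set qs \<inter> E = {}"
    and blkb: "\<And>i. i \<in> set qs \<union> E \<Longrightarrow> blk i < b"
    and cover: "\<And>i c. (i, c) \<in> OD \<Longrightarrow> i \<in> E \<or> (blk c = b \<and> i \<in> set qs)"
  shows "spherical d N w js"
proof -
  define ks where "ks = filter (\<lambda>k. \<forall>e\<in>E. blk e < k) [1..<b]"
  define ps where "ps = (Al b, qs, E) # map (\<lambda>k. (Al k, [] :: nat list, E)) ks"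
  have kb: "b \<in> {1..b}" using b1 by simp
  have ks: "k \<in> {1..b}" "k < b" if "k \<in> set ks" for k using that by (auto simp: ks_def)
  have psE: thesis if "p \<in> set ps" "p = (Al b, qs, E) \<Longrightarrow> thesis" "\<And>k. k \<in> set ks \<Longrightarrow> p = (Al k, [], E) \<Longrightarrow> thesis" for p thesis
    using that by (auto simp: ps_def)
  have Ab: "c \<in> set (Al b) \<longleftrightarrow> c \<in> set w \<and> blk c = b" for c by (rule set_Al[OF kb])
  show ?thesis
  proof (rule spherical_family_transpose[of ps])
    fix p assume "p \<in> set ps"
    then show "pivotable kappa rho p"
    proof (rule psE)
      assume "p = (Al b, qs, E)"
      then show ?thesis using qs E(1,3) distinct_Al sorted_Al[OF kb] by (auto simp: pivotable_def)
    next
      fix k assume "k \<in> set ks" "p = (Al k, [], E)"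
      then show ?thesis using E(1) distinct_Al sorted_Al[OF ks(1)] by (auto simp: pivotable_def)
    qed
  next
    have Adisj: "set (Al k) \<inter> set (Al k') = {}" if "k \<noteq> k'" "k \<in> {1..b}" "k' \<in> {1..b}" for k k'
      using that set_Al by auto
    have "sorted_wrt (\<lambda>x y. separated (Al x, [], E) (Al y, [], E)) ks"
    proof (rule sorted_wrt_mono_rel[of _ "(<)"])
      show "sorted_wrt (<) ks" by (simp add: ks_def sorted_wrt_filter)
      show "separated (Al x, [], E) (Al y, [], E)" if "x \<in> set ks" "y \<in> set ks" "x < y" for x y
        using Adisj[of x y] ks that by (simp add: separated_def)
    qed
    moreover have "separated (Al b, qs, E) (Al k, [], E)" if "k \<in> set ks" for k
      using Adisj[of b k] ks[OF that] kb E(3) by (auto simp: separated_def)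
    ultimately show "sorted_wrt separated ps"
      by (auto simp: ps_def sorted_wrt_map)
  next
    fix p and M :: "nat \<Rightarrow> nat \<Rightarrow> complex" assume p: "p \<in> set ps" and M: "\<And>i j. (i, j) \<notin> OD \<Longrightarrow> M i j = 0"
    from p show "isolated p (\<lambda>i j. M j i)"
    proof (rule psE)
      assume p: "p = (Al b, qs, E)"
      have "M i c = 0" if "c \<in> set (Al b)" "i \<notin> set qs \<union> E" for i c
        using cover[of i c] that M[of i c] by blast
      moreover have "M i c = 0" if "c \<notin> set (Al b)" "i \<in> set qs" for i c
      proof (rule M, rule notI)
        assume od: "(i, c) \<in> OD"
        then have "blk c = b" using cover[OF od] that(2) E(3) by blast
        then show False using that(1) Ab od by (simp add: OD_iff)
      qed
      ultimately show ?thesis unfolding p by (auto simp: isolated_def)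
    next
      fix k assume k: "k \<in> set ks" and p: "p = (Al k, [], E)"
      have "M i c = 0" if "c \<in> set (Al k)" "i \<notin> E" for i c
      proof (rule M, rule notI)
        assume "(i, c) \<in> OD"
        then have "blk c = b" using cover that(2) by blast
        then show False using set_Al[OF ks(1)[OF k]] that(1) ks(2)[OF k] by simp
      qed
      then show ?thesis unfolding p by (auto simp: isolated_def)
    qed
  next
    fix i c
    show "(i, c) \<in> OD \<longleftrightarrow> (c, i) \<in> (\<Union>p\<in>set ps. region p)"
    proof
      assume "(c, i) \<in> (\<Union>p\<in>set ps. region p)"
      then obtain p where p: "p \<in> set ps" "(c, i) \<in> region p" by blast
      from p(1) show "(i, c) \<in> OD"
      proof (rule psE)
        assume "p = (Al b, qs, E)"
        then have "c \<in> set (Al b)" "i \<in> set qs \<union> E" using p by (auto simp: region_def)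
        then show ?thesis using Ab blkb[of i] qs(3) E(2) by (auto simp: OD_iff)
      next
        fix k assume k: "k \<in> set ks" and "p = (Al k, [], E)"
        then have "c \<in> set (Al k)" "i \<in> E" using p by (auto simp: region_def)
        then show ?thesis using set_Al[OF ks(1)[OF k]] k E(2) by (auto simp: OD_iff ks_def)
      qed
    next
      assume od: "(i, c) \<in> OD"
      show "(c, i) \<in> (\<Union>p\<in>set ps. region p)"
      proof (cases "blk c = b")
        case True
        then have "(c, i) \<in> region (Al b, qs, E)" using cover[OF od] OD_blocks(5)[OF od] by (auto simp: region_def)
        then show ?thesis by (auto simp: ps_def)
      next
        case False
        then have i: "i \<in> E" using cover[OF od] by blast
        then have "blk c \<in> set ks" using OD_blocks[OF od] False E(1) by (auto simp: ks_def)
        moreover have "(c, i) \<in> region (Al (blk c), [], E)" using OD_blocks(5)[OF od] i by (simp add: region_def)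
        ultimately show ?thesis unfolding ps_def by auto
      qed
    qed
  qed
qed

text \<open>Here every column block other than the last meets only the row \<open>r\<close>, and
  every row block other than the first only the column \<open>e\<close>. Each such strip reduces to
  a single entry 1, and together with the entry at \<open>(r, e)\<close> these form a tree.\<close>

lemma spherical_cross_type:
  assumes r: "set (Ql 1) = {r}" and e: "set (Al b) = {e}" and b2: "2 \<le> b"
    and cover: "\<And>i c. (i, c) \<in> OD \<Longrightarrow> i = r \<or> c = e"
  shows "spherical d N w js"
proof -
  let ?off = "\<lambda>M :: nat \<Rightarrow> nat \<Rightarrow> complex. \<forall>i j. (i, j) \<notin> OD \<longrightarrow> M i j = 0"
  have k1: "1 \<in> {1..b}" and kb: "b \<in> {1..b}" using b1 by auto
  have in_range: "k \<in> {1..b}" if "k \<in> set [2..<b]" for k using that by auto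
  have re: "(r, e) \<in> OD" using OD_I[OF k1 kb] r e b2 by simp
  define ps1 where "ps1 = map (\<lambda>k. (Al k, [] :: nat list, {r})) [2..<b]"
  define ps2 where "ps2 = map (\<lambda>l. (Ql l, [] :: nat list, {e})) [2..<b]"
  define R1 where "R1 = {(i, c). (c, i) \<in> (\<Union>p\<in>set ps1. region p)}"
  define R2 where "R2 = (\<Union>p\<in>set ps2. region p)"
  have R1: "(i, c) \<in> R1 \<longleftrightarrow> i = r \<and> (\<exists>k\<in>{2..<b}. c \<in> set (Al k))" for i c
    by (auto simp: R1_def ps1_def region_def)
  have R2: "(i, c) \<in> R2 \<longleftrightarrow> c = e \<and> (\<exists>l\<in>{2..<b}. i \<in> set (Ql l))" for i c
    by (auto simp: R2_def ps2_def region_def)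
  have rQ: "r \<notin> set (Ql l)" if "l \<in> {2..<b}" for l
    using set_Ql[OF k1, of r] set_Ql[of l r] r that by auto
  have eA: "e \<notin> set (Al k)" if "k \<in> {2..<b}" for k
    using set_Al[OF kb, of e] set_Al[of k e] e that by auto
  have sep1: "sorted_wrt separated ps1"
    unfolding ps1_def sorted_wrt_map
    by (rule sorted_wrt_mono_rel[of _ "(<)"]) (auto simp: separated_def set_Al)
  have sep2: "sorted_wrt separated ps2"
    unfolding ps2_def sorted_wrt_map
    by (rule sorted_wrt_mono_rel[of _ "(<)"]) (auto simp: separated_def set_Ql)
  have piv1: "pivotable kappa rho p" if "p \<in> set ps1" for p
    using that distinct_Al sorted_Al[OF in_range] by (auto simp: ps1_def pivotable_def)
  have piv2: "pivotable rho kappa p" if "p \<in> set ps2" for p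
    using that distinct_Ql sorted_Ql[OF in_range] by (auto simp: ps2_def pivotable_def)
  obtain V1' where "generic_eqv kappa rho (\<lambda>M. \<forall>p\<in>set ps1. isolated p M) (\<Union>p\<in>set ps1. region p) V1'"
    using generic_elimination_family[OF piv1 sep1] by blast
  from generic_eqv_transpose[OF this]
  obtain V1 where G1: "generic_eqv rho kappa (\<lambda>M. \<forall>p\<in>set ps1. isolated p (\<lambda>i j. M j i)) R1 V1"
    unfolding R1_def by blast
  obtain V2 where G2: "generic_eqv rho kappa (\<lambda>M. \<forall>p\<in>set ps2. isolated p M) R2 V2"
    unfolding R2_def using generic_elimination_family[OF piv2 sep2] by blast
  have R1_OD: "(i, c) \<in> OD" if m: "(i, c) \<in> R1" for i c
  proof -
    obtain k where "k \<in> {2..<b}" "c \<in> set (Al k)" "i = r" using m[unfolded R1] by blast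
    then show ?thesis using OD_I[OF k1, of k i c] r by auto
  qed
  have R2_OD: "(i, c) \<in> OD" if m: "(i, c) \<in> R2" for i c
  proof -
    obtain l where "l \<in> {2..<b}" "i \<in> set (Ql l)" "c = e" using m[unfolded R2] by blast
    then show ?thesis using OD_I[OF _ kb, of l i c] e by auto
  qed
  have iso1: "isolated p (\<lambda>i j. M j i)" if M: "?off M" and p: "p \<in> set ps1" for p M
  proof -
    obtain k where k: "k \<in> {2..<b}" "p = (Al k, [], {r})" using p by (auto simp: ps1_def)
    have "M i c = 0" if "c \<in> set (Al k)" "i \<noteq> r" for i c
      using cover[of i c] that M eA[OF k(1)] by blast
    then show ?thesis unfolding k(2) by (auto simp: isolated_def)
  qed
  have iso2: "isolated p M" if M: "?off M" and p: "p \<in> set ps2" for p M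
  proof -
    obtain l where l: "l \<in> {2..<b}" "p = (Ql l, [], {e})" using p by (auto simp: ps2_def)
    have "M i c = 0" if "i \<in> set (Ql l)" "c \<noteq> e" for i c
      using cover[of i c] that M rQ[OF l(1)] by blast
    then show ?thesis unfolding l(2) by (auto simp: isolated_def)
  qed
  have off_overwrite: "?off (overwrite R V M)" if "?off M" "\<And>i c. (i, c) \<in> R \<Longrightarrow> (i, c) \<in> OD" for R V M
    using that by (auto simp: overwrite_def)
  have "generic_eqv rho kappa ?off (R1 \<union> R2) (overwrite R1 V1 V2)"
  proof (rule generic_eqv_conj[OF G1 G2])
    show "R1 \<inter> R2 = {}" using R1 R2 rQ by auto
    show "(\<forall>p\<in>set ps1. isolated p (\<lambda>i j. M j i)) \<and> (\<forall>p\<in>set ps2. isolated p (overwrite R1 V1 M))"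
      if "?off M" for M using iso1[OF that] iso2[OF off_overwrite[OF that R1_OD]] by blast
  qed
  \<comment> \<open>Dividing row \<open>r\<close> by its entry at \<open>e\<close> and multiplying
    every column except \<open>e\<close> by the same number changes nothing but that entry.\<close>
  moreover have "generic_eqv rho kappa ?off {(r, e)} (\<lambda>_ _. 1)"
  proof (rule generic_eqvI[of "\<lambda>x. x [r, e]"])
    fix M assume M: "?off M" and nz: "enc M [r, e] \<noteq> 0"
    have z: "M r e \<noteq> 0" using nz by (simp add: enc_def)
    define M1 where "M1 = (\<lambda>i j. if i = r then M i j / M r e else M i j)"
    have "elim_step rho kappa M M1"
      by (rule elim_rowI[of "\<lambda>i. if i = r then 1 / M r e else 1" "\<lambda>_. 0"]) (use z in \<open>auto simp: M1_def\<close>)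
    moreover have "elim_step rho kappa M1 (overwrite {(r, e)} (\<lambda>_ _. 1) M)"
    proof (rule elim_colI[of "\<lambda>j. if j = e then 1 else M r e" "\<lambda>_. 0"])
      fix i j
      have "M i j = 0" if "i \<noteq> r" "j \<noteq> e" using cover[of i j] M that by blast
      then show "overwrite {(r, e)} (\<lambda>_ _. 1) M i j = (if j = e then 1 else M r e) * M1 i j + 0 * M1 i 0"
        using z by (auto simp: overwrite_def M1_def)
    qed (use z in auto)
    ultimately show "elim_eqv rho kappa M (overwrite {(r, e)} (\<lambda>_ _. 1) M)" by simp
  qed (auto intro: polyfun.intros simp: enc_def)
  ultimately have "generic_eqv rho kappa ?off ((R1 \<union> R2) \<union> {(r, e)}) (overwrite (R1 \<union> R2) (overwrite R1 V1 V2) (\<lambda>_ _. 1))"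
  proof (rule generic_eqv_conj)
    have "(r, e) \<notin> R1" "(r, e) \<notin> R2" unfolding R1 R2 using eA rQ by auto
    then show "(R1 \<union> R2) \<inter> {(r, e)} = {}" by blast
    show "?off M \<and> ?off (overwrite (R1 \<union> R2) (overwrite R1 V1 V2) M)" if "?off M" for M
    proof -
      have "?off (overwrite (R1 \<union> R2) (overwrite R1 V1 V2) M)"
        by (rule off_overwrite[OF that]) (use R1_OD R2_OD in auto)
      then show ?thesis using that by simp
    qed
  qed
  moreover have "(R1 \<union> R2) \<union> {(r, e)} = OD"
  proof (rule Set.set_eqI, rule iffI)
    fix x assume "x \<in> (R1 \<union> R2) \<union> {(r, e)}"
    then show "x \<in> OD" using R1_OD R2_OD re by (cases x) auto
  next
    fix x assume "x \<in> OD"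
    then obtain i c where x: "x = (i, c)" "(i, c) \<in> OD" by (cases x) auto
    note ob = OD_blocks[OF x(2)]
    show "x \<in> (R1 \<union> R2) \<union> {(r, e)}"
    proof (cases "i = r")
      case True
      then have "i \<in> set (Ql 1)" using r by simp
      then have "blk i = 1" using set_Ql[OF k1] by blast
      then have "blk c = b \<or> blk c \<in> {2..<b}" using ob by auto
      then show ?thesis using True x ob(5) e R1[of i c] by auto
    next
      case False
      then have c: "c = e" using cover x by blast
      then have "c \<in> set (Al b)" using e by simp
      then have "blk c = b" using set_Al[OF kb] by blast
      moreover have "i \<notin> set (Ql 1)" using r False by simp
      then have "blk i \<noteq> 1" using ob(4) by metis
      ultimately have "blk i \<in> {2..<b}" using ob by auto
      then show ?thesis using x c R2[of i c] ob(4) by auto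
    qed
  qed
  ultimately show ?thesis using spherical_if_generic by simp
qed

lemma list_length_1: "length xs = 1 \<longleftrightarrow> (\<exists>x. xs = [x])"
  by (cases xs) auto

lemma list_length_2: "length xs = 2 \<longleftrightarrow> (\<exists>x y. xs = [x, y])"
  by (cases xs) (auto simp: list_length_1[symmetric])

lemma length_1_set: "length xs = 1 \<Longrightarrow> \<exists>x. set xs = {x}"
  by (cases xs) auto

text \<open>The borderline case \<open>n 2 = h 2\<close>, \<open>h 1 + 2 = n 1\<close>: the only
  free rows that meet later columns are the two of block 1, against the two column families of
  blocks 2 and 3.\<close>

lemma spherical_two_rows:
  assumes b3: "b = 3" and "q 1 = 2" "q 2 = 0"
  shows "spherical d N w js"
proof -
  have k: "1 \<in> {1..b}" "2 \<in> {1..b}" "3 \<in> {1..b}" using b3 by auto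
  obtain r1 r2 where r: "Ql 1 = [r2, r1]" using length_Ql[OF k(1)] assms by (auto simp: list_length_2)
  have "h 2 \<noteq> 0" using n_eq[OF k(2)] n_pos[OF k(2)] assms by simp
  then obtain c1 cs where cs: "Al 2 = c1 # cs" using length_Al[OF k(2)] by (cases "Al 2") auto
  have "h 3 \<noteq> 0" using hb_pos b3 by simp
  then obtain d1 ds where ds: "Al 3 = d1 # ds" using length_Al[OF k(3)] by (cases "Al 3") auto
  have "rho r1 r2" using sorted_Ql[OF k(1)] r by simp
  moreover have "r1 \<noteq> r2" using distinct_Ql[of 1] r by auto
  moreover have "set (c1 # cs) \<inter> set (d1 # ds) = {}" 
    unfolding cs[symmetric] ds[symmetric] using set_Al[OF k(2)] set_Al[OF k(3)] by auto
  ultimately obtain V where V: "generic_eqv rho kappa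
    (\<lambda>M. \<forall>i j. (i, j) \<notin> {r1, r2} \<times> (set (c1 # cs) \<union> set (d1 # ds)) \<longrightarrow> M i j = 0)
    ({r1, r2} \<times> (set (c1 # cs) \<union> set (d1 # ds))) V"
    using generic_two_rows[of rho r1 r2 kappa c1 cs d1 ds, OF _ _ sorted_Al[OF k(2), unfolded cs]
        sorted_Al[OF k(3), unfolded ds] distinct_Al[of 2, unfolded cs] distinct_Al[of 3, unfolded ds]] by blast
  have Q2: "set (Ql 2) = {}" using length_Ql[OF k(2)] assms by simp
  have "{r1, r2} \<times> (set (c1 # cs) \<union> set (d1 # ds)) = OD"
  proof (rule Set.set_eqI, rule iffI)
    fix x assume x: "x \<in> {r1, r2} \<times> (set (c1 # cs) \<union> set (d1 # ds))"
    then obtain i c where ic: "x = (i, c)" "i \<in> set (Ql 1)" "c \<in> set (Al 2) \<union> set (Al 3)"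
      using r cs ds by auto
    then show "x \<in> OD" using OD_I[OF k(1) k(2), of i c] OD_I[OF k(1) k(3), of i c] by auto
  next
    fix x assume "x \<in> OD"
    then obtain i c where ic: "x = (i, c)" "(i, c) \<in> OD" by (cases x) auto
    note ob = OD_blocks[OF ic(2)]
    have "blk i \<noteq> 2" using ob(4) Q2 by auto
    then have "blk i = 1" "blk c = 2 \<or> blk c = 3" using ob b3 by auto
    then show "x \<in> {r1, r2} \<times> (set (c1 # cs) \<union> set (d1 # ds))" using ic(1) ob r cs ds by auto
  qed
  then show ?thesis using spherical_if_generic V by simp
qed

text \<open>The borderline case \<open>h 2 = 0\<close>, \<open>h 3 = 2\<close>, which is the
  transpose of the preceding one.\<close>

lemma spherical_two_columns:
  assumes b3: "b = 3" and "h 3 = 2" "h 2 = 0"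
  shows "spherical d N w js"
proof -
  have k: "1 \<in> {1..b}" "2 \<in> {1..b}" "3 \<in> {1..b}" using b3 by auto
  obtain r1 r2 where r: "Al 3 = [r2, r1]" using length_Al[OF k(3)] assms by (auto simp: list_length_2)
  have "q 2 \<noteq> 0" using n_eq[OF k(2)] n_pos[OF k(2)] assms by simp
  then obtain d1 ds where ds: "Ql 2 = d1 # ds" using length_Ql[OF k(2)] by (cases "Ql 2") auto
  have "q 1 \<noteq> 0" using q1_pos by simp
  then obtain c1 cs where cs: "Ql 1 = c1 # cs" using length_Ql[OF k(1)] by (cases "Ql 1") auto
  have "kappa r1 r2" using sorted_Al[OF k(3)] r by simp
  moreover have "r1 \<noteq> r2" using distinct_Al[of 3] r by auto
  moreover have "set (c1 # cs) \<inter> set (d1 # ds) = {}" using set_Ql[OF k(1)] set_Ql[OF k(2)] unfolding cs[symmetric] ds[symmetric] by auto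
  ultimately obtain V where V: "generic_eqv kappa rho
    (\<lambda>M. \<forall>i j. (i, j) \<notin> {r1, r2} \<times> (set (c1 # cs) \<union> set (d1 # ds)) \<longrightarrow> M i j = 0)
    ({r1, r2} \<times> (set (c1 # cs) \<union> set (d1 # ds))) V"
    using generic_two_rows[of kappa r1 r2 rho c1 cs d1 ds, OF _ _ sorted_Ql[OF k(1), unfolded cs]
        sorted_Ql[OF k(2), unfolded ds] distinct_Ql[of 1, unfolded cs] distinct_Ql[of 2, unfolded ds]] by blast
  have A2: "set (Al 2) = {}" using length_Al[OF k(2)] assms by simp
  have OD: "(i, c) \<in> OD \<longleftrightarrow> (c, i) \<in> {r1, r2} \<times> (set (c1 # cs) \<union> set (d1 # ds))" for i c
  proof
    assume "(c, i) \<in> {r1, r2} \<times> (set (c1 # cs) \<union> set (d1 # ds))"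
    then have "c \<in> set (Al 3)" "i \<in> set (Ql 1) \<union> set (Ql 2)" using r cs ds by auto
    then show "(i, c) \<in> OD" using OD_I[OF k(1) k(3), of i c] OD_I[OF k(2) k(3), of i c] by auto
  next
    assume od: "(i, c) \<in> OD"
    note ob = OD_blocks[OF od]
    have "blk c \<noteq> 2" using ob(5) A2 by auto
    then have "blk c = 3" "blk i = 1 \<or> blk i = 2" using ob b3 by auto
    then show "(c, i) \<in> {r1, r2} \<times> (set (c1 # cs) \<union> set (d1 # ds))" using ob r cs ds by auto
  qed
  have eq: "{(i, j). (j, i) \<in> {r1, r2} \<times> (set (c1 # cs) \<union> set (d1 # ds))} = OD"
  proof (rule Set.set_eqI)
    fix x show "x \<in> {(i, j). (j, i) \<in> {r1, r2} \<times> (set (c1 # cs) \<union> set (d1 # ds))} \<longleftrightarrow> x \<in> OD"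
      by (cases x) (simp only: mem_Collect_eq prod.case OD)
  qed
  from generic_eqv_transpose[OF V]
  have "generic_eqv rho kappa (\<lambda>M. \<forall>i j. (i, j) \<notin> OD \<longrightarrow> M i j = 0) OD (\<lambda>i j. V j i)"
    unfolding eq by (rule generic_eqv_mono) (use OD in blast)
  then show ?thesis by (rule spherical_if_generic)
qed

lemma OD_pos: "(i, c) \<in> OD \<Longrightarrow> 1 \<le> q (blk i) \<and> 1 \<le> h (blk c)"
  using OD_blocks[of i c] length_Ql[of "blk i"] length_Al[of "blk c"]
  by (metis One_nat_def Suc_leI length_pos_if_in_set)

text \<open>The single column of block \<open>k\<close> is the extra one, block \<open>m\<close>
  supplies the pivot columns.\<close>

lemma spherical_column_blocks:
  assumes m: "m \<in> {2..b}" and k: "k \<in> {2..b}" "k \<noteq> m" "h k = 1"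
    and cover: "\<And>i c. (i, c) \<in> OD \<Longrightarrow> blk c = k \<or> (blk i = 1 \<and> blk c = m)"
  shows "spherical d N w js"
proof -
  have mb: "m \<in> {1..b}" and kb: "k \<in> {1..b}" using m k by auto
  obtain e where e: "set (Al k) = {e}" using length_1_set[of "Al k"] length_Al[OF kb] k(3) by auto
  show ?thesis
  proof (rule spherical_column_type[of "Al m" "set (Al k)" e])
    show "distinct (Al m)" "sorted_wrt (\<lambda>c j. kappa j c) (Al m)" by (rule distinct_Al, rule sorted_Al[OF mb])
    show "set (Al m) \<subseteq> set w" "set (Al k) \<subseteq> set w" "set (Al m) \<inter> set (Al k) = {}"
      using set_Al[OF mb] set_Al[OF kb] k(2) by auto
    show "2 \<le> blk c" if "c \<in> set (Al m) \<union> set (Al k)" for c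
      using that set_Al[OF mb] set_Al[OF kb] m k by auto
    show "c \<in> set (Al k) \<or> blk i = 1 \<and> c \<in> set (Al m)" if "(i, c) \<in> OD" for i c
      using cover[OF that] OD_blocks(5)[OF that] by auto
  qed (use e in auto)
qed

lemma spherical_row_blocks:
  assumes m: "m \<in> {1..<b}" and l: "l \<in> {1..<b}" "l \<noteq> m" "q l = 1"
    and cover: "\<And>i c. (i, c) \<in> OD \<Longrightarrow> blk i = l \<or> (blk c = b \<and> blk i = m)"
  shows "spherical d N w js"
proof -
  have mb: "m \<in> {1..b}" and lb: "l \<in> {1..b}" using m l by auto
  obtain e where e: "set (Ql l) = {e}" using length_1_set[of "Ql l"] length_Ql[OF lb] l(3) by auto
  show ?thesis
  proof (rule spherical_row_type[of "Ql m" "set (Ql l)" e])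
    show "distinct (Ql m)" "sorted_wrt (\<lambda>r i. rho i r) (Ql m)" by (rule distinct_Ql, rule sorted_Ql[OF mb])
    show "set (Ql m) \<subseteq> {1..N} - set w" "set (Ql l) \<subseteq> {1..N} - set w" "set (Ql m) \<inter> set (Ql l) = {}"
      using set_Ql[OF mb] set_Ql[OF lb] l(2) by auto
    show "blk i < b" if "i \<in> set (Ql m) \<union> set (Ql l)" for i
      using that set_Ql[OF mb] set_Ql[OF lb] m l by auto
    show "i \<in> set (Ql l) \<or> blk c = b \<and> i \<in> set (Ql m)" if "(i, c) \<in> OD" for i c
      using cover[OF that] OD_blocks(4)[OF that] by auto
  qed (use e in auto)
qed

lemma spherical_b_le_2:
  assumes "b \<le> 2" shows "spherical d N w js"
proof (cases "b = 1")
  case True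
  then have "(i, c) \<notin> OD" for i c using OD_blocks[of i c] by auto
  then show ?thesis by (intro spherical_column_type[of "[]" "{}" 0]) auto
next
  case False
  then have b2: "b = 2" using assms b1 by simp
  then have k2: "2 \<in> {1..b}" by simp
  show ?thesis
  proof (rule spherical_column_type[of "Al 2" "{}" 0])
    show "c \<in> {} \<or> blk i = 1 \<and> c \<in> set (Al 2)" if "(i, c) \<in> OD" for i c
    proof -
      have "blk i = 1 \<and> blk c = 2" using OD_blocks(1-3)[OF that] b2 by auto
      then show ?thesis using OD_blocks(5)[OF that] by simp
    qed
  qed (use set_Al[OF k2] distinct_Al sorted_Al[OF k2] in auto)
qed

lemma spherical_b_3:
  assumes b3: "b = 3" and c: "n 2 = 1 \<or> h 1 + 1 \<ge> n 1 \<or> (n 2 = h 2 \<and> h 1 + 2 \<ge> n 1)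
    \<or> (h 2 > 0 \<and> h 3 < 2) \<or> (h 2 = 0 \<and> h 3 \<le> 2)"
  shows "spherical d N w js"
proof -
  have k: "1 \<in> {1..b}" "2 \<in> {1..b}" "3 \<in> {1..b}" using b3 by auto
  note nq = n_eq[OF k(1)] n_eq[OF k(2)] n_eq[OF k(3)]
  have h3: "1 \<le> h 3" using hb_pos b3 by simp
  have ob: "(blk i = 1 \<and> blk c = 2) \<or> (blk i = 1 \<and> blk c = 3) \<or> (blk i = 2 \<and> blk c = 3)"
    "1 \<le> q (blk i)" "1 \<le> h (blk c)" if "(i, c) \<in> OD" for i c
    using OD_blocks(1-3)[OF that] OD_pos[OF that] b3 by auto
  \<comment> \<open>In terms of free rows the alternatives say that some block contributes only one
    row or one column, or that exactly two rows or two columns face two families. Positivity of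
    \<open>q 1\<close> and \<open>h 3\<close> turns the inequalities into the equalities of the six
    cases below.\<close>
  have "n 2 = 1 \<or> q 1 \<le> 1 \<or> (q 2 = 0 \<and> q 1 \<le> 2) \<or> h 3 < 2 \<or> (h 2 = 0 \<and> h 3 \<le> 2)"
    using c nq by (elim disjE) auto
  moreover have "h 2 = 0 \<or> h 2 = 1" if "n 2 = 1" using that nq(2) by linarith
  moreover have "q 1 = 1" if "q 1 \<le> 1" using that q1_pos by linarith
  moreover have "q 1 = 1 \<or> q 1 = 2" if "q 1 \<le> 2" using that q1_pos by linarith
  moreover have "h 3 = 1" if "h 3 < 2" using that h3 by linarith
  moreover have "h 3 = 1 \<or> h 3 = 2" if "h 3 \<le> 2" using that h3 by linarith
  ultimately consider "n 2 = 1" "h 2 = 0" | "n 2 = 1" "h 2 = 1" | "q 1 = 1" | "q 2 = 0" "q 1 = 2" | "h 3 = 1" | "h 2 = 0" "h 3 = 2"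
    by metis
  then show ?thesis
  proof cases
    case 1
    show ?thesis
    proof (rule spherical_row_blocks[of 1 2])
      fix i c assume "(i, c) \<in> OD"
      from ob[OF this] show "blk i = 2 \<or> blk c = b \<and> blk i = 1" using 1 b3 by auto
    qed (use 1 nq b3 in auto)
  next
    case 2
    then have "q 2 = 0" using nq by simp
    show ?thesis
    proof (rule spherical_column_blocks[of 3 2])
      fix i c assume "(i, c) \<in> OD"
      from ob[OF this] show "blk c = 2 \<or> blk i = 1 \<and> blk c = 3" using \<open>q 2 = 0\<close> by auto
    qed (use 2 b3 in auto)
  next
    case 3
    show ?thesis
    proof (rule spherical_row_blocks[of 2 1])
      fix i c assume "(i, c) \<in> OD"
      from ob[OF this] show "blk i = 1 \<or> blk c = b \<and> blk i = 2" using b3 by auto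
    qed (use 3 b3 in auto)
  next
    case 4
    then show ?thesis using spherical_two_rows[OF b3] by simp
  next
    case 5
    show ?thesis
    proof (rule spherical_column_blocks[of 2 3])
      fix i c assume "(i, c) \<in> OD"
      from ob[OF this] show "blk c = 3 \<or> blk i = 1 \<and> blk c = 2" by auto
    qed (use 5 b3 in auto)
  next
    case 6
    then show ?thesis using spherical_two_columns[OF b3] by simp
  qed
qed

lemma sum_split_last: "(p :: nat) < m \<Longrightarrow> (\<Sum>k = p + 1..m. f k) = (\<Sum>k = p + 1..<m. f k) + (f m :: nat)"
  by (cases m) (simp_all add: atLeastLessThanSuc_atLeastAtMost)

lemma pw_spec:
  fixes p
  defines "P \<equiv> \<lambda>p. 1 < p \<and> p < b - 1 \<and> (\<Sum>k = p + 1..b. h k) < 2"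
  shows "(P (pw js w) \<and> (\<forall>p < pw js w. \<not> P p)) \<or> ((\<forall>p. \<not> P p) \<and> pw js w = b - 1)"
proof -
  have pw_if: "pw js w = (if \<exists>p. P p then LEAST p. P p else b - 1)"
    by (simp only: pw_def P_def Let_def)
  show ?thesis
  proof (cases "\<exists>p. P p")
    case True
    then have "pw js w = (LEAST p. P p)" by (simp only: pw_if if_True)
    then show ?thesis using LeastI_ex[OF True] not_less_Least[of _ P] by metis
  next
    case False
    then have "pw js w = b - 1" by (simp only: pw_if if_False)
    then show ?thesis using False by blast
  qed
qed

text \<open>If \<open>p = 2\<close>, the only column beyond block 2 is the single one of the last
  block. If \<open>p > 2\<close>, the only free row before block \<open>p\<close> is one in block 1.
  For \<open>p = b - 1\<close> the other relevant rows then lie in block \<open>b - 1\<close>; for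
  smaller \<open>p\<close> the only column beyond block \<open>p\<close> is the last one, which
  gives the cross.\<close>

lemma spherical_b_ge_4:
  assumes b4: "4 \<le> b" and c: "pw js w = 2 \<or>
    (pw js w > 2 \<and> (\<Sum>k = 1..pw js w - 1. h k) + 1 \<ge> (\<Sum>k = 1..pw js w - 1. n k))"
  shows "spherical d N w js"
proof -
  define p where "p = pw js w"
  have hb: "1 \<le> h b" by (rule hb_pos)
  have tail: "h b = 1 \<and> (\<forall>k. p < k \<and> k < b \<longrightarrow> h k = 0)" if "p < b - 1" "(\<Sum>k = p + 1..b. h k) < 2"
  proof -
    have "(\<Sum>k = p + 1..b. h k) = (\<Sum>k = p + 1..<b. h k) + h b" using that(1) by (intro sum_split_last) simp
    then have "h b = 1" "(\<Sum>k = p + 1..<b. h k) = 0" using that(2) hb by linarith+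
    then show ?thesis by simp
  qed
  have ob: "1 \<le> blk i" "blk i < blk c" "blk c \<le> b" "1 \<le> q (blk i)" "1 \<le> h (blk c)" if "(i, c) \<in> OD" for i c
    using OD_blocks(1-3)[OF that] OD_pos[OF that] by auto
  have spec: "(1 < p \<and> p < b - 1 \<and> (\<Sum>k = p + 1..b. h k) < 2) \<or> p = b - 1" using pw_spec p_def by blast
  show ?thesis
  proof (cases "p = 2")
    case True
    then have t: "h b = 1" "\<And>k. 2 < k \<Longrightarrow> k < b \<Longrightarrow> h k = 0" using spec b4 tail by auto
    show ?thesis
    proof (rule spherical_column_blocks[of 2 b])
      fix i c assume od: "(i, c) \<in> OD"
      show "blk c = b \<or> blk i = 1 \<and> blk c = 2"
        using ob[OF od] t(2)[of "blk c"] by (cases "blk c = b"; cases "2 < blk c") auto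
    qed (use b4 t in auto)
  next
    case False
    then have p2: "p > 2" "(\<Sum>k = 1..p - 1. h k) + 1 \<ge> (\<Sum>k = 1..p - 1. n k)" using c p_def by auto
    have pb: "p \<le> b - 1" using spec by auto
    have "(\<Sum>k = 1..p - 1. n k) = (\<Sum>k = 1..p - 1. q k + h k)"
      using pb by (intro sum.cong n_eq) auto
    then have "(\<Sum>k = 1..p - 1. q k) \<le> 1" using p2(2) by (simp add: sum.distrib)
    moreover have "(\<Sum>k = 1..p - 1. q k) = q 1 + (\<Sum>k = 2..p - 1. q k)"
      using p2 by (subst sum.atLeast_Suc_atMost) (auto simp: numeral_2_eq_2)
    ultimately have q1: "q 1 = 1" and "(\<Sum>k = 2..p - 1. q k) = 0" using q1_pos by linarith+
    then have q0: "q k = 0" if "2 \<le> k" "k < p" for k using that p2 by (simp; fastforce)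
    show ?thesis
    proof (cases "p = b - 1")
      case True
      show ?thesis
      proof (rule spherical_row_blocks[of "b - 1" 1])
        fix i c assume od: "(i, c) \<in> OD"
        show "blk i = 1 \<or> blk c = b \<and> blk i = b - 1"
          using ob[OF od] q0[of "blk i"] True by (cases "blk i = 1"; cases "blk i < p") auto
      qed (use b4 q1 in auto)
    next
      case False
      then have t: "h b = 1" "\<And>k. p < k \<Longrightarrow> k < b \<Longrightarrow> h k = 0" using spec tail by auto
      have k1: "1 \<in> {1..b}" and kb: "b \<in> {1..b}" using b1 by auto
      obtain r where r: "set (Ql 1) = {r}" using length_1_set[of "Ql 1"] length_Ql[OF k1] q1 by auto
      obtain e where e: "set (Al b) = {e}" using length_1_set[of "Al b"] length_Al[OF kb] t(1) by auto
      show ?thesis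
      proof (rule spherical_cross_type[OF r e])
        fix i c assume od: "(i, c) \<in> OD"
        note o = ob[OF od] OD_blocks(4,5)[OF od]
        show "i = r \<or> c = e"
        proof (cases "blk i = 1")
          case True
          then show ?thesis using o(6) r by auto
        next
          case False
          then have "p \<le> blk i" using q0[of "blk i"] o by fastforce
          then have "blk c = b" using t(2)[of "blk c"] o by fastforce
          then show ?thesis using o(7) e by auto
        qed
      qed (use b4 in simp)
    qed
  qed
qed

lemma mf_condition_spherical:
  assumes "mf_condition js w" shows "spherical d N w js"
  using assms spherical_b_le_2 spherical_b_3 spherical_b_ge_4
  unfolding mf_condition_def Let_def by blast

end

section \<open>Borel eigenvectors in submodules of the coordinate ring\<close>

lemma subspace_0: "is_subspace V \<Longrightarrow> (\<lambda>x. 0) \<in> V"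
  and subspace_add: "is_subspace V \<Longrightarrow> f \<in> V \<Longrightarrow> g \<in> V \<Longrightarrow> (\<lambda>x. f x + g x) \<in> V"
  and subspace_scale: "is_subspace V \<Longrightarrow> f \<in> V \<Longrightarrow> (\<lambda>x. c * f x) \<in> V"
  by (auto simp: is_subspace_def)

lemma subspace_diff: "is_subspace V \<Longrightarrow> f \<in> V \<Longrightarrow> g \<in> V \<Longrightarrow> (\<lambda>x. f x - g x) \<in> V"
  using subspace_add[of V f "\<lambda>x. (-1) * g x"] subspace_scale[of V g "-1"] by simp

lemma subspace_sum:
  assumes "is_subspace V" "\<And>i. i \<in> I \<Longrightarrow> f i \<in> V"
  shows "(\<lambda>x. \<Sum>i\<in>I. f i x) \<in> V"
  using assms(2)
proof (induction I rule: infinite_finite_induct)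
  case (insert i I)
  then show ?case using subspace_add[OF assms(1), of "f i" "\<lambda>x. \<Sum>i\<in>I. f i x"] by simp
qed (auto intro: subspace_0[OF assms(1)])

text \<open>Replacing the polynomial \<open>h\<close> by \<open>h (2 t) - 2 ^ (K + 1) * h t\<close> removes the leading term.\<close>
lemma subspace_coefficients:
  assumes V: "is_subspace V" and "\<And>t. t \<noteq> 0 \<Longrightarrow> (\<lambda>x. \<Sum>k\<le>K. t ^ k * G k x) \<in> V" "k \<le> K"
  shows "G k \<in> V"
  using assms(2,3)
proof (induction K arbitrary: G k)
  case 0
  then show ?case using "0.prems"(1)[of 1] by simp
next
  case (Suc K)
  have low: "G k \<in> V" if "k \<le> K" for k
  proof -
    have "(\<lambda>x. (2 ^ k - 2 ^ Suc K) * G k x) \<in> V"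
    proof (rule Suc.IH[OF _ that, of "\<lambda>k x. (2 ^ k - 2 ^ Suc K) * G k x"])
      fix t :: complex assume t: "t \<noteq> 0"
      have "(\<lambda>x. (\<Sum>k\<le>Suc K. (2 * t) ^ k * G k x) - 2 ^ Suc K * (\<Sum>k\<le>Suc K. t ^ k * G k x)) \<in> V"
        by (intro subspace_diff[OF V] subspace_scale[OF V] Suc.prems(1); simp add: t)
      also have "(\<lambda>x. (\<Sum>k\<le>Suc K. (2 * t) ^ k * G k x) - 2 ^ Suc K * (\<Sum>k\<le>Suc K. t ^ k * G k x))
        = (\<lambda>x. \<Sum>k\<le>Suc K. t ^ k * ((2 ^ k - 2 ^ Suc K) * G k x))"
        unfolding sum_distrib_left sum_subtractf[symmetric]
        by (intro ext sum.cong) (auto simp: power_mult_distrib algebra_simps)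
      also have "\<dots> = (\<lambda>x. \<Sum>k\<le>K. t ^ k * ((2 ^ k - 2 ^ Suc K) * G k x))" by simp
      finally show "(\<lambda>x. \<Sum>k\<le>K. t ^ k * ((2 ^ k - 2 ^ Suc K) * G k x)) \<in> V" .
    qed
    then have "(\<lambda>x. 1 / (2 ^ k - 2 ^ Suc K) * ((2 ^ k - 2 ^ Suc K) * G k x)) \<in> V"
      by (rule subspace_scale[OF V])
    moreover have "(2 :: complex) ^ k - 2 ^ Suc K \<noteq> 0"
    proof -
      have "(2 :: nat) ^ k < 2 ^ Suc K" using that by (intro power_strict_increasing) auto
      then have "(2 :: nat) ^ k \<noteq> 2 ^ Suc K" by (rule less_imp_neq)
      then have "of_nat (2 ^ k) \<noteq> (of_nat (2 ^ Suc K) :: complex)" by (simp only: of_nat_eq_iff not_False_eq_True)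
      then show ?thesis by simp
    qed
    ultimately show ?thesis by simp
  qed
  show ?case
  proof (cases "k = Suc K")
    case True
    have "(\<lambda>x. \<Sum>k\<le>K. G k x) \<in> V" by (rule subspace_sum[OF V]) (use low in simp)
    moreover have "(\<lambda>x. \<Sum>k\<le>Suc K. 1 ^ k * G k x) \<in> V" by (rule Suc.prems(1)) simp
    ultimately have "(\<lambda>x. (\<Sum>k\<le>Suc K. 1 ^ k * G k x) - (\<Sum>k\<le>K. G k x)) \<in> V"
      by (intro subspace_diff[OF V])
    then show ?thesis using True by simp
  qed (use low Suc.prems(2) in simp)
qed

text \<open>The degree bound \<open>K\<close> does not depend on the point, so that a function has
  the same finite list of weight components everywhere.\<close>

lemma polyfun_scaling_poly:
  assumes "F \<in> polyfun"
  shows "\<exists>P K. (\<forall>k. (\<lambda>x. coeff (P x) k) \<in> polyfun) \<and> (\<forall>x. degree (P x) \<le> K)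
     \<and> (\<forall>t x. F (\<lambda>s. t ^ e s * x s) = poly (P x) t)"
  using assms
proof (induction rule: polyfun.induct)
  case (pconst c)
  show ?case
    by (intro exI[of _ "\<lambda>_. [:c:]"] exI[of _ 0]) (auto intro: polyfun.intros)
next
  case (pcoord s)
  show ?case
  proof (intro exI conjI allI)
    fix k show "(\<lambda>x :: nat list \<Rightarrow> complex. coeff (monom (x s) (e s)) k) \<in> polyfun"
      unfolding coeff_monom by (intro fun_alg_if polyfun.intros)
    show "degree (monom (x s) (e s)) \<le> e s" for x :: "nat list \<Rightarrow> complex" by (rule degree_monom_le)
    show "t ^ e s * x s = poly (monom (x s) (e s)) t" for t and x :: "nat list \<Rightarrow> complex" by (simp add: poly_monom)
  qed
next
  case (padd f g)
  then obtain P K Q M where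
    P: "\<And>k. (\<lambda>x. coeff (P x) k) \<in> polyfun" "\<And>x. degree (P x) \<le> K" "\<And>t x. f (\<lambda>s. t ^ e s * x s) = poly (P x) t"
    and Q: "\<And>k. (\<lambda>x. coeff (Q x) k) \<in> polyfun" "\<And>x. degree (Q x) \<le> M" "\<And>t x. g (\<lambda>s. t ^ e s * x s) = poly (Q x) t"
    by metis
  show ?case
  proof (intro exI conjI allI)
    show "(\<lambda>x. coeff (P x + Q x) k) \<in> polyfun" for k
      unfolding coeff_add by (rule polyfun.padd[OF P(1) Q(1)])
    show "degree (P x + Q x) \<le> max K M" for x using P(2)[of x] Q(2)[of x] degree_add_le_max[of "P x" "Q x"] by linarith
    show "f (\<lambda>s. t ^ e s * x s) + g (\<lambda>s. t ^ e s * x s) = poly (P x + Q x) t" for t x by (simp add: P(3) Q(3))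
  qed
next
  case (pmult f g)
  then obtain P K Q M where
    P: "\<And>k. (\<lambda>x. coeff (P x) k) \<in> polyfun" "\<And>x. degree (P x) \<le> K" "\<And>t x. f (\<lambda>s. t ^ e s * x s) = poly (P x) t"
    and Q: "\<And>k. (\<lambda>x. coeff (Q x) k) \<in> polyfun" "\<And>x. degree (Q x) \<le> M" "\<And>t x. g (\<lambda>s. t ^ e s * x s) = poly (Q x) t"
    by metis
  show ?case
  proof (intro exI conjI allI)
    show "(\<lambda>x. coeff (P x * Q x) k) \<in> polyfun" for k
      unfolding coeff_mult by (intro fun_alg_sum[OF fun_alg_polyfun] polyfun.pmult P(1) Q(1))
    show "degree (P x * Q x) \<le> K + M" for x using P(2)[of x] Q(2)[of x] degree_mult_le[of "P x" "Q x"] by linarith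
    show "f (\<lambda>s. t ^ e s * x s) * g (\<lambda>s. t ^ e s * x s) = poly (P x * Q x) t" for t x by (simp add: P(3) Q(3))
  qed
qed

lemma poly_sum_bound: "degree (p :: complex poly) \<le> K \<Longrightarrow> poly p t = (\<Sum>k\<le>K. t ^ k * coeff p k)"
  using sum.mono_neutral_left[of "{..K}" "{..degree p}" "\<lambda>k. t ^ k * coeff p k"]
  by (auto simp: poly_altdef mult.commute coeff_eq_0)

lemma minv_eq:
  assumes "g \<in> carrier_mat N N" "g' \<in> carrier_mat N N" "g' * g = 1\<^sub>m N" "g * g' = 1\<^sub>m N"
  shows "minv N g = g'"
proof -
  have uniq: "k = g'" if k: "k \<in> carrier_mat N N \<and> k * g = 1\<^sub>m N" for k
  proof -
    have "k = k * (g * g')" using assms(4) k right_mult_one_mat[of k N N] by simp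
    also have "\<dots> = (k * g) * g'" using k assms by (intro assoc_mult_mat[symmetric]) auto
    also have "\<dots> = g'" using assms k by simp
    finally show ?thesis .
  qed
  show ?thesis unfolding minv_def
    by (rule some_equality[where P = "\<lambda>h. h \<in> carrier_mat N N \<and> h * g = 1\<^sub>m N", OF conjI[OF assms(2,3)] uniq])
qed

context levi_schubert
begin

text \<open>Translation by \<open>g\<close> itself, without the inverse in \<open>fact\<close>. As
  \<open>g\<close> runs through the group both give the same translates, hence the same
  submodules.\<close>

definition tr :: "complex mat \<Rightarrow> ((nat list \<Rightarrow> complex) \<Rightarrow> complex) \<Rightarrow> (nat list \<Rightarrow> complex) \<Rightarrow> complex" where
  "tr g f = (\<lambda>x. if x \<in> X then f (act g x) else 0)"

lemma tr_fact: assumes "g \<in> L" obtains g' where "g' \<in> L" "\<And>f. tr g f = fact d N w g' f"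
proof -
  obtain g' where g': "g' \<in> L" "g' * g = 1\<^sub>m N" "g * g' = 1\<^sub>m N" using Levi_inverse[OF assms] by blast
  have "minv N g' = g" by (rule minv_eq) (use g' assms Levi_carrier in auto)
  then show thesis using g'(1) by (intro that[of g']) (auto simp: tr_def fact_def)
qed

lemma fact_tr: assumes "g \<in> L" obtains g' where "g' \<in> L" "\<And>f. fact d N w g f = tr g' f"
proof -
  obtain g' where g': "g' \<in> L" "g' * g = 1\<^sub>m N" "g * g' = 1\<^sub>m N" using Levi_inverse[OF assms] by blast
  have "minv N g = g'" by (rule minv_eq) (use g' assms Levi_carrier in auto)
  then show thesis using g'(1) by (intro that[of g']) (auto simp: tr_def fact_def)
qed

lemma Lsubmod_iff:
  "Lsubmod d N w js W \<longleftrightarrow> W \<subseteq> coord_ring d N w \<and> is_subspace W \<and> (\<forall>g\<in>L. \<forall>f\<in>W. tr g f \<in> W)"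
proof -
  have "(\<forall>g\<in>L. \<forall>f\<in>W. fact d N w g f \<in> W) \<longleftrightarrow> (\<forall>g\<in>L. \<forall>f\<in>W. tr g f \<in> W)"
    by (metis tr_fact fact_tr)
  then show ?thesis by (simp add: Lsubmod_def)
qed

lemma coord_ringE:
  assumes "f \<in> coord_ring d N w"
  obtains F where "F \<in> polyfun" "\<And>x. x \<in> X \<Longrightarrow> f x = F x" "\<And>x. x \<notin> X \<Longrightarrow> f x = 0"
  using assms by (auto simp: coord_ring_def)

definition dmat :: "(nat \<Rightarrow> complex) \<Rightarrow> complex mat" where
  "dmat T = emat (\<lambda>i j. if i = j then T i else 0)"

lemma dmat_BLv: "(\<And>i. T i \<noteq> 0) \<Longrightarrow> dmat T \<in> BLv"
  unfolding dmat_def by (rule emat_BLv) (auto split: if_splits)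

lemma act_dmat:
  assumes "x \<in> X"
  shows "act (dmat T) x = (\<lambda>s. (\<Prod>i<d. T (s ! i)) * x s)"
proof -
  have "act (dmat T) x = (\<lambda>s. if s \<in> Idn d N then (\<Prod>i<d. dmat T $$ (s ! i - 1, s ! i - 1)) * x s else 0)"
    by (rule wact_diag[where t = "\<lambda>i. dmat T $$ (i, i)"]) (auto simp: dmat_def emat_def)
  also have "\<dots> = (\<lambda>s. (\<Prod>i<d. T (s ! i)) * x s)"
  proof
    fix s
    have "dmat T $$ (s ! i - 1, s ! i - 1) = T (s ! i)" if "s \<in> Idn d N" "i < d" for i
      using emat_entry[of "s ! i" "s ! i"] Idn_nth[OF that] by (simp add: dmat_def)
    then show "(if s \<in> Idn d N then (\<Prod>i<d. dmat T $$ (s ! i - 1, s ! i - 1)) * x s else 0) = (\<Prod>i<d. T (s ! i)) * x s"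
      using X_supp[OF assms] by auto
  qed
  finally show ?thesis .
qed

text \<open>Exponents are natural numbers, so translating a polynomial function gives a polynomial
  in \<open>t\<close>, its weights are natural numbers, and a least weight exists.\<close>

definition torus1 :: "(nat \<Rightarrow> nat) \<Rightarrow> complex \<Rightarrow> complex mat" where
  "torus1 m t = dmat (\<lambda>i. t ^ m i)"

lemma torus1_BLv: "t \<noteq> 0 \<Longrightarrow> torus1 m t \<in> BLv"
  unfolding torus1_def by (rule dmat_BLv) simp

lemma act_torus1: "x \<in> X \<Longrightarrow> act (torus1 m t) x = (\<lambda>s. t ^ (\<Sum>i<d. m (s ! i)) * x s)"
  unfolding torus1_def by (simp add: act_dmat power_sum)

definition has_weight :: "(nat \<Rightarrow> nat) \<Rightarrow> nat \<Rightarrow> ((nat list \<Rightarrow> complex) \<Rightarrow> complex) \<Rightarrow> bool" where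
  "has_weight m k f \<longleftrightarrow> (\<forall>t x. t \<noteq> 0 \<longrightarrow> x \<in> X \<longrightarrow> f (act (torus1 m t) x) = t ^ k * f x)"

text \<open>The components are the coefficients of the polynomial in \<open>t\<close> obtained by
  translating \<open>f\<close> with the one-parameter group. They lie in \<open>V\<close> since its
  translates for all nonzero \<open>t\<close> do, by \<open>subspace_coefficients\<close>; no finite
  dimension is needed.\<close>

lemma weight_decomposition:
  assumes V: "is_subspace V" "V \<subseteq> coord_ring d N w" and st: "\<And>t f. t \<noteq> 0 \<Longrightarrow> f \<in> V \<Longrightarrow> tr (torus1 m t) f \<in> V"
    and f: "f \<in> V"
  obtains K G where "\<And>k. k \<le> K \<Longrightarrow> G k \<in> V" "\<And>k. has_weight m k (G k)" "\<And>x. f x = (\<Sum>k\<le>K. G k x)"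
proof -
  obtain F where F: "F \<in> polyfun" "\<And>x. x \<in> X \<Longrightarrow> f x = F x" "\<And>x. x \<notin> X \<Longrightarrow> f x = 0"
    using coord_ringE[OF subsetD[OF V(2) f]] by blast
  let ?e = "\<lambda>s. \<Sum>i<d. m (s ! i)"
  obtain P K where P: "\<And>x. degree (P x) \<le> K" "\<And>t x. F (\<lambda>s. t ^ ?e s * x s) = poly (P x) t"
    using polyfun_scaling_poly[OF F(1), of ?e] by blast
  define G where "G = (\<lambda>k x. if x \<in> X then coeff (P x) k else 0)"
  have XL: "act (torus1 m t) x \<in> X" if "x \<in> X" "t \<noteq> 0" for x t
    using X_Bor torus1_BLv that by blast
  have sum: "tr (torus1 m t) f = (\<lambda>x. \<Sum>k\<le>K. t ^ k * G k x)" if "t \<noteq> 0" for t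
  proof
    fix x
    show "tr (torus1 m t) f x = (\<Sum>k\<le>K. t ^ k * G k x)"
    proof (cases "x \<in> X")
      case True
      then have "tr (torus1 m t) f x = poly (P x) t"
        using F(2)[OF XL[OF True that]] by (simp add: tr_def act_torus1 P(2))
      then show ?thesis using True poly_sum_bound[OF P(1)] by (simp add: G_def)
    qed (simp add: tr_def G_def)
  qed
  have GV: "G k \<in> V" if "k \<le> K" for k
    by (rule subspace_coefficients[OF V(1) _ that]) (use sum st f in metis)
  have GW: "has_weight m k (G k)" for k
    unfolding has_weight_def
  proof (intro allI impI)
    fix t x assume t: "t \<noteq> (0 :: complex)" and x: "x \<in> X"
    \<comment> \<open>Translating by \<open>t\<close> and then by \<open>s\<close> is translating by
      \<open>s * t\<close>; comparing coefficients in \<open>s\<close> shows that coefficient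
      \<open>k\<close> is multiplied by \<open>t ^ k\<close>.\<close>
    have "poly (P (act (torus1 m t) x)) s = poly (pcompose (P x) [:0, t:]) s" for s
    proof -
      have "poly (P (act (torus1 m t) x)) s = F (\<lambda>r. s ^ ?e r * (t ^ ?e r * x r))"
        unfolding P(2)[symmetric] act_torus1[OF x] ..
      also have "(\<lambda>r. s ^ ?e r * (t ^ ?e r * x r)) = (\<lambda>r. (s * t) ^ ?e r * x r)"
        by (simp add: power_mult_distrib mult.assoc)
      also have "F \<dots> = poly (P x) (s * t)" by (rule P(2))
      finally show ?thesis by (simp add: poly_pcompose mult.commute)
    qed
    then have "P (act (torus1 m t) x) = pcompose (P x) [:0, t:]"
      by (simp add: poly_eq_poly_eq_iff[symmetric] fun_eq_iff)
    then show "G k (act (torus1 m t) x) = t ^ k * G k x"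
      using XL[OF x t] x by (simp add: G_def coeff_pcompose_linear)
  qed
  have "f x = (\<Sum>k\<le>K. G k x)" for x
  proof (cases "x \<in> X")
    case True
    have "f x = poly (P x) 1" using F(2)[OF True] P(2)[of 1 x] by simp
    then show ?thesis using True poly_sum_bound[OF P(1), of x 1] by (simp add: G_def)
  qed (simp add: F(3) G_def)
  then show thesis using that GV GW by blast
qed

lemma weight_vector_exists:
  assumes V: "is_subspace V" "V \<subseteq> coord_ring d N w" and st: "\<And>t f. t \<noteq> 0 \<Longrightarrow> f \<in> V \<Longrightarrow> tr (torus1 m t) f \<in> V"
    and f: "f \<in> V" "f \<noteq> (\<lambda>x. 0)"
  obtains g k where "g \<in> V" "g \<noteq> (\<lambda>x. 0)" "has_weight m k g"
proof -
  obtain K G where G: "\<And>k. k \<le> K \<Longrightarrow> G k \<in> V" "\<And>k. has_weight m k (G k)" "\<And>x. f x = (\<Sum>k\<le>K. G k x)"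
    using weight_decomposition[OF V st f(1)] by blast
  have "\<exists>k\<le>K. G k \<noteq> (\<lambda>x. 0)"
  proof (rule ccontr)
    assume "\<not> (\<exists>k\<le>K. G k \<noteq> (\<lambda>x. 0))"
    then have "f x = 0" for x using G(3)[of x] by simp
    then show False using f(2) by auto
  qed
  then show thesis using that G by blast
qed

lemma act_mult_BLv: "g \<in> BLv \<Longrightarrow> g' \<in> BLv \<Longrightarrow> act (g * g') x = act g (act g' x)"
  using wact_mult Bor_carrier by blast

lemma torus_commute: "x \<in> X \<Longrightarrow> s \<noteq> 0 \<Longrightarrow> t \<noteq> 0 \<Longrightarrow>
    act (torus1 m s) (act (torus1 m' t) x) = act (torus1 m' t) (act (torus1 m s) x)"
  using X_Bor[of "torus1 m s" x] X_Bor[of "torus1 m' t" x] torus1_BLv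
  by (auto simp: act_torus1 ac_simps)

lemma weight_space_stable:
  fixes m :: "nat \<Rightarrow> nat" and k :: nat
  assumes V: "is_subspace V" "V \<subseteq> coord_ring d N w" and st: "\<And>m t f. t \<noteq> 0 \<Longrightarrow> f \<in> V \<Longrightarrow> tr (torus1 m t) f \<in> V"
  defines "V' \<equiv> {f \<in> V. has_weight m k f}"
  shows "is_subspace V'" "V' \<subseteq> coord_ring d N w" "\<And>m' t f. t \<noteq> 0 \<Longrightarrow> f \<in> V' \<Longrightarrow> tr (torus1 m' t) f \<in> V'"
proof -
  show "is_subspace V'"
    using V(1) unfolding is_subspace_def V'_def has_weight_def by (auto simp: algebra_simps)
  show "V' \<subseteq> coord_ring d N w" using V(2) by (auto simp: V'_def)
  fix m' t f assume t: "t \<noteq> (0 :: complex)" and f: "f \<in> V'"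
  have XL: "act (torus1 m t) x \<in> X" if "x \<in> X" "t \<noteq> 0" for x t m
    using X_Bor torus1_BLv that by blast
  have "has_weight m k (tr (torus1 m' t) f)"
    unfolding has_weight_def
  proof (intro allI impI)
    fix s x assume s: "s \<noteq> (0 :: complex)" and x: "x \<in> X"
    have "tr (torus1 m' t) f (act (torus1 m s) x) = f (act (torus1 m s) (act (torus1 m' t) x))"
      using torus_commute[OF x s t] XL[OF x s] by (simp add: tr_def)
    also have "\<dots> = s ^ k * f (act (torus1 m' t) x)"
      using f s XL[OF x t] by (auto simp: V'_def has_weight_def)
    finally show "tr (torus1 m' t) f (act (torus1 m s) x) = s ^ k * tr (torus1 m' t) f x"
      using x by (simp add: tr_def)
  qed
  then show "tr (torus1 m' t) f \<in> V'" using st[OF t] f by (simp add: V'_def)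
qed

definition unit_exp :: "nat \<Rightarrow> nat \<Rightarrow> nat" where "unit_exp i = (\<lambda>j. if j = i then 1 else 0)"

text \<open>Passing to a weight space of one coordinate torus after the other works because the
  torus is commutative, so each weight space stays stable under the remaining ones.\<close>

lemma torus_eigenvector_exists:
  fixes n :: nat
  assumes V: "is_subspace V" "V \<subseteq> coord_ring d N w" and st: "\<And>m t f. t \<noteq> 0 \<Longrightarrow> f \<in> V \<Longrightarrow> tr (torus1 m t) f \<in> V"
    and f: "f \<in> V" "f \<noteq> (\<lambda>x. 0)"
  shows "\<exists>g k. g \<in> V \<and> g \<noteq> (\<lambda>x. 0) \<and> (\<forall>i<n. has_weight (unit_exp i) (k i) g)"
  using assms
proof (induction n arbitrary: V f)
  case (Suc n)
  obtain g k where g: "g \<in> V" "g \<noteq> (\<lambda>x. 0)" "has_weight (unit_exp n) k g"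
    using weight_vector_exists[OF Suc.prems(1,2) Suc.prems(3) Suc.prems(4,5)] by blast
  let ?V = "{f \<in> V. has_weight (unit_exp n) k f}"
  have "\<exists>g k. g \<in> ?V \<and> g \<noteq> (\<lambda>x. 0) \<and> (\<forall>i<n. has_weight (unit_exp i) (k i) g)"
    by (rule Suc.IH[OF weight_space_stable[OF Suc.prems(1,2) Suc.prems(3)], where f = g]) (use g in auto)
  then obtain g' k' where g': "g' \<in> ?V" "g' \<noteq> (\<lambda>x. 0)" "\<forall>i<n. has_weight (unit_exp i) (k' i) g'" by blast
  then show ?case by (intro exI[of _ g'] exI[of _ "k'(n := k)"]) (auto simp: less_Suc_eq)
qed auto

text \<open>A diagonal matrix is a product of coordinate one-parameter matrices; \<open>T'\<close>
  switches on its entries one at a time.\<close>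

lemma torus_eigenvector:
  assumes wt: "\<And>i. i \<le> N \<Longrightarrow> has_weight (unit_exp i) (k i) f" and T: "\<And>i. T i \<noteq> 0" and x: "x \<in> X"
  shows "f (act (dmat T) x) = (\<Prod>i\<le>N. T i ^ k i) * f x"
proof -
  define T' where "T' = (\<lambda>n i. if i < n then T i else 1)"
  have "f (act (dmat (T' n)) x) = (\<Prod>i<n. T i ^ k i) * f x" if "n \<le> Suc N" for n
    using that
  proof (induction n)
    case 0
    have "act (dmat (T' 0)) x = x" unfolding act_dmat[OF x] by (simp add: T'_def)
    then show ?case by simp
  next
    case (Suc n)
    have dX: "act (dmat (T' n)) x \<in> X" using X_Bor[of "dmat (T' n)"] dmat_BLv[of "T' n"] T x by (auto simp: T'_def)
    have "act (dmat (T' (Suc n))) x = act (torus1 (unit_exp n) (T n)) (act (dmat (T' n)) x)"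
    proof
      fix s
      have "(\<Prod>i<d. T' (Suc n) (s ! i)) = (\<Prod>i<d. T n ^ unit_exp n (s ! i)) * (\<Prod>i<d. T' n (s ! i))"
        unfolding prod.distrib[symmetric] by (rule prod.cong) (auto simp: T'_def unit_exp_def less_Suc_eq)
      then show "act (dmat (T' (Suc n))) x s = act (torus1 (unit_exp n) (T n)) (act (dmat (T' n)) x) s"
        unfolding act_torus1[OF dX] unfolding act_dmat[OF x] by (simp add: power_sum)
    qed
    then show ?case
      using wt[of n] Suc T dX by (simp add: has_weight_def)
  qed
  from this[of "Suc N"] have "f (act (dmat (T' (Suc N))) x) = (\<Prod>i\<le>N. T i ^ k i) * f x"
    by (simp add: lessThan_Suc_atMost)
  moreover have "dmat (T' (Suc N)) = dmat T" unfolding dmat_def emat_def T'_def by (intro eq_matI) auto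
  ultimately show ?thesis by simp
qed

text \<open>For a weight vector \<open>f\<close> of minimal weight the function \<open>t \<mapsto> f (l(t) u l(1/t) x)\<close> is a polynomial both
  in \<open>t\<close> and in \<open>1/t\<close>, hence constant; its values at 1 and 0 are \<open>f (u x)\<close> and \<open>f x\<close>.\<close>
lemma minimal_weight_unipotent:
  fixes n :: nat
  assumes V: "is_subspace V" "V \<subseteq> coord_ring d N w" and st: "\<And>g f. g \<in> L \<Longrightarrow> f \<in> V \<Longrightarrow> tr g f \<in> V"
    and f: "f \<in> V" "has_weight (\<lambda>i. N - i) n f"
    and min: "\<And>g k. g \<in> V \<Longrightarrow> has_weight (\<lambda>i. N - i) k g \<Longrightarrow> k < n \<Longrightarrow> g = (\<lambda>x. 0)"
    and u: "u \<in> BLv" "\<And>i. i < N \<Longrightarrow> u $$ (i, i) = 1" and x: "x \<in> X"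
  shows "f (act u x) = f x"
proof -
  let ?m = "\<lambda>i. N - i :: nat"
  have uL: "u \<in> L" and uB: "u \<in> Bor N" and uc: "u \<in> carrier_mat N N" using u(1) Bor_carrier by auto
  obtain F where F: "F \<in> polyfun" "\<And>x. x \<in> X \<Longrightarrow> f x = F x" using coord_ringE[OF subsetD[OF V(2) f(1)]] by blast
  have XB: "act g x \<in> X" if "x \<in> X" "g \<in> BLv" for x g using X_Bor that by blast
  have st': "tr (torus1 ?m t) f \<in> V" if "t \<noteq> 0" "f \<in> V" for t f using st torus1_BLv that by blast
  obtain K G where G: "\<And>k. k \<le> K \<Longrightarrow> G k \<in> V" "\<And>k. has_weight ?m k (G k)" "\<And>x. tr u f x = (\<Sum>k\<le>K. G k x)"
    using weight_decomposition[OF V st' st[OF uL f(1)]] by blast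
  have G0: "G k = (\<lambda>x. 0)" if "k < n" "k \<le> K" for k using min G(1,2) that by blast
  \<comment> \<open>\<open>U t\<close> is the conjugate of \<open>u\<close> by diag(t^(N-i)). Above
    the diagonal the exponents \<open>j - i\<close> are positive, so the formula makes sense at
    \<open>t = 0\<close>, where only the diagonal remains.\<close>
  define U where "U = (\<lambda>t. emat (\<lambda>i j. if i \<le> j then t ^ (j - i) * u $$ (i - 1, j - 1) else 0))"
  have UB: "U t \<in> BLv" for t
    unfolding U_def
  proof (rule BLvI)
    fix i j assume ij: "1 \<le> i" "i \<le> N" "1 \<le> j" "j \<le> N" "i \<noteq> j"
      "emat (\<lambda>i j. if i \<le> j then t ^ (j - i) * u $$ (i - 1, j - 1) else 0) $$ (i - 1, j - 1) \<noteq> 0"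
    from ij(6) have "i \<le> j" "u $$ (i - 1, j - 1) \<noteq> 0" unfolding emat_entry[OF ij(1-4)] by (auto split: if_splits)
    then show "i < j \<and> blk i = blk j" using Levi_entry[OF uL ij(1-4)] ij by auto
  next
    fix i assume "1 \<le> i" "i \<le> N"
    moreover from this have "i - 1 < N" by linarith
    ultimately show "emat (\<lambda>i j. if i \<le> j then t ^ (j - i) * u $$ (i - 1, j - 1) else 0) $$ (i - 1, i - 1) \<noteq> 0"
      by (simp add: emat_entry u(2) del: One_nat_def)
  qed (simp add: emat_def)
  have U1: "U 1 = u"
    unfolding U_def emat_def
  proof (rule eq_matI)
    fix a c assume "a < dim_row u" "c < dim_col u"
    then have ac: "a < N" "c < N" using uc by auto
    have "u $$ (a, c) = 0" if "c < a" using uB ac that by (auto simp: Bor_def)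
    then show "mat N N (\<lambda>(i, j). if Suc i \<le> Suc j then 1 ^ (Suc j - Suc i) * u $$ (Suc i - 1, Suc j - 1) else 0) $$ (a, c) = u $$ (a, c)"
      using ac by simp
  qed (use uc in auto)
  have "act (U 0) x = act (dmat (\<lambda>i. 1)) x"
  proof -
    have "U 0 = dmat (\<lambda>i. 1)"
      unfolding U_def dmat_def emat_def by (rule eq_matI) (use u(2) in auto)
    then show ?thesis by simp
  qed
  then have U0: "act (U 0) x = x" by (simp add: act_dmat[OF x])
  have conj: "U t * torus1 ?m t = torus1 ?m t * u" for t
  proof (rule eq_matI)
    fix a c assume "a < dim_row (torus1 ?m t * u)" "c < dim_col (torus1 ?m t * u)"
    then have ac: "a < N" "c < N" using uc by (auto simp: torus1_def dmat_def emat_def)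
    have 1: "(U t * torus1 ?m t) $$ (a, c) = (\<Sum>l = 0..<N. U t $$ (a, l) * torus1 ?m t $$ (l, c))"
      using ac by (auto simp: scalar_prod_def U_def torus1_def dmat_def emat_def)
    have 2: "\<dots> = U t $$ (a, c) * t ^ (N - Suc c)"
      using ac by (subst sum.mono_neutral_right[of _ "{c}"]) (auto simp: torus1_def dmat_def emat_def)
    have 3: "(torus1 ?m t * u) $$ (a, c) = (\<Sum>l = 0..<N. torus1 ?m t $$ (a, l) * u $$ (l, c))"
      using ac uc by (auto simp: scalar_prod_def U_def torus1_def dmat_def emat_def)
    have 4: "\<dots> = t ^ (N - Suc a) * u $$ (a, c)"
      using ac by (subst sum.mono_neutral_right[of _ "{a}"]) (auto simp: torus1_def dmat_def emat_def)
    have 5: "U t $$ (a, c) * t ^ (N - Suc c) = t ^ (N - Suc a) * u $$ (a, c)"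
    proof (cases "a \<le> c")
      case True
      then have "N - Suc a = (c - a) + (N - Suc c)" using ac by simp
      then have "t ^ (N - Suc a) = t ^ (c - a) * t ^ (N - Suc c)" by (simp only: power_add)
      then show ?thesis using True ac by (simp add: U_def emat_def)
    next
      case False
      then have "u $$ (a, c) = 0" using uB ac by (auto simp: Bor_def)
      then show ?thesis using False ac by (simp add: U_def emat_def)
    qed
    show "(U t * torus1 ?m t) $$ (a, c) = (torus1 ?m t * u) $$ (a, c)" using 1 2 3 4 5 by simp
  qed (use uc in \<open>auto simp: U_def torus1_def dmat_def emat_def\<close>)
  have "(\<lambda>t. F (act (U t) x)) \<in> polyline"
  proof (rule polyfun_comp[OF fun_alg_polyline F(1)])
    fix s
    show "(\<lambda>t. act (U t) x s) \<in> polyline"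
    proof (cases "s \<in> Idn d N")
      case True
      have "(\<lambda>t. minor (U t) s r) \<in> polyline" if r: "r \<in> Idn d N" for r
        unfolding minor_dt
      proof (rule fun_alg_dt[OF fun_alg_polyline])
        fix i j assume "i < length s" "j < length s"
        then have ij: "1 \<le> s ! i" "s ! i \<le> N" "1 \<le> r ! j" "r ! j \<le> N"
          using Idn_nth[OF True, of i] Idn_nth[OF r, of j] Idn_length[OF True] by auto
        show "(\<lambda>t. U t $$ (s ! i - 1, r ! j - 1)) \<in> polyline"
          unfolding U_def emat_entry[OF ij]
          by (intro fun_alg_if fun_alg_mult[OF fun_alg_polyline] fun_alg_power[OF fun_alg_polyline]
                fun_alg_const[OF fun_alg_polyline] polyline_id)
      qed
      then have "(\<lambda>t. \<Sum>r\<in>Idn d N. minor (U t) s r * x r) \<in> polyline"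
        by (intro fun_alg_sum[OF fun_alg_polyline] fun_alg_mult[OF fun_alg_polyline] fun_alg_const[OF fun_alg_polyline])
      then show ?thesis using True by (simp add: wact_def)
    next
      case False
      then show ?thesis by (simp add: wact_def fun_alg_const[OF fun_alg_polyline])
    qed
  qed
  then obtain p where p: "\<And>t. F (act (U t) x) = poly p t" by (auto simp: polyline_def fun_eq_iff)
  \<comment> \<open>\<open>t ^ K\<close> clears the negative powers of \<open>t\<close>. Minimality
    leaves only components with \<open>k \<ge> n\<close>, so \<open>r\<close> has degree at most
    \<open>K\<close>, and \<open>t ^ K * p = r\<close> then forces \<open>p\<close> to be
    constant.\<close>
  define r where "r = (\<Sum>k\<in>{n..K}. monom (G k x) (n + K - k))"
  have key: "t ^ K * poly p t = poly r t" if t: "t \<noteq> 0" for t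
  proof -
    define y where "y = act (torus1 ?m (1 / t)) x"
    have yX: "y \<in> X" unfolding y_def using XB[OF x torus1_BLv] t by simp
    have xy: "x = act (torus1 ?m t) y"
      unfolding act_torus1[OF yX] unfolding y_def act_torus1[OF x] using t by (simp add: power_divide)
    have tX: "act (U t) x \<in> X" by (rule XB[OF x UB])
    have "poly p t = f (act (U t) x)" using p F(2)[OF tX] by simp
    also have "act (U t) x = act (torus1 ?m t) (act u y)"
    proof -
      have "act (U t) x = act (U t) (act (torus1 ?m t) y)" by (rule arg_cong[OF xy])
      also have "\<dots> = act (U t * torus1 ?m t) y" by (rule act_mult_BLv[OF UB torus1_BLv[OF t], symmetric])
      also have "\<dots> = act (torus1 ?m t * u) y" by (simp only: conj)
      also have "\<dots> = act (torus1 ?m t) (act u y)" by (rule act_mult_BLv[OF torus1_BLv[OF t] u(1)])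
      finally show ?thesis .
    qed
    also have "f \<dots> = t ^ n * f (act u y)"
      using f(2) t XB[OF yX u(1)] by (auto simp: has_weight_def)
    also have "f (act u y) = (\<Sum>k\<le>K. G k y)" using G(3)[of y] yX by (simp add: tr_def)
    also have "\<dots> = (\<Sum>k\<le>K. (1 / t) ^ k * G k x)"
      using G(2) x t by (intro sum.cong) (auto simp: has_weight_def y_def)
    also have "\<dots> = (\<Sum>k\<in>{n..K}. (1 / t) ^ k * G k x)"
      by (rule sum.mono_neutral_right) (use G0 in auto)
    finally have "t ^ K * poly p t = (\<Sum>k\<in>{n..K}. t ^ K * t ^ n * (1 / t) ^ k * G k x)"
      by (simp add: sum_distrib_left mult.assoc)
    also have "\<dots> = poly r t"
      unfolding r_def poly_sum
    proof (rule sum.cong[OF refl])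
      fix k assume "k \<in> {n..K}"
      then have "t ^ (n + K) = t ^ (n + K - k) * t ^ k" by (simp flip: power_add)
      then show "t ^ K * t ^ n * (1 / t) ^ k * G k x = poly (monom (G k x) (n + K - k)) t"
        using t by (simp add: poly_monom power_divide power_add field_simps)
    qed
    finally show ?thesis .
  qed
  have "finite {t. poly (monom 1 K * p - r) t \<noteq> 0}"
    by (rule finite_subset[of _ "{0}"]) (use key in \<open>auto simp: poly_monom\<close>)
  have "monom 1 K * p = r"
  proof (rule ccontr)
    assume "monom 1 K * p \<noteq> r"
    then have "finite {t. poly (monom 1 K * p - r) t = 0}" by (intro poly_roots_finite) simp
    then have "finite ({t. poly (monom 1 K * p - r) t = 0} \<union> {t. poly (monom 1 K * p - r) t \<noteq> 0})"
      using \<open>finite {t. poly (monom 1 K * p - r) t \<noteq> 0}\<close> by (rule finite_UnI)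
    moreover have "{t. poly (monom 1 K * p - r) t = 0} \<union> {t. poly (monom 1 K * p - r) t \<noteq> 0} = UNIV" by blast
    ultimately show False using infinite_UNIV_char_0[where 'a = complex] by (simp only:)
  qed
  moreover have "degree r \<le> K"
    unfolding r_def by (rule degree_sum_le) (auto intro!: order.trans[OF degree_monom_le])
  ultimately have "degree p = 0"
    by (cases "p = 0") (auto simp: degree_mult_eq degree_monom_eq)
  then obtain c where "p = [:c:]" by (rule degree_eq_zeroE)
  then have "F (act (U 1) x) = F (act (U 0) x)" using p by simp
  then show ?thesis using U1 U0 F(2)[OF x] F(2)[OF XB[OF x u(1)]] by simp
qed

text \<open>A Borel element is a diagonal matrix times a unipotent one. The unipotent factor fixes
  every vector of least weight for diag(t^(N-i)), and inside that weight space an eigenvector of the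
  whole torus can be chosen.\<close>

lemma Borel_eigenvector_exists:
  assumes W: "Lsubmod d N w js W" "W \<noteq> {\<lambda>x. 0}"
  obtains f \<chi> where "f \<in> W" "f \<noteq> (\<lambda>x. 0)" "\<And>g x. g \<in> BLv \<Longrightarrow> x \<in> X \<Longrightarrow> f (act g x) = \<chi> g * f x"
proof -
  have V: "is_subspace W" "W \<subseteq> coord_ring d N w" and st: "\<And>g f. g \<in> L \<Longrightarrow> f \<in> W \<Longrightarrow> tr g f \<in> W"
    using W(1) unfolding Lsubmod_iff by auto
  have st1: "tr (torus1 m t) f \<in> W" if "t \<noteq> 0" "f \<in> W" for m t f using st torus1_BLv that by blast
  let ?m = "\<lambda>i. N - i :: nat"
  obtain f0 where f0: "f0 \<in> W" "f0 \<noteq> (\<lambda>x. 0)" using W(2) subspace_0[OF V(1)] by blast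
  let ?P = "\<lambda>n. \<exists>f\<in>W. f \<noteq> (\<lambda>x. 0) \<and> has_weight ?m n f"
  have ex: "\<exists>n. ?P n"
    using weight_vector_exists[OF V st1 f0] by metis
  define n where "n = (LEAST n. ?P n)"
  have n: "?P n" unfolding n_def using ex by (rule LeastI_ex)
  have min: "g = (\<lambda>x. 0)" if "g \<in> W" "has_weight ?m k g" "k < n" for g k
    using not_less_Least[of k ?P] that unfolding n_def by blast
  let ?V = "{f \<in> W. has_weight ?m n f}"
  obtain f1 where f1: "f1 \<in> ?V" "f1 \<noteq> (\<lambda>x. 0)" using n by blast
  obtain f k where f: "f \<in> ?V" "f \<noteq> (\<lambda>x. 0)" "\<And>i. i < Suc N \<Longrightarrow> has_weight (unit_exp i) (k i) f"
    using torus_eigenvector_exists[OF weight_space_stable[OF V st1] f1, of "Suc N"] by blast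
  have "f (act g x) = (\<Prod>i\<le>N. (if 1 \<le> i \<and> i \<le> N then g $$ (i - 1, i - 1) else 1) ^ k i) * f x"
    if g: "g \<in> BLv" and x: "x \<in> X" for g x
  proof -
    define T where "T = (\<lambda>i. if 1 \<le> i \<and> i \<le> N then g $$ (i - 1, i - 1) else 1)"
    have T0: "T i \<noteq> 0" for i
    proof (cases "1 \<le> i \<and> i \<le> N")
      case True
      then have "i - 1 < N" by linarith
      then show ?thesis using g Bor_diag[of g N "i - 1"] by (auto simp: T_def)
    qed (auto simp: T_def)
    define u where "u = emat (\<lambda>i j. g $$ (i - 1, j - 1) / T i)"
    have uB: "u \<in> BLv"
      unfolding u_def
    proof (rule BLvI)
      fix i j assume ij: "1 \<le> i" "i \<le> N" "1 \<le> j" "j \<le> N" "i \<noteq> j" "emat (\<lambda>i j. g $$ (i - 1, j - 1) / T i) $$ (i - 1, j - 1) \<noteq> 0"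
      from ij(6) have nz: "g $$ (i - 1, j - 1) \<noteq> 0" unfolding emat_entry[OF ij(1-4)] by auto
      have "\<not> j < i" using Bor_lower[of g N i j] g ij nz by auto
      then show "i < j \<and> blk i = blk j" using Levi_entry[of g i j] g ij nz by auto
    next
      fix i assume i: "1 \<le> i" "i \<le> N"
      then show "emat (\<lambda>i j. g $$ (i - 1, j - 1) / T i) $$ (i - 1, i - 1) \<noteq> 0"
        using T0[of i] unfolding emat_entry[OF i i] by (auto simp: T_def)
    qed (simp add: emat_def)
    have u1: "u $$ (i, i) = 1" if "i < N" for i
      using that T0[of "Suc i"] by (simp add: u_def emat_def T_def)
    have gc: "g \<in> carrier_mat N N" using g Bor_carrier by blast
    have dg: "dmat T * u = g"
    proof (rule eq_matI)
      fix a c assume "a < dim_row g" "c < dim_col g"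
      then have ac: "a < N" "c < N" using gc by auto
      have "(dmat T * u) $$ (a, c) = (\<Sum>l = 0..<N. dmat T $$ (a, l) * u $$ (l, c))"
        using ac by (auto simp: scalar_prod_def dmat_def u_def emat_def)
      also have "\<dots> = T (Suc a) * u $$ (a, c)"
        using ac by (subst sum.mono_neutral_right[of _ "{a}"]) (auto simp: dmat_def emat_def)
      also have "\<dots> = g $$ (a, c)" using ac T0[of "Suc a"] by (simp add: u_def emat_def)
      finally show "(dmat T * u) $$ (a, c) = g $$ (a, c)" .
    qed (use gc in \<open>auto simp: dmat_def u_def emat_def\<close>)
    have uX: "act u x \<in> X" using X_Bor uB x by blast
    have "f (act g x) = f (act (dmat T) (act u x))"
      using act_mult_BLv[OF dmat_BLv[of T] uB, of x] T0 dg by simp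
    also have "\<dots> = (\<Prod>i\<le>N. T i ^ k i) * f (act u x)"
      by (rule torus_eigenvector[OF f(3) T0 uX]) simp
    also have "f (act u x) = f x"
      by (rule minimal_weight_unipotent[OF V st _ _ min uB u1 x]) (use f(1) in auto)
    finally show ?thesis by (simp add: T_def)
  qed
  then show thesis
    by (intro that[of f "\<lambda>g. \<Prod>i\<le>N. (if 1 \<le> i \<and> i \<le> N then g $$ (i - 1, i - 1) else 1) ^ k i"]) (use f(1,2) in auto)
qed

text \<open>\<open>spherical\<close> allows a scalar beside the group element; a \<open>d\<close>-th
  root of it gives a scalar matrix in \<open>BLv\<close>, so the Borel character controls the values
  on the whole set.\<close>

lemma scalar_in_BLv:
  assumes "c \<noteq> 0"
  obtains g where "g \<in> BLv" "\<And>x. x \<in> X \<Longrightarrow> (\<lambda>s. c * x s) = act g x"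
proof -
  have "\<exists>t. t ^ d = c"
  proof -
    have "card {z. z ^ d = c} \<noteq> 0" using card_nth_roots[OF assms, of d] d1 by simp
    then have "{z. z ^ d = c} \<noteq> {}" by (metis card.empty)
    then show ?thesis by blast
  qed
  then obtain t where t: "t ^ d = c" by blast
  then have "t \<noteq> 0" using assms d1 by auto
  then show thesis
    using t by (intro that[of "dmat (\<lambda>_. t)"] dmat_BLv) (auto simp: act_dmat)
qed

lemma spherical_imp_mult_free:
  assumes "spherical d N w js" shows "mult_free d N w js"
  unfolding mult_free_def
proof (intro allI impI)
  fix W1 W2
  assume asm: "Lirred d N w js W1 \<and> Lirred d N w js W2 \<and> Liso d N w js W1 W2"
  then have s1: "Lsubmod d N w js W1" and s2: "Lsubmod d N w js W2"
    and i1: "\<And>V. Lsubmod d N w js V \<Longrightarrow> V \<subseteq> W1 \<Longrightarrow> V = {\<lambda>x. 0} \<or> V = W1" "W1 \<noteq> {\<lambda>x. 0}"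
    and i2: "\<And>V. Lsubmod d N w js V \<Longrightarrow> V \<subseteq> W2 \<Longrightarrow> V = {\<lambda>x. 0} \<or> V = W2"
    by (auto simp: Lirred_def)
  obtain \<phi> where phi: "bij_betw \<phi> W1 W2" "\<And>c f. f \<in> W1 \<Longrightarrow> \<phi> (\<lambda>x. c * f x) = (\<lambda>x. c * \<phi> f x)"
    "\<And>g f. g \<in> L \<Longrightarrow> f \<in> W1 \<Longrightarrow> \<phi> (fact d N w g f) = fact d N w g (\<phi> f)"
    using asm unfolding Liso_def by blast
  obtain f1 \<chi> where f1: "f1 \<in> W1" "f1 \<noteq> (\<lambda>x. 0)" "\<And>g x. g \<in> BLv \<Longrightarrow> x \<in> X \<Longrightarrow> f1 (act g x) = \<chi> g * f1 x"
    using Borel_eigenvector_exists[OF s1 i1(2)] by blast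
  have c1: "W1 \<subseteq> coord_ring d N w" and c2: "W2 \<subseteq> coord_ring d N w"
    and sub1: "is_subspace W1" and sub2: "is_subspace W2" using s1 s2 by (auto simp: Lsubmod_def)
  define f2 where "f2 = \<phi> f1"
  have f2W: "f2 \<in> W2" using phi(1) f1(1) by (auto simp: f2_def bij_betw_def)
  have z: "\<phi> (\<lambda>x. 0) = (\<lambda>x. 0)" using phi(2)[OF f1(1), of 0] by simp
  have f20: "f2 \<noteq> (\<lambda>x. 0)"
  proof
    assume "f2 = (\<lambda>x. 0)"
    then have "\<phi> f1 = \<phi> (\<lambda>x. 0)" using z f2_def by simp
    then show False using phi(1) f1(1,2) subspace_0[OF sub1] by (auto simp: bij_betw_def inj_on_def)
  qed
  have f1z: "f1 x = 0" if "x \<notin> X" for x using coord_ringE[OF subsetD[OF c1 f1(1)]] that by metis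
  have f2z: "f2 x = 0" if "x \<notin> X" for x using coord_ringE[OF subsetD[OF c2 f2W]] that by metis
  have f2e: "f2 (act g x) = \<chi> g * f2 x" if g: "g \<in> BLv" and x: "x \<in> X" for g x
  proof -
    obtain g' where g': "g' \<in> L" "\<And>f. tr g f = fact d N w g' f" using tr_fact g by blast
    have "fact d N w g' f1 = (\<lambda>x. \<chi> g * f1 x)"
      using f1(3)[OF g] f1z unfolding g'(2)[symmetric] tr_def by auto
    then have "tr g f2 = (\<lambda>x. \<chi> g * f2 x)"
      using phi(2)[OF f1(1)] phi(3)[OF g'(1) f1(1)] g'(2) f2_def by metis
    then have "tr g f2 x = \<chi> g * f2 x" by simp
    then show ?thesis using x by (simp add: tr_def)
  qed
  obtain v where v: "v \<in> X" "zar_dense_in X {(\<lambda>s. c * act g v s) | c g. c \<noteq> 0 \<and> g \<in> BLv}"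
    using assms unfolding spherical_def Let_def by blast
  obtain F1 where F1: "F1 \<in> polyfun" "\<And>x. x \<in> X \<Longrightarrow> f1 x = F1 x" using coord_ringE[OF subsetD[OF c1 f1(1)]] by blast
  obtain F2 where F2: "F2 \<in> polyfun" "\<And>x. x \<in> X \<Longrightarrow> f2 x = F2 x" using coord_ringE[OF subsetD[OF c2 f2W]] by blast
  have dense: "\<forall>x\<in>X. p x = 0" if "p \<in> polyfun" "\<And>x g. g \<in> BLv \<Longrightarrow> p (act g v) = 0" for p
  proof -
    have "p x = 0" if x: "x \<in> {(\<lambda>s. c * act g v s) | c g. c \<noteq> 0 \<and> g \<in> BLv}" for x
    proof -
      obtain c g where cg: "x = (\<lambda>s. c * act g v s)" "c \<noteq> 0" "g \<in> BLv" using x by blast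
      obtain g' where g': "g' \<in> BLv" "\<And>x. x \<in> X \<Longrightarrow> (\<lambda>s. c * x s) = act g' x" using scalar_in_BLv[OF cg(2)] by blast
      have "act g v \<in> X" using X_Bor cg(3) v(1) by blast
      then have "x = act (g' * g) v" using g'(2) cg act_mult_BLv[OF g'(1) cg(3)] by simp
      then show ?thesis using \<open>\<And>x g. g \<in> BLv \<Longrightarrow> p (act g v) = 0\<close> BLv_mult[OF g'(1) cg(3)] by simp
    qed
    then show ?thesis using v(2) that(1) unfolding zar_dense_in_def by blast
  qed
  have gX: "act g v \<in> X" if "g \<in> BLv" for g using X_Bor that v(1) by blast
  have v1: "f1 v \<noteq> 0"
  proof
    assume "f1 v = 0"
    then have "\<forall>x\<in>X. F1 x = 0"
      using f1(3)[OF _ v(1)] F1(2)[OF gX] by (intro dense[OF F1(1)]) simp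
    then show False using F1(2) f1z f1(2) by (metis ext)
  qed
  \<comment> \<open>This combination of two eigenvectors of equal character vanishes at
    \<open>v\<close>, hence on the orbit of \<open>v\<close>, hence by density on the cone.\<close>
  have "\<forall>x\<in>X. F1 v * F2 x - F2 v * F1 x = 0"
  proof (rule dense)
    show "(\<lambda>x. F1 v * F2 x - F2 v * F1 x) \<in> polyfun"
      by (intro fun_alg_diff[OF fun_alg_polyfun] fun_alg_cmult[OF fun_alg_polyfun] F1(1) F2(1))
    fix x :: "nat list \<Rightarrow> complex" and g assume g: "g \<in> BLv"
    show "F1 v * F2 (act g v) - F2 v * F1 (act g v) = 0"
      using f1(3)[OF g v(1)] f2e[OF g v(1)] F1(2)[OF gX[OF g]] F2(2)[OF gX[OF g]] F1(2)[OF v(1)] F2(2)[OF v(1)] by simp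
  qed
  then have eq: "f2 x = f2 v / f1 v * f1 x" for x
    using v1 F1(2) F2(2) v(1) f1z[of x] f2z[of x] by (cases "x \<in> X") (auto simp: field_simps)
  have "f2 = (\<lambda>x. f2 v / f1 v * f1 x)" by (rule ext) (rule eq)
  then have "f2 \<in> W1" using subspace_scale[OF sub1 f1(1), of "f2 v / f1 v"] by metis
  then have ne: "W1 \<inter> W2 \<noteq> {\<lambda>x. 0}" using f2W f20 by blast
  have "Lsubmod d N w js (W1 \<inter> W2)"
    using s1 s2 unfolding Lsubmod_def is_subspace_def by auto
  then have "W1 \<inter> W2 = W1" "W1 \<inter> W2 = W2" using i1(1)[of "W1 \<inter> W2"] i2[of "W1 \<inter> W2"] ne by auto
  then show "W1 = W2" by simp
qed

end

section \<open>Pairs of highest weight vectors of equal weight\<close>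

definition ip :: "'i set \<Rightarrow> ('i \<Rightarrow> complex) \<Rightarrow> ('i \<Rightarrow> complex) \<Rightarrow> complex" where
  "ip I u v = (\<Sum>j\<in>I. u j * cnj (v j))"

lemma ip_add_left: "ip I (\<lambda>j. u j + v j) z = ip I u z + ip I v z"
  and ip_diff_left: "ip I (\<lambda>j. u j - v j) z = ip I u z - ip I v z"
  and ip_scale_left: "ip I (\<lambda>j. c * u j) z = c * ip I u z"
  and ip_add_right: "ip I z (\<lambda>j. u j + v j) = ip I z u + ip I z v"
  and ip_diff_right: "ip I z (\<lambda>j. u j - v j) = ip I z u - ip I z v"
  and ip_scale_right: "ip I z (\<lambda>j. c * u j) = cnj c * ip I z u"
  and ip_zero_left: "ip I (\<lambda>j. 0) z = 0"
  and ip_zero_right: "ip I z (\<lambda>j. 0) = 0"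
  by (simp_all add: ip_def sum.distrib sum_subtractf sum_distrib_left algebra_simps)

lemmas ip_linear = ip_add_left ip_diff_left ip_scale_left ip_add_right ip_diff_right ip_scale_right
  ip_zero_left ip_zero_right

lemma ip_cnj: "ip I v u = cnj (ip I u v)"
  by (simp add: ip_def mult.commute)

lemma ip_zero_commute: "ip I u v = 0 \<longleftrightarrow> ip I v u = 0"
  using ip_cnj[of I u v] by auto

lemma ip_self: "ip I u u = of_real (\<Sum>j\<in>I. (cmod (u j))\<^sup>2)"
  by (simp add: ip_def flip: complex_norm_square)

lemma ip_self_eq_0: "finite I \<Longrightarrow> ip I u u = 0 \<longleftrightarrow> (\<forall>j\<in>I. u j = 0)"
  unfolding ip_self of_real_eq_0_iff by (subst sum_nonneg_eq_0_iff) auto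

definition vec_subspace :: "('i \<Rightarrow> complex) set \<Rightarrow> bool" where
  "vec_subspace V \<longleftrightarrow> (\<lambda>j. 0) \<in> V \<and> (\<forall>u\<in>V. \<forall>v\<in>V. (\<lambda>j. u j + v j) \<in> V) \<and> (\<forall>c. \<forall>u\<in>V. (\<lambda>j. c * u j) \<in> V)"

lemma vec_subspace_zero: "vec_subspace V \<Longrightarrow> (\<lambda>j. 0) \<in> V"
  and vec_subspace_add: "vec_subspace V \<Longrightarrow> u \<in> V \<Longrightarrow> v \<in> V \<Longrightarrow> (\<lambda>j. u j + v j) \<in> V"
  and vec_subspace_scale: "vec_subspace V \<Longrightarrow> u \<in> V \<Longrightarrow> (\<lambda>j. c * u j) \<in> V"
  by (auto simp: vec_subspace_def)

lemma vec_subspace_diff: "vec_subspace V \<Longrightarrow> u \<in> V \<Longrightarrow> v \<in> V \<Longrightarrow> (\<lambda>j. u j - v j) \<in> V"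
  using vec_subspace_add[of V u "\<lambda>j. (-1) * v j"] vec_subspace_scale[of V v "-1"] by simp

text \<open>Gram-Schmidt as an induction on the coordinates \<open>A\<close> allowed to be nonzero:
  the members of \<open>V\<close> that vanish at \<open>a\<close> form the smaller space
  \<open>V'\<close>, and one vector \<open>m1\<close> orthogonal to \<open>V'\<close> with
  \<open>m1 a\<close> nonzero completes it to \<open>V\<close>.\<close>

lemma orthogonal_projection_aux:
  assumes "finite I" "finite A" "A \<subseteq> I"
  shows "vec_subspace V \<Longrightarrow> (\<And>u j. u \<in> V \<Longrightarrow> j \<notin> A \<Longrightarrow> u j = 0) \<Longrightarrow>
    \<exists>p\<in>V. \<forall>m\<in>V. ip I (\<lambda>j. v j - p j) m = 0"
  using assms(2,3)
proof (induction A arbitrary: V v rule: finite_induct)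
  case empty
  then have "m = (\<lambda>j. 0)" if "m \<in> V" for m using that by auto
  then show ?case using vec_subspace_zero[OF empty.prems(1)] by (metis ip_zero_right)
next
  case (insert a A)
  show ?case
  proof (cases "\<exists>m\<in>V. m a \<noteq> 0")
    case False
    then have "u j = 0" if "u \<in> V" "j \<notin> A" for u j using insert.prems(2)[of u j] that by (cases "j = a") auto
    then show ?thesis using insert.IH[OF insert.prems(1)] insert.prems(3) by blast
  next
    case True
    then obtain m0 where m0: "m0 \<in> V" "m0 a \<noteq> 0" by blast
    define V' where "V' = {m \<in> V. m a = 0}"
    have V': "vec_subspace V'" using insert.prems(1) by (auto simp: vec_subspace_def V'_def)
    have sup: "u j = 0" if "u \<in> V'" "j \<notin> A" for u j
      using insert.prems(2)[of u j] that by (cases "j = a") (auto simp: V'_def)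
    have IH: "\<exists>p\<in>V'. \<forall>m\<in>V'. ip I (\<lambda>j. v j - p j) m = 0" for v
      using insert.IH[OF V'] sup insert.prems(3) by blast
    obtain p0 where p0: "p0 \<in> V'" "\<forall>m\<in>V'. ip I (\<lambda>j. m0 j - p0 j) m = 0" using IH[of m0] by blast
    obtain p1 where p1: "p1 \<in> V'" "\<forall>m\<in>V'. ip I (\<lambda>j. v j - p1 j) m = 0" using IH[of v] by blast
    define m1 where "m1 = (\<lambda>j. m0 j - p0 j)"
    have m1V: "m1 \<in> V" unfolding m1_def using m0 p0 by (intro vec_subspace_diff[OF insert.prems(1)]) (auto simp: V'_def)
    have m1a: "m1 a \<noteq> 0" using m0 p0 by (simp add: m1_def V'_def)
    have m1o: "ip I m1 m = 0" "ip I m m1 = 0" if "m \<in> V'" for m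
      using p0(2) that ip_zero_commute[of I m1 m] by (auto simp: m1_def)
    have nz: "ip I m1 m1 \<noteq> 0" using m1a insert.prems(3) ip_self_eq_0[OF assms(1), of m1] by auto
    define c where "c = ip I v m1 / ip I m1 m1"
    define p where "p = (\<lambda>j. p1 j + c * m1 j)"
    have "p \<in> V" unfolding p_def using p1(1) m1V
      by (intro vec_subspace_add[OF insert.prems(1)] vec_subspace_scale[OF insert.prems(1)]) (auto simp: V'_def)
    moreover have "ip I (\<lambda>j. v j - p j) m = 0" if m: "m \<in> V" for m
    proof -
      define e where "e = m a / m1 a"
      define m' where "m' = (\<lambda>j. m j - e * m1 j)"
      have "m' \<in> V" unfolding m'_def
        by (rule vec_subspace_diff[OF insert.prems(1) m vec_subspace_scale[OF insert.prems(1) m1V]])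
      moreover have "m' a = 0" using m1a by (simp add: m'_def e_def)
      ultimately have m'V: "m' \<in> V'" by (simp add: V'_def)
      have "ip I (\<lambda>j. v j - p j) m' = 0"
        using p1(2) m'V m1o(1)[OF m'V] unfolding p_def by (simp add: ip_linear)
      moreover have "ip I (\<lambda>j. v j - p j) m1 = ip I v m1 - c * ip I m1 m1"
        using m1o(2)[OF p1(1)] unfolding p_def by (simp add: ip_linear)
      then have "ip I (\<lambda>j. v j - p j) m1 = 0" using nz by (simp add: c_def)
      moreover have "m = (\<lambda>j. m' j + e * m1 j)" by (simp add: m'_def)
      then have "ip I (\<lambda>j. v j - p j) m = ip I (\<lambda>j. v j - p j) m' + cnj e * ip I (\<lambda>j. v j - p j) m1"
        by (metis ip_add_right ip_scale_right)
      ultimately show ?thesis by simp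
    qed
    ultimately show ?thesis by blast
  qed
qed

lemma orthogonal_projection:
  assumes "finite I" "vec_subspace V" "\<And>u j. u \<in> V \<Longrightarrow> j \<notin> I \<Longrightarrow> u j = 0"
  obtains p where "p \<in> V" "\<And>m. m \<in> V \<Longrightarrow> ip I (\<lambda>j. v j - p j) m = 0"
proof -
  have "\<exists>p\<in>V. \<forall>m\<in>V. ip I (\<lambda>j. v j - p j) m = 0"
    by (rule orthogonal_projection_aux[of I I]) (use assms in auto)
  then show thesis using that by blast
qed

section \<open>Conjugate transpose\<close>

lemma dt_cnj: "dt n (\<lambda>i j. cnj (a i j)) = cnj (dt n a)"
  unfolding dt_leibniz by (simp add: sign_def)

definition adjoint :: "nat \<Rightarrow> complex mat \<Rightarrow> complex mat" where
  "adjoint N g = mat N N (\<lambda>(i, j). cnj (g $$ (j, i)))"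

lemma minor_adjoint:
  assumes "s \<in> Idn d N" "t \<in> Idn d N"
  shows "minor (adjoint N g) s t = cnj (minor g t s)"
proof -
  have "minor (adjoint N g) s t = dt d (\<lambda>i j. cnj (g $$ (t ! j - 1, s ! i - 1)))"
    unfolding minor_dt Idn_length[OF assms(1)]
  proof (rule dt_cong)
    fix i j assume "i < d" "j < d"
    then have "s ! i - 1 < N" "t ! j - 1 < N" using Idn_nth[OF assms(1), of i] Idn_nth[OF assms(2), of j] by linarith+
    then show "adjoint N g $$ (s ! i - 1, t ! j - 1) = cnj (g $$ (t ! j - 1, s ! i - 1))" by (simp add: adjoint_def)
  qed
  also have "\<dots> = cnj (dt d (\<lambda>i j. g $$ (t ! j - 1, s ! i - 1)))" by (rule dt_cnj)
  also have "\<dots> = cnj (minor g t s)"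
    unfolding minor_dt Idn_length[OF assms(2)] using dt_transpose[of d "\<lambda>i j. g $$ (t ! i - 1, s ! j - 1)"] by simp
  finally show ?thesis .
qed

lemma adjoint_adjoint: "g \<in> carrier_mat N N \<Longrightarrow> adjoint N (adjoint N g) = g"
  by (rule eq_matI) (auto simp: adjoint_def)

lemma adjoint_carrier: "adjoint N g \<in> carrier_mat N N"
  by (simp add: adjoint_def)

lemma det_adjoint: "g \<in> carrier_mat N N \<Longrightarrow> det (adjoint N g) = cnj (det g)"
proof -
  assume g: "g \<in> carrier_mat N N"
  have "det (adjoint N g) = dt N (\<lambda>i j. cnj (g $$ (j, i)))" by (simp add: adjoint_def dt_def)
  also have "\<dots> = cnj (dt N (\<lambda>i j. g $$ (j, i)))" by (rule dt_cnj)
  also have "dt N (\<lambda>i j. g $$ (j, i)) = dt N (\<lambda>i j. g $$ (i, j))" by (rule dt_transpose)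
  also have "\<dots> = det g" unfolding dt_def by (rule arg_cong[of _ _ det]) (use g in auto)
  finally show ?thesis .
qed

section \<open>Cubic functions and their coefficient vectors\<close>

context levi_schubert
begin

lemma adjoint_Levi: assumes "g \<in> L" shows "adjoint N g \<in> L"
proof -
  have "adjoint N g \<in> GLn N"
    using Levi_GLn[OF assms] det_adjoint[of g N] adjoint_carrier[of N g] by (auto simp: GLn_def)
  moreover have "adjoint N g $$ (i - 1, j - 1) = 0" if "1 \<le> i" "i \<le> N" "1 \<le> j" "j \<le> N" "blk i \<noteq> blk j" for i j
  proof -
    have "i - 1 < N" "j - 1 < N" using that by linarith+
    then show ?thesis using Levi_entry[OF assms that(3,4,1,2)] that(5) by (simp add: adjoint_def)
  qed
  ultimately show ?thesis using Levi_iff by blast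
qed

text \<open>Polynomial functions of degree 3 on the cone are represented by their coefficient vectors, indexed by
  triples; the functions vanishing on the cone form the kernel \<open>K3\<close>, and its orthogonal complement \<open>S3\<close> is
  isomorphic to the degree 3 part of the coordinate ring.\<close>
type_synonym triple = "nat list \<times> nat list \<times> nat list"

definition T3 :: "triple set" where
  "T3 = Idn d N \<times> Idn d N \<times> Idn d N"

definition phi3 :: "(nat list \<Rightarrow> complex) \<Rightarrow> triple \<Rightarrow> complex" where
  "phi3 x = (\<lambda>(s, t, u). x s * x t * x u)"

definition psi :: "(triple \<Rightarrow> complex) \<Rightarrow> (nat list \<Rightarrow> complex) \<Rightarrow> complex" where
  "psi v x = (\<Sum>j\<in>T3. v j * phi3 x j)"

definition minor3 :: "complex mat \<Rightarrow> triple \<Rightarrow> triple \<Rightarrow> complex" where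
  "minor3 g = (\<lambda>(s, t, u) (s', t', u'). minor g s s' * minor g t t' * minor g u u')"

text \<open>The coefficient vector of the translated cubic function
  \<open>x -> psi v (act g x)\<close>. Translations compose in reverse order, as
  \<open>R3_mult\<close> shows.\<close>

definition R3 :: "complex mat \<Rightarrow> (triple \<Rightarrow> complex) \<Rightarrow> triple \<Rightarrow> complex" where
  "R3 g v j' = (if j' \<in> T3 then \<Sum>j\<in>T3. v j * minor3 g j j' else 0)"

abbreviation ip3 where "ip3 \<equiv> ip T3"

lemma finite_T3: "finite T3"
  by (simp add: T3_def Idn_finite)

lemma sum_T3: "(\<Sum>j\<in>T3. case j of (s, t, u) \<Rightarrow> a s * c t * e u)
   = (\<Sum>s\<in>Idn d N. a s) * (\<Sum>t\<in>Idn d N. c t) * (\<Sum>u\<in>Idn d N. (e u :: complex))"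
  unfolding T3_def
  by (simp only: sum.cartesian_product[symmetric] sum_distrib_left[symmetric] sum_distrib_right[symmetric])

lemma phi3_act: "j \<in> T3 \<Longrightarrow> phi3 (act g x) j = (\<Sum>j'\<in>T3. minor3 g j j' * phi3 x j')"
proof -
  assume j: "j \<in> T3"
  obtain s t u where stu: "j = (s, t, u)" by (cases j) auto
  have in_I: "s \<in> Idn d N" "t \<in> Idn d N" "u \<in> Idn d N" using j stu by (auto simp: T3_def)
  have "phi3 (act g x) j = (\<Sum>s'\<in>Idn d N. minor g s s' * x s') * (\<Sum>t'\<in>Idn d N. minor g t t' * x t')
      * (\<Sum>u'\<in>Idn d N. minor g u u' * x u')"
    using in_I by (simp add: stu phi3_def wact_def)
  also have "\<dots> = (\<Sum>j'\<in>T3. case j' of (s', t', u') \<Rightarrow> (minor g s s' * x s') * (minor g t t' * x t') * (minor g u u' * x u'))"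
    by (rule sum_T3[symmetric])
  also have "\<dots> = (\<Sum>j'\<in>T3. minor3 g j j' * phi3 x j')"
    by (intro sum.cong) (auto simp: stu minor3_def phi3_def)
  finally show ?thesis .
qed

lemma psi_R3: "psi (R3 g v) x = psi v (act g x)"
proof -
  have "psi (R3 g v) x = (\<Sum>j'\<in>T3. \<Sum>j\<in>T3. v j * minor3 g j j' * phi3 x j')"
    by (simp add: psi_def R3_def sum_distrib_right)
  also have "\<dots> = (\<Sum>j\<in>T3. \<Sum>j'\<in>T3. v j * minor3 g j j' * phi3 x j')" by (rule sum.swap)
  also have "\<dots> = psi v (act g x)"
    by (simp add: psi_def phi3_act sum_distrib_left mult.assoc)
  finally show ?thesis .
qed

lemma minor3_adjoint: "j \<in> T3 \<Longrightarrow> j' \<in> T3 \<Longrightarrow> minor3 (adjoint N g) j' j = cnj (minor3 g j j')"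
  by (auto simp: minor3_def T3_def minor_adjoint)

text \<open>The minors of the conjugate transpose are the transposed conjugate minors. As
  \<open>L\<close> is closed under conjugate transpose, orthogonal complements of submodules are
  submodules; this takes the place of complete reducibility.\<close>

lemma R3_adjoint: "ip3 (R3 g u) v = ip3 u (R3 (adjoint N g) v)"
proof -
  have "ip3 (R3 g u) v = (\<Sum>j'\<in>T3. \<Sum>j\<in>T3. u j * minor3 g j j' * cnj (v j'))"
    by (simp add: ip_def R3_def sum_distrib_right)
  also have "\<dots> = (\<Sum>j\<in>T3. \<Sum>j'\<in>T3. u j * minor3 g j j' * cnj (v j'))" by (rule sum.swap)
  also have "\<dots> = ip3 u (R3 (adjoint N g) v)"
    by (simp add: ip_def R3_def sum_distrib_left minor3_adjoint mult.assoc mult.left_commute mult.commute[of "cnj (v _)"])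
  finally show ?thesis .
qed

lemma minor3_mult:
  assumes "g \<in> carrier_mat N N" "k \<in> carrier_mat N N" "j \<in> T3" "j'' \<in> T3"
  shows "minor3 (g * k) j j'' = (\<Sum>j'\<in>T3. minor3 g j j' * minor3 k j' j'')"
proof -
  obtain s t u s' t' u' where stu: "j = (s, t, u)" "j'' = (s', t', u')" by (cases j; cases j'') auto
  have in_I: "s \<in> Idn d N" "t \<in> Idn d N" "u \<in> Idn d N" "s' \<in> Idn d N" "t' \<in> Idn d N" "u' \<in> Idn d N"
    using assms(3,4) stu by (auto simp: T3_def)
  have "minor3 (g * k) j j'' = (\<Sum>r\<in>Idn d N. minor g s r * minor k r s') * (\<Sum>r\<in>Idn d N. minor g t r * minor k r t')
      * (\<Sum>r\<in>Idn d N. minor g u r * minor k r u')"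
    using minor_mult[OF assms(1,2)] in_I by (simp add: stu minor3_def)
  also have "\<dots> = (\<Sum>j'\<in>T3. case j' of (a, c, e) \<Rightarrow> (minor g s a * minor k a s') * (minor g t c * minor k c t') * (minor g u e * minor k e u'))"
    by (rule sum_T3[symmetric])
  also have "\<dots> = (\<Sum>j'\<in>T3. minor3 g j j' * minor3 k j' j'')"
    by (intro sum.cong) (auto simp: stu minor3_def)
  finally show ?thesis .
qed

lemma R3_mult:
  assumes "g \<in> carrier_mat N N" "k \<in> carrier_mat N N"
  shows "R3 (g * k) v = R3 k (R3 g v)"
proof
  fix j
  show "R3 (g * k) v j = R3 k (R3 g v) j"
  proof (cases "j \<in> T3")
    case True
    have "R3 (g * k) v j = (\<Sum>i\<in>T3. \<Sum>l\<in>T3. v i * (minor3 g i l * minor3 k l j))"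
      using True minor3_mult[OF assms] by (simp add: R3_def sum_distrib_left)
    also have "\<dots> = (\<Sum>l\<in>T3. \<Sum>i\<in>T3. v i * (minor3 g i l * minor3 k l j))" by (rule sum.swap)
    also have "\<dots> = R3 k (R3 g v) j"
      using True by (simp add: R3_def sum_distrib_right mult.assoc)
    finally show ?thesis .
  qed (simp add: R3_def)
qed

lemma R3_add: "R3 g (\<lambda>j. u j + v j) = (\<lambda>j. R3 g u j + R3 g v j)"
  and R3_diff: "R3 g (\<lambda>j. u j - v j) = (\<lambda>j. R3 g u j - R3 g v j)"
  and R3_scale: "R3 g (\<lambda>j. c * u j) = (\<lambda>j. c * R3 g u j)"
  and R3_zero: "R3 g (\<lambda>j. 0) = (\<lambda>j. 0)"
  by (auto simp: R3_def fun_eq_iff sum.distrib sum_subtractf sum_distrib_left algebra_simps)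

lemma psi_add: "psi (\<lambda>j. u j + v j) x = psi u x + psi v x"
  and psi_diff: "psi (\<lambda>j. u j - v j) x = psi u x - psi v x"
  and psi_scale: "psi (\<lambda>j. c * u j) x = c * psi u x"
  and psi_zero: "psi (\<lambda>j. 0) x = 0"
  by (simp_all add: psi_def sum.distrib sum_subtractf sum_distrib_left algebra_simps)

definition K3 :: "(triple \<Rightarrow> complex) set" where
  "K3 = {v. (\<forall>j. j \<notin> T3 \<longrightarrow> v j = 0) \<and> (\<forall>x\<in>X. psi v x = 0)}"

definition S3 :: "(triple \<Rightarrow> complex) set" where
  "S3 = {v. (\<forall>j. j \<notin> T3 \<longrightarrow> v j = 0) \<and> (\<forall>k\<in>K3. ip3 v k = 0)}"

lemma S3_subspace: "vec_subspace S3"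
  by (auto simp: vec_subspace_def S3_def ip_linear)

lemma K3_subspace: "vec_subspace K3"
  by (auto simp: vec_subspace_def K3_def psi_add psi_scale psi_zero)

lemma R3_K3: "g \<in> L \<Longrightarrow> v \<in> K3 \<Longrightarrow> R3 g v \<in> K3"
  using X_Levi[of g] by (simp add: K3_def psi_R3) (simp add: R3_def)

lemma R3_S3: "g \<in> L \<Longrightarrow> v \<in> S3 \<Longrightarrow> R3 g v \<in> S3"
  using R3_K3[OF adjoint_Levi] by (simp add: S3_def R3_adjoint) (simp add: R3_def)

lemma ip3_eq_0: "v \<in> S3 \<Longrightarrow> ip3 v v = 0 \<Longrightarrow> v = (\<lambda>j. 0)"
proof
  fix j assume "v \<in> S3" "ip3 v v = 0"
  then show "v j = 0" using ip_self_eq_0[OF finite_T3, of v] by (cases "j \<in> T3") (simp_all add: S3_def del: split_paired_All)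
qed

text \<open>Such a vector lies in \<open>K3\<close> and in its complement, so it is orthogonal to
  itself.\<close>

lemma psi_inj: "v \<in> S3 \<Longrightarrow> (\<And>x. x \<in> X \<Longrightarrow> psi v x = 0) \<Longrightarrow> v = (\<lambda>j. 0)"
  by (rule ip3_eq_0) (auto simp: S3_def K3_def)

lemma psi_inj2:
  assumes "u \<in> S3" "v \<in> S3" "\<And>x. x \<in> X \<Longrightarrow> psi u x = psi v x"
  shows "u = v"
proof -
  have "(\<lambda>j. u j - v j) = (\<lambda>j. 0)"
    by (rule psi_inj[OF vec_subspace_diff[OF S3_subspace]]) (use assms in \<open>auto simp: psi_diff\<close>)
  then show ?thesis by (auto simp: fun_eq_iff)
qed

lemma S3_represent:
  assumes "\<And>j. j \<notin> T3 \<Longrightarrow> v j = 0"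
  obtains u where "u \<in> S3" "\<And>x. x \<in> X \<Longrightarrow> psi u x = psi v x"
proof -
  obtain p where p: "p \<in> K3" "\<And>m. m \<in> K3 \<Longrightarrow> ip3 (\<lambda>j. v j - p j) m = 0"
  proof (rule orthogonal_projection[OF finite_T3 K3_subspace, where v = v])
    show "u j = 0" if "u \<in> K3" "j \<notin> T3" for u j using that by (simp add: K3_def del: split_paired_All)
  qed blast
  show thesis
  proof (rule that)
    show "(\<lambda>j. v j - p j) \<in> S3" using p assms by (auto simp: S3_def K3_def)
    show "psi (\<lambda>j. v j - p j) x = psi v x" if "x \<in> X" for x using p(1) that by (simp add: psi_diff K3_def)
  qed
qed

lemma R3_one: assumes "v \<in> S3" shows "R3 (1\<^sub>m N) v = v"
proof (rule psi_inj2[OF _ assms])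
  have "1\<^sub>m N \<in> BLv" by (rule BLvI) (auto split: if_splits)
  then show "R3 (1\<^sub>m N) v \<in> S3" using R3_S3 assms by blast
  show "psi (R3 (1\<^sub>m N) v) x = psi v x" if "x \<in> X" for x
    using wact_one[of d N x] X_supp[OF that] by (simp add: psi_R3)
qed

section \<open>Generic factorisation of Levi elements into triangular factors\<close>

definition rhoL :: "nat \<Rightarrow> nat \<Rightarrow> bool" where
  "rhoL i r \<longleftrightarrow> 1 \<le> i \<and> i < r \<and> r \<le> N \<and> blk i = blk r"

definition gent :: "complex mat \<Rightarrow> nat \<Rightarrow> nat \<Rightarrow> complex" where
  "gent g = (\<lambda>i j. if 1 \<le> i \<and> i \<le> N \<and> 1 \<le> j \<and> j \<le> N then g $$ (i - 1, j - 1) else 0)"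

lemma emat_gent: "g \<in> carrier_mat N N \<Longrightarrow> emat (gent g) = g"
  by (rule eq_matI) (auto simp: emat_def gent_def)

lemma emat_mult: "emat A * emat C = emat (\<lambda>i j. \<Sum>m = 1..N. A i m * C m j)"
proof (rule eq_matI)
  fix a c assume "a < dim_row (emat (\<lambda>i j. \<Sum>m = 1..N. A i m * C m j))" "c < dim_col (emat (\<lambda>i j. \<Sum>m = 1..N. A i m * C m j))"
  then have ac: "1 \<le> Suc a" "Suc a \<le> N" "1 \<le> Suc c" "Suc c \<le> N" by (auto simp: emat_def)
  have cm: "emat A \<in> carrier_mat N N" "emat C \<in> carrier_mat N N" by (auto simp: emat_def)
  have "(emat A * emat C) $$ (Suc a - 1, Suc c - 1) = (\<Sum>m = 1..N. emat A $$ (Suc a - 1, m - 1) * emat C $$ (m - 1, Suc c - 1))"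
    by (rule mat_mult_entry[OF cm ac])
  also have "\<dots> = (\<Sum>m = 1..N. A (Suc a) m * C m (Suc c))"
  proof (rule sum.cong[OF refl])
    fix m assume "m \<in> {1..N}"
    then show "emat A $$ (Suc a - 1, m - 1) * emat C $$ (m - 1, Suc c - 1) = A (Suc a) m * C m (Suc c)"
      using emat_entry[of "Suc a" m A] emat_entry[of m "Suc c" C] ac by simp
  qed
  finally show "(emat A * emat C) $$ (a, c) = emat (\<lambda>i j. \<Sum>m = 1..N. A i m * C m j) $$ (a, c)"
    using ac by (simp add: emat_def)
qed (auto simp: emat_def)

lemma emat_cong: "(\<And>i j. 1 \<le> i \<Longrightarrow> i \<le> N \<Longrightarrow> 1 \<le> j \<Longrightarrow> j \<le> N \<Longrightarrow> A i j = C i j) \<Longrightarrow> emat A = emat C"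
  by (rule eq_matI) (auto simp: emat_def)

lemma elim_row_left_mult:
  assumes "\<And>i. t i \<noteq> 0" "\<And>i. u i \<noteq> 0 \<Longrightarrow> rhoL i r"
  shows "\<exists>g\<in>BLv. emat (\<lambda>i j. t i * M i j + u i * M r j) = g * emat M"
proof -
  have ur: "u i \<noteq> 0 \<Longrightarrow> 1 \<le> i \<and> i < r \<and> r \<le> N \<and> blk i = blk r" for i
    using assms(2) by (auto simp: rhoL_def)
  define G where "G = (\<lambda>i m. if i = m then t i else if m = r then u i else 0)"
  have "emat G \<in> BLv"
    by (rule emat_BLv) (use assms(1) ur in \<open>auto simp: G_def split: if_splits\<close>)
  moreover have "emat (\<lambda>i j. t i * M i j + u i * M r j) = emat (\<lambda>i j. \<Sum>m = 1..N. G i m * M m j)"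
  proof (rule emat_cong)
    fix i j assume ij: "1 \<le> i" "i \<le> N" "1 \<le> j" "j \<le> N"
    show "t i * M i j + u i * M r j = (\<Sum>m = 1..N. G i m * M m j)"
    proof (cases "i = r")
      case True
      then have "u i = 0" using ur[of i] by auto
      moreover have "(\<Sum>m = 1..N. G i m * M m j) = (\<Sum>m = 1..N. if m = i then t i * M i j else 0)"
        using True by (intro sum.cong) (auto simp: G_def)
      ultimately show ?thesis using ij by simp
    next
      case False
      have "(\<Sum>m = 1..N. G i m * M m j) = G i i * M i j + (if r \<in> {1..N} then G i r * M r j else 0)"
        by (rule sum_diag_plus) (use ij False in \<open>auto simp: G_def\<close>)
      then show ?thesis using ur[of i] False by (cases "u i = 0") (auto simp: G_def)
    qed
  qed
  ultimately show ?thesis using emat_mult[of G M] by metis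
qed

text \<open>Conjugate transpose of the row case. \<open>rhoL\<close> adds later columns to earlier
  ones, so the right factor is lower triangular, the adjoint of a Borel element.\<close>

lemma elim_col_right_mult:
  assumes "\<And>j. t j \<noteq> 0" "\<And>j. u j \<noteq> 0 \<Longrightarrow> rhoL j c"
  shows "\<exists>g\<in>BLv. emat (\<lambda>i j. t j * M i j + u j * M i c) = emat M * adjoint N g"
proof -
  obtain g where g: "g \<in> BLv" "emat (\<lambda>i j. cnj (t i) * cnj (M j i) + cnj (u i) * cnj (M j c)) = g * emat (\<lambda>i j. cnj (M j i))"
    using elim_row_left_mult[of "\<lambda>i. cnj (t i)" "\<lambda>i. cnj (u i)" c "\<lambda>i j. cnj (M j i)"] assms by auto
  have adj_emat: "adjoint N (emat A) = emat (\<lambda>i j. cnj (A j i))" for A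
    by (rule eq_matI) (auto simp: adjoint_def emat_def)
  have gc: "g \<in> carrier_mat N N" using g(1) Bor_carrier by blast
  have adj_mult: "adjoint N (g * emat A) = adjoint N (emat A) * adjoint N g" for A
  proof (rule eq_matI)
    fix a e assume "a < dim_row (adjoint N (emat A) * adjoint N g)" "e < dim_col (adjoint N (emat A) * adjoint N g)"
    then have "a < N" "e < N" by (auto simp: adjoint_def)
    then show "adjoint N (g * emat A) $$ (a, e) = (adjoint N (emat A) * adjoint N g) $$ (a, e)"
      using gc by (auto simp: adjoint_def emat_def scalar_prod_def mult.commute)
  qed (auto simp: adjoint_def)
  have "emat (\<lambda>i j. t j * M i j + u j * M i c) = adjoint N (g * emat (\<lambda>i j. cnj (M j i)))"
    unfolding g(2)[symmetric] adj_emat by simp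
  also have "\<dots> = emat M * adjoint N g" unfolding adj_mult adj_emat by simp
  finally show ?thesis using g(1) by blast
qed

definition blist :: "nat \<Rightarrow> nat list" where "blist k = rev [J (k - 1) + 1 ..< J k + 1]"

lemma set_blist: "k \<in> {1..b} \<Longrightarrow> i \<in> set (blist k) \<longleftrightarrow> 1 \<le> i \<and> i \<le> N \<and> blk i = k"
  using blk_index[of k i] blk_bounds[of i] by (auto simp: blist_def)

text \<open>The open cell of the Levi group: elimination runs through every diagonal block from its
  last row and column backwards, and with as many pivots as rows the normal form is the
  identity.\<close>

lemma Levi_generic_elimination:
  "\<exists>f\<in>polyfun. f (enc (gent (1\<^sub>m N))) \<noteq> 0 \<and>
    (\<forall>g. g \<in> carrier_mat N N \<and> (\<forall>i j. 1 \<le> i \<longrightarrow> i \<le> N \<longrightarrow> 1 \<le> j \<longrightarrow> j \<le> N \<longrightarrow> blk i \<noteq> blk j \<longrightarrow> g $$ (i - 1, j - 1) = 0)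
      \<and> f (enc (gent g)) \<noteq> 0 \<longrightarrow> elim_eqv rhoL rhoL (gent g) (gent (1\<^sub>m N)))"
proof -
  define ps where "ps = map (\<lambda>k. (blist k, blist k, {} :: nat set)) [1..<Suc b]"
  have kb: "k \<in> {1..b}" if "k \<in> set [1..<Suc b]" for k using that by auto
  have sorted: "sorted_wrt (\<lambda>r i. rhoL i r) (blist k)" if "k \<in> {1..b}" for k
  proof -
    have "sorted_wrt (\<lambda>r i. i < r) (blist k)" by (simp add: blist_def sorted_wrt_rev del: upt_Suc)
    then show ?thesis
      by (rule sorted_wrt_mono_rel[rotated]) (use set_blist[OF that] in \<open>auto simp: rhoL_def\<close>)
  qed
  have dist: "distinct (blist k)" for k by (simp add: blist_def del: upt_Suc)
  have piv: "pivotable rhoL rhoL p" if "p \<in> set ps" for p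
    using that sorted[OF kb] dist by (auto simp: ps_def pivotable_def simp del: upt_Suc)
  have sep: "sorted_wrt separated ps"
    unfolding ps_def sorted_wrt_map
    by (rule sorted_wrt_mono_rel[of _ "(<)"]) (auto simp: separated_def set_blist simp del: upt_Suc)
  let ?R = "\<Union>p\<in>set ps. region p"
  obtain V where V: "generic_eqv rhoL rhoL (\<lambda>M. \<forall>p\<in>set ps. isolated p M) ?R V"
    "\<forall>rs cs E. (rs, cs, E) \<in> set ps \<longrightarrow> (\<forall>(i, j)\<in>region (rs, cs, E). V i j = nform rs cs E i j)"
    using generic_elimination_family[OF piv sep] by blast
  have R: "(i, j) \<in> ?R \<longleftrightarrow> 1 \<le> i \<and> i \<le> N \<and> 1 \<le> j \<and> j \<le> N \<and> blk i = blk j" for i j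
  proof
    assume "(i, j) \<in> ?R"
    then obtain k where "k \<in> set [1..<Suc b]" "i \<in> set (blist k)" "j \<in> set (blist k)"
      by (auto simp: ps_def region_def simp del: upt_Suc set_upt)
    then show "1 \<le> i \<and> i \<le> N \<and> 1 \<le> j \<and> j \<le> N \<and> blk i = blk j" using set_blist[OF kb] by simp
  next
    assume ij: "1 \<le> i \<and> i \<le> N \<and> 1 \<le> j \<and> j \<le> N \<and> blk i = blk j"
    then have k: "blk i \<in> {1..b}" using blk_range by blast
    then have "i \<in> set (blist (blk i))" "j \<in> set (blist (blk i))" using set_blist ij by auto
    then show "(i, j) \<in> ?R" using k by (auto simp: ps_def region_def simp del: upt_Suc intro!: bexI[of _ "blk i"])
  qed
  have Vid: "V i j = gent (1\<^sub>m N) i j" if "(i, j) \<in> ?R" for i j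
  proof -
    have ij: "1 \<le> i" "i \<le> N" "1 \<le> j" "j \<le> N" "blk i = blk j" using that R by auto
    then have k: "blk i \<in> {1..b}" using blk_range by blast
    then have m: "i \<in> set (blist (blk i))" "j \<in> set (blist (blk i))" using set_blist ij by auto
    have "(blist (blk i), blist (blk i), {}) \<in> set ps" using k by (auto simp: ps_def simp del: upt_Suc)
    then have "V i j = nform (blist (blk i)) (blist (blk i)) {} i j" using V(2) m by (fastforce simp: region_def)
    also have "\<dots> = (if i = j then 1 else 0)" by (rule nform_diag[OF dist m])
    also have "\<dots> = gent (1\<^sub>m N) i j"
    proof -
      have "i - 1 < N" "j - 1 < N" "i - 1 = j - 1 \<longleftrightarrow> i = j" using ij by linarith+
      then show ?thesis using ij by (simp add: gent_def del: One_nat_def)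
    qed
    finally show ?thesis .
  qed
  obtain f where f: "f \<in> polyfun" "f (enc V) \<noteq> 0"
    "\<And>M M'. (\<And>i j. (i, j) \<in> ?R \<Longrightarrow> M i j = M' i j) \<Longrightarrow> f (enc M) = f (enc M')"
    "\<And>M. (\<forall>p\<in>set ps. isolated p M) \<Longrightarrow> f (enc M) \<noteq> 0 \<Longrightarrow> elim_eqv rhoL rhoL M (overwrite ?R V M)"
    using generic_eqvE[OF V(1)] by blast
  have f1: "f (enc (gent (1\<^sub>m N))) = f (enc V)" by (rule f(3)) (simp add: Vid)
  have "elim_eqv rhoL rhoL (gent g) (gent (1\<^sub>m N))"
    if g: "\<And>i j. 1 \<le> i \<Longrightarrow> i \<le> N \<Longrightarrow> 1 \<le> j \<Longrightarrow> j \<le> N \<Longrightarrow> blk i \<noteq> blk j \<Longrightarrow> g $$ (i - 1, j - 1) = 0"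
      and nz: "f (enc (gent g)) \<noteq> 0" for g
  proof -
    have g0: "gent g i j = 0" if "blk i \<noteq> blk j \<or> \<not> (1 \<le> i \<and> i \<le> N \<and> 1 \<le> j \<and> j \<le> N)" for i j
      using g[of i j] that by (auto simp: gent_def)
    have "isolated p (gent g)" if p: "p \<in> set ps" for p
    proof -
      obtain k where k: "k \<in> set [1..<Suc b]" "p = (blist k, blist k, {})"
        using p by (auto simp: ps_def simp del: upt_Suc set_upt)
      have sb: "i \<in> set (blist k) \<longleftrightarrow> 1 \<le> i \<and> i \<le> N \<and> blk i = k" for i by (rule set_blist[OF kb[OF k(1)]])
      have "gent g i j = 0" if "i \<in> set (blist k)" "j \<notin> set (blist k)" for i j
      proof (rule g0)
        show "blk i \<noteq> blk j \<or> \<not> (1 \<le> i \<and> i \<le> N \<and> 1 \<le> j \<and> j \<le> N)" using that unfolding sb by metis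
      qed
      moreover have "gent g i j = 0" if "i \<notin> set (blist k)" "j \<in> set (blist k)" for i j
      proof (rule g0)
        show "blk i \<noteq> blk j \<or> \<not> (1 \<le> i \<and> i \<le> N \<and> 1 \<le> j \<and> j \<le> N)" using that unfolding sb by metis
      qed
      ultimately show ?thesis unfolding k(2) isolated_def by simp
    qed
    then have "elim_eqv rhoL rhoL (gent g) (overwrite ?R V (gent g))" using f(4) nz by blast
    moreover have "overwrite ?R V (gent g) = gent (1\<^sub>m N)"
    proof (intro ext)
      fix i j
      show "overwrite ?R V (gent g) i j = gent (1\<^sub>m N) i j"
      proof (cases "(i, j) \<in> ?R")
        case True
        then show ?thesis using Vid by (simp add: overwrite_def)
      next
        case False
        have "gent (1\<^sub>m N) i j = 0"
          using False R[of i j] by (auto simp: gent_def) (metis One_nat_def Suc_pred' le_simps(3) zero_less_one diff_Suc_1 Suc_le_D)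
        moreover have "gent g i j = 0" using False R[of i j] by (intro g0) blast
        ultimately show ?thesis using False by (simp add: overwrite_def)
      qed
    qed
    ultimately show ?thesis by simp
  qed
  then show ?thesis using f(1,2) f1 by (intro bexI[of _ f]) auto
qed

definition hw :: "(complex mat \<Rightarrow> complex) \<Rightarrow> (triple \<Rightarrow> complex) \<Rightarrow> bool" where
  "hw \<chi> v \<longleftrightarrow> v \<in> S3 \<and> (\<forall>g\<in>BLv. R3 g v = (\<lambda>j. \<chi> g * v j))"

lemma hwD: "hw \<chi> v \<Longrightarrow> g \<in> BLv \<Longrightarrow> R3 g v = (\<lambda>j. \<chi> g * v j)"
  and hw_S3: "hw \<chi> v \<Longrightarrow> v \<in> S3"
  by (auto simp: hw_def)

lemma hw_zero: "hw \<chi> (\<lambda>j. 0)"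
  using vec_subspace_zero[OF S3_subspace] by (simp add: hw_def R3_zero)

lemma hw_combine: "hw \<chi> u \<Longrightarrow> hw \<chi> v \<Longrightarrow> hw \<chi> (\<lambda>j. a * u j + c * v j)"
  unfolding hw_def using vec_subspace_add[OF S3_subspace] vec_subspace_scale[OF S3_subspace]
  by (auto simp: R3_add R3_scale algebra_simps)

lemma gent_one: "emat (gent (1\<^sub>m N)) = 1\<^sub>m N"
  by (rule emat_gent) simp

text \<open>The matrix coefficients of two pairs of highest weight vectors of equal weight agree on the dense set of
  products of an upper and a lower triangular matrix as soon as they agree at 1.\<close>
lemma hw_matrix_coefficient:
  assumes hw: "hw \<chi> a" "hw \<chi> c" "hw \<chi> a'" "hw \<chi> c'" and chi: "\<And>g. g \<in> BLv \<Longrightarrow> \<chi> g \<noteq> 0"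
    and eq: "ip3 a c = ip3 a' c'" and g: "g \<in> L"
  shows "ip3 (R3 g a) c = ip3 (R3 g a') c'"
proof -
  define Inv where "Inv = (\<lambda>g. ip3 (R3 g a) c = ip3 (R3 g a') c')"
  \<comment> \<open>A factor from \<open>BLv\<close> on the left, or its adjoint on the right,
    multiplies both coefficients by the same nonzero number, since all four vectors share the
    character.\<close>
  have left: "Inv (k * g) \<longleftrightarrow> Inv g" if k: "k \<in> BLv" and g: "g \<in> carrier_mat N N" for k g
  proof -
    have kc: "k \<in> carrier_mat N N" using k Bor_carrier by blast
    show ?thesis unfolding Inv_def R3_mult[OF kc g] hwD[OF hw(1) k] hwD[OF hw(3) k] R3_scale ip_scale_left
      using chi[OF k] by simp
  qed
  have right: "Inv (g * adjoint N k) \<longleftrightarrow> Inv g" if k: "k \<in> BLv" and g: "g \<in> carrier_mat N N" for k g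
  proof -
    have kc: "k \<in> carrier_mat N N" using k Bor_carrier by blast
    show ?thesis
      unfolding Inv_def R3_mult[OF g adjoint_carrier] R3_adjoint[of "adjoint N k"] adjoint_adjoint[OF kc]
        hwD[OF hw(2) k] hwD[OF hw(4) k] ip_scale_right
      using chi[OF k] by simp
  qed
  have em: "emat M \<in> carrier_mat N N" for M by (simp add: emat_def)
  have step: "Inv (emat M') \<longleftrightarrow> Inv (emat M)" if "elim_step rhoL rhoL M M'" for M M'
    using that
  proof cases
    case (row t u r)
    then obtain k where "k \<in> BLv" "emat M' = k * emat M" using elim_row_left_mult[of t u r M] by blast
    then show ?thesis using left em by simp
  next
    case (col t u r)
    then obtain k where "k \<in> BLv" "emat M' = emat M * adjoint N k" using elim_col_right_mult[of t u r M] by blast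
    then show ?thesis using right em by simp
  qed
  have steps: "Inv (emat M') \<longleftrightarrow> Inv (emat M)" if "elim_eqv rhoL rhoL M M'" for M M'
    using that by (induction rule: rtranclp_induct) (auto dest: step)
  have "Inv (1\<^sub>m N)" unfolding Inv_def using R3_one hw_S3 hw eq by simp
  then have gen: "Inv g" if "g \<in> carrier_mat N N" "elim_eqv rhoL rhoL (gent g) (gent (1\<^sub>m N))" for g
    using steps[OF that(2)] emat_gent[OF that(1)] gent_one by simp
  obtain f where f: "f \<in> polyfun" "f (enc (gent (1\<^sub>m N))) \<noteq> 0"
    "\<And>g. g \<in> carrier_mat N N \<Longrightarrow> (\<forall>i j. 1 \<le> i \<longrightarrow> i \<le> N \<longrightarrow> 1 \<le> j \<longrightarrow> j \<le> N \<longrightarrow> blk i \<noteq> blk j \<longrightarrow> g $$ (i - 1, j - 1) = 0)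
      \<Longrightarrow> f (enc (gent g)) \<noteq> 0 \<Longrightarrow> elim_eqv rhoL rhoL (gent g) (gent (1\<^sub>m N))"
    using Levi_generic_elimination by blast
  \<comment> \<open>The line from the identity to \<open>g\<close>. Its points are block diagonal
    but possibly singular, which is harmless: matrix coefficients and elimination make sense for
    every such matrix.\<close>
  define G where "G = (\<lambda>s. mat N N (\<lambda>(i, j). (if i = j then 1 else 0) + s * (g $$ (i, j) - (if i = j then 1 else 0))))"
  have gc: "g \<in> carrier_mat N N" using g by (rule Levi_carrier)
  have G0: "G 0 = 1\<^sub>m N" and G1: "G 1 = g" using gc by (auto simp: G_def)
  have Gc: "G s \<in> carrier_mat N N" for s by (simp add: G_def)
  have entry: "(\<lambda>s. G s $$ (i, j)) \<in> polyline" if "i < N" "j < N" for i j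
    using that unfolding G_def
    by (auto intro!: fun_alg_add[OF fun_alg_polyline] fun_alg_mult[OF fun_alg_polyline] fun_alg_const[OF fun_alg_polyline] polyline_id)
  have block: "G s $$ (i - 1, j - 1) = 0" if ij: "1 \<le> i" "i \<le> N" "1 \<le> j" "j \<le> N" "blk i \<noteq> blk j" for s i j
  proof -
    have "i - 1 \<noteq> j - 1"
    proof
      assume "i - 1 = j - 1"
      then have "i = j" using ij by linarith
      then show False using ij(5) by simp
    qed
    moreover have "i - 1 < N" "j - 1 < N" using ij by linarith+
    ultimately show ?thesis using Levi_entry[OF g ij] by (simp add: G_def)
  qed
  have minor_pl: "(\<lambda>s. minor (G s) p r) \<in> polyline" if p: "p \<in> Idn d N" and r: "r \<in> Idn d N" for p r
    unfolding minor_dt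
  proof (rule fun_alg_dt[OF fun_alg_polyline])
    fix i j assume "i < length p" "j < length p"
    then have "p ! i - 1 < N" "r ! j - 1 < N"
      using Idn_nth[OF p, of i] Idn_nth[OF r, of j] Idn_length[OF p] by auto
    then show "(\<lambda>s. G s $$ (p ! i - 1, r ! j - 1)) \<in> polyline" by (rule entry)
  qed
  have minor3_pl: "(\<lambda>s. minor3 (G s) j j') \<in> polyline" if "j \<in> T3" "j' \<in> T3" for j j'
    using that unfolding minor3_def T3_def
    by (cases j; cases j') (auto intro!: fun_alg_mult[OF fun_alg_polyline] minor_pl)
  have coeff: "(\<lambda>s. ip3 (R3 (G s) u) v) \<in> polyline" for u v
  proof -
    have "(\<lambda>s. ip3 (R3 (G s) u) v) = (\<lambda>s. \<Sum>j'\<in>T3. (\<Sum>j\<in>T3. u j * minor3 (G s) j j') * cnj (v j'))"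
      by (simp add: ip_def R3_def)
    also have "\<dots> \<in> polyline"
      by (intro fun_alg_sum[OF fun_alg_polyline] fun_alg_mult[OF fun_alg_polyline] fun_alg_const[OF fun_alg_polyline] minor3_pl)
    finally show ?thesis .
  qed
  define D where "D = (\<lambda>s. ip3 (R3 (G s) a) c - ip3 (R3 (G s) a') c')"
  have D: "D \<in> polyline" unfolding D_def by (intro fun_alg_diff[OF fun_alg_polyline] coeff)
  have E: "(\<lambda>s. f (enc (gent (G s)))) \<in> polyline"
  proof (rule polyfun_comp[OF fun_alg_polyline f(1)])
    fix r
    show "(\<lambda>s. enc (gent (G s)) r) \<in> polyline"
      unfolding enc_def gent_def by (intro fun_alg_if fun_alg_const[OF fun_alg_polyline] entry) auto
  qed
  have DE: "D s = 0 \<or> f (enc (gent (G s))) = 0" for s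
  proof (rule disjCI)
    assume "f (enc (gent (G s))) \<noteq> 0"
    then have "Inv (G s)" using gen[OF Gc f(3)[OF Gc]] block by blast
    then show "D s = 0" by (simp add: D_def Inv_def)
  qed
  have "D 1 = 0"
  proof (rule ccontr)
    assume "D 1 \<noteq> 0"
    then have "finite {s. D s = 0}" by (rule polyline_zeros_finite[OF D])
    moreover have "finite {s. f (enc (gent (G s))) = 0}"
      by (rule polyline_zeros_finite[OF E, of 0]) (use f(2) G0 in simp)
    ultimately have "finite ({s. D s = 0} \<union> {s. f (enc (gent (G s))) = 0})" by (rule finite_UnI)
    moreover have "{s. D s = 0} \<union> {s. f (enc (gent (G s))) = 0} = UNIV" using DE by blast
    ultimately show False using infinite_UNIV_char_0[where 'a = complex] by (simp only:)
  qed
  then show ?thesis by (simp add: D_def G1)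
qed

section \<open>Submodules generated by one vector\<close>

definition submod :: "(triple \<Rightarrow> complex) set \<Rightarrow> bool" where
  "submod M \<longleftrightarrow> M \<subseteq> S3 \<and> vec_subspace M \<and> (\<forall>g\<in>L. \<forall>v\<in>M. R3 g v \<in> M)"

definition gen :: "(triple \<Rightarrow> complex) \<Rightarrow> (triple \<Rightarrow> complex) set" where
  "gen v = {u \<in> S3. \<forall>M. submod M \<and> v \<in> M \<longrightarrow> u \<in> M}"

lemma gen_minimal: "submod M \<Longrightarrow> v \<in> M \<Longrightarrow> gen v \<subseteq> M"
  by (auto simp: gen_def)

lemma gen_mem: "v \<in> S3 \<Longrightarrow> v \<in> gen v"
  by (auto simp: gen_def)

lemma gen_submod: "submod (gen v)"
  unfolding submod_def
proof (intro conjI ballI)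
  show "gen v \<subseteq> S3" by (auto simp: gen_def)
  show "vec_subspace (gen v)"
    using S3_subspace unfolding vec_subspace_def gen_def submod_def by (auto; blast)
  show "R3 g u \<in> gen v" if "g \<in> L" "u \<in> gen v" for g u
    using that R3_S3 unfolding gen_def by (auto simp: submod_def)
qed

text \<open>The vectors all of whose translates are orthogonal to \<open>u\<close> form a submodule,
  and \<open>v\<close> belongs to it.\<close>

lemma gen_orthogonal1:
  assumes u: "u \<in> S3" and v: "v \<in> S3" and o: "\<And>g. g \<in> L \<Longrightarrow> ip3 (R3 g v) u = 0" and x: "x \<in> gen v"
  shows "ip3 x u = 0"
proof -
  let ?M = "{x \<in> S3. \<forall>g\<in>L. ip3 (R3 g x) u = 0}"
  have "submod ?M"
    unfolding submod_def
  proof (intro conjI ballI)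
    show "vec_subspace ?M"
      using S3_subspace unfolding vec_subspace_def by (auto simp: R3_add R3_scale R3_zero ip_linear)
    show "R3 k x \<in> ?M" if "k \<in> L" "x \<in> ?M" for k x
    proof -
      have "ip3 (R3 g (R3 k x)) u = 0" if "g \<in> L" for g
        using \<open>x \<in> ?M\<close> Levi_mult[OF \<open>k \<in> L\<close> that] R3_mult[OF Levi_carrier Levi_carrier, OF \<open>k \<in> L\<close> that, of x] by auto
      then show ?thesis using R3_S3 that by auto
    qed
  qed auto
  then have "gen v \<subseteq> ?M" by (rule gen_minimal) (use v o in auto)
  moreover have "1\<^sub>m N \<in> L" using BLvI[of "1\<^sub>m N"] by (auto split: if_splits)
  ultimately have "ip3 (R3 (1\<^sub>m N) x) u = 0" "x \<in> S3" using x by auto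
  then show ?thesis using R3_one by simp
qed

lemma gen_orthogonal:
  assumes u: "u \<in> S3" and v: "v \<in> S3" and o: "\<And>g. g \<in> L \<Longrightarrow> ip3 (R3 g v) u = 0" and x: "x \<in> gen v" and y: "y \<in> gen u"
  shows "ip3 x y = 0"
proof -
  have xS: "x \<in> S3" using x by (simp add: gen_def)
  have "ip3 (R3 g u) x = 0" if g: "g \<in> L" for g
  proof -
    have "R3 (adjoint N g) x \<in> gen v" using gen_submod x adjoint_Levi[OF g] by (auto simp: submod_def)
    then have "ip3 (R3 (adjoint N g) x) u = 0" using gen_orthogonal1[OF u v] o by blast
    then have "ip3 x (R3 g u) = 0" by (simp add: R3_adjoint adjoint_adjoint[OF Levi_carrier[OF g]])
    then show ?thesis using ip_zero_commute by metis
  qed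
  then have "ip3 y x = 0" by (rule gen_orthogonal1[OF xS u _ y])
  then show ?thesis using ip_zero_commute by metis
qed

lemma R3_submod: "submod M \<Longrightarrow> g \<in> L \<Longrightarrow> v \<in> M \<Longrightarrow> R3 g v \<in> M"
  by (auto simp: submod_def)

text \<open>The projection \<open>p\<close> of \<open>v\<close> to \<open>M\<close> is again a
  highest weight vector of the same weight. Its part orthogonal to \<open>v\<close> is orthogonal to
  all of \<open>gen v\<close> by the coefficient lemma, yet lies in \<open>gen v\<close>; so
  \<open>p\<close> is a multiple of \<open>v\<close>. Either \<open>v\<close> lies in
  \<open>M\<close>, or \<open>v\<close> is orthogonal to \<open>M\<close>.\<close>

lemma gen_irreducible:
  assumes hv: "hw \<chi> v" and chi: "\<And>g. g \<in> BLv \<Longrightarrow> \<chi> g \<noteq> 0" and M: "submod M" "M \<subseteq> gen v"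
  shows "M = {\<lambda>j. 0} \<or> M = gen v"
proof (cases "v = (\<lambda>j. 0)")
  case True
  have "submod {\<lambda>j. 0}"
    using vec_subspace_zero[OF S3_subspace] by (auto simp: submod_def vec_subspace_def R3_zero)
  then have "gen v \<subseteq> {\<lambda>j. 0}" by (rule gen_minimal) (simp add: True)
  moreover have "(\<lambda>j. 0) \<in> M" using M(1) vec_subspace_zero unfolding submod_def by blast
  ultimately show ?thesis using M(2) by blast
next
  case False
  have MV: "vec_subspace M" and MS: "M \<subseteq> S3" using M(1) by (auto simp: submod_def)
  have vS: "v \<in> S3" using hv by (rule hw_S3)
  have vv: "ip3 v v \<noteq> 0" using ip3_eq_0[OF vS] False by blast
  obtain p where p: "p \<in> M" "\<And>m. m \<in> M \<Longrightarrow> ip3 (\<lambda>j. v j - p j) m = 0"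
  proof (rule orthogonal_projection[OF finite_T3 MV, where v = v])
    show "u j = 0" if "u \<in> M" "j \<notin> T3" for u j
      using that MS by (auto simp: S3_def simp del: split_paired_All)
  qed blast
  have pS: "p \<in> S3" using p(1) MS by blast
  have hp: "hw \<chi> p"
    unfolding hw_def
  proof (intro conjI pS ballI)
    fix g assume g: "g \<in> BLv"
    then have gL: "g \<in> L" by simp
    \<comment> \<open>\<open>z\<close> lies in \<open>M\<close>. It is orthogonal to itself, because
      \<open>v - p\<close> and its translates are orthogonal to \<open>M\<close> and
      \<open>v\<close> is an eigenvector.\<close>
    define z where "z = (\<lambda>j. R3 g p j - \<chi> g * p j)"
    have zM: "z \<in> M" unfolding z_def
      by (intro vec_subspace_diff[OF MV] vec_subspace_scale[OF MV] R3_submod[OF M(1) gL] p(1))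
    have "ip3 (R3 g (\<lambda>j. v j - p j)) z = 0"
      unfolding R3_adjoint by (rule p(2)[OF R3_submod[OF M(1) adjoint_Levi[OF gL] zM]])
    then have o1: "ip3 (\<lambda>j. \<chi> g * v j - R3 g p j) z = 0" using hwD[OF hv g] by (simp add: R3_diff)
    have o2: "ip3 (\<lambda>j. \<chi> g * (v j - p j)) z = 0" using p(2)[OF zM] by (simp add: ip_scale_left)
    have "z = (\<lambda>j. \<chi> g * (v j - p j) - (\<chi> g * v j - R3 g p j))" by (simp add: z_def algebra_simps)
    from arg_cong[OF this, of "\<lambda>u. ip3 u z"]
    have "ip3 z z = ip3 (\<lambda>j. \<chi> g * (v j - p j)) z - ip3 (\<lambda>j. \<chi> g * v j - R3 g p j) z"
      unfolding ip_diff_left[of T3 "\<lambda>j. \<chi> g * (v j - p j)"] .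
    then have "ip3 z z = 0" unfolding o1 o2 by simp
    moreover have "z \<in> S3" using zM MS by blast
    ultimately have "z = (\<lambda>j. 0)" using ip3_eq_0 by blast
    then show "R3 g p = (\<lambda>j. \<chi> g * p j)" by (auto simp: z_def fun_eq_iff)
  qed
  define \<kappa> where "\<kappa> = ip3 p v / ip3 v v"
  define p0 where "p0 = (\<lambda>j. 1 * p j + (- \<kappa>) * v j)"
  have hp0: "hw \<chi> p0" unfolding p0_def by (rule hw_combine[OF hp hv])
  have p0v: "ip3 p0 v = 0" unfolding p0_def ip_add_left ip_scale_left using vv by (simp add: \<kappa>_def)
  have "ip3 (R3 g v) p0 = 0" if g: "g \<in> L" for g
    using hw_matrix_coefficient[OF hv hp0 hw_zero hw_zero chi _ g] p0v ip_zero_commute[of T3 p0 v]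
    by (simp add: R3_zero ip_linear)
  then have orth: "ip3 x p0 = 0" if "x \<in> gen v" for x
    by (rule gen_orthogonal1[OF hw_S3[OF hp0] vS _ that])
  have "p0 \<in> gen v"
    unfolding p0_def using gen_submod[of v] p(1) M(2) gen_mem[OF vS]
    by (intro vec_subspace_add vec_subspace_scale) (auto simp: submod_def)
  then have "p0 = (\<lambda>j. 0)" using orth ip3_eq_0[OF hw_S3[OF hp0]] by blast
  then have pk: "p = (\<lambda>j. \<kappa> * v j)" by (auto simp: p0_def fun_eq_iff)
  show ?thesis
  proof (cases "\<kappa> = 0")
    case False
    have "v = (\<lambda>j. 1 / \<kappa> * p j)" using False by (simp add: pk)
    then have "v \<in> M" using vec_subspace_scale[OF MV p(1), of "1 / \<kappa>"] by simp
    then show ?thesis using gen_minimal[OF M(1)] M(2) by blast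
  next
    \<comment> \<open>Now \<open>v\<close> is orthogonal to \<open>M\<close>. Moving group elements
      to the other side by the adjoint, so are all its translates, hence all of
      \<open>gen v\<close>, which contains \<open>M\<close>.\<close>
    case True
    then have p00: "p = (\<lambda>j. 0)" using pk by simp
    have "m = (\<lambda>j. 0)" if m: "m \<in> M" for m
    proof -
      have mS: "m \<in> S3" and mg: "m \<in> gen v" using m MS M(2) by auto
      have "ip3 (R3 g v) m = 0" if g: "g \<in> L" for g
        using p(2)[OF R3_submod[OF M(1) adjoint_Levi[OF g] m]] p00 by (simp add: R3_adjoint)
      then have "ip3 m m = 0" using gen_orthogonal1[OF mS vS _ mg] by blast
      then show ?thesis by (rule ip3_eq_0[OF mS])
    qed
    moreover have "(\<lambda>j. 0) \<in> M" using MV by (rule vec_subspace_zero)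
    ultimately show ?thesis by blast
  qed
qed

section \<open>Passage from coefficient vectors to functions on the cone\<close>

definition fn :: "(triple \<Rightarrow> complex) \<Rightarrow> (nat list \<Rightarrow> complex) \<Rightarrow> complex" where
  "fn v = (\<lambda>x. if x \<in> X then psi v x else 0)"

lemma fn_coord_ring: "fn v \<in> coord_ring d N w"
proof -
  have "(\<lambda>x. phi3 x j) \<in> polyfun" for j
    by (cases j) (auto simp: phi3_def intro!: polyfun.intros)
  then have "(\<lambda>x. psi v x) \<in> polyfun"
    unfolding psi_def by (intro fun_alg_sum[OF fun_alg_polyfun] fun_alg_cmult[OF fun_alg_polyfun])
  then show ?thesis unfolding coord_ring_def fn_def by blast
qed

lemma fn_inj: "u \<in> S3 \<Longrightarrow> v \<in> S3 \<Longrightarrow> fn u = fn v \<Longrightarrow> u = v"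
  by (rule psi_inj2) (auto simp: fn_def fun_eq_iff split: if_splits)

lemma fn_add: "fn (\<lambda>j. u j + v j) = (\<lambda>x. fn u x + fn v x)"
  and fn_scale: "fn (\<lambda>j. c * u j) = (\<lambda>x. c * fn u x)"
  and fn_zero: "fn (\<lambda>j. 0) = (\<lambda>x. 0)"
  by (auto simp: fn_def psi_add psi_scale psi_zero fun_eq_iff)

lemma fn_tr: "g \<in> L \<Longrightarrow> tr g (fn v) = fn (R3 g v)"
  using X_Levi by (auto simp: tr_def fn_def psi_R3 fun_eq_iff)

lemma fn_Lsubmod: "submod M \<Longrightarrow> Lsubmod d N w js (fn ` M)"
  unfolding Lsubmod_iff
proof (intro conjI ballI)
  assume M: "submod M"
  then have V: "vec_subspace M" by (simp add: submod_def)
  show "fn ` M \<subseteq> coord_ring d N w" using fn_coord_ring by blast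
  show "is_subspace (fn ` M)"
    unfolding is_subspace_def
  proof (intro conjI ballI allI)
    show "(\<lambda>x. 0) \<in> fn ` M" using vec_subspace_zero[OF V] fn_zero by (metis imageI)
    fix f assume f: "f \<in> fn ` M"
    show "(\<lambda>x. f x + g x) \<in> fn ` M" if g: "g \<in> fn ` M" for g
    proof -
      obtain u v where uv: "u \<in> M" "v \<in> M" "f = fn u" "g = fn v" using f g by blast
      have "fn (\<lambda>j. u j + v j) \<in> fn ` M" using vec_subspace_add[OF V uv(1,2)] by (rule imageI)
      then show ?thesis unfolding fn_add uv(3,4) .
    qed
    show "(\<lambda>x. c * f x) \<in> fn ` M" for c
    proof -
      obtain u where u: "u \<in> M" "f = fn u" using f by blast
      have "fn (\<lambda>j. c * u j) \<in> fn ` M" using vec_subspace_scale[OF V u(1)] by (rule imageI)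
      then show ?thesis unfolding fn_scale u(2) .
    qed
  qed
  show "tr g f \<in> fn ` M" if "g \<in> L" "f \<in> fn ` M" for g f
    using that R3_submod[OF M] fn_tr by auto
qed

text \<open>\<open>fn\<close> is injective on \<open>S3\<close> and intertwines \<open>R3\<close>
  with \<open>tr\<close>, so submodules of the image are images of submodules of
  \<open>gen v\<close>.\<close>

lemma fn_Lirred:
  assumes hv: "hw \<chi> v" and chi: "\<And>g. g \<in> BLv \<Longrightarrow> \<chi> g \<noteq> 0" and v0: "v \<noteq> (\<lambda>j. 0)"
  shows "Lirred d N w js (fn ` gen v)"
  unfolding Lirred_def
proof (intro conjI allI impI)
  have vS: "v \<in> S3" using hv by (rule hw_S3)
  have gS: "gen v \<subseteq> S3" by (auto simp: gen_def)
  have zS: "(\<lambda>j. 0) \<in> S3" using vec_subspace_zero[OF S3_subspace] .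
  show "Lsubmod d N w js (fn ` gen v)" by (rule fn_Lsubmod[OF gen_submod])
  show "fn ` gen v \<noteq> {\<lambda>x. 0}"
  proof
    assume "fn ` gen v = {\<lambda>x. 0}"
    then have "fn v = fn (\<lambda>j. 0)" using gen_mem[OF vS] fn_zero by (metis imageI singletonD)
    then show False using fn_inj[OF vS zS] v0 by blast
  qed
  fix V assume V: "Lsubmod d N w js V \<and> V \<subseteq> fn ` gen v"
  define M where "M = {u \<in> gen v. fn u \<in> V}"
  have VM: "V = fn ` M" using V by (auto simp: M_def)
  have sV: "is_subspace V" and tV: "\<And>g f. g \<in> L \<Longrightarrow> f \<in> V \<Longrightarrow> tr g f \<in> V" using V by (auto simp: Lsubmod_iff)
  have gv: "vec_subspace (gen v)" using gen_submod by (simp add: submod_def)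
  have "submod M"
    unfolding submod_def
  proof (intro conjI ballI)
    show "M \<subseteq> S3" using gS by (auto simp: M_def)
    show "vec_subspace M"
      unfolding vec_subspace_def M_def
      using vec_subspace_zero[OF gv] vec_subspace_add[OF gv] vec_subspace_scale[OF gv]
        subspace_0[OF sV] subspace_add[OF sV] subspace_scale[OF sV]
      by (auto simp: fn_add fn_scale fn_zero)
    show "R3 g u \<in> M" if "g \<in> L" "u \<in> M" for g u
      using that tV[of g "fn u"] R3_submod[OF gen_submod] by (auto simp: M_def fn_tr)
  qed
  moreover have "M \<subseteq> gen v" by (auto simp: M_def)
  ultimately have "M = {\<lambda>j. 0} \<or> M = gen v" using gen_irreducible[OF hv] chi by blast
  then show "V = {\<lambda>x. 0} \<or> V = fn ` gen v" using VM fn_zero by auto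
qed

lemma hw_pair_not_mult_free_aux:
  assumes h1: "hw \<chi> v1" and h2: "hw \<chi> v2" and chi: "\<And>g. g \<in> BLv \<Longrightarrow> \<chi> g \<noteq> 0"
    and nz: "ip3 v1 v1 \<noteq> 0" and norm: "ip3 v1 v1 = ip3 v2 v2" and orth: "ip3 v1 v2 = 0"
  shows "\<not> mult_free d N w js"
proof -
  have S: "v1 \<in> S3" "v2 \<in> S3" using hw_S3 h1 h2 by auto
  have v10: "v1 \<noteq> (\<lambda>j. 0)" and v20: "v2 \<noteq> (\<lambda>j. 0)" using nz norm by (auto simp: ip_linear)
  have orth': "ip3 v2 v1 = 0" using orth ip_zero_commute by metis
  have c12: "ip3 (R3 g v1) v2 = 0" if "g \<in> L" for g
    using hw_matrix_coefficient[OF h1 h2 hw_zero hw_zero chi _ that] orth by (simp add: R3_zero ip_linear)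
  have c21: "ip3 (R3 g v2) v1 = 0" if "g \<in> L" for g
    using hw_matrix_coefficient[OF h2 h1 hw_zero hw_zero chi _ that] orth' by (simp add: R3_zero ip_linear)
  \<comment> \<open>Equality of norms enters here: it is the agreement at 1 of the two coefficient
    functions.\<close>
  have c11: "ip3 (R3 g v1) v1 = ip3 (R3 g v2) v2" if "g \<in> L" for g
    by (rule hw_matrix_coefficient[OF h1 h1 h2 h2 chi norm that])
  have gen12: "ip3 x y = 0" if "x \<in> gen v1" "y \<in> gen v2" for x y
    by (rule gen_orthogonal[OF S(2,1) c12 that])
  have gen21: "ip3 x y = 0" if "x \<in> gen v2" "y \<in> gen v1" for x y
    by (rule gen_orthogonal[OF S(1,2) c21 that])
  define \<alpha> where "\<alpha> = (\<lambda>j. v1 j + v2 j)"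
  define \<beta> where "\<beta> = (\<lambda>j. v1 j - v2 j)"
  have abS: "\<alpha> \<in> S3" "\<beta> \<in> S3" unfolding \<alpha>_def \<beta>_def
    using S vec_subspace_add[OF S3_subspace] vec_subspace_diff[OF S3_subspace] by auto
  have "ip3 (R3 g \<alpha>) \<beta> = 0" if "g \<in> L" for g
    using c12[OF that] c21[OF that] c11[OF that] by (simp add: \<alpha>_def \<beta>_def R3_add ip_linear)
  then have ab: "ip3 x y = 0" if "x \<in> gen \<alpha>" "y \<in> gen \<beta>" for x y
    by (rule gen_orthogonal[OF abS(2,1) _ that])
  have Rb: "R3 g \<beta> \<in> gen \<beta>" if "g \<in> L" for g using R3_submod[OF gen_submod that gen_mem[OF abS(2)]] .
  have Rv: "R3 g v1 \<in> gen v1" "R3 g v2 \<in> gen v2" if "g \<in> L" for g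
    using R3_submod[OF gen_submod that gen_mem] S by auto
  \<comment> \<open>A member of \<open>gen \<alpha>\<close> is orthogonal to all translates of
    \<open>\<beta>\<close>, a member of \<open>gen v2\<close> to all translates of
    \<open>v1\<close>; hence \<open>u\<close> is orthogonal to all translates of \<open>v2\<close>,
    and so to itself. With \<open>uniq1\<close> this makes the relation \<open>rel\<close> below
    single valued in both directions.\<close>
  have uniq2: "u = (\<lambda>j. 0)" if u: "u \<in> gen v2" "u \<in> gen \<alpha>" for u
  proof -
    have uS: "u \<in> S3" using u by (simp add: gen_def)
    have "ip3 (R3 g v2) u = 0" if g: "g \<in> L" for g
    proof -
      have "ip3 u (R3 g \<beta>) = 0" by (rule ab[OF u(2) Rb[OF g]])
      moreover have "ip3 u (R3 g v1) = 0" by (rule gen21[OF u(1) Rv(1)[OF g]])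
      ultimately have "ip3 u (R3 g v2) = 0" by (simp add: \<beta>_def R3_diff ip_linear)
      then show ?thesis using ip_zero_commute by metis
    qed
    then have "ip3 u u = 0" by (rule gen_orthogonal1[OF uS S(2) _ u(1)])
    then show ?thesis by (rule ip3_eq_0[OF uS])
  qed
  have uniq1: "u = (\<lambda>j. 0)" if u: "u \<in> gen v1" "u \<in> gen \<alpha>" for u
  proof -
    have uS: "u \<in> S3" using u by (simp add: gen_def)
    have "ip3 (R3 g v1) u = 0" if g: "g \<in> L" for g
    proof -
      have "ip3 u (R3 g \<beta>) = 0" by (rule ab[OF u(2) Rb[OF g]])
      moreover have "ip3 u (R3 g v2) = 0" by (rule gen12[OF u(1) Rv(2)[OF g]])
      ultimately have "ip3 u (R3 g v1) = 0" by (simp add: \<beta>_def R3_diff ip_linear)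
      then show ?thesis using ip_zero_commute by metis
    qed
    then have "ip3 u u = 0" by (rule gen_orthogonal1[OF uS S(1) _ u(1)])
    then show ?thesis by (rule ip3_eq_0[OF uS])
  qed
  have vs: "vec_subspace (gen v)" for v using gen_submod by (simp add: submod_def)
  define rel where "rel = (\<lambda>u1 u2. u1 \<in> gen v1 \<and> u2 \<in> gen v2 \<and> (\<lambda>j. u1 j + u2 j) \<in> gen \<alpha>)"
  have rel_add: "rel (\<lambda>j. u j + u' j) (\<lambda>j. z j + z' j)" if "rel u z" "rel u' z'" for u z u' z'
  proof -
    have "(\<lambda>j. (u j + z j) + (u' j + z' j)) \<in> gen \<alpha>" using that vec_subspace_add[OF vs] by (auto simp: rel_def)
    also have "(\<lambda>j. (u j + z j) + (u' j + z' j)) = (\<lambda>j. (u j + u' j) + (z j + z' j))" by (simp add: algebra_simps)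
    finally show ?thesis using that vec_subspace_add[OF vs] by (auto simp: rel_def)
  qed
  have rel_scale: "rel (\<lambda>j. c * u j) (\<lambda>j. c * z j)" if "rel u z" for c u z
  proof -
    have "(\<lambda>j. c * (u j + z j)) \<in> gen \<alpha>" using that vec_subspace_scale[OF vs] by (auto simp: rel_def)
    then show ?thesis using that vec_subspace_scale[OF vs] by (auto simp: rel_def algebra_simps)
  qed
  have rel_R: "rel (R3 g u) (R3 g z)" if "rel u z" "g \<in> L" for g u z
    using that R3_submod[OF gen_submod that(2), of "\<lambda>j. u j + z j" \<alpha>] R3_submod[OF gen_submod that(2)]
    by (auto simp: rel_def R3_add)
  have rel_zero: "rel (\<lambda>j. 0) (\<lambda>j. 0)" using vec_subspace_zero[OF vs] by (simp add: rel_def)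
  have rel_v: "rel v1 v2" using gen_mem S abS by (simp add: rel_def \<alpha>_def)
  have ex2: "\<exists>z. rel u z" if "u \<in> gen v1" for u
  proof -
    have "submod {u \<in> gen v1. \<exists>z. rel u z}"
      unfolding submod_def vec_subspace_def
      using gen_submod[of v1] rel_add rel_scale rel_R rel_zero
      by (auto simp: submod_def vec_subspace_def) blast+
    then have "gen v1 \<subseteq> {u \<in> gen v1. \<exists>z. rel u z}"
      by (rule gen_minimal) (use rel_v gen_mem S in auto)
    then show ?thesis using that by blast
  qed
  have ex1: "\<exists>u. rel u z" if "z \<in> gen v2" for z
  proof -
    have "submod {z \<in> gen v2. \<exists>u. rel u z}"
      unfolding submod_def vec_subspace_def
      using gen_submod[of v2] rel_add rel_scale rel_R rel_zero
      by (auto simp: submod_def vec_subspace_def) blast+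
    then have "gen v2 \<subseteq> {z \<in> gen v2. \<exists>u. rel u z}"
      by (rule gen_minimal) (use rel_v gen_mem S in auto)
    then show ?thesis using that by blast
  qed
  have un2: "z = z'" if "rel u z" "rel u z'" for u z z'
  proof -
    have "rel (\<lambda>j. u j + (-1) * u j) (\<lambda>j. z j + (-1) * z' j)" by (rule rel_add[OF that(1) rel_scale[OF that(2)]])
    then have "(\<lambda>j. z j + (-1) * z' j) = (\<lambda>j. 0)" by (intro uniq2) (auto simp: rel_def)
    then show ?thesis by (auto simp: fun_eq_iff)
  qed
  have un1: "u = u'" if "rel u z" "rel u' z" for u u' z
  proof -
    have "rel (\<lambda>j. u j + (-1) * u' j) (\<lambda>j. z j + (-1) * z j)" by (rule rel_add[OF that(1) rel_scale[OF that(2)]])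
    then have "(\<lambda>j. u j + (-1) * u' j) = (\<lambda>j. 0)" by (intro uniq1) (auto simp: rel_def)
    then show ?thesis by (auto simp: fun_eq_iff)
  qed
  define \<theta> where "\<theta> = (\<lambda>u. SOME z. rel u z)"
  have th: "rel u (\<theta> u)" if "u \<in> gen v1" for u unfolding \<theta>_def using ex2[OF that] by (rule someI_ex)
  have th_eq: "\<theta> u = z" if "rel u z" for u z using un2[OF th that] that by (auto simp: rel_def)
  have gS: "gen v \<subseteq> S3" for v by (auto simp: gen_def)
  have fn_inj_on: "inj_on fn (gen v)" for v using fn_inj gS by (intro inj_onI) blast
  define \<phi> where "\<phi> = (\<lambda>f. fn (\<theta> (inv_into (gen v1) fn f)))"
  have phi: "\<phi> (fn u) = fn (\<theta> u)" if "u \<in> gen v1" for u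
    unfolding \<phi>_def using inv_into_f_f[OF fn_inj_on that] by simp
  have "Liso d N w js (fn ` gen v1) (fn ` gen v2)"
    unfolding Liso_def
  proof (intro exI[of _ \<phi>] conjI ballI allI)
    show "bij_betw \<phi> (fn ` gen v1) (fn ` gen v2)"
    proof (rule bij_betwI')
      fix f f' assume "f \<in> fn ` gen v1" "f' \<in> fn ` gen v1"
      then obtain u u' where u: "u \<in> gen v1" "f = fn u" "u' \<in> gen v1" "f' = fn u'" by blast
      have t: "\<theta> u \<in> gen v2" "\<theta> u' \<in> gen v2" using th u by (auto simp: rel_def)
      show "(\<phi> f = \<phi> f') = (f = f')"
      proof
        assume "\<phi> f = \<phi> f'"
        then have "\<theta> u = \<theta> u'" using phi u fn_inj t gS by (metis subsetD)
        then have "u = u'" using un1 th u by metis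
        then show "f = f'" using u by simp
      qed simp
    next
      fix f assume "f \<in> fn ` gen v1"
      then show "\<phi> f \<in> fn ` gen v2" using phi th by (auto simp: rel_def)
    next
      fix f' assume "f' \<in> fn ` gen v2"
      then obtain z where z: "z \<in> gen v2" "f' = fn z" by blast
      then obtain u where u: "rel u z" using ex1 by blast
      have "\<theta> u = z" using u by (rule th_eq)
      then have "\<phi> (fn u) = f'" using phi z u by (simp add: rel_def)
      then show "\<exists>f\<in>fn ` gen v1. f' = \<phi> f" using u by (auto simp: rel_def)
    qed
  next
    fix f f' assume "f \<in> fn ` gen v1" "f' \<in> fn ` gen v1"
    then obtain u u' where u: "u \<in> gen v1" "f = fn u" "u' \<in> gen v1" "f' = fn u'" by blast
    have "\<phi> (\<lambda>x. f x + f' x) = fn (\<theta> (\<lambda>j. u j + u' j))"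
      using phi[OF vec_subspace_add[OF vs u(1,3)]] by (simp add: u fn_add)
    also have "\<theta> (\<lambda>j. u j + u' j) = (\<lambda>j. \<theta> u j + \<theta> u' j)" by (rule th_eq[OF rel_add[OF th th]]) (use u in auto)
    finally show "\<phi> (\<lambda>x. f x + f' x) = (\<lambda>x. \<phi> f x + \<phi> f' x)" using phi u by (simp add: fn_add)
  next
    fix c f assume "f \<in> fn ` gen v1"
    then obtain u where u: "u \<in> gen v1" "f = fn u" by blast
    have "\<phi> (\<lambda>x. c * f x) = fn (\<theta> (\<lambda>j. c * u j))"
      using phi[OF vec_subspace_scale[OF vs u(1)]] by (simp add: u fn_scale)
    also have "\<theta> (\<lambda>j. c * u j) = (\<lambda>j. c * \<theta> u j)" by (rule th_eq[OF rel_scale[OF th]]) (use u in auto)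
    finally show "\<phi> (\<lambda>x. c * f x) = (\<lambda>x. c * \<phi> f x)" using phi u by (simp add: fn_scale)
  next
    fix g f assume g: "g \<in> L" and "f \<in> fn ` gen v1"
    then obtain u where u: "u \<in> gen v1" "f = fn u" by blast
    obtain g' where g': "g' \<in> L" "\<And>f. fact d N w g f = tr g' f" using fact_tr[OF g] by blast
    have "\<phi> (tr g' f) = fn (\<theta> (R3 g' u))"
      using phi[OF R3_submod[OF gen_submod g'(1) u(1)]] fn_tr[OF g'(1)] u by simp
    also have "\<theta> (R3 g' u) = R3 g' (\<theta> u)" by (rule th_eq[OF rel_R[OF th[OF u(1)] g'(1)]])
    also have "fn (R3 g' (\<theta> u)) = tr g' (\<phi> f)" using phi[OF u(1)] fn_tr[OF g'(1)] u by simp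
    finally show "\<phi> (fact d N w g f) = fact d N w g (\<phi> f)" by (simp add: g'(2))
  qed
  moreover have "fn ` gen v1 \<noteq> fn ` gen v2"
  proof
    assume "fn ` gen v1 = fn ` gen v2"
    then obtain z where z: "z \<in> gen v2" "fn v1 = fn z" using gen_mem[OF S(1)] by (metis imageE imageI)
    then have "v1 = z" using fn_inj[OF S(1)] gS by blast
    then have "ip3 v1 v1 = 0" using gen12[OF gen_mem[OF S(1)] z(1)] by simp
    then show False using nz by simp
  qed
  moreover have "Lirred d N w js (fn ` gen v1)" "Lirred d N w js (fn ` gen v2)"
    using fn_Lirred[OF h1 chi v10] fn_Lirred[OF h2 chi v20] by auto
  ultimately show ?thesis unfolding mult_free_def by blast
qed

text \<open>The points \<open>x1\<close> and \<open>x2\<close> show that the two functions are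
  independent on the cone. Subtracting the projection of the first representative on the second and
  rescaling the second gives an orthogonal pair of equal norm.\<close>

lemma hw_pair_not_mult_free:
  assumes F: "\<And>j. j \<notin> T3 \<Longrightarrow> F1 j = 0" "\<And>j. j \<notin> T3 \<Longrightarrow> F2 j = 0"
    and e: "\<And>g x. g \<in> BLv \<Longrightarrow> x \<in> X \<Longrightarrow> psi F1 (act g x) = \<chi> g * psi F1 x"
      "\<And>g x. g \<in> BLv \<Longrightarrow> x \<in> X \<Longrightarrow> psi F2 (act g x) = \<chi> g * psi F2 x"
    and chi: "\<And>g. g \<in> BLv \<Longrightarrow> \<chi> g \<noteq> 0"
    and x1: "x1 \<in> X" "psi F1 x1 \<noteq> 0" "psi F2 x1 = 0" and x2: "x2 \<in> X" "psi F2 x2 \<noteq> 0"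
  shows "\<not> mult_free d N w js"
proof -
  obtain u1 where u1: "u1 \<in> S3" "\<And>x. x \<in> X \<Longrightarrow> psi u1 x = psi F1 x" using S3_represent[of F1] F(1) by blast
  obtain u2 where u2: "u2 \<in> S3" "\<And>x. x \<in> X \<Longrightarrow> psi u2 x = psi F2 x" using S3_represent[of F2] F(2) by blast
  have XB: "act g x \<in> X" if "g \<in> BLv" "x \<in> X" for g x using X_Bor that by blast
  have h1: "hw \<chi> u1" unfolding hw_def
  proof (intro conjI u1(1) ballI)
    fix g assume g: "g \<in> BLv"
    show "R3 g u1 = (\<lambda>j. \<chi> g * u1 j)"
      by (rule psi_inj2[OF R3_S3 vec_subspace_scale[OF S3_subspace]])
         (use g u1 e(1)[OF g] XB[OF g] in \<open>auto simp: psi_R3 psi_scale\<close>)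
  qed
  have h2: "hw \<chi> u2" unfolding hw_def
  proof (intro conjI u2(1) ballI)
    fix g assume g: "g \<in> BLv"
    show "R3 g u2 = (\<lambda>j. \<chi> g * u2 j)"
      by (rule psi_inj2[OF R3_S3 vec_subspace_scale[OF S3_subspace]])
         (use g u2 e(2)[OF g] XB[OF g] in \<open>auto simp: psi_R3 psi_scale\<close>)
  qed
  have u20: "ip3 u2 u2 \<noteq> 0"
  proof
    assume "ip3 u2 u2 = 0"
    then have "u2 = (\<lambda>j. 0)" by (rule ip3_eq_0[OF u2(1)])
    then show False using u2(2)[OF x2(1)] x2(2) by (simp add: psi_zero)
  qed
  define c where "c = ip3 u1 u2 / ip3 u2 u2"
  define y where "y = (\<lambda>j. 1 * u1 j + (- c) * u2 j)"
  have hy: "hw \<chi> y" unfolding y_def by (rule hw_combine[OF h1 h2])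
  have yo: "ip3 y u2 = 0" unfolding y_def ip_add_left ip_scale_left using u20 by (simp add: c_def)
  have "psi y x1 = psi F1 x1" unfolding y_def psi_add psi_scale using u1(2)[OF x1(1)] u2(2)[OF x1(1)] x1(3) by simp
  then have "y \<noteq> (\<lambda>j. 0)" using x1(2) by (auto simp: psi_zero)
  then have y0: "ip3 y y \<noteq> 0" using ip3_eq_0 hw_S3[OF hy] by blast
  define ry where "ry = (\<Sum>j\<in>T3. (cmod (y j))\<^sup>2)"
  define r2 where "r2 = (\<Sum>j\<in>T3. (cmod (u2 j))\<^sup>2)"
  have iy: "ip3 y y = of_real ry" and i2: "ip3 u2 u2 = of_real r2" unfolding ry_def r2_def by (rule ip_self)+
  have pos: "ry > 0" "r2 > 0"
  proof -
    have "ry \<noteq> 0" "r2 \<noteq> 0" using y0 u20 unfolding iy i2 by simp_all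
    moreover have "ry \<ge> 0" "r2 \<ge> 0" unfolding ry_def r2_def by (simp_all add: sum_nonneg)
    ultimately show "ry > 0" "r2 > 0" by linarith+
  qed
  define k where "k = sqrt (ry / r2)"
  \<comment> \<open>A mere multiple of \<open>u2\<close>, written as a combination so that
    \<open>hw_combine\<close> applies.\<close>
  define z where "z = (\<lambda>j. 0 * u2 j + of_real k * u2 j)"
  have hz: "hw \<chi> z" unfolding z_def by (rule hw_combine[OF h2 h2])
  have "ip3 z z = of_real (k * k * r2)" unfolding z_def by (simp add: ip_linear i2)
  also have "k * k = ry / r2" using pos by (simp add: k_def)
  finally have nz: "ip3 y y = ip3 z z" using pos iy by simp
  have "ip3 y z = 0" unfolding z_def using yo by (simp add: ip_linear)
  then show ?thesis using hw_pair_not_mult_free_aux[OF hy hz _ y0 nz] chi by blast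
qed

section \<open>Pluecker coordinates that are Borel eigenvectors\<close>

text \<open>Row \<open>i\<close> is supported in columns whose labels belong to \<open>s\<close>,
  and the unit rows at these labels also occur in the minor; so row \<open>i\<close> is a
  combination of other rows.\<close>

lemma cellpt_eq_0:
  assumes s: "s \<in> Idn d N" and i: "i \<in> set s" "i \<notin> set w" and z: "\<And>c. c \<in> set w \<Longrightarrow> c \<notin> set s \<Longrightarrow> M i c = 0"
  shows "cellpt M s = 0"
proof -
  obtain a0 where a0: "a0 < d" "s ! a0 = i" using i(1) Idn_length[OF s] by (metis in_set_conv_nth)
  have "dt d (\<lambda>a. zred M (s ! a)) = 0"
  proof (rule dt_left_kernel[of a0 d "\<lambda>a. if a = a0 then 1 else if s ! a \<in> set w then - M i (s ! a) else 0"])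
    fix j assume j: "j < d"
    show "(\<Sum>a<d. (if a = a0 then 1 else if s ! a \<in> set w then - M i (s ! a) else 0) * zred M (s ! a) j) = 0"
    proof (cases "w ! j \<in> set s")
      case True
      then obtain a1 where a1: "a1 < d" "s ! a1 = w ! j" using Idn_length[OF s] by (metis in_set_conv_nth)
      have ne: "a1 \<noteq> a0" using a0 a1 i w_nth_mem[OF j] by auto
      have "(\<Sum>a<d. (if a = a0 then 1 else if s ! a \<in> set w then - M i (s ! a) else 0) * zred M (s ! a) j)
        = (\<Sum>a<d. (if a = a0 then M i (w ! j) else 0) + (if a = a1 then - M i (w ! j) else 0))"
      proof (rule sum.cong[OF refl])
        fix a assume a: "a \<in> {..<d}"
        have "s ! a = w ! j \<longleftrightarrow> a = a1"
          using a a1 Idn_length[OF s] nth_eq_iff_index_eq[OF Idn_distinct[OF s], of a a1] by auto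
        then show "(if a = a0 then 1 else if s ! a \<in> set w then - M i (s ! a) else 0) * zred M (s ! a) j
          = (if a = a0 then M i (w ! j) else 0) + (if a = a1 then - M i (w ! j) else 0)"
          using a0 a1 ne i(2) w_nth_mem[OF j] by (auto simp: zred_def)
      qed
      also have "\<dots> = 0" using a0 a1 by (simp add: sum.distrib)
      finally show ?thesis .
    next
      case False
      show ?thesis
      proof (rule sum.neutral, rule ballI)
        fix a assume a: "a \<in> {..<d}"
        have "s ! a \<noteq> w ! j" using False a Idn_length[OF s] by (metis lessThan_iff nth_mem)
        moreover have "M i (w ! j) = 0" using z[OF w_nth_mem[OF j] False] .
        ultimately show "(if a = a0 then 1 else if s ! a \<in> set w then - M i (s ! a) else 0) * zred M (s ! a) j = 0"
          using a0 i(2) by (auto simp: zred_def)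
      qed
    qed
  qed (use a0 in auto)
  then show ?thesis using s by (simp add: cellpt_def pl_def)
qed

text \<open>For a vector in the kernel, the unit rows kill the components at columns in
  \<open>s\<close>; for each remaining column the pivot row contains no other unknown. Entries in
  columns of \<open>s\<close> may thus be arbitrary.\<close>

lemma cellpt_neq_0:
  assumes s: "s \<in> Idn d N"
    and pivot: "\<And>c. c \<in> set w \<Longrightarrow> c \<notin> set s \<Longrightarrow>
      \<exists>i\<in>set s - set w. M i c \<noteq> 0 \<and> (\<forall>c'\<in>set w - set s. M i c' \<noteq> 0 \<longrightarrow> c' = c)"
  shows "cellpt M s \<noteq> 0"
proof -
  have "dt d (\<lambda>a. zred M (s ! a)) \<noteq> 0"
  proof (rule dt_nonzero)
    fix v :: "nat \<Rightarrow> complex"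
    assume v: "\<And>a. a < d \<Longrightarrow> (\<Sum>j<d. zred M (s ! a) j * v j) = 0"
    have row: "(\<Sum>j<d. zred M i j * v j) = 0" if "i \<in> set s" for i
      using v that Idn_length[OF s] by (metis in_set_conv_nth)
    have in_s: "v j = 0" if j: "j < d" "w ! j \<in> set s" for j
    proof -
      have "(\<Sum>l<d. zred M (w ! j) l * v l) = (\<Sum>l<d. if l = j then v j else 0)"
        using j w_nth_mem w_nth_eq by (intro sum.cong) (auto simp: zred_def)
      then show ?thesis using row[OF j(2)] j by simp
    qed
    have "v j = 0" if j: "j < d" "w ! j \<notin> set s" for j
    proof -
      obtain i where i: "i \<in> set s" "i \<notin> set w" "M i (w ! j) \<noteq> 0" "\<And>c'. c' \<in> set w - set s \<Longrightarrow> M i c' \<noteq> 0 \<Longrightarrow> c' = w ! j"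
        using pivot[OF w_nth_mem[OF j(1)] j(2)] by blast
      have "(\<Sum>l<d. zred M i l * v l) = (\<Sum>l<d. if l = j then M i (w ! j) * v j else 0)"
      proof (rule sum.cong[OF refl])
        fix l assume l: "l \<in> {..<d}"
        show "zred M i l * v l = (if l = j then M i (w ! j) * v j else 0)"
        proof (cases "l = j")
          case False
          then have "w ! l \<noteq> w ! j" using w_nth_eq j l by simp
          then have "v l = 0 \<or> M i (w ! l) = 0" using in_s[of l] i(4)[of "w ! l"] w_nth_mem[of l] l by auto
          then show ?thesis using False i(2) by (auto simp: zred_def)
        qed (use i(2) in \<open>simp add: zred_def\<close>)
      qed
      then show ?thesis using row[OF i(1)] i(3) j by simp
    qed
    then show "\<forall>j<d. v j = 0" using in_s by blast
  qed
  then show ?thesis using s by (simp add: cellpt_def pl_def)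
qed

text \<open>The content \<open>c\<close> stands for the Pluecker coordinate indexed by the final \<open>c k\<close> elements of each block \<open>k\<close>;
  these are the coordinates that are eigenvectors of the Borel subgroup of the Levi group.\<close>
definition seg :: "nat \<Rightarrow> nat \<Rightarrow> nat set" where "seg k m = {J k - m<..J k}"

definition tauset :: "(nat \<Rightarrow> nat) \<Rightarrow> nat set" where "tauset c = (\<Union>k\<in>{1..b}. seg k (c k))"

definition tau :: "(nat \<Rightarrow> nat) \<Rightarrow> nat list" where "tau c = sorted_list_of_set (tauset c)"

definition valid :: "(nat \<Rightarrow> nat) \<Rightarrow> bool" where
  "valid c \<longleftrightarrow> (\<forall>k\<in>{1..b}. c k \<le> n k) \<and> (\<Sum>k\<in>{1..b}. c k) = d"

lemma seg_mem:
  assumes "k \<in> {1..b}" "m \<le> n k"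
  shows "i \<in> seg k m \<longleftrightarrow> 1 \<le> i \<and> i \<le> N \<and> blk i = k \<and> J k - m < i"
proof -
  have "J (k - 1) \<le> J k - m" using J_n[OF assms(1)] assms(2) by simp
  then show ?thesis using blk_index[OF assms(1), of i] blk_bounds[of i] by (auto simp: seg_def)
qed

lemma tauset_mem_bounded:
  assumes "\<forall>k\<in>{1..b}. c k \<le> n k"
  shows "i \<in> tauset c \<longleftrightarrow> 1 \<le> i \<and> i \<le> N \<and> J (blk i) - c (blk i) < i"
proof -
  have "i \<in> tauset c \<longleftrightarrow> (\<exists>k\<in>{1..b}. i \<in> seg k (c k))" by (simp add: tauset_def)
  also have "\<dots> \<longleftrightarrow> (\<exists>k\<in>{1..b}. 1 \<le> i \<and> i \<le> N \<and> blk i = k \<and> J k - c k < i)"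
    using seg_mem assms by (intro bex_cong refl) blast
  also have "\<dots> \<longleftrightarrow> 1 \<le> i \<and> i \<le> N \<and> J (blk i) - c (blk i) < i"
  proof
    assume a: "1 \<le> i \<and> i \<le> N \<and> J (blk i) - c (blk i) < i"
    then have "blk i \<in> {1..b}" using blk_range[of i] by simp
    then show "\<exists>k\<in>{1..b}. 1 \<le> i \<and> i \<le> N \<and> blk i = k \<and> J k - c k < i"
      by (intro bexI[of _ "blk i"]) (use a in simp_all)
  qed auto
  finally show ?thesis .
qed

lemma tauset_mem: "valid c \<Longrightarrow> i \<in> tauset c \<longleftrightarrow> 1 \<le> i \<and> i \<le> N \<and> J (blk i) - c (blk i) < i"
  unfolding valid_def using tauset_mem_bounded by blast

lemma seg_disjoint: "k \<in> {1..b} \<Longrightarrow> l \<in> {1..b} \<Longrightarrow> m \<le> n k \<Longrightarrow> m' \<le> n l \<Longrightarrow> k \<noteq> l \<Longrightarrow> seg k m \<inter> seg l m' = {}" (is "_ \<Longrightarrow> _ \<Longrightarrow> _ \<Longrightarrow> _ \<Longrightarrow> _ \<Longrightarrow> ?thesis")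
proof -
  assume "k \<in> {1..b}" "l \<in> {1..b}" "m \<le> n k" "m' \<le> n l" "k \<noteq> l"
  then have "i \<notin> seg k m \<or> i \<notin> seg l m'" for i using seg_mem[of k m i] seg_mem[of l m' i] by metis
  then show ?thesis by blast
qed

lemma segments_disjoint:
  assumes "\<forall>k\<in>{1..b}. c k \<le> n k"
  shows "\<forall>k\<in>{1..b}. \<forall>l\<in>{1..b}. k \<noteq> l \<longrightarrow> seg k (c k) \<inter> seg l (c l) = {}"
  using assms by (intro ballI impI seg_disjoint) blast+

lemma finite_seg: "finite (seg k m)"
  by (simp add: seg_def)

lemma card_segments:
  assumes "\<forall>k\<in>{1..b}. c k \<le> n k"
  shows "card (tauset c) = (\<Sum>k\<in>{1..b}. c k)"
proof -
  have "card (tauset c) = (\<Sum>k\<in>{1..b}. card (seg k (c k)))"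
    unfolding tauset_def using finite_seg by (intro card_UN_disjoint segments_disjoint[OF assms]) simp_all
  also have "\<dots> = (\<Sum>k\<in>{1..b}. c k)"
  proof (rule sum.cong[OF refl])
    fix k assume "k \<in> {1..b}"
    then have "c k \<le> J k" using assms J_n[of k] by (metis le_add2 le_trans)
    then show "card (seg k (c k)) = c k" by (simp add: seg_def)
  qed
  finally show ?thesis .
qed

lemma tauset_h: "tauset h = set w"
proof -
  have "i \<in> tauset h \<longleftrightarrow> i \<in> set w" for i
  proof -
    have "i \<in> tauset h \<longleftrightarrow> 1 \<le> i \<and> i \<le> N \<and> J (blk i) - h (blk i) < i"
    proof (rule tauset_mem_bounded)
      show "\<forall>k\<in>{1..b}. h k \<le> n k" using h_le_n by simp
    qed
    then show ?thesis using w_iff[of i] w_range[of i] by (cases "1 \<le> i \<and> i \<le> N") auto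
  qed
  then show ?thesis by blast
qed

lemma valid_h: "valid h"
proof -
  have a: "\<forall>k\<in>{1..b}. h k \<le> n k" using h_le_n by simp
  have "(\<Sum>k\<in>{1..b}. h k) = d" using card_segments[OF a] Idn_card[OF wI] unfolding tauset_h by simp
  with a show ?thesis unfolding valid_def by (rule conjI)
qed

lemma tau_props: assumes "valid c" shows "tau c \<in> Idn d N" "set (tau c) = tauset c"
proof -
  have a: "\<forall>k\<in>{1..b}. c k \<le> n k" and s: "(\<Sum>k\<in>{1..b}. c k) = d"
    using assms unfolding valid_def by (rule conjunct1, rule conjunct2)
  have "tauset c \<subseteq> {1..N}"
  proof
    fix i assume "i \<in> tauset c"
    then have "1 \<le> i \<and> i \<le> N \<and> J (blk i) - c (blk i) < i" unfolding tauset_mem[OF assms] .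
    then show "i \<in> {1..N}" by simp
  qed
  moreover have "card (tauset c) = d" unfolding card_segments[OF a] by (rule s)
  ultimately show "tau c \<in> Idn d N" "set (tau c) = tauset c"
    unfolding tau_def by (rule Idn_sorted_list)+
qed

definition chi :: "(nat \<Rightarrow> nat) \<Rightarrow> complex mat \<Rightarrow> complex" where
  "chi c g = (\<Prod>k\<in>{1..b}. \<Prod>i\<in>seg k (c k). g $$ (i - 1, i - 1))"

text \<open>A nonzero minor of a Borel element of \<open>L\<close> matches every member of
  \<open>tau c\<close> with a member of \<open>s\<close> that is not smaller and lies in the same
  block. Final segments are closed under such moves, so \<open>s\<close> is contained in
  \<open>tau c\<close> and only the diagonal minor remains.\<close>

lemma tau_eigen:
  assumes c: "valid c" and g: "g \<in> BLv"
  shows "act g x (tau c) = chi c g * x (tau c)"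
proof -
  note t = tau_props[OF c]
  have gB: "g \<in> Bor N" and gL: "g \<in> L" using g by auto
  have zero: "minor g (tau c) s = 0" if s: "s \<in> Idn d N" "s \<noteq> tau c" for s
  proof (rule ccontr)
    assume nz: "minor g (tau c) s \<noteq> 0"
    obtain p where p: "p permutes {0..<d}" "\<And>i. i < d \<Longrightarrow> g $$ (tau c ! i - 1, s ! p i - 1) \<noteq> 0"
      "\<And>i. i < d \<Longrightarrow> tau c ! i \<le> s ! p i"
      by (rule minor_upper_count[OF _ t(1) s(1) nz]) (use Bor_lower[OF gB] in auto)
    have plt: "p i < d \<longleftrightarrow> i < d" for i using permutes_in_image[OF p(1), of i] by auto
    have "s ! p i \<in> tauset c" if i: "i < d" for i
    proof -
      have r: "1 \<le> tau c ! i" "tau c ! i \<le> N" "1 \<le> s ! p i" "s ! p i \<le> N"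
        using Idn_nth[OF t(1) i] Idn_nth[OF s(1), of "p i"] plt i by auto
      have "blk (tau c ! i) = blk (s ! p i)" using Levi_entry[OF gL r] p(2)[OF i] by blast
      moreover have "tau c ! i \<in> tauset c" using t i Idn_length[OF t(1)] by (metis nth_mem)
      ultimately show ?thesis using p(3)[OF i] r tauset_mem[OF c] by auto
    qed
    moreover have "set s \<subseteq> (\<lambda>i. s ! p i) ` {..<d}"
    proof
      fix y assume "y \<in> set s"
      then obtain k where k: "k < d" "y = s ! k" using Idn_length[OF s(1)] by (metis in_set_conv_nth)
      then have "k \<in> p ` {..<d}" using permutes_image[OF p(1)] by (simp add: atLeast0LessThan)
      then show "y \<in> (\<lambda>i. s ! p i) ` {..<d}" using k(2) by auto
    qed
    ultimately have "set s \<subseteq> set (tau c)" using t(2) by auto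
    then have "set s = set (tau c)" using Idn_card[OF s(1)] Idn_card[OF t(1)] by (intro card_subset_eq) auto
    then show False using Idn_eqI[OF s(1) t(1)] s(2) by blast
  qed
  have "act g x (tau c) = (\<Sum>s\<in>Idn d N. minor g (tau c) s * x s)" using t(1) by (simp add: wact_def)
  also have "\<dots> = (\<Sum>s\<in>Idn d N. if s = tau c then minor g (tau c) (tau c) * x (tau c) else 0)"
    using zero by (intro sum.cong) auto
  also have "\<dots> = minor g (tau c) (tau c) * x (tau c)" using t(1) Idn_finite[of d N] by simp
  also have "minor g (tau c) (tau c) = (\<Prod>i<d. g $$ (tau c ! i - 1, tau c ! i - 1))"
    unfolding minor_dt Idn_length[OF t(1)]
  proof (rule dt_upper_triangular)
    fix i j assume ij: "i < d" "j < i"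
    then have "tau c ! j < tau c ! i" using Idn_sorted[OF t(1)] Idn_length[OF t(1)] by (simp add: sorted_wrt_nth_less)
    then show "g $$ (tau c ! i - 1, tau c ! j - 1) = 0"
      using Bor_lower[OF gB, of "tau c ! i" "tau c ! j"] Idn_nth[OF t(1), of i] Idn_nth[OF t(1), of j] ij by simp
  qed
  also have "\<dots> = (\<Prod>i\<in>tauset c. g $$ (i - 1, i - 1))"
    using prod.reindex_bij_betw[OF Idn_nth_bij[OF t(1)], of "\<lambda>i. g $$ (i - 1, i - 1)"] t(2) by simp
  also have "\<dots> = chi c g"
    unfolding tauset_def chi_def using c finite_seg unfolding valid_def
    by (intro prod.UNION_disjoint segments_disjoint) simp_all
  finally show ?thesis .
qed

lemma chi_nonzero: "g \<in> BLv \<Longrightarrow> valid c \<Longrightarrow> chi c g \<noteq> 0"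
proof -
  assume g: "g \<in> BLv" and c: "valid c"
  have "g $$ (i - 1, i - 1) \<noteq> 0" if "k \<in> {1..b}" "i \<in> seg k (c k)" for k i
  proof -
    have "1 \<le> i" "i \<le> N" using that seg_mem[of k "c k" i] c by (auto simp: valid_def)
    then have "i - 1 < N" by linarith
    then show ?thesis using g Bor_diag by blast
  qed
  then show ?thesis unfolding chi_def by (auto simp: seg_def)
qed

definition ind3 :: "(nat \<Rightarrow> nat) \<Rightarrow> (nat \<Rightarrow> nat) \<Rightarrow> (nat \<Rightarrow> nat) \<Rightarrow> triple \<Rightarrow> complex" where
  "ind3 c1 c2 c3 = (\<lambda>j. if j = (tau c1, tau c2, tau c3) then 1 else 0)"

lemma psi_ind3:
  assumes "valid c1" "valid c2" "valid c3"
  shows "psi (ind3 c1 c2 c3) x = x (tau c1) * x (tau c2) * x (tau c3)"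
proof -
  have "(tau c1, tau c2, tau c3) \<in> T3" using assms tau_props by (simp add: T3_def)
  then show ?thesis
    using finite_T3 by (simp add: psi_def ind3_def phi3_def if_distrib[of "\<lambda>x. x * _"] cong: if_cong)
qed

text \<open>\<open>eq\<close> expresses that in every block the two triples of contents form the
  same multiset, in the shape in which characters use it: \<open>f m\<close> becomes the product of
  the last \<open>m\<close> diagonal entries of the block.\<close>

lemma content_pair_not_mult_free:
  assumes v: "valid c1" "valid c2" "valid c3" "valid e1" "valid e2" "valid e3"
    and eq: "\<And>k f. f (c1 k) * f (c2 k) * f (c3 k) = (f (e1 k) * f (e2 k) * f (e3 k) :: complex)"
    and x: "x \<in> X" "x (tau c1) \<noteq> 0" "x (tau c2) \<noteq> 0" "x (tau c3) \<noteq> 0" "x (tau e1) = 0 \<or> x (tau e2) = 0 \<or> x (tau e3) = 0"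
    and y: "y \<in> X" "y (tau e1) \<noteq> 0" "y (tau e2) \<noteq> 0" "y (tau e3) \<noteq> 0"
  shows "\<not> mult_free d N w js"
proof -
  define \<chi> where "\<chi> = (\<lambda>g. chi c1 g * chi c2 g * chi c3 g)"
  have chi2: "\<chi> g = chi e1 g * chi e2 g * chi e3 g" for g
    unfolding \<chi>_def chi_def prod.distrib[symmetric]
    by (rule prod.cong[OF refl]) (rule eq)
  show ?thesis
  proof (rule hw_pair_not_mult_free[of "ind3 c1 c2 c3" "ind3 e1 e2 e3" \<chi> x y])
    show "ind3 c1 c2 c3 j = 0" "ind3 e1 e2 e3 j = 0" if "j \<notin> T3" for j
      using that v tau_props by (auto simp: ind3_def T3_def)
    show "psi (ind3 c1 c2 c3) (act g z) = \<chi> g * psi (ind3 c1 c2 c3) z" if "g \<in> BLv" for g z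
      using tau_eigen[OF _ that] v by (simp add: psi_ind3 \<chi>_def)
    show "psi (ind3 e1 e2 e3) (act g z) = \<chi> g * psi (ind3 e1 e2 e3) z" if "g \<in> BLv" for g z
      using tau_eigen[OF _ that] v by (simp add: psi_ind3 chi2)
    show "\<chi> g \<noteq> 0" if "g \<in> BLv" for g using chi_nonzero[OF that] v by (simp add: \<chi>_def)
  qed (use v x y in \<open>auto simp: psi_ind3\<close>)
qed

text \<open>\<open>qv l m\<close> is the element number \<open>m\<close>, counted downwards from 0, of block \<open>l\<close> outside \<open>w\<close>, and \<open>av k m\<close> the
  element number \<open>m\<close>, counted upwards from 0, of block \<open>k\<close> in \<open>w\<close>; in these terms \<open>ups c\<close> and \<open>downs c\<close> are the
  differences \<open>tau c - w\<close> and \<open>w - tau c\<close>.\<close>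
definition qv :: "nat \<Rightarrow> nat \<Rightarrow> nat" where "qv l m = J l - h l - m"

definition av :: "nat \<Rightarrow> nat \<Rightarrow> nat" where "av k m = J k - h k + 1 + m"

definition ups :: "(nat \<Rightarrow> nat) \<Rightarrow> (nat \<times> nat) set" where "ups c = {(l, m). l \<in> {1..b} \<and> m < c l - h l}"

definition downs :: "(nat \<Rightarrow> nat) \<Rightarrow> (nat \<times> nat) set" where "downs c = {(k, m). k \<in> {1..b} \<and> m < h k - c k}"

lemma qv_props:
  assumes "l \<in> {1..b}" "m < q l"
  shows "1 \<le> qv l m" "qv l m \<le> N" "blk (qv l m) = l" "qv l m \<notin> set w"
proof -
  note Jb = J_bounds[OF assms(1)]
  have "J (l - 1) < qv l m" "qv l m \<le> J l" using Jb assms(2) by (auto simp: qv_def)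
  then show r: "1 \<le> qv l m" "qv l m \<le> N" "blk (qv l m) = l" using blk_index[OF assms(1)] by blast+
  show "qv l m \<notin> set w" using w_iff[OF r(1,2)] r(3) by (simp add: qv_def)
qed

lemma av_props:
  assumes "k \<in> {1..b}" "m < h k"
  shows "1 \<le> av k m" "av k m \<le> N" "blk (av k m) = k" "av k m \<in> set w"
proof -
  note Jb = J_bounds[OF assms(1)]
  have "J (k - 1) < av k m" "av k m \<le> J k" using Jb assms(2) by (auto simp: av_def)
  then show r: "1 \<le> av k m" "av k m \<le> N" "blk (av k m) = k" using blk_index[OF assms(1)] by blast+
  show "av k m \<in> set w" using w_iff[OF r(1,2)] r(3) by (simp add: av_def)
qed

lemma ups_range: "valid c \<Longrightarrow> (l, m) \<in> ups c \<Longrightarrow> l \<in> {1..b} \<and> m < q l"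
  by (auto simp: ups_def valid_def q_def) (metis atLeastAtMost_iff diff_le_mono order_less_le_trans Suc_le_eq One_nat_def)

lemma downs_range: "(k, m) \<in> downs c \<Longrightarrow> k \<in> {1..b} \<and> m < h k"
  by (auto simp: downs_def)

lemma tau_minus_w:
  assumes c: "valid c"
  shows "set (tau c) - set w = {qv l m | l m. (l, m) \<in> ups c}"
proof (rule Set.set_eqI, rule iffI)
  fix i assume i: "i \<in> set (tau c) - set w"
  then have r: "1 \<le> i" "i \<le> N" "J (blk i) - c (blk i) < i" using tau_props[OF c] tauset_mem[OF c] by auto
  have "i \<le> J (blk i) - h (blk i)" using w_iff[OF r(1,2)] i by simp
  then have "i = qv (blk i) (J (blk i) - h (blk i) - i)" "J (blk i) - h (blk i) - i < c (blk i) - h (blk i)"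
    using r by (auto simp: qv_def)
  then show "i \<in> {qv l m | l m. (l, m) \<in> ups c}" using blk_range[OF r(1,2)] unfolding ups_def by blast
next
  fix i assume "i \<in> {qv l m | l m. (l, m) \<in> ups c}"
  then obtain l m where lm: "i = qv l m" "(l, m) \<in> ups c" by blast
  note r = ups_range[OF c lm(2)]
  note p = qv_props[of l m]
  have "m < c l - h l" using lm(2) by (simp add: ups_def)
  moreover have "J (l - 1) + q l + h l = J l" using J_bounds r by blast
  ultimately have "J l - c l < qv l m" using r by (auto simp: qv_def)
  then show "i \<in> set (tau c) - set w" using p r lm(1) tau_props[OF c] tauset_mem[OF c] by simp
qed

lemma w_minus_tau:
  assumes c: "valid c"
  shows "set w - set (tau c) = {av k m | k m. (k, m) \<in> downs c}"
proof (rule Set.set_eqI, rule iffI)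
  fix i assume i: "i \<in> set w - set (tau c)"
  then have r: "1 \<le> i" "i \<le> N" using w_range by auto
  then have "i \<le> J (blk i) - c (blk i)" using i tau_props[OF c] tauset_mem[OF c] by auto
  moreover have "J (blk i) - h (blk i) < i" using w_iff[OF r] i by simp
  ultimately have "i = av (blk i) (i - (J (blk i) - h (blk i) + 1))" "i - (J (blk i) - h (blk i) + 1) < h (blk i) - c (blk i)"
    by (auto simp: av_def)
  then show "i \<in> {av k m | k m. (k, m) \<in> downs c}" using blk_range[OF r] unfolding downs_def by blast
next
  fix i assume "i \<in> {av k m | k m. (k, m) \<in> downs c}"
  then obtain k m where km: "i = av k m" "(k, m) \<in> downs c" by blast
  note r = downs_range[OF km(2)]
  note p = av_props[of k m]
  have "m < h k - c k" using km(2) by (simp add: downs_def)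
  moreover have "J (k - 1) + q k + h k = J k" using J_bounds r by blast
  ultimately have "\<not> J k - c k < av k m" by (auto simp: av_def)
  then show "i \<in> set w - set (tau c)" using p r km(1) tau_props[OF c] tauset_mem[OF c] by simp
qed

section \<open>Test points given by graphs between free rows and columns\<close>

definition emb :: "((nat \<times> nat) \<times> (nat \<times> nat)) set \<Rightarrow> nat \<Rightarrow> nat \<Rightarrow> complex" where
  "emb E = (\<lambda>i c. if \<exists>l m k m'. ((l, m), (k, m')) \<in> E \<and> i = qv l m \<and> c = av k m' then 1 else 0)"

text \<open>\<open>l < k\<close> puts the entries strictly above the block diagonal, so that the
  point lies in the cone.\<close>

definition goodE :: "((nat \<times> nat) \<times> (nat \<times> nat)) set \<Rightarrow> bool" where
  "goodE E \<longleftrightarrow> (\<forall>((l, m), (k, m')) \<in> E. l \<in> {1..b} \<and> m < q l \<and> k \<in> {1..b} \<and> m' < h k \<and> l < k)"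

lemma emb_eval:
  assumes E: "goodE E" and "l \<in> {1..b}" "m < q l" "k \<in> {1..b}" "m' < h k"
  shows "emb E (qv l m) (av k m') \<noteq> 0 \<longleftrightarrow> ((l, m), (k, m')) \<in> E"
proof -
  have "l2 = l \<and> m2 = m" if "l2 \<in> {1..b}" "m2 < q l2" "qv l m = qv l2 m2" for l2 m2
  proof -
    have l: "l2 = l" using qv_props(3)[OF that(1,2)] qv_props(3)[OF assms(2,3)] that(3) by simp
    have "q l \<le> J l - h l" using J_bounds[OF assms(2)] by simp
    then show ?thesis using that l assms(3) by (auto simp: qv_def)
  qed
  moreover have "k2 = k \<and> m2 = m'" if "k2 \<in> {1..b}" "m2 < h k2" "av k m' = av k2 m2" for k2 m2
  proof -
    have k: "k2 = k" using av_props(3)[OF that(1,2)] av_props(3)[OF assms(4,5)] that(3) by simp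
    then show ?thesis using that by (auto simp: av_def)
  qed
  note inj = calculation this
  show ?thesis
  proof
    assume "emb E (qv l m) (av k m') \<noteq> 0"
    then obtain l2 m2 k2 m3 where e: "((l2, m2), (k2, m3)) \<in> E" "qv l m = qv l2 m2" "av k m' = av k2 m3"
      unfolding emb_def by (metis (no_types, lifting))
    then have "l2 \<in> {1..b}" "m2 < q l2" "k2 \<in> {1..b}" "m3 < h k2" using E by (auto simp: goodE_def)
    then show "((l, m), (k, m')) \<in> E" using inj(1)[of l2 m2] inj(2)[of k2 m3] e by simp
  next
    assume "((l, m), (k, m')) \<in> E"
    then have "\<exists>l2 m2 k2 m3. ((l2, m2), (k2, m3)) \<in> E \<and> qv l m = qv l2 m2 \<and> av k m' = av k2 m3" by blast
    then show "emb E (qv l m) (av k m') \<noteq> 0" by (simp add: emb_def)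
  qed
qed

lemma emb_in_X: assumes E: "goodE E" shows "cellpt (emb E) \<in> X"
proof (rule cellpt_in_X)
  fix i c assume ic: "1 \<le> i" "i \<le> N" "i \<notin> set w" "c \<in> set w" "c < i"
  show "emb E i c = 0"
  proof (rule ccontr)
    assume "emb E i c \<noteq> 0"
    then obtain l m k m' where e: "((l, m), (k, m')) \<in> E" "i = qv l m" "c = av k m'" by (auto simp: emb_def split: if_splits)
    then have "l \<in> {1..b} \<and> m < q l \<and> k \<in> {1..b} \<and> m' < h k \<and> l < k" using E by (auto simp: goodE_def)
    then have "blk i < blk c" using qv_props(3)[of l m] av_props(3)[of k m'] e by simp
    then show False using blk_less_imp_less[of c i] w_range[OF ic(4)] ic by simp
  qed
qed

lemma emb_zero:
  assumes E: "goodE E" and c: "valid c" and lm: "(l, m) \<in> ups c" and z: "\<And>y. y \<in> downs c \<Longrightarrow> ((l, m), y) \<notin> E"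
  shows "cellpt (emb E) (tau c) = 0"
proof -
  have r: "l \<in> {1..b}" "m < q l" using ups_range[OF c lm] by auto
  have "qv l m \<in> set (tau c) - set w" unfolding tau_minus_w[OF c] using lm by blast
  then show ?thesis
  proof (intro cellpt_eq_0[OF tau_props(1)[OF c], of "qv l m"])
    fix e assume "e \<in> set w" "e \<notin> set (tau c)"
    then obtain k m' where e: "e = av k m'" "(k, m') \<in> downs c" using w_minus_tau[OF c] by blast
    then show "emb E (qv l m) e = 0" using emb_eval[OF E r, of k m'] downs_range[OF e(2)] z[OF e(2)] by blast
  qed auto
qed

lemma emb_nonzero:
  assumes E: "goodE E" and c: "valid c"
    and piv: "\<And>y. y \<in> downs c \<Longrightarrow> \<exists>x\<in>ups c. (x, y) \<in> E \<and> (\<forall>y'\<in>downs c. (x, y') \<in> E \<longrightarrow> y' = y)"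
  shows "cellpt (emb E) (tau c) \<noteq> 0"
proof (rule cellpt_neq_0[OF tau_props(1)[OF c]])
  fix e assume "e \<in> set w" "e \<notin> set (tau c)"
  then obtain k m' where e: "e = av k m'" "(k, m') \<in> downs c" using w_minus_tau[OF c] by blast
  obtain l m where lm: "(l, m) \<in> ups c" "((l, m), (k, m')) \<in> E" "\<forall>y'\<in>downs c. ((l, m), y') \<in> E \<longrightarrow> y' = (k, m')"
    using piv[OF e(2)] by (metis surj_pair)
  have r: "l \<in> {1..b}" "m < q l" using ups_range[OF c lm(1)] by auto
  show "\<exists>i\<in>set (tau c) - set w. emb E i e \<noteq> 0 \<and> (\<forall>c'\<in>set w - set (tau c). emb E i c' \<noteq> 0 \<longrightarrow> c' = e)"
  proof (intro bexI conjI ballI impI)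
    show "qv l m \<in> set (tau c) - set w" unfolding tau_minus_w[OF c] using lm(1) by blast
    show "emb E (qv l m) e \<noteq> 0" using emb_eval[OF E r, of k m'] downs_range[OF e(2)] lm(2) e(1) by blast
    fix c' assume "c' \<in> set w - set (tau c)" and nz: "emb E (qv l m) c' \<noteq> 0"
    then obtain k2 m2 where e2: "c' = av k2 m2" "(k2, m2) \<in> downs c" using w_minus_tau[OF c] by blast
    then have "((l, m), (k2, m2)) \<in> E" using emb_eval[OF E r, of k2 m2] downs_range[OF e2(2)] nz by blast
    then show "c' = e" using lm(3) e2 e(1) by blast
  qed
qed

text \<open>One unit of content passes from block \<open>k\<close> to block \<open>l\<close>: a
  column of block \<open>k\<close> is exchanged for a free row of block \<open>l\<close>.\<close>

definition move :: "nat \<Rightarrow> nat \<Rightarrow> (nat \<Rightarrow> nat) \<Rightarrow> nat \<Rightarrow> nat" where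
  "move k l c = c(k := c k - 1, l := c l + 1)"

lemma valid_move:
  assumes c: "valid c" and k: "k \<in> {1..b}" "1 \<le> c k" and l: "l \<in> {1..b}" "c l < n l" and kl: "k \<noteq> l"
  shows "valid (move k l c)"
proof -
  have split: "(\<Sum>i\<in>{1..b}. f i) = f k + (f l + (\<Sum>i\<in>{1..b} - {k} - {l}. f i))" for f :: "nat \<Rightarrow> nat"
    using k l kl sum.remove[of "{1..b}" k f] sum.remove[of "{1..b} - {k}" l f] by simp
  have "(\<Sum>i\<in>{1..b} - {k} - {l}. move k l c i) = (\<Sum>i\<in>{1..b} - {k} - {l}. c i)"
    by (intro sum.cong) (auto simp: move_def)
  then have "(\<Sum>i\<in>{1..b}. move k l c i) = (\<Sum>i\<in>{1..b}. c i)"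
    unfolding split[of "move k l c"] split[of c] using k kl by (simp add: move_def)
  moreover have "move k l c i \<le> n i" if "i \<in> {1..b}" for i
  proof -
    have "c i \<le> n i" using c that unfolding valid_def by blast
    then show ?thesis using l kl by (auto simp: move_def)
  qed
  ultimately show ?thesis using c unfolding valid_def by simp
qed

lemma q_less: "l \<in> {1..b} \<Longrightarrow> m < q l \<Longrightarrow> h l + m < n l"
  using n_eq[of l] by simp

lemma downs_h: "downs h = {}"
  by (simp add: downs_def)

text \<open>Up to sign, the coordinate of a content is the minor of \<open>M\<close> with rows
  \<open>ups\<close> and columns \<open>downs\<close>. This lemma and those following it list the
  minors of size one, two and three that occur in the invariants.\<close>

lemma one_move:
  assumes "k \<in> {1..b}" "l \<in> {1..b}" "k \<noteq> l" "1 \<le> h k" "1 \<le> q l"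
  shows "valid (move k l h)" "ups (move k l h) = {(l, 0)}" "downs (move k l h) = {(k, 0)}"
proof -
  have "h l < n l" using q_less[of l 0] assms by simp
  then show "valid (move k l h)" using assms by (intro valid_move valid_h) auto
  show "ups (move k l h) = {(l, 0)}" "downs (move k l h) = {(k, 0)}"
    using assms by (auto simp: ups_def downs_def move_def split: if_splits)
qed

lemma two_moves_column:
  assumes "m \<in> {1..b}" "l1 \<in> {1..b}" "l2 \<in> {1..b}" "m \<noteq> l1" "m \<noteq> l2" "l1 \<noteq> l2" "2 \<le> h m" "1 \<le> q l1" "1 \<le> q l2"
  shows "valid (move m l1 (move m l2 h))" "ups (move m l1 (move m l2 h)) = {(l1, 0), (l2, 0)}"
    "downs (move m l1 (move m l2 h)) = {(m, 0), (m, 1)}"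
proof -
  have "h l1 < n l1" using q_less[of l1 0] assms by simp
  have v: "valid (move m l2 h)" using assms by (intro one_move) auto
  show "valid (move m l1 (move m l2 h))"
    by (rule valid_move[OF v]) (use assms \<open>h l1 < n l1\<close> in \<open>auto simp: move_def\<close>)
  show "ups (move m l1 (move m l2 h)) = {(l1, 0), (l2, 0)}" "downs (move m l1 (move m l2 h)) = {(m, 0), (m, 1)}"
    using assms by (auto simp: ups_def downs_def move_def split: if_splits)
qed

lemma two_moves_row:
  assumes "k1 \<in> {1..b}" "k2 \<in> {1..b}" "l \<in> {1..b}" "k1 \<noteq> l" "k2 \<noteq> l" "k1 \<noteq> k2" "1 \<le> h k1" "1 \<le> h k2" "2 \<le> q l"
  shows "valid (move k1 l (move k2 l h))" "ups (move k1 l (move k2 l h)) = {(l, 0), (l, 1)}"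
    "downs (move k1 l (move k2 l h)) = {(k1, 0), (k2, 0)}"
proof -
  have "h l + 1 < n l" using q_less[of l 1] assms by simp
  have v: "valid (move k2 l h)" using assms by (intro one_move) auto
  show "valid (move k1 l (move k2 l h))"
    by (rule valid_move[OF v]) (use assms \<open>h l + 1 < n l\<close> in \<open>auto simp: move_def\<close>)
  show "ups (move k1 l (move k2 l h)) = {(l, 0), (l, 1)}" "downs (move k1 l (move k2 l h)) = {(k1, 0), (k2, 0)}"
    using assms by (auto simp: ups_def downs_def move_def split: if_splits)
qed

lemma two_moves_square:
  assumes "m \<in> {1..b}" "l \<in> {1..b}" "m \<noteq> l" "2 \<le> h m" "2 \<le> q l"
  shows "valid (move m l (move m l h))" "ups (move m l (move m l h)) = {(l, 0), (l, 1)}"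
    "downs (move m l (move m l h)) = {(m, 0), (m, 1)}"
proof -
  have "h l + 1 < n l" using q_less[of l 1] assms by simp
  have v: "valid (move m l h)" using assms by (intro one_move) auto
  show "valid (move m l (move m l h))"
    by (rule valid_move[OF v]) (use assms \<open>h l + 1 < n l\<close> in \<open>auto simp: move_def\<close>)
  show "ups (move m l (move m l h)) = {(l, 0), (l, 1)}" "downs (move m l (move m l h)) = {(m, 0), (m, 1)}"
    using assms by (auto simp: ups_def downs_def move_def split: if_splits)
qed

lemma three_moves_column:
  assumes "m \<in> {1..b}" "l \<in> {1..b}" "l' \<in> {1..b}" "m \<noteq> l" "m \<noteq> l'" "l \<noteq> l'" "3 \<le> h m" "2 \<le> q l" "1 \<le> q l'"
  shows "valid (move m l (move m l (move m l' h)))"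
    "ups (move m l (move m l (move m l' h))) = {(l, 0), (l, 1), (l', 0)}"
    "downs (move m l (move m l (move m l' h))) = {(m, 0), (m, 1), (m, 2)}"
proof -
  have "h l + 1 < n l" using q_less[of l 1] assms by simp
  have v: "valid (move m l (move m l' h))" using assms by (intro two_moves_column) auto
  show "valid (move m l (move m l (move m l' h)))"
    by (rule valid_move[OF v]) (use assms \<open>h l + 1 < n l\<close> in \<open>auto simp: move_def\<close>)
  show "ups (move m l (move m l (move m l' h))) = {(l, 0), (l, 1), (l', 0)}"
    "downs (move m l (move m l (move m l' h))) = {(m, 0), (m, 1), (m, 2)}"
    using assms by (auto simp: ups_def downs_def move_def split: if_splits)
qed

lemma three_moves_row:
  assumes "k \<in> {1..b}" "m \<in> {1..b}" "l \<in> {1..b}" "k \<noteq> l" "m \<noteq> l" "k \<noteq> m" "2 \<le> h k" "1 \<le> h m" "3 \<le> q l"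
  shows "valid (move k l (move k l (move m l h)))"
    "ups (move k l (move k l (move m l h))) = {(l, 0), (l, 1), (l, 2)}"
    "downs (move k l (move k l (move m l h))) = {(k, 0), (k, 1), (m, 0)}"
proof -
  have "h l + 2 < n l" using q_less[of l 2] assms by simp
  have v: "valid (move k l (move m l h))" using assms by (intro two_moves_row) auto
  show "valid (move k l (move k l (move m l h)))"
    by (rule valid_move[OF v]) (use assms \<open>h l + 2 < n l\<close> in \<open>auto simp: move_def\<close>)
  show "ups (move k l (move k l (move m l h))) = {(l, 0), (l, 1), (l, 2)}"
    "downs (move k l (move k l (move m l h))) = {(k, 0), (k, 1), (m, 0)}"
    using assms by (auto simp: ups_def downs_def move_def split: if_splits)
qed

lemma emb_h: "goodE E \<Longrightarrow> cellpt (emb E) (tau h) \<noteq> 0"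
  by (rule emb_nonzero[OF _ valid_h]) (auto simp: downs_h)

lemma content_pair_emb:
  assumes v: "valid c1" "valid c2" "valid c3" "valid e1" "valid e2" "valid e3"
    and eq: "\<And>k f. f (c1 k) * f (c2 k) * f (c3 k) = (f (e1 k) * f (e2 k) * f (e3 k) :: complex)"
    and E: "goodE E" "goodE E'"
    and x: "cellpt (emb E) (tau c1) \<noteq> 0" "cellpt (emb E) (tau c2) \<noteq> 0" "cellpt (emb E) (tau c3) \<noteq> 0"
      "cellpt (emb E) (tau e2) = 0"
    and y: "cellpt (emb E') (tau e1) \<noteq> 0" "cellpt (emb E') (tau e2) \<noteq> 0" "cellpt (emb E') (tau e3) \<noteq> 0"
  shows "\<not> mult_free d N w js"
  by (rule content_pair_not_mult_free[OF v eq emb_in_X[OF E(1)] x(1-3) _ emb_in_X[OF E(2)] y]) (use x(4) in blast)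

text \<open>In each of the following patterns both products of three coordinates use in every block the same
  multiset of contents, so that their weights agree; the supports of the two points \<open>emb E\<close> are chosen such
  that the second product vanishes at the first point and not at the second.\<close>

lemma four_cycle:
  assumes "l \<in> {1..b}" "l' \<in> {1..b}" "k \<in> {1..b}" "k' \<in> {1..b}" "l \<noteq> l'" "k \<noteq> k'"
    "l < k" "l < k'" "l' < k" "l' < k'" "1 \<le> q l" "1 \<le> q l'" "1 \<le> h k" "1 \<le> h k'"
  shows "\<not> mult_free d N w js"
proof -
  \<comment> \<open>The supports are the two matchings of the rows of \<open>l\<close>,
    \<open>l'\<close> with the columns of \<open>k\<close>, \<open>k'\<close>; the invariant is the
    cross ratio x_lk x_l'k' / (x_l'k x_lk').\<close>
  let ?E = "{((l, 0), (k, 0)), ((l', 0), (k', 0))}" and ?E' = "{((l', 0), (k, 0)), ((l, 0), (k', 0))}"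
  have E: "goodE ?E" "goodE ?E'" using assms by (auto simp: goodE_def)
  have kl: "k \<noteq> l" "k' \<noteq> l'" "k \<noteq> l'" "k' \<noteq> l" using assms by auto
  note c = one_move[OF assms(3,1) kl(1) assms(13,11)] one_move[OF assms(4,2) kl(2) assms(14,12)]
    one_move[OF assms(3,2) kl(3) assms(13,12)] one_move[OF assms(4,1) kl(4) assms(14,11)]
  show ?thesis
  proof (rule content_pair_emb[of "move k l h" "move k' l' h" h "move k l' h" "move k' l h" h ?E ?E'])
    show "f (move k l h i) * f (move k' l' h i) * f (h i) = f (move k l' h i) * f (move k' l h i) * f (h i)"
      for i and f :: "nat \<Rightarrow> complex"
      using assms kl by (auto simp: move_def)
    show "cellpt (emb ?E) (tau (move k l h)) \<noteq> 0"
      by (rule emb_nonzero[OF E(1) c(1)]) (use c assms in auto)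
    show "cellpt (emb ?E) (tau (move k' l' h)) \<noteq> 0"
      by (rule emb_nonzero[OF E(1) c(4)]) (use c assms in auto)
    show "cellpt (emb ?E) (tau (move k' l h)) = 0"
      by (rule emb_zero[OF E(1) c(10), of l 0]) (use c assms in auto)
    show "cellpt (emb ?E') (tau (move k l' h)) \<noteq> 0"
      by (rule emb_nonzero[OF E(2) c(7)]) (use c assms in auto)
    show "cellpt (emb ?E') (tau (move k' l h)) \<noteq> 0"
      by (rule emb_nonzero[OF E(2) c(10)]) (use c assms in auto)
  qed (use c valid_h E emb_h in auto)
qed

text \<open>Three rows from different blocks face two columns of one block. With [i j] for the minor
  of two rows in these columns and x_i for an entry in the first of them, the invariant is [l1 l2]
  x_l3 / ([l1 l3] x_l2). At the first point row \<open>l2\<close> misses the first column, so x_l2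
  vanishes.\<close>

lemma column_star:
  assumes m: "m \<in> {1..b}" "2 \<le> h m" and l: "l1 \<in> {1..b}" "l2 \<in> {1..b}" "l3 \<in> {1..b}" "l1 < m" "l2 < m" "l3 < m"
    "l1 \<noteq> l2" "l1 \<noteq> l3" "l2 \<noteq> l3" "1 \<le> q l1" "1 \<le> q l2" "1 \<le> q l3"
  shows "\<not> mult_free d N w js"
proof -
  let ?E = "{((l1, 0), (m, 0)), ((l2, 0), (m, 1)), ((l3, 0), (m, 0))}"
  let ?E' = "{((l1, 0), (m, 0)), ((l3, 0), (m, 1)), ((l2, 0), (m, 0))}"
  have ne: "m \<noteq> l1" "m \<noteq> l2" "m \<noteq> l3" "1 \<le> h m" using m l by auto
  have E: "goodE ?E" "goodE ?E'" using m l by (auto simp: goodE_def)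
  note a = two_moves_column[OF m(1) l(1,2) ne(1,2) l(7) m(2) l(10,11)]
  note b = two_moves_column[OF m(1) l(1,3) ne(1,3) l(8) m(2) l(10,12)]
  note c = one_move[OF m(1) l(3) ne(3,4) l(12)]
  note e = one_move[OF m(1) l(2) ne(2,4) l(11)]
  show ?thesis
  proof (rule content_pair_emb[of "move m l1 (move m l2 h)" "move m l3 h" h "move m l1 (move m l3 h)" "move m l2 h" h ?E ?E'])
    show "f (move m l1 (move m l2 h) i) * f (move m l3 h i) * f (h i)
       = f (move m l1 (move m l3 h) i) * f (move m l2 h i) * f (h i)" for i and f :: "nat \<Rightarrow> complex"
      using m l ne by (auto simp: move_def)
    show "cellpt (emb ?E) (tau (move m l1 (move m l2 h))) \<noteq> 0"
      by (rule emb_nonzero[OF E(1) a(1)]) (use a l ne in auto)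
    show "cellpt (emb ?E) (tau (move m l3 h)) \<noteq> 0"
      by (rule emb_nonzero[OF E(1) c(1)]) (use c l ne in auto)
    show "cellpt (emb ?E) (tau (move m l2 h)) = 0"
      by (rule emb_zero[OF E(1) e(1), of l2 0]) (use e l ne in auto)
    show "cellpt (emb ?E') (tau (move m l1 (move m l3 h))) \<noteq> 0"
      by (rule emb_nonzero[OF E(2) b(1)]) (use b l ne in auto)
    show "cellpt (emb ?E') (tau (move m l2 h)) \<noteq> 0"
      by (rule emb_nonzero[OF E(2) e(1)]) (use e l ne in auto)
  qed (use a b c e valid_h E emb_h in auto)
qed

text \<open>The transpose of \<open>column_star\<close>: two rows of one block face three columns
  from different blocks.\<close>

lemma row_star:
  assumes l: "l \<in> {1..b}" "2 \<le> q l" and k: "k1 \<in> {1..b}" "k2 \<in> {1..b}" "k3 \<in> {1..b}" "l < k1" "l < k2" "l < k3"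
    "k1 \<noteq> k2" "k1 \<noteq> k3" "k2 \<noteq> k3" "1 \<le> h k1" "1 \<le> h k2" "1 \<le> h k3"
  shows "\<not> mult_free d N w js"
proof -
  let ?E = "{((l, 0), (k1, 0)), ((l, 1), (k2, 0)), ((l, 0), (k3, 0))}"
  let ?E' = "{((l, 0), (k1, 0)), ((l, 1), (k3, 0)), ((l, 0), (k2, 0))}"
  have ne: "k1 \<noteq> l" "k2 \<noteq> l" "k3 \<noteq> l" "1 \<le> q l" using k l by auto
  have E: "goodE ?E" "goodE ?E'" using k l by (auto simp: goodE_def)
  note a = two_moves_row[OF k(1,2) l(1) ne(1,2) k(7) k(10,11) l(2)]
  note b = two_moves_row[OF k(1,3) l(1) ne(1,3) k(8) k(10,12) l(2)]
  note c = one_move[OF k(3) l(1) ne(3) k(12) ne(4)]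
  note e = one_move[OF k(2) l(1) ne(2) k(11) ne(4)]
  show ?thesis
  proof (rule content_pair_emb[of "move k1 l (move k2 l h)" "move k3 l h" h "move k1 l (move k3 l h)" "move k2 l h" h ?E ?E'])
    show "f (move k1 l (move k2 l h) i) * f (move k3 l h i) * f (h i)
       = f (move k1 l (move k3 l h) i) * f (move k2 l h i) * f (h i)" for i and f :: "nat \<Rightarrow> complex"
      using k l ne by (auto simp: move_def)
    show "cellpt (emb ?E) (tau (move k1 l (move k2 l h))) \<noteq> 0"
      by (rule emb_nonzero[OF E(1) a(1)]) (use a k ne in auto)
    show "cellpt (emb ?E) (tau (move k3 l h)) \<noteq> 0"
      by (rule emb_nonzero[OF E(1) c(1)]) (use c k ne in auto)
    show "cellpt (emb ?E) (tau (move k2 l h)) = 0"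
      by (rule emb_zero[OF E(1) e(1), of l 0]) (use e k ne in auto)
    show "cellpt (emb ?E') (tau (move k1 l (move k3 l h))) \<noteq> 0"
      by (rule emb_nonzero[OF E(2) b(1)]) (use b k ne in auto)
    show "cellpt (emb ?E') (tau (move k2 l h)) \<noteq> 0"
      by (rule emb_nonzero[OF E(2) e(1)]) (use e k ne in auto)
  qed (use a b c e valid_h E emb_h in auto)
qed

text \<open>The blocks are linked in a path k - l - m - p. The two 2 by 2 minors with rows l, l and
  columns k, m, and with rows l, p and columns m, m, together with p_w, are balanced against the
  entries at (p, m) and (l, k) and the minor with rows l, l and columns m, m. At the first point the
  entry at (l, k) vanishes, since \<open>(l, 0)\<close> is linked to \<open>m\<close> only.\<close>

lemma path_four:
  assumes k: "k \<in> {1..b}" "l \<in> {1..b}" "m \<in> {1..b}" "p \<in> {1..b}" "l < k" "l < m" "p < m" "k \<noteq> m" "p \<noteq> l"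
    and q: "1 \<le> h k" "2 \<le> q l" "2 \<le> h m" "1 \<le> q p"
  shows "\<not> mult_free d N w js"
proof -
  let ?E = "{((l, 0), (m, 0)), ((l, 1), (k, 0)), ((p, 0), (m, 1))}"
  let ?E' = "{((l, 0), (k, 0)), ((l, 0), (m, 0)), ((l, 1), (m, 1)), ((p, 0), (m, 0))}"
  have ne: "k \<noteq> l" "m \<noteq> l" "m \<noteq> p" "1 \<le> h m" "1 \<le> q l" "l \<noteq> p" using k q by auto
  have E: "goodE ?E" "goodE ?E'" using k q by (auto simp: goodE_def)
  note a1 = two_moves_row[OF k(1,3,2) ne(1,2) k(8) q(1) ne(4) q(2)]
  note a2 = two_moves_column[OF k(3,2,4) ne(2,3,6) q(3) ne(5) q(4)]
  note e1 = one_move[OF k(3,4) ne(3,4) q(4)]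
  note e2 = one_move[OF k(1,2) ne(1) q(1) ne(5)]
  note e3 = two_moves_square[OF k(3,2) ne(2) q(3,2)]
  show ?thesis
  proof (rule content_pair_emb[of "move k l (move m l h)" "move m l (move m p h)" h "move m p h" "move k l h" "move m l (move m l h)" ?E ?E'])
    show "f (move k l (move m l h) i) * f (move m l (move m p h) i) * f (h i)
       = f (move m p h i) * f (move k l h i) * f (move m l (move m l h) i)" for i and f :: "nat \<Rightarrow> complex"
      using k ne by (auto simp: move_def)
    show "cellpt (emb ?E) (tau (move k l (move m l h))) \<noteq> 0"
      by (rule emb_nonzero[OF E(1) a1(1)]) (use a1 k ne in auto)
    show "cellpt (emb ?E) (tau (move m l (move m p h))) \<noteq> 0"
      by (rule emb_nonzero[OF E(1) a2(1)]) (use a2 k ne in auto)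
    show "cellpt (emb ?E) (tau (move k l h)) = 0"
      by (rule emb_zero[OF E(1) e2(1), of l 0]) (use e2 k ne in auto)
    show "cellpt (emb ?E') (tau (move m p h)) \<noteq> 0"
      by (rule emb_nonzero[OF E(2) e1(1)]) (use e1 k ne in auto)
    show "cellpt (emb ?E') (tau (move k l h)) \<noteq> 0"
      by (rule emb_nonzero[OF E(2) e2(1)]) (use e2 k ne in auto)
    show "cellpt (emb ?E') (tau (move m l (move m l h))) \<noteq> 0"
      by (rule emb_nonzero[OF E(2) e3(1)]) (use e3 k ne in auto)
  qed (use a1 a2 e1 e2 e3 valid_h E emb_h in auto)
qed

text \<open>Two row blocks with two rows each face three columns of one block. Writing minors in the
  leading columns by the blocks of their rows, the invariant is [l l l'] [l' l'] [l] / ([l' l' l]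
  [l'] [l l]). The second support arises from the first by exchanging \<open>l\<close> and
  \<open>l'\<close>.\<close>

lemma column_pair:
  assumes k: "m \<in> {1..b}" "l \<in> {1..b}" "l' \<in> {1..b}" "l < m" "l' < m" "l \<noteq> l'"
    and q: "3 \<le> h m" "2 \<le> q l" "2 \<le> q l'"
  shows "\<not> mult_free d N w js"
proof -
  let ?E = "{((l, 0), (m, 0)), ((l', 0), (m, 1)), ((l', 1), (m, 0)), ((l, 1), (m, 2))}"
  let ?E' = "{((l', 0), (m, 0)), ((l, 0), (m, 1)), ((l, 1), (m, 0)), ((l', 1), (m, 2))}"
  have ne: "m \<noteq> l" "m \<noteq> l'" "l' \<noteq> l" "2 \<le> h m" "1 \<le> h m" "1 \<le> q l" "1 \<le> q l'" using k q by auto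
  have E: "goodE ?E" "goodE ?E'" using k q by (auto simp: goodE_def)
  note a1 = three_moves_column[OF k(1,2,3) ne(1,2) k(6) q(1,2) ne(7)]
  note b1 = three_moves_column[OF k(1,3,2) ne(2,1,3) q(1,3) ne(6)]
  note a2 = two_moves_square[OF k(1,3) ne(2,4) q(3)]
  note b2 = two_moves_square[OF k(1,2) ne(1,4) q(2)]
  note a3 = one_move[OF k(1,2) ne(1,5,6)]
  note b3 = one_move[OF k(1,3) ne(2,5,7)]
  show ?thesis
  proof (rule content_pair_emb[of "move m l (move m l (move m l' h))" "move m l' (move m l' h)" "move m l h"
        "move m l' (move m l' (move m l h))" "move m l' h" "move m l (move m l h)" ?E ?E'])
    show "f (move m l (move m l (move m l' h)) i) * f (move m l' (move m l' h) i) * f (move m l h i)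
       = f (move m l' (move m l' (move m l h)) i) * f (move m l' h i) * f (move m l (move m l h) i)" for i and f :: "nat \<Rightarrow> complex"
      using k ne by (auto simp: move_def)
    show "cellpt (emb ?E) (tau (move m l (move m l (move m l' h)))) \<noteq> 0"
      by (rule emb_nonzero[OF E(1) a1(1)]) (use a1 k ne in auto)
    show "cellpt (emb ?E) (tau (move m l' (move m l' h))) \<noteq> 0"
      by (rule emb_nonzero[OF E(1) a2(1)]) (use a2 k ne in auto)
    show "cellpt (emb ?E) (tau (move m l h)) \<noteq> 0"
      by (rule emb_nonzero[OF E(1) a3(1)]) (use a3 k ne in auto)
    show "cellpt (emb ?E) (tau (move m l' h)) = 0"
      by (rule emb_zero[OF E(1) b3(1), of l' 0]) (use b3 k ne in auto)
    show "cellpt (emb ?E') (tau (move m l' (move m l' (move m l h)))) \<noteq> 0"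
      by (rule emb_nonzero[OF E(2) b1(1)]) (use b1 k ne in auto)
    show "cellpt (emb ?E') (tau (move m l' h)) \<noteq> 0"
      by (rule emb_nonzero[OF E(2) b3(1)]) (use b3 k ne in auto)
    show "cellpt (emb ?E') (tau (move m l (move m l h))) \<noteq> 0"
      by (rule emb_nonzero[OF E(2) b2(1)]) (use b2 k ne in auto)
  qed (use a1 a2 a3 b1 b2 b3 E in auto)
qed

text \<open>The transpose of \<open>column_pair\<close>: three rows of block \<open>l\<close> face
  two columns in each of the blocks \<open>k\<close> and \<open>m\<close>.\<close>

lemma row_pair:
  assumes k: "l \<in> {1..b}" "k \<in> {1..b}" "m \<in> {1..b}" "l < k" "l < m" "k \<noteq> m"
    and q: "3 \<le> q l" "2 \<le> h k" "2 \<le> h m"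
  shows "\<not> mult_free d N w js"
proof -
  let ?E = "{((l, 0), (k, 0)), ((l, 1), (m, 0)), ((l, 0), (m, 1)), ((l, 2), (k, 1))}"
  let ?E' = "{((l, 0), (m, 0)), ((l, 1), (k, 0)), ((l, 0), (k, 1)), ((l, 2), (m, 1))}"
  have ne: "k \<noteq> l" "m \<noteq> l" "m \<noteq> k" "2 \<le> q l" "1 \<le> q l" "1 \<le> h k" "1 \<le> h m" using k q by auto
  have E: "goodE ?E" "goodE ?E'" using k q by (auto simp: goodE_def)
  note a1 = three_moves_row[OF k(2,3,1) ne(1,2) k(6) q(2) ne(7) q(1)]
  note b1 = three_moves_row[OF k(3,2,1) ne(2,1,3) q(3) ne(6) q(1)]
  note a2 = two_moves_square[OF k(3,1) ne(2) q(3) ne(4)]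
  note b2 = two_moves_square[OF k(2,1) ne(1) q(2) ne(4)]
  note a3 = one_move[OF k(2,1) ne(1,6,5)]
  note b3 = one_move[OF k(3,1) ne(2,7,5)]
  show ?thesis
  proof (rule content_pair_emb[of "move k l (move k l (move m l h))" "move m l (move m l h)" "move k l h"
        "move m l (move m l (move k l h))" "move m l h" "move k l (move k l h)" ?E ?E'])
    show "f (move k l (move k l (move m l h)) i) * f (move m l (move m l h) i) * f (move k l h i)
       = f (move m l (move m l (move k l h)) i) * f (move m l h i) * f (move k l (move k l h) i)" for i and f :: "nat \<Rightarrow> complex"
      using k ne by (auto simp: move_def)
    show "cellpt (emb ?E) (tau (move k l (move k l (move m l h)))) \<noteq> 0"
      by (rule emb_nonzero[OF E(1) a1(1)]) (use a1 k ne in auto)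
    show "cellpt (emb ?E) (tau (move m l (move m l h))) \<noteq> 0"
      by (rule emb_nonzero[OF E(1) a2(1)]) (use a2 k ne in auto)
    show "cellpt (emb ?E) (tau (move k l h)) \<noteq> 0"
      by (rule emb_nonzero[OF E(1) a3(1)]) (use a3 k ne in auto)
    show "cellpt (emb ?E) (tau (move m l h)) = 0"
      by (rule emb_zero[OF E(1) b3(1), of l 0]) (use b3 k ne in auto)
    show "cellpt (emb ?E') (tau (move m l (move m l (move k l h)))) \<noteq> 0"
      by (rule emb_nonzero[OF E(2) b1(1)]) (use b1 k ne in auto)
    show "cellpt (emb ?E') (tau (move m l h)) \<noteq> 0"
      by (rule emb_nonzero[OF E(2) b3(1)]) (use b3 k ne in auto)
    show "cellpt (emb ?E') (tau (move k l (move k l h))) \<noteq> 0"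
      by (rule emb_nonzero[OF E(2) b2(1)]) (use b2 k ne in auto)
  qed (use a1 a2 a3 b1 b2 b3 E in auto)
qed

section \<open>The failing cases matched with the patterns\<close>

lemma b_3_not_mult_free:
  assumes b3: "b = 3" and c: "\<not> (n 2 = 1 \<or> h 1 + 1 \<ge> n 1 \<or> (n 2 = h 2 \<and> h 1 + 2 \<ge> n 1)
    \<or> (h 2 > 0 \<and> h 3 < 2) \<or> (h 2 = 0 \<and> h 3 \<le> 2))"
  shows "\<not> mult_free d N w js"
proof -
  have k: "1 \<in> {1..b}" "2 \<in> {1..b}" "3 \<in> {1..b}" using b3 by auto
  note nq = n_eq[OF k(1)] n_eq[OF k(2)] n_eq[OF k(3)]
  have n2: "2 \<le> n 2" using c n_pos[OF k(2)] by auto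
  have q1: "2 \<le> q 1" using c nq by auto
  show ?thesis
  proof (cases "h 2 = 0")
    case True
    then have "3 \<le> h 3" "2 \<le> q 2" using c nq n2 by auto
    \<comment> \<open>The free rows of blocks 1 and 2 face the columns of block 3, the only ones
      they meet.\<close>
    then show ?thesis using q1 by (intro column_pair[OF k(3,1,2)]) auto
  next
    case False
    then have h3: "2 \<le> h 3" using c by auto
    show ?thesis
    proof (cases "q 2 = 0")
      case True
      then have "3 \<le> q 1" "2 \<le> h 2" using c nq n2 by auto
      then show ?thesis using h3 by (intro row_pair[OF k]) auto
    next
      case q2: False
      \<comment> \<open>Block 2 occurs twice: its columns at one end of the path and its free rows
        at the other.\<close>
      then show ?thesis using False h3 q1 by (intro path_four[OF k(2,1,3,2)]) auto
    qed
  qed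
qed

text \<open>Minimality of \<open>p\<close> leaves at least two columns in the blocks from
  \<open>p\<close> on, and failure of the inequality at least two free rows before \<open>p\<close>.
  Whether the rows are spread over two blocks or lie in block 1, and whether some column lies before
  the last block, decides between the four patterns.\<close>

lemma b_ge_4_not_mult_free:
  assumes b4: "4 \<le> b" and c: "\<not> (pw js w = 2 \<or>
    (pw js w > 2 \<and> (\<Sum>k = 1..pw js w - 1. h k) + 1 \<ge> (\<Sum>k = 1..pw js w - 1. n k)))"
  shows "\<not> mult_free d N w js"
proof -
  define p where "p = pw js w"
  have spec: "((1 < p \<and> p < b - 1) \<and> (\<forall>r < p. \<not> (1 < r \<and> r < b - 1 \<and> (\<Sum>k = r + 1..b. h k) < 2)))
      \<or> ((\<forall>r. \<not> (1 < r \<and> r < b - 1 \<and> (\<Sum>k = r + 1..b. h k) < 2)) \<and> p = b - 1)"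
    using pw_spec unfolding p_def by blast
  have p: "3 \<le> p" "p \<le> b - 1" using spec b4 c unfolding p_def[symmetric] by auto
  \<comment> \<open>Since \<open>p\<close> is at least 3, the index \<open>p - 1\<close> is still in
    the range over which \<open>p\<close> is minimal; this holds also when \<open>p\<close> is the
    default value \<open>b - 1\<close>.\<close>
  have "\<not> (\<Sum>k = (p - 1) + 1..b. h k) < 2"
  proof
    assume "(\<Sum>k = (p - 1) + 1..b. h k) < 2"
    then have "1 < p - 1 \<and> p - 1 < b - 1 \<and> (\<Sum>k = (p - 1) + 1..b. h k) < 2" using p by auto
    moreover have "p - 1 < p" using p by simp
    ultimately show False using spec by blast
  qed
  then have "2 \<le> (\<Sum>k = p..b. h k)" using p by simp
  also have "\<dots> = (\<Sum>k = (p - 1) + 1..<b. h k) + h b" using sum_split_last[of "p - 1" b h] p by simp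
  finally have tail: "2 \<le> (\<Sum>k = p..<b. h k) + h b" using p by simp
  have hb: "1 \<le> h b" by (rule hb_pos)
  have "\<not> (\<Sum>k = 1..p - 1. h k) + 1 \<ge> (\<Sum>k = 1..p - 1. n k)" using c p p_def by auto
  moreover have "(\<Sum>k = 1..p - 1. n k) = (\<Sum>k = 1..p - 1. q k + h k)" using p by (intro sum.cong n_eq) auto
  ultimately have "2 \<le> (\<Sum>k = 1..p - 1. q k)" by (simp add: sum.distrib)
  moreover have "(\<Sum>k = 1..p - 1. q k) = q 1 + (\<Sum>k = 2..p - 1. q k)"
    using p by (subst sum.atLeast_Suc_atMost) (auto simp: numeral_2_eq_2)
  ultimately have qs: "2 \<le> q 1 + (\<Sum>k = 2..p - 1. q k)" by simp
  have k1: "1 \<in> {1..b}" and k2: "2 \<in> {1..b}" and kp: "p \<in> {1..b}" and kb: "b \<in> {1..b}" using b4 p by auto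
  \<comment> \<open>If no block from \<open>p\<close> to \<open>b - 1\<close> has a column, block
    \<open>p\<close> must have a free row, which supplies the last row needed by
    \<open>column_star\<close> and \<open>path_four\<close>.\<close>
  have np: "1 \<le> q p \<or> 1 \<le> h p" using n_pos[OF kp] n_eq[OF kp] by linarith
  show ?thesis
  proof (cases "\<exists>l\<in>{2..p - 1}. 1 \<le> q l")
    case True
    then obtain l where l: "2 \<le> l" "l \<le> p - 1" "1 \<le> q l" by auto
    then have lb: "l \<in> {1..b}" "l < p" "l < b" "1 \<noteq> l" using p by auto
    show ?thesis
    proof (cases "\<exists>k\<in>{p..<b}. 1 \<le> h k")
      case True
      then obtain k where k: "p \<le> k" "k < b" "1 \<le> h k" by auto
      show ?thesis
        by (rule four_cycle[of 1 l k b]) (use k lb l p hb q1_pos b4 in auto)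
    next
      case False
      then have "(\<Sum>k = p..<b. h k) = 0" by (auto simp: not_less_eq_eq)
      then have hb2: "2 \<le> h b" using tail by simp
      have "1 \<le> q p" using False np p by fastforce
      then show ?thesis
        by (intro column_star[of b 1 l p]) (use hb2 lb l p q1_pos b4 in auto)
    qed
  next
    case False
    then have "(\<Sum>k = 2..p - 1. q k) = 0" by (auto simp: not_less_eq_eq)
    then have q1: "2 \<le> q 1" using qs by simp
    have "q 2 = 0" using False p by (auto simp: not_less_eq_eq)
    then have h2: "1 \<le> h 2" using n_pos[OF k2] n_eq[OF k2] by simp
    show ?thesis
    proof (cases "\<exists>k\<in>{p..<b}. 1 \<le> h k")
      case True
      then obtain k where k: "p \<le> k" "k < b" "1 \<le> h k" by auto
      show ?thesis
        by (rule row_star[of 1 2 k b]) (use k p hb h2 q1 b4 in auto)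
    next
      case False
      then have "(\<Sum>k = p..<b. h k) = 0" by (auto simp: not_less_eq_eq)
      then have hb2: "2 \<le> h b" using tail by simp
      have "1 \<le> q p" using False np p by fastforce
      then show ?thesis
        by (intro path_four[of 2 1 b p]) (use hb2 p h2 q1 b4 in auto)
    qed
  qed
qed

lemma mult_free_mf_condition:
  assumes "mult_free d N w js" shows "mf_condition js w"
proof (rule ccontr)
  assume "\<not> mf_condition js w"
  then have c: "\<not> b \<le> 2" "b = 3 \<Longrightarrow> \<not> (n 2 = 1 \<or> h 1 + 1 \<ge> n 1 \<or> (n 2 = h 2 \<and> h 1 + 2 \<ge> n 1)
      \<or> (h 2 > 0 \<and> h 3 < 2) \<or> (h 2 = 0 \<and> h 3 \<le> 2))"
    "4 \<le> b \<Longrightarrow> \<not> (pw js w = 2 \<or>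
      (pw js w > 2 \<and> (\<Sum>k = 1..pw js w - 1. h k) + 1 \<ge> (\<Sum>k = 1..pw js w - 1. n k)))"
    unfolding mf_condition_def Let_def by blast+
  then consider "b = 3" | "4 \<le> b" by linarith
  then show False using b_3_not_mult_free b_ge_4_not_mult_free c(2,3) assms by cases blast+
qed

end

theorem theorem5p5:
  fixes d N :: nat and w js :: "nat list"
  assumes "1 \<le> d" and "d < N"
    and "w \<in> Idn d N"
    and "levi_ok N js"
    and "stable d N w js"
    and "reduced N w"
  shows "(mult_free d N w js \<longleftrightarrow> mf_condition js w)
       \<and> (spherical d N w js \<longleftrightarrow> mf_condition js w)"
proof -
  interpret levi_schubert d N w js
    by unfold_locales (use assms in auto)
  show ?thesis
    using mf_condition_spherical spherical_imp_mult_free mult_free_mf_condition by blast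
qed

end
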